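(* Let $p$ be an odd prime, $q=p^k$ with $k\ge 1$, and let $U$ be the Sylow $p$-subgroup of ${}^3D_4(q^3)$ described in the context, with elements $x(t_1,t_2,t_3,t_4,t_5,t_6)$. In the following, starred parameters are nonzero elements: $t_1^*,t_3^*,t_4^*,A_{12}^*,A_{13}^*,A_{15}^*\in\mathbb{F}_{q^3}^*$ and $t_2^*,t_5^*,t_6^*,A_{23}^*,A_{16}^*,A_{17}^*\in\mathbb{F}_q^*$. **(A) Conjugacy classes.** The following elements form a complete set of representatives of the distinct conjugacy classes of $U$, and the conjugacy class ${}^Ux$ of each is as indicated. In each class the parameters $s_i$ run freely over the indicated sets, and $\hat s_i$ denotes an element that is uniquely determined by the parameters of the representative and the $s_j$'s displayed. 1. $x=1$: ${}^Ux=\{1\}$, $|{}^Ux|=1$. 2. $x=x_6(t_6^* )$: ${}^Ux=\{x\}$, $|{}^Ux|=1$. 3. $x=x_5(t_5^* )$: ${}^Ux=\{x(0,0,0,0,t_5^*,s_6): s_6\in\mathbb{F}_q\}$, $|{}^Ux|=q$. 4. $x=x_4(t_4^* )$: ${}^Ux=\{x(0,0,0,t_4^*,s_5,s_6): s_5,s_6\in\mathbb{F}_q\}$, $|{}^Ux|=q^2$. 5. $x=x(0,0,t_3^*,0,t_5,0)$, $t_5\in\mathbb{F}_q$: ${}^Ux=\{x(0,0,t_3^*,s_4,\hat s_5,s_6): s_4\in\mathbb{F}_{q^3}, s_6\in\mathbb{F}_q\}$, $|{}^Ux|=q^4$. 6. $x=x(0,t_2^*,0,t_4,t_5,0)$,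 $t_4\in\mathbb{F}_{q^3}$, $t_5\in\mathbb{F}_q$: ${}^Ux=\{x(0,t_2^*,s_3,\hat s_4,\hat s_5,s_6): s_3\in\mathbb{F}_{q^3}, s_6\in\mathbb{F}_q\}$, $|{}^Ux|=q^4$. 7. $x=x(t_1^*,0,0,0,0,t_6)$, $t_6\in\mathbb{F}_q$: ${}^Ux=\{x(t_1^*,0,t_1^*s_2,s_4,s_5,\hat s_6): s_4\in\mathbb{F}_{q^3}, s_2,s_5\in\mathbb{F}_q\}$, $|{}^Ux|=q^5$. 8. $x=x(t_1^*,0,\bar t_3^*,0,0,0)$, $0\ne\bar t_3^*\in T^{t_1^*}$: ${}^Ux=\{x(t_1^*,0,\bar t_3^*+t_1^*s_2,s_4,s_5,s_6): s_4\in\mathbb{F}_{q^3}, s_2,s_5,s_6\in\mathbb{F}_q\}$, $|{}^Ux|=q^6$. 9. $x=x(t_1^*,t_2^*,0,0,0,0)$: ${}^Ux=\{x(t_1^*,t_2^*,s_3,s_4,s_5,s_6): s_3,s_4\in\mathbb{F}_{q^3}, s_5,s_6\in\mathbb{F}_q\}$, $|{}^Ux|=q^8$. **(B) Irreducible characters.** All of the pairwise orthogonal complex irreducible characters of $U$ are constructed as follows (distinct parameters give distinct characters); bars denote images in the quotient group $\bar U$ (or $\bar H$) considered in each item. 1. Let $\bar U=(X_3X_4X_5X_6)\backslash U=\bar X_2\bar X_1$ and let $\chi_{lin}^{A_{12},A_{23}}$ be the lift to $U$ of the linear character $\bar x_2(t_2)\bar x_1(t_1)\mapsto\vartheta\pi_q(A_{12}t_1)\cdot\vartheta(A_{23}t_2)$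 of $\bar U$. Then $$\mathfrak{F}_{lin}:=\{\chi\in\mathrm{Irr}(U): X_3X_4X_5X_6\subseteq\ker\chi\}=\{\chi_{lin}^{A_{12},A_{23}}: A_{12}\in\mathbb{F}_{q^3}, A_{23}\in\mathbb{F}_q\}.$$ 2. Let $\bar U=(X_4X_5X_6)\backslash U=\bar X_2\bar X_1\bar X_3$, $\bar H=\bar X_1\bar X_3$, and for $A_{12},A_{13}\in\mathbb{F}_{q^3}$ let $\bar\chi_{3,q}^{A_{13},A_{12}}\in\mathrm{Irr}(\bar H)$ be $\bar x_1(t_1)\bar x_3(t_3)\mapsto\vartheta\pi_q(A_{12}t_1-A_{13}t_3)$. For $\bar A_{12}^{A_{13}^*}\in T^{A_{13}^*}$ let $\chi_{3,q}^{A_{13}^*,\bar A_{12}^{A_{13}^*}}$ be the lift to $U$ of $\mathrm{Ind}_{\bar H}^{\bar U}\bar\chi_{3,q}^{A_{13}^*,\bar A_{12}^{A_{13}^*}}$. Then $$\mathfrak{F}_3:=\{\chi\in\mathrm{Irr}(U): X_4X_5X_6\subseteq\ker\chi,\ X_3\nsubseteq\ker\chi\}=\{\chi_{3,q}^{A_{13}^*,\bar A_{12}^{A_{13}^*}}: A_{13}^*\in\mathbb{F}_{q^3}^*,\ \bar A_{12}^{A_{13}^*}\in T^{A_{13}^*}\}.$$ 3. Let $\bar U=(X_5X_6)\backslash U=\bar X_2\bar X_1\bar X_3\bar X_4$, $\bar H=\bar X_2\bar X_3\bar X_4$, and let $\bar\chi_{4,q^3}^{A_{15},A_{23},A_{13}}\in\mathrm{Irr}(\bar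 H)$ be $\bar x_2(t_2)\bar x_3(t_3)\bar x_4(t_4)\mapsto\vartheta(A_{23}t_2)\cdot\vartheta\pi_q(-A_{13}t_3)\cdot\vartheta\pi_q(A_{15}^qt_4+A_{15}t_4^{q^2})$. Let $\chi_{4,q^3}^{A_{15}^*,A_{23}}$ be the lift to $U$ of $\mathrm{Ind}_{\bar H}^{\bar U}\bar\chi_{4,q^3}^{A_{15}^*,A_{23},0}$. Then $$\mathfrak{F}_4:=\{\chi\in\mathrm{Irr}(U): X_5X_6\subseteq\ker\chi,\ X_4\nsubseteq\ker\chi\}=\{\chi_{4,q^3}^{A_{15}^*,A_{23}}: A_{15}^*\in\mathbb{F}_{q^3}^*, A_{23}\in\mathbb{F}_q\}.$$ 4. Let $\bar U=X_6\backslash U=\bar X_2\bar X_1\bar X_3\bar X_4\bar X_5$, $\bar H=\bar X_2\bar X_3\bar X_4\bar X_5$, and let $\bar\chi_{5,q^3}^{A_{16},A_{23},A_{13},A_{15}}\in\mathrm{Irr}(\bar H)$ be $\bar x_2(t_2)\bar x_3(t_3)\bar x_4(t_4)\bar x_5(t_5)\mapsto\vartheta(A_{23}t_2)\cdot\vartheta\pi_q(-A_{13}t_3)\cdot\vartheta\pi_q(A_{15}^qt_4+A_{15}t_4^{q^2})\cdot\vartheta(A_{16}t_5)$. Let $\chi_{5,q^3}^{A_{16}^*,A_{23},A_{13}}$ be the lift to $U$ of $\mathrm{Ind}_{\bar H}^{\bar U}\bar\chi_{5,q^3}^{A_{16}^*,A_{23},A_{13},0}$. Then $$\mathfrak{F}_5:=\{\chi\in\mathrm{Irr}(U):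 X_6\subseteq\ker\chi,\ X_5\nsubseteq\ker\chi\}=\{\chi_{5,q^3}^{A_{16}^*,A_{23},A_{13}}: A_{16}^*\in\mathbb{F}_q^*, A_{23}\in\mathbb{F}_q, A_{13}\in\mathbb{F}_{q^3}\}.$$ 5. Let $H=X_1X_4X_5X_6$, $\bar H=(X_4X_5)\backslash H\cong\bar X_1\bar X_6$, let $\tilde\chi_{6,q^4}^{A_{17},A_{12}}$ be the lift to $H$ of the character $\bar x_1(t_1)\bar x_6(t_6)\mapsto\vartheta\pi_q(A_{12}t_1)\cdot\vartheta(A_{17}t_6)$ of $\bar H$, and let $\chi_{6,q^4}^{A_{17}^*,A_{12}}:=\mathrm{Ind}_H^U\tilde\chi_{6,q^4}^{A_{17}^*,A_{12}}$. Then $$\mathfrak{F}_6:=\{\chi\in\mathrm{Irr}(U): X_6\nsubseteq\ker\chi\}=\{\chi_{6,q^4}^{A_{17}^*,A_{12}}: A_{17}^*\in\mathbb{F}_q^*, A_{12}\in\mathbb{F}_{q^3}\}.$$ Hence $\mathrm{Irr}(U)=\mathfrak{F}_{lin}\,\dot\cup\,\mathfrak{F}_3\,\dot\cup\,\mathfrak{F}_4\,\dot\cup\,\mathfrak{F}_5\,\dot\cup\,\mathfrak{F}_6$. **(C) Character table.** The values of these characters on the class representatives of (A) are as follows. 1. $\chi_{lin}^{A_{12},A_{23}}$ takes the value $\vartheta\pi_q(A_{12}t_1^* )$ at $x_1(t_1^* )x_6(t_6)$ and at $x_1(t_1^* )x_3(\bar t_3^* )$; $\vartheta(A_{23}t_2^*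 )$ at $x_2(t_2^* )x_4(t_4)x_5(t_5)$; $\vartheta\pi_q(A_{12}t_1^* )\cdot\vartheta(A_{23}t_2^* )$ at $x_2(t_2^* )x_1(t_1^* )$; and $1$ at $1$, $x_3(t_3^* )x_5(t_5)$, $x_4(t_4^* )$, $x_5(t_5^* )$, $x_6(t_6^* )$. 2. $\chi=\chi_{3,q}^{A_{13}^*,\bar A_{12}^{A_{13}^*}}$ takes the value $q$ at $1$, $x_4(t_4^* )$, $x_5(t_5^* )$, $x_6(t_6^* )$; $0$ at $x_2(t_2^* )x_4(t_4)x_5(t_5)$ and $x_2(t_2^* )x_1(t_1^* )$; $q\,\vartheta\pi_q(-A_{13}^*t_3^* )$ at $x_3(t_3^* )x_5(t_5)$; and $$\chi(x_1(t_1^* )x_6(t_6))=\sum_{r_2\in\mathbb{F}_q}\vartheta\pi_q\big((\bar A_{12}^{A_{13}^*}-A_{13}^*r_2)t_1^*\big),$$ $$\chi(x_1(t_1^* )x_3(\bar t_3^* ))=\sum_{r_2\in\mathbb{F}_q}\vartheta\pi_q\big((\bar A_{12}^{A_{13}^*}-A_{13}^*r_2)t_1^*-\bar t_3^*A_{13}^*\big).$$ 3. $\chi=\chi_{4,q^3}^{A_{15}^*,A_{23}}$ takes the value $q^3$ at $1$, $x_5(t_5^* )$, $x_6(t_6^* )$; $0$ at $x_1(t_1^* )x_6(t_6)$, $x_1(t_1^* )x_3(\bar t_3^* )$, $x_2(t_2^* )x_1(t_1^* )$, $x_3(t_3^* )x_5(t_5)$; $q^3\,\vartheta\pi_q({A_{15}^*}^qt_4^*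 )\cdot\vartheta\pi_q(A_{15}^*{t_4^*}^{q^2})$ at $x_4(t_4^* )$; and $$\chi(x_2(t_2^* )x_4(t_4)x_5(t_5))=\vartheta(A_{23}t_2^* )\cdot\sum_{r_1\in\mathbb{F}_{q^3}}\vartheta\pi_q\big({A_{15}^*}^q(t_4-t_2^*r_1^{q+1})+A_{15}^*(t_4^{q^2}-t_2^*r_1^{q^2+1})\big).$$ 4. $\chi=\chi_{5,q^3}^{A_{16}^*,A_{23},A_{13}}$ takes the value $q^3$ at $1$, $x_6(t_6^* )$; $0$ at $x_1(t_1^* )x_6(t_6)$, $x_1(t_1^* )x_3(\bar t_3^* )$, $x_2(t_2^* )x_1(t_1^* )$, $x_4(t_4^* )$; $q^3\,\vartheta(A_{16}^*t_5^* )$ at $x_5(t_5^* )$; and $$\chi(x_3(t_3^* )x_5(t_5))=\vartheta\pi_q(-A_{13}t_3^*+A_{16}^*t_5)\cdot\sum_{r_1\in\mathbb{F}_{q^3}}\vartheta\big(A_{16}^*\phi_0(t_3^*r_1^{q^2+q})\big),$$ $$\chi(x_2(t_2^* )x_4(t_4)x_5(t_5))=\vartheta(A_{23}t_2^*+A_{16}^*t_5)\cdot\sum_{r_1\in\mathbb{F}_{q^3}}\vartheta\pi_q\big(A_{13}r_1t_2^*+A_{16}^*(\phi_0(r_1t_4^q)-t_2^*r_1^{q^2+q+1})\big).$$ 5. $\chi=\chi_{6,q^4}^{A_{17}^*,A_{12}}$ takes the value $q^4$ at $1$; $0$ at $x_1(t_1^* )x_3(\bar t_3^* )$, $x_2(t_2^*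 )x_4(t_4)x_5(t_5)$, $x_2(t_2^* )x_1(t_1^* )$, $x_3(t_3^* )x_5(t_5)$, $x_4(t_4^* )$, $x_5(t_5^* )$; $q^4\,\vartheta(A_{17}^*t_6^* )$ at $x_6(t_6^* )$; and $$\chi(x_1(t_1^* )x_6(t_6))=\vartheta\pi_q(A_{12}t_1^*+A_{17}^*t_6)\cdot\sum_{r_3\in\mathbb{F}_{q^3}}\vartheta\big(A_{17}^*\phi_0(-t_1^*r_3^{q^2+q})\big).$$
   Context: Maps and characters on fields. $\phi_0:\mathbb{F}_{q^3}\to\mathbb{F}_q$, $\phi_0(t)=t+t^q+t^{q^2}$. Fix $\eta\in\mathbb{F}_{q^3}\setminus\mathbb{F}_q$ with $\eta^{q^2}+\eta^q+\eta=1$, and put $\pi_q:\mathbb{F}_{q^3}\to\mathbb{F}_q$, $\pi_q(x)=\phi_0(\eta x)$ (so $\pi_q$ is the identity on $\mathbb{F}_q$). Fix a nontrivial linear character $\vartheta:\mathbb{F}_q^+\to\mathbb{C}^*$ of the additive group; $\vartheta\pi_q$ denotes the composite. For $a\in\mathbb{F}_{q^3}^*$, $T^a$ denotes a fixed transversal (complete set of coset representatives) of the subgroup $a\mathbb{F}_q$ in $\mathbb{F}_{q^3}^+$, chosen so that the representative of the coset $a\mathbb{F}_q$ is $0$; thus $|T^a|=q^2$. The group $U$. ${}^3D_4(q^3)$ is the Steinberg triality group: the fixed points in the Chevalley group $D_4(q^3)$ of $F=\rho F_q$, where $\rho$ is the graph automorphism of order 3 permuting the simple roots $r_1\to r_3\to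 r_4\to r_1$ and fixing $r_2$, and $F_q$ is the field automorphism $t\mapsto t^q$. In terms of root elements $x_r(t)$ of $D_4(q^3)$, put $x_1(t)=x_{r_1}(t)x_{r_3}(t^q)x_{r_4}(t^{q^2})$, $x_3(t)=x_{r_1+r_2}(t)x_{r_2+r_3}(t^q)x_{r_2+r_4}(t^{q^2})$, $x_4(t)=x_{r_1+r_2+r_3}(t)x_{r_2+r_3+r_4}(t^q)x_{r_1+r_2+r_4}(t^{q^2})$ for $t\in\mathbb{F}_{q^3}$, and $x_2(t)=x_{r_2}(t)$, $x_5(t)=x_{r_1+r_2+r_3+r_4}(t)$, $x_6(t)=x_{r_1+2r_2+r_3+r_4}(t)$ for $t\in\mathbb{F}_q$. Let $X_i=\{x_i(t)\}$, with $t$ in $\mathbb{F}_{q^3}$ for $i=1,3,4$ and $t$ in $\mathbb{F}_q$ for $i=2,5,6$. Then $t\mapsto x_i(t)$ is an isomorphism from the additive group of the field onto $X_i$, and $U=X_2X_1X_3X_4X_5X_6$ is a Sylow $p$-subgroup of ${}^3D_4(q^3)$, of order $q^{12}$, in which every element is uniquely of the form $$x(t_1,t_2,t_3,t_4,t_5,t_6):=x_2(t_2)x_1(t_1)x_3(t_3)x_4(t_4)x_5(t_5)x_6(t_6),\quad t_1,t_3,t_4\in\mathbb{F}_{q^3},\ t_2,t_5,t_6\in\mathbb{F}_q.$$ With $[x,y]=x^{-1}y^{-1}xy$ and the signs of the Chevalley basis chosen appropriately, the following relations hold, all other commutators $[x_i(t_i),x_j(t_j)]$ with $i<j$ being trivial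 (these relations determine $U$): $[x_1(t_1),x_2(t_2)]=x_3(-t_2t_1)x_4(t_2t_1^{q+1})x_5(-t_2t_1^{q^2+q+1})x_6(2t_2^2t_1^{q^2+q+1})$; $[x_1(t_1),x_3(t_3)]=x_4(t_1t_3^q+t_1^qt_3)\,x_5(-t_1^{q+1}t_3^{q^2}-t_1^{q^2+q}t_3-t_1^{q^2+1}t_3^q)\,x_6(-t_1t_3^{q^2+q}-t_1^qt_3^{q^2+1}-t_1^{q^2}t_3^{q+1})$; $[x_1(t_1),x_4(t_4)]=x_5(t_1t_4^q+t_1^qt_4^{q^2}+t_1^{q^2}t_4)$; $[x_3(t_3),x_4(t_4)]=x_6(t_3t_4^q+t_3^qt_4^{q^2}+t_3^{q^2}t_4)$; $[x_2(t_2),x_5(t_5)]=x_6(t_2t_5)$. The conjugacy class of $x$ is ${}^Ux=\{vxv^{-1}:v\in U\}$. $\mathrm{Irr}(G)$ is the set of complex irreducible characters of $G$; $\ker\chi=\{g:\chi(g)=\chi(1)\}$; $N\backslash G$ is the quotient group; the lift of a character of $N\backslash G$ to $G$ is its composite with the quotient map; $\mathrm{Ind}$ is induction of characters. Unstarred parameters $A_{12},A_{13},A_{15}$ range over $\mathbb{F}_{q^3}$ and $A_{23},A_{16},A_{17}$ over $\mathbb{F}_q$. *)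

theory Defs
  imports
    "HOL-Algebra.Bij"
    "HOL-Algebra.Coset"
    "HOL-Algebra.Generated_Groups"
    "HOL-Computational_Algebra.Primes"
    "Jordan_Normal_Form.VS_Connect"
begin

section \<open>Complex characters of finite groups\<close>

text \<open>Characters are extensional functions on the carrier, so that equality of characters is
  equality of HOL functions.\<close>

definition matrix_rep ::
    "('g, 'm) monoid_scheme \<Rightarrow> nat \<Rightarrow> ('g \<Rightarrow> complex mat) \<Rightarrow> bool" where
  "matrix_rep G n \<rho> \<longleftrightarrow>
     (\<forall>g\<in>carrier G. \<rho> g \<in> carrier_mat n n) \<and>
     \<rho> \<one>\<^bsub>G\<^esub> = 1\<^sub>m n \<and>
     (\<forall>g\<in>carrier G. \<forall>h\<in>carrier G. \<rho> (g \<otimes>\<^bsub>G\<^esub> h) = \<rho> g * \<rho> h)"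

definition irreducible_rep ::
    "('g, 'm) monoid_scheme \<Rightarrow> nat \<Rightarrow> ('g \<Rightarrow> complex mat) \<Rightarrow> bool" where
  "irreducible_rep G n \<rho> \<longleftrightarrow>
     matrix_rep G n \<rho> \<and> n > 0 \<and>
     (\<forall>W. subspace class_ring W (module_vec TYPE(complex) n) \<and>
          (\<forall>g\<in>carrier G. \<forall>w\<in>W. \<rho> g *\<^sub>v w \<in> W) \<longrightarrow>
          W = {0\<^sub>v n} \<or> W = carrier_vec n)"

definition rep_character ::
    "('g, 'm) monoid_scheme \<Rightarrow> nat \<Rightarrow> ('g \<Rightarrow> complex mat) \<Rightarrow> 'g \<Rightarrow> complex" where
  "rep_character G n \<rho> = (\<lambda>g\<in>carrier G. \<Sum>i<n. \<rho> g $$ (i, i))"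

definition Irr :: "('g, 'm) monoid_scheme \<Rightarrow> ('g \<Rightarrow> complex) set" where
  "Irr G = {rep_character G n \<rho> | n \<rho>. irreducible_rep G n \<rho>}"

definition char_kernel :: "('g, 'm) monoid_scheme \<Rightarrow> ('g \<Rightarrow> complex) \<Rightarrow> 'g set" where
  "char_kernel G \<chi> = {g \<in> carrier G. \<chi> g = \<chi> \<one>\<^bsub>G\<^esub>}"

definition char_inner ::
    "('g, 'm) monoid_scheme \<Rightarrow> ('g \<Rightarrow> complex) \<Rightarrow> ('g \<Rightarrow> complex) \<Rightarrow> complex" where
  "char_inner G \<chi> \<psi> = (\<Sum>g\<in>carrier G. \<chi> g * cnj (\<psi> g)) / of_nat (card (carrier G))"

definition lift_char ::
    "('g, 'm) monoid_scheme \<Rightarrow> 'g set \<Rightarrow> ('g set \<Rightarrow> complex) \<Rightarrow> 'g \<Rightarrow> complex" where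
  "lift_char G N \<phi> = (\<lambda>g\<in>carrier G. \<phi> (N #>\<^bsub>G\<^esub> g))"

definition ind_char ::
    "('g, 'm) monoid_scheme \<Rightarrow> 'g set \<Rightarrow> ('g \<Rightarrow> complex) \<Rightarrow> 'g \<Rightarrow> complex" where
  "ind_char G H \<phi> = (\<lambda>g\<in>carrier G.
     (\<Sum>y\<in>carrier G.
        if inv\<^bsub>G\<^esub> y \<otimes>\<^bsub>G\<^esub> g \<otimes>\<^bsub>G\<^esub> y \<in> H
        then \<phi> (inv\<^bsub>G\<^esub> y \<otimes>\<^bsub>G\<^esub> g \<otimes>\<^bsub>G\<^esub> y) else 0) / of_nat (card H))"

definition conj_class :: "('g, 'm) monoid_scheme \<Rightarrow> 'g \<Rightarrow> 'g set" where
  "conj_class G x = {v \<otimes>\<^bsub>G\<^esub> x \<otimes>\<^bsub>G\<^esub> inv\<^bsub>G\<^esub> v | v. v \<in> carrier G}"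

definition bar :: "('g, 'm) monoid_scheme \<Rightarrow> 'g set \<Rightarrow> 'g set \<Rightarrow> 'g set set" where
  "bar G N S = (\<lambda>g. N #>\<^bsub>G\<^esub> g) ` S"

text \<open>The function \<open>P t \<mapsto> f t\<close> (\<open>t \<in> A\<close>) on the set \<open>P ` A\<close>, for \<open>P\<close> injective on \<open>A\<close>.\<close>

definition on_coords :: "'t set \<Rightarrow> ('t \<Rightarrow> 'g) \<Rightarrow> ('t \<Rightarrow> complex) \<Rightarrow> 'g \<Rightarrow> complex" where
  "on_coords A P f = (\<lambda>g \<in> P ` A. f (the_inv_into A P g))"


section \<open>The Chevalley group of type \<open>D\<^sub>4\<close>\<close>

text \<open>In odd characteristic, \<open>K \<otimes> L\<^sub>\<int>\<close> for the Lie algebra \<open>L\<^sub>\<int>\<close> of type \<open>D\<^sub>4\<close> is the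
  orthogonal Lie algebra of the form with antidiagonal Gram matrix.\<close>

definition gram8 :: "'a::field mat" where
  "gram8 = mat 8 8 (\<lambda>(a, b). if a + b = 7 then 1 else 0)"

definition so8 :: "'a::field mat set" where
  "so8 = {A \<in> carrier_mat 8 8. A\<^sup>T * gram8 + gram8 * A = 0\<^sub>m 8 8}"

text \<open>Matrix units, with rows and columns numbered from 1 to 8.\<close>

definition unit8 :: "nat \<Rightarrow> nat \<Rightarrow> 'a::field mat" where
  "unit8 i j = mat 8 8 (\<lambda>(a, b). if a + 1 = i \<and> b + 1 = j then 1 else 0)"

text \<open>Up to sign, the root vectors for \<open>\<epsilon>\<^sub>i - \<epsilon>\<^sub>j\<close> and \<open>\<epsilon>\<^sub>i + \<epsilon>\<^sub>j\<close>, with respect to the Cartan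
  subalgebra of diagonal matrices \<open>diag(h\<^sub>1, \<dots>, h\<^sub>4, -h\<^sub>4, \<dots>, -h\<^sub>1)\<close>, \<open>\<epsilon>\<^sub>i(h) = h\<^sub>i\<close>.\<close>

definition root_diff :: "nat \<Rightarrow> nat \<Rightarrow> 'a::field mat" where
  "root_diff i j = unit8 i j - unit8 (9 - j) (9 - i)"

definition root_sum :: "nat \<Rightarrow> nat \<Rightarrow> 'a::field mat" where
  "root_sum i j = unit8 i (9 - j) - unit8 j (9 - i)"

text \<open>\<open>R12234\<close> stands for \<open>r\<^sub>1 + 2 r\<^sub>2 + r\<^sub>3 + r\<^sub>4\<close>, and so on; the simple roots are \<open>r\<^sub>1 = \<epsilon>\<^sub>1 - \<epsilon>\<^sub>2\<close>,
  \<open>r\<^sub>2 = \<epsilon>\<^sub>2 - \<epsilon>\<^sub>3\<close>, \<open>r\<^sub>3 = \<epsilon>\<^sub>3 - \<epsilon>\<^sub>4\<close>, \<open>r\<^sub>4 = \<epsilon>\<^sub>3 + \<epsilon>\<^sub>4\<close>, with central node \<open>r\<^sub>2\<close>.\<close>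

datatype pos_root = R1 | R2 | R3 | R4 | R12 | R23 | R24 | R123 | R234 | R124 | R1234 | R12234

fun root_vec :: "pos_root \<Rightarrow> 'a::field mat" where
  "root_vec R1 = root_diff 1 2"
| "root_vec R2 = root_diff 2 3"
| "root_vec R3 = root_diff 3 4"
| "root_vec R4 = root_sum 3 4"
| "root_vec R12 = - root_diff 1 3"
| "root_vec R23 = root_diff 2 4"
| "root_vec R24 = root_sum 2 4"
| "root_vec R123 = root_diff 1 4"
| "root_vec R234 = root_sum 2 3"
| "root_vec R124 = root_sum 1 4"
| "root_vec R1234 = root_sum 1 3"
| "root_vec R12234 = root_sum 1 2"

text \<open>\<open>exp (t ad e)\<close>: as \<open>e * e = 0\<close> for every root vector \<open>e\<close>, this is
  \<open>A \<mapsto> exp (t e) A exp (- t e)\<close> with \<open>exp (t e) = 1 + t e\<close>.\<close>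

definition exp_ad :: "'a::field mat \<Rightarrow> 'a \<Rightarrow> 'a mat \<Rightarrow> 'a mat" where
  "exp_ad e t = (\<lambda>A\<in>so8. (1\<^sub>m 8 + t \<cdot>\<^sub>m e) * A * (1\<^sub>m 8 - t \<cdot>\<^sub>m e))"

text \<open>The root vectors of the negative roots are the transposes of those of the positive roots.\<close>

definition chevalley_D4 :: "('a::field mat \<Rightarrow> 'a mat) monoid" where
  "chevalley_D4 = (BijGroup so8)\<lparr>carrier := generate (BijGroup so8)
     {exp_ad e t | e t. e \<in> range root_vec \<union> transpose_mat ` range root_vec}\<rparr>"

abbreviation xr :: "pos_root \<Rightarrow> 'a::field \<Rightarrow> 'a mat \<Rightarrow> 'a mat" where
  "xr r \<equiv> exp_ad (root_vec r)"


section \<open>The Sylow subgroup \<open>U\<close> of the triality group\<close>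

text \<open>The field with \<open>q\<^sup>3\<close> elements is a type \<open>'a\<close>, and the field with \<open>q\<close> elements is its
  subfield \<open>Fq q\<close>.  The root elements \<open>x1\<close>, \<dots>, \<open>x6\<close> are those of \<open>\<^sup>3D\<^sub>4(q\<^sup>3)\<close>, the group of fixed
  points in \<^const>\<open>chevalley_D4\<close> of the composite of \<open>t \<mapsto> t ^ q\<close> with the graph automorphism
  \<open>r\<^sub>1 \<mapsto> r\<^sub>3 \<mapsto> r\<^sub>4 \<mapsto> r\<^sub>1\<close>.  That the signs of the root vectors are the appropriate ones is shown
  in \<open>commutator_relations\<close> below.\<close>

definition Fq :: "nat \<Rightarrow> 'a::field set" where
  "Fq q = {t. t ^ q = t}"

definition x1 :: "nat \<Rightarrow> 'a::field \<Rightarrow> 'a mat \<Rightarrow> 'a mat" where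
  "x1 q t = xr R1 t \<otimes>\<^bsub>chevalley_D4\<^esub> xr R3 (t ^ q) \<otimes>\<^bsub>chevalley_D4\<^esub> xr R4 (t ^ q\<^sup>2)"

definition x2 :: "'a::field \<Rightarrow> 'a mat \<Rightarrow> 'a mat" where
  "x2 t = xr R2 t"

definition x3 :: "nat \<Rightarrow> 'a::field \<Rightarrow> 'a mat \<Rightarrow> 'a mat" where
  "x3 q t = xr R12 t \<otimes>\<^bsub>chevalley_D4\<^esub> xr R23 (t ^ q) \<otimes>\<^bsub>chevalley_D4\<^esub> xr R24 (t ^ q\<^sup>2)"

definition x4 :: "nat \<Rightarrow> 'a::field \<Rightarrow> 'a mat \<Rightarrow> 'a mat" where
  "x4 q t = xr R123 t \<otimes>\<^bsub>chevalley_D4\<^esub> xr R234 (t ^ q) \<otimes>\<^bsub>chevalley_D4\<^esub> xr R124 (t ^ q\<^sup>2)"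

definition x5 :: "'a::field \<Rightarrow> 'a mat \<Rightarrow> 'a mat" where
  "x5 t = xr R1234 t"

definition x6 :: "'a::field \<Rightarrow> 'a mat \<Rightarrow> 'a mat" where
  "x6 t = xr R12234 t"

definition X1 :: "nat \<Rightarrow> ('a::field mat \<Rightarrow> 'a mat) set" where "X1 q = range (x1 q)"
definition X2 :: "nat \<Rightarrow> ('a::field mat \<Rightarrow> 'a mat) set" where "X2 q = x2 ` Fq q"
definition X3 :: "nat \<Rightarrow> ('a::field mat \<Rightarrow> 'a mat) set" where "X3 q = range (x3 q)"
definition X4 :: "nat \<Rightarrow> ('a::field mat \<Rightarrow> 'a mat) set" where "X4 q = range (x4 q)"
definition X5 :: "nat \<Rightarrow> ('a::field mat \<Rightarrow> 'a mat) set" where "X5 q = x5 ` Fq q"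
definition X6 :: "nat \<Rightarrow> ('a::field mat \<Rightarrow> 'a mat) set" where "X6 q = x6 ` Fq q"

definition triality_U :: "nat \<Rightarrow> ('a::field mat \<Rightarrow> 'a mat) monoid" where
  "triality_U q = chevalley_D4\<lparr>carrier :=
     X2 q <#>\<^bsub>chevalley_D4\<^esub> X1 q <#>\<^bsub>chevalley_D4\<^esub> X3 q <#>\<^bsub>chevalley_D4\<^esub> X4 q
       <#>\<^bsub>chevalley_D4\<^esub> X5 q <#>\<^bsub>chevalley_D4\<^esub> X6 q\<rparr>"

definition x_elt :: "nat \<Rightarrow> 'a::field \<Rightarrow> 'a \<Rightarrow> 'a \<Rightarrow> 'a \<Rightarrow> 'a \<Rightarrow> 'a \<Rightarrow> 'a mat \<Rightarrow> 'a mat" where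
  "x_elt q t1 t2 t3 t4 t5 t6 =
     x2 t2 \<otimes>\<^bsub>triality_U q\<^esub> x1 q t1 \<otimes>\<^bsub>triality_U q\<^esub> x3 q t3
       \<otimes>\<^bsub>triality_U q\<^esub> x4 q t4 \<otimes>\<^bsub>triality_U q\<^esub> x5 t5 \<otimes>\<^bsub>triality_U q\<^esub> x6 t6"

definition X56 :: "nat \<Rightarrow> ('a::field mat \<Rightarrow> 'a mat) set" where
  "X56 q = X5 q <#>\<^bsub>triality_U q\<^esub> X6 q"

definition X456 :: "nat \<Rightarrow> ('a::field mat \<Rightarrow> 'a mat) set" where
  "X456 q = X4 q <#>\<^bsub>triality_U q\<^esub> X5 q <#>\<^bsub>triality_U q\<^esub> X6 q"

definition X3456 :: "nat \<Rightarrow> ('a::field mat \<Rightarrow> 'a mat) set" where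
  "X3456 q = X3 q <#>\<^bsub>triality_U q\<^esub> X4 q <#>\<^bsub>triality_U q\<^esub> X5 q <#>\<^bsub>triality_U q\<^esub> X6 q"

definition X45 :: "nat \<Rightarrow> ('a::field mat \<Rightarrow> 'a mat) set" where
  "X45 q = X4 q <#>\<^bsub>triality_U q\<^esub> X5 q"

definition X1456 :: "nat \<Rightarrow> ('a::field mat \<Rightarrow> 'a mat) set" where
  "X1456 q = X1 q <#>\<^bsub>triality_U q\<^esub> X4 q <#>\<^bsub>triality_U q\<^esub> X5 q <#>\<^bsub>triality_U q\<^esub> X6 q"


section \<open>Characters and transversals of the fields\<close>

definition \<phi>0 :: "nat \<Rightarrow> 'a::field \<Rightarrow> 'a" where
  "\<phi>0 q t = t + t ^ q + t ^ q\<^sup>2"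

definition \<pi>q :: "nat \<Rightarrow> 'a::field \<Rightarrow> 'a \<Rightarrow> 'a" where
  "\<pi>q q \<eta> t = \<phi>0 q (\<eta> * t)"

text \<open>Only the values of \<open>\<theta>\<close> on \<open>Fq q\<close> matter.\<close>

definition nontrivial_additive_char :: "nat \<Rightarrow> ('a::field \<Rightarrow> complex) \<Rightarrow> bool" where
  "nontrivial_additive_char q \<theta> \<longleftrightarrow>
     (\<forall>s\<in>Fq q. \<theta> s \<noteq> 0) \<and>
     (\<forall>s\<in>Fq q. \<forall>t\<in>Fq q. \<theta> (s + t) = \<theta> s * \<theta> t) \<and>
     (\<exists>s\<in>Fq q. \<theta> s \<noteq> 1)"

definition line_transversal :: "nat \<Rightarrow> 'a::field \<Rightarrow> 'a set \<Rightarrow> bool" where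
  "line_transversal q a S \<longleftrightarrow> 0 \<in> S \<and> (\<forall>t. \<exists>!r. r \<in> S \<and> t - r \<in> {a * s | s. s \<in> Fq q})"


section \<open>The irreducible characters of \<open>U\<close>\<close>

text \<open>Below, \<open>Ubar\<close>i is the quotient group, \<open>Hbar\<close>i its subgroup from which one induces, and
  \<open>\<mu>\<close>i the linear character which is induced.\<close>

definition Ubar_lin :: "nat \<Rightarrow> ('a::field mat \<Rightarrow> 'a mat) set monoid" where
  "Ubar_lin q = triality_U q Mod X3456 q"

definition \<mu>_lin :: "nat \<Rightarrow> 'a::field \<Rightarrow> ('a \<Rightarrow> complex) \<Rightarrow> 'a \<Rightarrow> 'a
    \<Rightarrow> ('a mat \<Rightarrow> 'a mat) set \<Rightarrow> complex" where
  "\<mu>_lin q \<eta> \<theta> A12 A23 =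
     on_coords (Fq q \<times> UNIV)
       (\<lambda>(t2, t1). (X3456 q #>\<^bsub>triality_U q\<^esub> x2 t2) \<otimes>\<^bsub>Ubar_lin q\<^esub> (X3456 q #>\<^bsub>triality_U q\<^esub> x1 q t1))
       (\<lambda>(t2, t1). \<theta> (\<pi>q q \<eta> (A12 * t1)) * \<theta> (A23 * t2))"

definition \<chi>_lin :: "nat \<Rightarrow> 'a::field \<Rightarrow> ('a \<Rightarrow> complex) \<Rightarrow> 'a \<Rightarrow> 'a
    \<Rightarrow> ('a mat \<Rightarrow> 'a mat) \<Rightarrow> complex" where
  "\<chi>_lin q \<eta> \<theta> A12 A23 = lift_char (triality_U q) (X3456 q) (\<mu>_lin q \<eta> \<theta> A12 A23)"

definition Ubar3 :: "nat \<Rightarrow> ('a::field mat \<Rightarrow> 'a mat) set monoid" where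
  "Ubar3 q = triality_U q Mod X456 q"

definition Hbar3 :: "nat \<Rightarrow> ('a::field mat \<Rightarrow> 'a mat) set set" where
  "Hbar3 q = bar (triality_U q) (X456 q) (X1 q) <#>\<^bsub>Ubar3 q\<^esub> bar (triality_U q) (X456 q) (X3 q)"

definition \<mu>3 :: "nat \<Rightarrow> 'a::field \<Rightarrow> ('a \<Rightarrow> complex) \<Rightarrow> 'a \<Rightarrow> 'a
    \<Rightarrow> ('a mat \<Rightarrow> 'a mat) set \<Rightarrow> complex" where
  "\<mu>3 q \<eta> \<theta> A13 A12 =
     on_coords UNIV
       (\<lambda>(t1, t3). (X456 q #>\<^bsub>triality_U q\<^esub> x1 q t1) \<otimes>\<^bsub>Ubar3 q\<^esub> (X456 q #>\<^bsub>triality_U q\<^esub> x3 q t3))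
       (\<lambda>(t1, t3). \<theta> (\<pi>q q \<eta> (A12 * t1 - A13 * t3)))"

definition \<chi>3 :: "nat \<Rightarrow> 'a::field \<Rightarrow> ('a \<Rightarrow> complex) \<Rightarrow> 'a \<Rightarrow> 'a
    \<Rightarrow> ('a mat \<Rightarrow> 'a mat) \<Rightarrow> complex" where
  "\<chi>3 q \<eta> \<theta> A13 A12 =
     lift_char (triality_U q) (X456 q) (ind_char (Ubar3 q) (Hbar3 q) (\<mu>3 q \<eta> \<theta> A13 A12))"

definition Ubar4 :: "nat \<Rightarrow> ('a::field mat \<Rightarrow> 'a mat) set monoid" where
  "Ubar4 q = triality_U q Mod X56 q"

definition Hbar4 :: "nat \<Rightarrow> ('a::field mat \<Rightarrow> 'a mat) set set" where
  "Hbar4 q = bar (triality_U q) (X56 q) (X2 q) <#>\<^bsub>Ubar4 q\<^esub> bar (triality_U q) (X56 q) (X3 q)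
     <#>\<^bsub>Ubar4 q\<^esub> bar (triality_U q) (X56 q) (X4 q)"

definition \<mu>4 :: "nat \<Rightarrow> 'a::field \<Rightarrow> ('a \<Rightarrow> complex) \<Rightarrow> 'a \<Rightarrow> 'a \<Rightarrow> 'a
    \<Rightarrow> ('a mat \<Rightarrow> 'a mat) set \<Rightarrow> complex" where
  "\<mu>4 q \<eta> \<theta> A15 A23 A13 =
     on_coords (Fq q \<times> UNIV \<times> UNIV)
       (\<lambda>(t2, t3, t4). (X56 q #>\<^bsub>triality_U q\<^esub> x2 t2) \<otimes>\<^bsub>Ubar4 q\<^esub> (X56 q #>\<^bsub>triality_U q\<^esub> x3 q t3)
          \<otimes>\<^bsub>Ubar4 q\<^esub> (X56 q #>\<^bsub>triality_U q\<^esub> x4 q t4))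
       (\<lambda>(t2, t3, t4). \<theta> (A23 * t2) * \<theta> (\<pi>q q \<eta> (- A13 * t3))
          * \<theta> (\<pi>q q \<eta> (A15 ^ q * t4 + A15 * t4 ^ q\<^sup>2)))"

definition \<chi>4 :: "nat \<Rightarrow> 'a::field \<Rightarrow> ('a \<Rightarrow> complex) \<Rightarrow> 'a \<Rightarrow> 'a
    \<Rightarrow> ('a mat \<Rightarrow> 'a mat) \<Rightarrow> complex" where
  "\<chi>4 q \<eta> \<theta> A15 A23 =
     lift_char (triality_U q) (X56 q) (ind_char (Ubar4 q) (Hbar4 q) (\<mu>4 q \<eta> \<theta> A15 A23 0))"

definition Ubar5 :: "nat \<Rightarrow> ('a::field mat \<Rightarrow> 'a mat) set monoid" where
  "Ubar5 q = triality_U q Mod X6 q"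

definition Hbar5 :: "nat \<Rightarrow> ('a::field mat \<Rightarrow> 'a mat) set set" where
  "Hbar5 q = bar (triality_U q) (X6 q) (X2 q) <#>\<^bsub>Ubar5 q\<^esub> bar (triality_U q) (X6 q) (X3 q)
     <#>\<^bsub>Ubar5 q\<^esub> bar (triality_U q) (X6 q) (X4 q) <#>\<^bsub>Ubar5 q\<^esub> bar (triality_U q) (X6 q) (X5 q)"

definition \<mu>5 :: "nat \<Rightarrow> 'a::field \<Rightarrow> ('a \<Rightarrow> complex) \<Rightarrow> 'a \<Rightarrow> 'a \<Rightarrow> 'a \<Rightarrow> 'a
    \<Rightarrow> ('a mat \<Rightarrow> 'a mat) set \<Rightarrow> complex" where
  "\<mu>5 q \<eta> \<theta> A16 A23 A13 A15 =
     on_coords (Fq q \<times> UNIV \<times> UNIV \<times> Fq q)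
       (\<lambda>(t2, t3, t4, t5). (X6 q #>\<^bsub>triality_U q\<^esub> x2 t2) \<otimes>\<^bsub>Ubar5 q\<^esub> (X6 q #>\<^bsub>triality_U q\<^esub> x3 q t3)
          \<otimes>\<^bsub>Ubar5 q\<^esub> (X6 q #>\<^bsub>triality_U q\<^esub> x4 q t4) \<otimes>\<^bsub>Ubar5 q\<^esub> (X6 q #>\<^bsub>triality_U q\<^esub> x5 t5))
       (\<lambda>(t2, t3, t4, t5). \<theta> (A23 * t2) * \<theta> (\<pi>q q \<eta> (- A13 * t3))
          * \<theta> (\<pi>q q \<eta> (A15 ^ q * t4 + A15 * t4 ^ q\<^sup>2)) * \<theta> (A16 * t5))"

definition \<chi>5 :: "nat \<Rightarrow> 'a::field \<Rightarrow> ('a \<Rightarrow> complex) \<Rightarrow> 'a \<Rightarrow> 'a \<Rightarrow> 'a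
    \<Rightarrow> ('a mat \<Rightarrow> 'a mat) \<Rightarrow> complex" where
  "\<chi>5 q \<eta> \<theta> A16 A23 A13 =
     lift_char (triality_U q) (X6 q) (ind_char (Ubar5 q) (Hbar5 q) (\<mu>5 q \<eta> \<theta> A16 A23 A13 0))"

text \<open>Here \<open>Hbar6\<close> is a quotient of the subgroup \<open>H6\<close> of \<open>U\<close>, and one induces from \<open>H6\<close>.\<close>

definition H6 :: "nat \<Rightarrow> ('a::field mat \<Rightarrow> 'a mat) monoid" where
  "H6 q = (triality_U q)\<lparr>carrier := X1456 q\<rparr>"

definition Hbar6 :: "nat \<Rightarrow> ('a::field mat \<Rightarrow> 'a mat) set monoid" where
  "Hbar6 q = H6 q Mod X45 q"

definition \<mu>6 :: "nat \<Rightarrow> 'a::field \<Rightarrow> ('a \<Rightarrow> complex) \<Rightarrow> 'a \<Rightarrow> 'a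
    \<Rightarrow> ('a mat \<Rightarrow> 'a mat) set \<Rightarrow> complex" where
  "\<mu>6 q \<eta> \<theta> A17 A12 =
     on_coords (UNIV \<times> Fq q)
       (\<lambda>(t1, t6). (X45 q #>\<^bsub>H6 q\<^esub> x1 q t1) \<otimes>\<^bsub>Hbar6 q\<^esub> (X45 q #>\<^bsub>H6 q\<^esub> x6 t6))
       (\<lambda>(t1, t6). \<theta> (\<pi>q q \<eta> (A12 * t1)) * \<theta> (A17 * t6))"

definition \<chi>6 :: "nat \<Rightarrow> 'a::field \<Rightarrow> ('a \<Rightarrow> complex) \<Rightarrow> 'a \<Rightarrow> 'a
    \<Rightarrow> ('a mat \<Rightarrow> 'a mat) \<Rightarrow> complex" where
  "\<chi>6 q \<eta> \<theta> A17 A12 =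
     ind_char (triality_U q) (X1456 q) (lift_char (H6 q) (X45 q) (\<mu>6 q \<eta> \<theta> A17 A12))"


section \<open>The commutator relations\<close>

abbreviation root_mat :: "pos_root \<Rightarrow> 'a::field \<Rightarrow> 'a mat" where
  "root_mat r t \<equiv> 1\<^sub>m 8 + t \<cdot>\<^sub>m root_vec r"

lemma unit8_carrier[simp]: "unit8 i j \<in> carrier_mat 8 8" "dim_row (unit8 i j) = 8" "dim_col (unit8 i j) = 8"
  by (auto simp: unit8_def)

lemma root_vec_carrier[simp]: "root_vec r \<in> carrier_mat 8 8"
  by (cases r) (auto simp: root_diff_def root_sum_def)
lemma root_vec_dim[simp]: "dim_row (root_vec r) = 8" "dim_col (root_vec r) = 8"
  by (rule carrier_matD[OF root_vec_carrier])+

definition vec8 :: "'a \<Rightarrow> 'a \<Rightarrow> 'a \<Rightarrow> 'a \<Rightarrow> 'a \<Rightarrow> 'a \<Rightarrow> 'a \<Rightarrow> 'a \<Rightarrow> 'a vec" where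
  "vec8 a b c d e f g h = vec 8 (\<lambda>i. [a,b,c,d,e,f,g,h] ! i)"

lemma vec8_carrier[simp]: "vec8 a b c d e f g h \<in> carrier_vec 8"
  by (simp add: vec8_def)

lemma vec8_ex: "v \<in> carrier_vec 8 \<Longrightarrow> v = vec8 (v$0) (v$1) (v$2) (v$3) (v$4) (v$5) (v$6) (v$7)"
  by (intro eq_vecI)
    (auto simp: vec8_def less_Suc_eq numeral_eq_Suc)

lemma root_mat_index: "i < 8 \<Longrightarrow> (root_mat r t *\<^sub>v vec8 a b c d e f g h) $ i =
   (let w = [a,b,c,d,e,f,g,h]; m = (\<lambda>j. root_vec r $$ (i,j)) in
    w ! i + t * (m 0 * a + m 1 * b + m 2 * c + m 3 * d + m 4 * e + m 5 * f + m 6 * g + m 7 * h))"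
  by (auto simp: vec8_def scalar_prod_def less_Suc_eq numeral_eq_Suc Let_def algebra_simps)

lemmas unit8_simps = root_diff_def root_sum_def unit8_def

lemma root_mat_vec8:
  "root_mat R1 t *\<^sub>v vec8 a b c d e f g h = vec8 (a + t * b) b c d e f (g - t * h) h"
  "root_mat R2 t *\<^sub>v vec8 a b c d e f g h = vec8 a (b + t * c) c d e (f - t * g) g h"
  "root_mat R3 t *\<^sub>v vec8 a b c d e f g h = vec8 a b (c + t * d) d (e - t * f) f g h"
  "root_mat R4 t *\<^sub>v vec8 a b c d e f g h = vec8 a b (c + t * e) (d - t * f) e f g h"
  "root_mat R12 t *\<^sub>v vec8 a b c d e f g h = vec8 (a - t * c) b c d e (f + t * h) g h"
  "root_mat R23 t *\<^sub>v vec8 a b c d e f g h = vec8 a (b + t * d) c d (e - t * g) f g h"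
  "root_mat R24 t *\<^sub>v vec8 a b c d e f g h = vec8 a (b + t * e) c (d - t * g) e f g h"
  "root_mat R123 t *\<^sub>v vec8 a b c d e f g h = vec8 (a + t * d) b c d (e - t * h) f g h"
  "root_mat R234 t *\<^sub>v vec8 a b c d e f g h = vec8 a (b + t * f) (c - t * g) d e f g h"
  "root_mat R124 t *\<^sub>v vec8 a b c d e f g h = vec8 (a + t * e) b c (d - t * h) e f g h"
  "root_mat R1234 t *\<^sub>v vec8 a b c d e f g h = vec8 (a + t * f) b (c - t * h) d e f g h"
  "root_mat R12234 t *\<^sub>v vec8 a b c d e f g h = vec8 (a + t * g) (b - t * h) c d e f g h"
  by (rule eq_vecI, subst root_mat_index; (simp add: vec8_def)?; 
      auto simp: vec8_def Let_def unit8_simps numeral_eq_Suc less_Suc_eq)+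

lemma mult_unit_vec_col: "A \<in> carrier_mat n m \<Longrightarrow> j < m \<Longrightarrow> A *\<^sub>v unit_vec m j = col A (j::nat)" for A :: "'a::field mat"
  by (intro eq_vecI) auto

lemma mat_eq_vec8:
  assumes "A \<in> carrier_mat 8 8" "B \<in> carrier_mat 8 8"
    and "\<And>a b c d e f g h. A *\<^sub>v vec8 a b c d e f g h = B *\<^sub>v vec8 a b c d e f g h"
  shows "A = (B :: 'a::field mat)"
proof (rule eq_matI)
  fix i j assume ij: "i < dim_row B" "j < dim_col B"
  have "A *\<^sub>v unit_vec 8 j = B *\<^sub>v unit_vec 8 j"
    using assms(3) vec8_ex[of "unit_vec 8 j"] by (metis unit_vec_carrier)
  hence "col A j = col B j" using assms(1,2) ij by (metis carrier_matD(2) mult_unit_vec_col)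
  thus "A $$ (i, j) = B $$ (i, j)" using assms(1,2) ij
    by (metis carrier_matD index_col)
qed (use assms in auto)

lemma root_mat_carrier[simp]: "root_mat r t \<in> carrier_mat 8 8"
  by auto

lemma root_mat_minus: "1\<^sub>m 8 - t \<cdot>\<^sub>m root_vec r = root_mat r (- t)"
  by (rule eq_matI) auto

lemma root_mat_inv: "root_mat r t * root_mat r (-t) = 1\<^sub>m 8"
proof (rule mat_eq_vec8)
  fix a b c d e f g h
  have "root_mat r t * root_mat r (-t) *\<^sub>v vec8 a b c d e f g h = root_mat r t *\<^sub>v (root_mat r (-t) *\<^sub>v vec8 a b c d e f g h)"
    by (rule assoc_mult_mat_vec) auto
  also have "\<dots> = vec8 a b c d e f g h"
    by (cases r; hypsubst; simp only: root_mat_vec8; simp)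
  finally show "root_mat r t * root_mat r (-t) *\<^sub>v vec8 a b c d e f g h = 1\<^sub>m 8 *\<^sub>v vec8 a b c d e f g h" by simp
qed auto

text \<open>Mutually inverse elements of the orthogonal group of \<^const>\<open>gram8\<close>.\<close>

definition iso_pair :: "'a::field mat \<Rightarrow> 'a mat \<Rightarrow> bool" where
  "iso_pair g h \<longleftrightarrow> g \<in> carrier_mat 8 8 \<and> h \<in> carrier_mat 8 8 \<and> g * h = 1\<^sub>m 8 \<and> h * g = 1\<^sub>m 8
     \<and> g\<^sup>T * gram8 = gram8 * h \<and> gram8 * g = h\<^sup>T * gram8"

definition conj_map :: "'a::field mat \<Rightarrow> 'a mat \<Rightarrow> 'a mat \<Rightarrow> 'a mat" where
  "conj_map g h = (\<lambda>A\<in>so8. g * A * h)"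

lemma gram8_carrier[simp]: "gram8 \<in> carrier_mat 8 8" by (simp add: gram8_def)

lemma gram8_dim[simp]: "dim_row gram8 = 8" "dim_col gram8 = 8" by (simp_all add: gram8_def)
lemmas mult_one8 [simp] = left_mult_one_mat[of _ 8 8] right_mult_one_mat[of _ 8 8]

lemma gram_root: "(root_vec r)\<^sup>T * gram8 + gram8 * root_vec r = 0\<^sub>m 8 8"
  by (cases r; rule eq_matI) (auto simp: unit8_simps gram8_def scalar_prod_def less_Suc_eq numeral_eq_Suc)

lemma iso_pair_root: "iso_pair (root_mat r t) (root_mat r (- t))" for t :: "'a::field"
proof -
  let ?e = "root_vec r :: 'a mat" and ?J = "gram8 :: 'a mat"
  have e: "?e \<in> carrier_mat 8 8" and J: "?J \<in> carrier_mat 8 8" by auto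
  have g: "?e\<^sup>T * ?J = - (?J * ?e)"
  proof (rule eq_matI)
    fix i j assume "i < dim_row (- (?J * ?e))" "j < dim_col (- (?J * ?e))"
    hence ij: "i < 8" "j < 8" using J by auto
    have "(?e\<^sup>T * ?J + ?J * ?e) $$ (i, j) = 0" using ij by (simp only: gram_root) simp
    thus "(?e\<^sup>T * ?J) $$ (i, j) = (- (?J * ?e)) $$ (i, j)"
      using ij e J by (simp add: eq_neg_iff_add_eq_0)
  qed (use J in auto)
  have 1: "(root_mat r t)\<^sup>T * ?J = ?J * root_mat r (- t)" if "True" for t :: 'a
  proof -
    have "(root_mat r t)\<^sup>T * ?J = (1\<^sub>m 8 + t \<cdot>\<^sub>m ?e\<^sup>T) * ?J"
    proof -
      have "(root_mat r t)\<^sup>T = 1\<^sub>m 8 + t \<cdot>\<^sub>m ?e\<^sup>T" by (rule eq_matI) auto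
      thus ?thesis by simp
    qed
    also have "\<dots> = ?J + t \<cdot>\<^sub>m (?e\<^sup>T * ?J)"
      using J e by (subst add_mult_distrib_mat[of _ 8 8]) auto
    also have "\<dots> = ?J + (- t) \<cdot>\<^sub>m (?J * ?e)"
      unfolding g by (rule eq_matI) auto
    also have "\<dots> = ?J * root_mat r (- t)"
      using J e by (subst mult_add_distrib_mat[of _ 8 8]) auto
    finally show ?thesis .
  qed
  have "root_mat r (- t) * root_mat r t = 1\<^sub>m 8" using root_mat_inv[where r = r and t = "- t"] by simp
  moreover have "?J * root_mat r t = (root_mat r (- t))\<^sup>T * ?J" using 1[of "- t"] by simp
  ultimately show ?thesis
    using 1[of t] root_mat_inv[where r = r and t = t] unfolding iso_pair_def by simp
qed

lemma exp_ad_conj_map: "xr r t = conj_map (root_mat r t) (root_mat r (-t))"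
  unfolding exp_ad_def conj_map_def root_mat_minus ..

lemma iso_pair_mult: "iso_pair g h \<Longrightarrow> iso_pair g' h' \<Longrightarrow> iso_pair (g * g') (h' * h)"
proof -
  assume a: "iso_pair g h" and b: "iso_pair g' h'"
  have c: "g \<in> carrier_mat 8 8" "h \<in> carrier_mat 8 8" "g' \<in> carrier_mat 8 8" "h' \<in> carrier_mat 8 8"
    using a b by (auto simp: iso_pair_def)
  have J: "gram8 \<in> carrier_mat 8 8" by simp
  note A = assoc_mult_mat[of _ 8 8 _ 8 _ 8]
  have "g * g' * (h' * h) = g * (g' * h') * h" using c by (simp add: A)
  also have "\<dots> = 1\<^sub>m 8" using a b c by (simp add: iso_pair_def)
  finally have 1: "g * g' * (h' * h) = 1\<^sub>m 8" .
  have "h' * h * (g * g') = h' * (h * g) * g'" using c by (simp add: A)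
  also have "\<dots> = 1\<^sub>m 8" using a b c by (simp add: iso_pair_def)
  finally have 2: "h' * h * (g * g') = 1\<^sub>m 8" .
  have "(g * g')\<^sup>T * gram8 = g'\<^sup>T * (g\<^sup>T * gram8)"
    using c by (simp add: transpose_mult[of _ 8 8] A)
  also have "\<dots> = (g'\<^sup>T * gram8) * h" using a c by (simp add: iso_pair_def A)
  also have "\<dots> = gram8 * (h' * h)" using b c by (simp add: iso_pair_def A)
  finally have 3: "(g * g')\<^sup>T * gram8 = gram8 * (h' * h)" .
  have "(h' * h)\<^sup>T * gram8 = h\<^sup>T * (h'\<^sup>T * gram8)"
    using c by (simp add: transpose_mult[of _ 8 8] A)
  also have "\<dots> = h\<^sup>T * (gram8 * g')" using b by (simp add: iso_pair_def)
  also have "\<dots> = (h\<^sup>T * gram8) * g'" using c by (simp add: A)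
  also have "\<dots> = (gram8 * g) * g'" using a by (simp add: iso_pair_def)
  also have "\<dots> = gram8 * (g * g')" using c by (simp add: A)
  finally show ?thesis using 1 2 3 c by (simp add: iso_pair_def)
qed

lemma conj_map_so8:
  assumes "iso_pair g h" "A \<in> so8"
  shows "g * A * h \<in> so8"
proof -
  note S = assoc_mult_mat[of _ 8 8 _ 8 _ 8]
  have c: "g \<in> carrier_mat 8 8" "h \<in> carrier_mat 8 8" "A \<in> carrier_mat 8 8"
    and gJ: "g\<^sup>T * gram8 = gram8 * h" and Jg: "gram8 * g = h\<^sup>T * gram8"
    and AJ: "A\<^sup>T * gram8 + gram8 * A = 0\<^sub>m 8 8"
    using assms by (auto simp: iso_pair_def so8_def)
  have "(g * A * h)\<^sup>T * gram8 = h\<^sup>T * (A\<^sup>T * (g\<^sup>T * gram8))"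
  proof -
    have "(g * A * h)\<^sup>T = h\<^sup>T * (g * A)\<^sup>T" by (rule transpose_mult[of _ 8 8 _ 8]) (use c in auto)
    also have "(g * A)\<^sup>T = A\<^sup>T * g\<^sup>T" by (rule transpose_mult[of _ 8 8 _ 8]) (use c in auto)
    finally show ?thesis using c by (simp add: S)
  qed
  also have "\<dots> = h\<^sup>T * (A\<^sup>T * gram8) * h" using c by (simp add: gJ S)
  finally have 1: "(g * A * h)\<^sup>T * gram8 = h\<^sup>T * (A\<^sup>T * gram8) * h" .
  have "gram8 * (g * A * h) = (gram8 * g) * A * h" using c by (simp add: S)
  also have "\<dots> = h\<^sup>T * (gram8 * A) * h" unfolding Jg using c by (simp add: S)
  finally have 2: "gram8 * (g * A * h) = h\<^sup>T * (gram8 * A) * h" .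
  have "h\<^sup>T * (A\<^sup>T * gram8) * h + h\<^sup>T * (gram8 * A) * h = h\<^sup>T * (A\<^sup>T * gram8 + gram8 * A) * h"
  proof -
    have "h\<^sup>T * (A\<^sup>T * gram8 + gram8 * A) = h\<^sup>T * (A\<^sup>T * gram8) + h\<^sup>T * (gram8 * A)"
      by (rule mult_add_distrib_mat[of _ 8 8 _ 8]) (use c in auto)
    moreover have "(h\<^sup>T * (A\<^sup>T * gram8) + h\<^sup>T * (gram8 * A)) * h
        = h\<^sup>T * (A\<^sup>T * gram8) * h + h\<^sup>T * (gram8 * A) * h"
      by (rule add_mult_distrib_mat[of _ 8 8 _ _ 8]) (use c in auto)
    ultimately show ?thesis by simp
  qed
  also have "\<dots> = 0\<^sub>m 8 8" unfolding AJ using c by simp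
  finally show ?thesis using 1 2 c by (simp add: so8_def)
qed

lemma so8_carrier: "A \<in> so8 \<Longrightarrow> A \<in> carrier_mat 8 8" by (simp add: so8_def)

lemma iso_pair_sym: "iso_pair g h \<Longrightarrow> iso_pair h g"
  by (auto simp: iso_pair_def)

lemma conj_map_inv:
  assumes "iso_pair g h" "A \<in> so8" shows "h * (g * A * h) * g = A"
proof -
  note S = assoc_mult_mat[of _ 8 8 _ 8 _ 8]
  have c: "g \<in> carrier_mat 8 8" "h \<in> carrier_mat 8 8" "A \<in> carrier_mat 8 8"
    "h * g = 1\<^sub>m 8"
    using assms by (auto simp: iso_pair_def so8_def)
  have "h * (g * A * h) * g = (h * g) * A * (h * g)" using c(1-3) by (simp add: S)
  thus ?thesis using c by simp
qed

lemma conj_map_Bij: "iso_pair g h \<Longrightarrow> conj_map g h \<in> Bij so8"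
  unfolding Bij_def conj_map_def
  by (auto intro!: bij_betw_byWitness[where f' = "\<lambda>A. h * A * g"]
      simp: conj_map_so8 iso_pair_sym conj_map_inv dest: iso_pair_sym)

lemma conj_map_mult:
  assumes "iso_pair g h" "iso_pair g' h'"
  shows "conj_map g h \<otimes>\<^bsub>BijGroup so8\<^esub> conj_map g' h' = conj_map (g * g') (h' * h)"
proof -
  have "compose so8 (conj_map g h) (conj_map g' h') = conj_map (g * g') (h' * h)"
  proof
    fix A
    show "compose so8 (conj_map g h) (conj_map g' h') A = conj_map (g * g') (h' * h) A"
    proof (cases "A \<in> so8")
      case True
      have c: "g \<in> carrier_mat 8 8" "h \<in> carrier_mat 8 8" "A \<in> carrier_mat 8 8"
        "g' \<in> carrier_mat 8 8" "h' \<in> carrier_mat 8 8"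
        using assms True by (auto simp: iso_pair_def so8_def)
      show ?thesis using True c conj_map_so8[OF assms(2) True]
        by (simp add: compose_def conj_map_def assoc_mult_mat[of _ 8 8 _ 8 _ 8])
    qed (simp add: compose_def conj_map_def)
  qed
  thus ?thesis using assms by (simp add: BijGroup_def conj_map_Bij)
qed

lemma iso_pair_unique: "iso_pair g h \<Longrightarrow> iso_pair g h' \<Longrightarrow> h = h'"
proof -
  assume a: "iso_pair g h" "iso_pair g h'"
  have "h = h * (g * h')" using a unfolding iso_pair_def by (metis right_mult_one_mat)
  also have "\<dots> = (h * g) * h'" using a unfolding iso_pair_def by (metis assoc_mult_mat)
  also have "\<dots> = h'" using a by (auto simp: iso_pair_def)
  finally show ?thesis .
qed

text \<open>Words in root elements.  Two words are compared through their action on the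
  coordinates of a vector of length 8.\<close>

fun word_mat :: "(pos_root \<times> 'a::field) list \<Rightarrow> 'a mat" where
  "word_mat [] = 1\<^sub>m 8"
| "word_mat ((r, t) # w) = root_mat r t * word_mat w"

fun word_inv :: "(pos_root \<times> 'a::field) list \<Rightarrow> 'a mat" where
  "word_inv [] = 1\<^sub>m 8"
| "word_inv ((r, t) # w) = word_inv w * root_mat r (- t)"

lemma iso_pair_one: "iso_pair (1\<^sub>m 8) (1\<^sub>m 8)"
  by (auto simp: iso_pair_def)

lemma iso_pair_w: "iso_pair (word_mat w) (word_inv w)"
proof (induction w)
  case (Cons a w)
  thus ?case by (cases a) (auto intro: iso_pair_mult iso_pair_root)
qed (simp add: iso_pair_one)

lemma word_mat_carrier[simp]: "word_mat w \<in> carrier_mat 8 8" "word_inv w \<in> carrier_mat 8 8"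
  using iso_pair_w[of w] by (auto simp: iso_pair_def)

definition word_aut :: "(pos_root \<times> 'a::field) list \<Rightarrow> 'a mat \<Rightarrow> 'a mat" where
  "word_aut w = conj_map (word_mat w) (word_inv w)"

lemma word_mat_append: "word_mat (v @ w) = word_mat v * word_mat w"
proof (induction v)
  case (Cons a v)
  obtain r t where a: "a = (r, t)" by (cases a)
  show ?case using Cons unfolding a by (simp add: assoc_mult_mat[of _ 8 8 _ 8 _ 8])
qed simp

lemma word_inv_append: "word_inv (v @ w) = word_inv w * word_inv v"
proof (induction v)
  case (Cons a v)
  obtain r t where a: "a = (r, t)" by (cases a)
  show ?case using Cons unfolding a by (simp add: assoc_mult_mat[of _ 8 8 _ 8 _ 8])
qed simp

lemma word_aut_mult: "word_aut v \<otimes>\<^bsub>BijGroup so8\<^esub> word_aut w = word_aut (v @ w)"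
  unfolding word_aut_def by (simp add: conj_map_mult iso_pair_w word_mat_append word_inv_append)

lemma xr_word: "xr r t = word_aut [(r, t)]"
  unfolding word_aut_def exp_ad_conj_map by simp

lemma word_aut_Bij: "word_aut w \<in> Bij so8"
  unfolding word_aut_def by (rule conj_map_Bij) (rule iso_pair_w)

lemma word_aut_Nil: "word_aut [] = \<one>\<^bsub>BijGroup so8\<^esub>"
  by (auto simp: word_aut_def conj_map_def BijGroup_def so8_def fun_eq_iff)

fun word_act :: "(pos_root \<times> 'a::field) list \<Rightarrow> 'a vec \<Rightarrow> 'a vec" where
  "word_act [] v = v"
| "word_act ((r, t) # w) v = root_mat r t *\<^sub>v word_act w v"

lemma word_act: "v \<in> carrier_vec 8 \<Longrightarrow> word_mat w *\<^sub>v v = word_act w v \<and> word_act w v \<in> carrier_vec 8"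
proof (induction w)
  case (Cons a w)
  obtain r t where a: "a = (r, t)" by (cases a)
  show ?case using Cons unfolding a
    by (simp add: assoc_mult_mat_vec[of _ 8 8 _ 8] mult_mat_vec_carrier[OF root_mat_carrier] del: assoc_mult_mat_vec)
qed simp

lemma word_aut_eqI:
  assumes "\<And>a b c d e f g h. word_act v (vec8 a b c d e f g h) = word_act w (vec8 a b c d e f g h)"
  shows "word_aut v = word_aut w"
proof -
  have e: "word_mat v = word_mat w"
    by (rule mat_eq_vec8) (use assms word_act[OF vec8_carrier] in \<open>auto simp: word_act[OF vec8_carrier]\<close>)
  have "word_inv v = word_inv w"
    using iso_pair_unique[of "word_mat v" "word_inv v" "word_inv w"] iso_pair_w[of v] iso_pair_w[of w] e by simp
  with e show ?thesis by (simp add: word_aut_def)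
qed

lemma D4_mult: "mult chevalley_D4 = mult (BijGroup so8)" "one chevalley_D4 = one (BijGroup so8)"
  by (auto simp: chevalley_D4_def)

definition word1 where "word1 q t = [(R1, t), (R3, t ^ q), (R4, t ^ q\<^sup>2)]"
definition word3 where "word3 q t = [(R12, t), (R23, t ^ q), (R24, t ^ q\<^sup>2)]"
definition word4 where "word4 q t = [(R123, t), (R234, t ^ q), (R124, t ^ q\<^sup>2)]"

lemmas word_defs = word1_def word3_def word4_def

lemma x_word:
  "x1 q t = word_aut (word1 q t)" "x3 q t = word_aut (word3 q t)" "x4 q t = word_aut (word4 q t)"
  "x2 t = word_aut [(R2, t)]" "x5 t = word_aut [(R1234, t)]" "x6 t = word_aut [(R12234, t)]"
  by (simp_all only: x1_def x3_def x4_def x2_def x5_def x6_def D4_mult xr_word word_aut_mult word_defs append.simps)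

lemma of_nat_card_UNIV_eq_0: "of_nat (card (UNIV :: 'a set)) = (0 :: 'a::finite_field)"
proof -
  have "(\<Sum>t\<in>UNIV. t + (1 :: 'a)) = (\<Sum>t\<in>UNIV. t)"
    by (rule sum.reindex_bij_witness[of _ "\<lambda>t. t - 1" "\<lambda>t. t + 1"]) auto
  thus ?thesis by (simp add: sum.distrib)
qed

lemma commutator_eqI:
  fixes G (structure)
  assumes "group G" "a \<in> carrier G" "b \<in> carrier G" "c \<in> carrier G"
    and "a \<otimes>\<^bsub>G\<^esub> b = b \<otimes>\<^bsub>G\<^esub> a \<otimes>\<^bsub>G\<^esub> c"
  shows "inv\<^bsub>G\<^esub> a \<otimes>\<^bsub>G\<^esub> inv\<^bsub>G\<^esub> b \<otimes>\<^bsub>G\<^esub> a \<otimes>\<^bsub>G\<^esub> b = c"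
proof -
  interpret group G by fact
  have "inv a \<otimes> inv b \<otimes> a \<otimes> b = inv a \<otimes> inv b \<otimes> (a \<otimes> b)"
    using assms(2-4) by (simp add: m_assoc)
  also have "\<dots> = inv (b \<otimes> a) \<otimes> (b \<otimes> a \<otimes> c)"
    using assms(2-5) by (simp add: inv_mult_group)
  also have "\<dots> = inv (b \<otimes> a) \<otimes> (b \<otimes> a) \<otimes> c"
    using assms(2-4) by (intro m_assoc[symmetric]) auto
  also have "\<dots> = c" using assms(2-4) by simp
  finally show ?thesis .
qed

lemma word_commutator:
  assumes "word_aut (v @ w) = word_aut (w @ v @ z)"
  shows "inv\<^bsub>BijGroup so8\<^esub> word_aut v \<otimes>\<^bsub>BijGroup so8\<^esub> inv\<^bsub>BijGroup so8\<^esub> word_aut w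
    \<otimes>\<^bsub>BijGroup so8\<^esub> word_aut v \<otimes>\<^bsub>BijGroup so8\<^esub> word_aut w = word_aut z"
  by (rule commutator_eqI)
     (use assms in \<open>simp_all add: group_BijGroup word_aut_mult, simp_all add: BijGroup_def word_aut_Bij\<close>)

text \<open>The signs in \<^const>\<open>root_vec\<close> are those which give the following relations.  The inverses
  may be taken in any subgroup of \<^term>\<open>BijGroup so8\<close>.\<close>

theorem commutator_relations:
  fixes t1 t2 t3 t4 t5 t6 :: "'a::finite_field"
  assumes "prime p" "odd p" "q = p ^ k" "card (UNIV :: 'a set) = q ^ 3" "t2 \<in> Fq q"
  defines "G \<equiv> BijGroup (so8 :: 'a mat set)"
  defines "comm \<equiv> \<lambda>a b. inv\<^bsub>G\<^esub> a \<otimes>\<^bsub>G\<^esub> inv\<^bsub>G\<^esub> b \<otimes>\<^bsub>G\<^esub> a \<otimes>\<^bsub>G\<^esub> b"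
  shows
   "comm (x1 q t1) (x2 t2) =
      x3 q (- t2 * t1) \<otimes>\<^bsub>G\<^esub> x4 q (t2 * t1 ^ (q + 1))
        \<otimes>\<^bsub>G\<^esub> x5 (- t2 * t1 ^ (q\<^sup>2 + q + 1)) \<otimes>\<^bsub>G\<^esub> x6 (2 * t2\<^sup>2 * t1 ^ (q\<^sup>2 + q + 1))"
   "comm (x1 q t1) (x3 q t3) =
      x4 q (t1 * t3 ^ q + t1 ^ q * t3)
        \<otimes>\<^bsub>G\<^esub> x5 (- (t1 ^ (q + 1) * t3 ^ q\<^sup>2) - t1 ^ (q\<^sup>2 + q) * t3 - t1 ^ (q\<^sup>2 + 1) * t3 ^ q)
        \<otimes>\<^bsub>G\<^esub> x6 (- t1 * t3 ^ (q\<^sup>2 + q) - t1 ^ q * t3 ^ (q\<^sup>2 + 1) - t1 ^ q\<^sup>2 * t3 ^ (q + 1))"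
   "comm (x1 q t1) (x4 q t4) = x5 (t1 * t4 ^ q + t1 ^ q * t4 ^ q\<^sup>2 + t1 ^ q\<^sup>2 * t4)"
   "comm (x3 q t3) (x4 q t4) = x6 (t3 * t4 ^ q + t3 ^ q * t4 ^ q\<^sup>2 + t3 ^ q\<^sup>2 * t4)"
   "comm (x2 t2) (x5 t5) = x6 (t2 * t5)"
   "comm (x1 q t1) (x5 t5) = \<one>\<^bsub>G\<^esub>" "comm (x1 q t1) (x6 t6) = \<one>\<^bsub>G\<^esub>"
   "comm (x2 t2) (x3 q t3) = \<one>\<^bsub>G\<^esub>" "comm (x2 t2) (x4 q t4) = \<one>\<^bsub>G\<^esub>" "comm (x2 t2) (x6 t6) = \<one>\<^bsub>G\<^esub>"
   "comm (x3 q t3) (x5 t5) = \<one>\<^bsub>G\<^esub>" "comm (x3 q t3) (x6 t6) = \<one>\<^bsub>G\<^esub>"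
   "comm (x4 q t4) (x5 t5) = \<one>\<^bsub>G\<^esub>" "comm (x4 q t4) (x6 t6) = \<one>\<^bsub>G\<^esub>"
   "comm (x5 t5) (x6 t6) = \<one>\<^bsub>G\<^esub>"
proof -
  have "CHAR('a) dvd (p ^ k) ^ 3"
    using of_nat_card_UNIV_eq_0[where ?'a = 'a] unfolding assms(3,4) of_nat_eq_0_iff_char_dvd .
  moreover have prime_char: "prime CHAR('a)"
    by (intro prime_CHAR_semidom finite_imp_CHAR_pos) simp
  ultimately have char: "CHAR('a) = p"
    using assms(1) by (metis prime_dvd_power primes_dvd_imp_eq)
  have add: "(a + b) ^ q = a ^ q + b ^ q" for a b :: 'a
    by (rule freshmans_dream') (use char prime_char assms(3) in auto)
  have neg: "(- a) ^ q = - (a ^ q)" for a :: 'a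
    using assms(2,3) by simp
  have p2: "a ^ q\<^sup>2 = (a ^ q) ^ q" for a :: 'a
    by (simp add: power2_eq_square power_mult)
  have p3: "((a ^ q) ^ q) ^ q = a" for a :: 'a
    using finite_field_power_card_eq_same[of a] assms(4) by (simp add: power3_eq_cube power_mult)
  have t2: "t2 ^ q = t2" using assms(5) by (simp add: Fq_def)
  note frob = p2 p3 add neg t2 power_mult_distrib power_add power2_eq_square[of t2]
  note one = word_aut_Nil[symmetric]
  show
   "comm (x1 q t1) (x2 t2) =
      x3 q (- t2 * t1) \<otimes>\<^bsub>G\<^esub> x4 q (t2 * t1 ^ (q + 1))
        \<otimes>\<^bsub>G\<^esub> x5 (- t2 * t1 ^ (q\<^sup>2 + q + 1)) \<otimes>\<^bsub>G\<^esub> x6 (2 * t2\<^sup>2 * t1 ^ (q\<^sup>2 + q + 1))"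
   "comm (x1 q t1) (x3 q t3) =
      x4 q (t1 * t3 ^ q + t1 ^ q * t3)
        \<otimes>\<^bsub>G\<^esub> x5 (- (t1 ^ (q + 1) * t3 ^ q\<^sup>2) - t1 ^ (q\<^sup>2 + q) * t3 - t1 ^ (q\<^sup>2 + 1) * t3 ^ q)
        \<otimes>\<^bsub>G\<^esub> x6 (- t1 * t3 ^ (q\<^sup>2 + q) - t1 ^ q * t3 ^ (q\<^sup>2 + 1) - t1 ^ q\<^sup>2 * t3 ^ (q + 1))"
   "comm (x1 q t1) (x4 q t4) = x5 (t1 * t4 ^ q + t1 ^ q * t4 ^ q\<^sup>2 + t1 ^ q\<^sup>2 * t4)"
   "comm (x3 q t3) (x4 q t4) = x6 (t3 * t4 ^ q + t3 ^ q * t4 ^ q\<^sup>2 + t3 ^ q\<^sup>2 * t4)"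
   "comm (x2 t2) (x5 t5) = x6 (t2 * t5)"
   "comm (x1 q t1) (x5 t5) = \<one>\<^bsub>G\<^esub>" "comm (x1 q t1) (x6 t6) = \<one>\<^bsub>G\<^esub>"
   "comm (x2 t2) (x3 q t3) = \<one>\<^bsub>G\<^esub>" "comm (x2 t2) (x4 q t4) = \<one>\<^bsub>G\<^esub>" "comm (x2 t2) (x6 t6) = \<one>\<^bsub>G\<^esub>"
   "comm (x3 q t3) (x5 t5) = \<one>\<^bsub>G\<^esub>" "comm (x3 q t3) (x6 t6) = \<one>\<^bsub>G\<^esub>"
   "comm (x4 q t4) (x5 t5) = \<one>\<^bsub>G\<^esub>" "comm (x4 q t4) (x6 t6) = \<one>\<^bsub>G\<^esub>"
   "comm (x5 t5) (x6 t6) = \<one>\<^bsub>G\<^esub>"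
    unfolding x_word comm_def G_def word_aut_mult one
    by (rule word_commutator, rule word_aut_eqI,
        simp only: word_defs append.simps append_assoc word_act.simps root_mat_vec8,
        simp add: algebra_simps frob)+
qed

end

theory Submission
  imports Defs "Jordan_Normal_Form.Char_Poly"
    "HOL-Computational_Algebra.Fundamental_Theorem_Algebra"
begin

text \<open>Commuting with suitable diagonal elements of the Lie algebra shows that \<open>x(t\<^sub>1, \<dots>, t\<^sub>6)\<close> determines its
  parameters, and multiplying the 8 by 8 root matrices gives an explicit multiplication law in these coordinates.
  The equation \<open>v x = y v\<close> expressing conjugacy then becomes a triangular system which is solved one
  coordinate at a time; this uses that \<open>q\<close> is odd and that \<open>r \<mapsto> t r\<^sup>q + t\<^sup>q r\<close> is bijective for \<open>t \<noteq> 0\<close>.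

  Each character in (B) is induced from a linear character \<open>\<mu>\<close> of a subgroup \<open>H\<close>. Irreducibility follows
  from a normal subgroup inside \<open>H\<close> on which the conjugates of \<open>\<mu>\<close> by a transversal of \<open>H\<close> are
  pairwise distinct, and two such inductions can only agree if the linear characters are conjugate.
  The squares of the degrees sum up to \<open>q ^ 12 = |U|\<close>, so by Bessel's inequality for the regular character the
  families exhaust \<open>Irr U\<close>. The values are the usual sums over a transversal.\<close>

section \<open>Characters of finite groups\<close>

text \<open>The elements of U are automorphisms of \<open>so8\<close>, not matrices. Equal matrices
  of words give equal automorphisms, but conjugation forgets scalar factors, so that different
  parameters give different elements has to be recovered from the action on diagonal elements. In
  both halves the engine is the nondegenerate form Tr (a r), explicit because \<eta> has trace 1.
  For classes it lets a coordinate of the conjugating element reach any value of a later coordinate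
  of the conjugate; for characters it makes \<theta> see the commutator shifts caused by different
  transversal elements. The commutator of X1 with X3 is different, since its leading term t r^q +
  t^q r ranges over the large field. There the obstacle would be a nonzero w with w^q = - w, which
  cannot exist because Frobenius has order 3 and q is odd. Counting takes the place of Clifford
  theory: the families only have to be irreducible, distinct and large enough, and their kernels are
  read off from their values afterwards.\<close>

lemma subspace_module_vec_iff:
  "VectorSpace.subspace class_ring W (module_vec TYPE(complex) n) \<longleftrightarrow>
     W \<subseteq> carrier_vec n \<and> 0\<^sub>v n \<in> W \<and> (\<forall>v\<in>W. \<forall>w\<in>W. v + w \<in> W) \<and> (\<forall>c. \<forall>v\<in>W. c \<cdot>\<^sub>v v \<in> W)"
  unfolding VectorSpace.subspace_def submodule_def
  using vec_vs[where ?'a = complex and n = n] vec_module[where ?'a = complex and n = n]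
  by (auto simp: module_vec_simps)

section \<open>Matrix representations and Schur's lemma\<close>

lemma matrix_repD:
  assumes "matrix_rep G n \<rho>"
  shows "g \<in> carrier G \<Longrightarrow> \<rho> g \<in> carrier_mat n n" "\<rho> \<one>\<^bsub>G\<^esub> = 1\<^sub>m n"
    "g \<in> carrier G \<Longrightarrow> h \<in> carrier G \<Longrightarrow> \<rho> (g \<otimes>\<^bsub>G\<^esub> h) = \<rho> g * \<rho> h"
  using assms by (auto simp: matrix_rep_def)

lemma index_mult_mat_sum:
  assumes "A \<in> carrier_mat n m" "B \<in> carrier_mat m l" "i < n" "j < l"
  shows "(A * B) $$ (i, j) = (\<Sum>k<m. A $$ (i, k) * B $$ (k, j))"
  using assms by (auto simp: scalar_prod_def atLeast0LessThan intro!: sum.cong)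

lemma matrix_rep_index_mult:
  assumes "matrix_rep G n \<rho>" "g \<in> carrier G" "h \<in> carrier G" "i < n" "j < n"
  shows "\<rho> (g \<otimes>\<^bsub>G\<^esub> h) $$ (i, j) = (\<Sum>k<n. \<rho> g $$ (i, k) * \<rho> h $$ (k, j))"
  using index_mult_mat_sum[OF matrix_repD(1)[OF assms(1,2)] matrix_repD(1)[OF assms(1,3)]]
    matrix_repD(3)[OF assms(1-3)] assms(4,5) by simp

text \<open>The trace is cyclic for rectangular factors too. Thus an invertible n by m intertwiner
  yields equal characters before n = m is known.\<close>

lemma sum_diag_mult_commute:
  fixes A :: "'a :: comm_ring_1 mat"
  assumes "A \<in> carrier_mat n m" "B \<in> carrier_mat m n"
  shows "(\<Sum>i<n. (A * B) $$ (i, i)) = (\<Sum>i<m. (B * A) $$ (i, i))"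
proof -
  have "(\<Sum>i<n. (A * B) $$ (i, i)) = (\<Sum>i<n. \<Sum>k<m. A $$ (i, k) * B $$ (k, i))"
    using assms by (intro sum.cong refl index_mult_mat_sum) auto
  also have "\<dots> = (\<Sum>k<m. \<Sum>i<n. B $$ (k, i) * A $$ (i, k))"
    by (subst sum.swap) (simp add: mult.commute)
  also have "\<dots> = (\<Sum>k<m. (B * A) $$ (k, k))"
    using assms by (intro sum.cong refl index_mult_mat_sum[symmetric]) auto
  finally show ?thesis .
qed

text \<open>Schur's lemma: kernel and image of an intertwiner are invariant subspaces, so a nonzero
  T has trivial kernel and full image. The two-sided inverse is exhibited as a matrix because n and
  m are not assumed equal.\<close>

lemma intertwiner_zero_or_invertible:
  assumes irr: "irreducible_rep G n \<rho>" "irreducible_rep G m \<sigma>"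
    and T: "T \<in> carrier_mat n m"
    and comm: "\<And>g. g \<in> carrier G \<Longrightarrow> \<rho> g * T = T * \<sigma> g"
  shows "T = 0\<^sub>m n m \<or> (\<exists>S\<in>carrier_mat m n. T * S = 1\<^sub>m n \<and> S * T = 1\<^sub>m m)"
proof (cases "T = 0\<^sub>m n m")
  case False
  have rho: "matrix_rep G n \<rho>" and sig: "matrix_rep G m \<sigma>" using irr by (auto simp: irreducible_rep_def)
  note rC = matrix_repD(1)[OF rho] and sC = matrix_repD(1)[OF sig]
  let ?K = "{v \<in> carrier_vec m. T *\<^sub>v v = 0\<^sub>v n}"
  let ?I = "(\<lambda>v. T *\<^sub>v v) ` carrier_vec m"
  have zero_if: "T = 0\<^sub>m n m" if "\<And>v. v \<in> carrier_vec m \<Longrightarrow> T *\<^sub>v v = 0\<^sub>v n"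
  proof (rule eq_matI)
    fix i j assume ij: "i < dim_row (0\<^sub>m n m)" "j < dim_col (0\<^sub>m n m)"
    have "col T j = 0\<^sub>v n"
      using that[of "unit_vec m j"] mult_unit_vec_col[OF T, of j] ij by simp
    with ij T show "T $$ (i, j) = 0\<^sub>m n m $$ (i, j)"
      by (metis carrier_matD index_col index_zero_mat index_zero_vec(1))
  qed (use T in auto)
  have "?K = {0\<^sub>v m} \<or> ?K = carrier_vec m"
  proof -
    have "VectorSpace.subspace class_ring ?K (module_vec TYPE(complex) m)"
      unfolding subspace_module_vec_iff using T
      by (auto simp: mult_add_distrib_mat_vec[OF T] mult_mat_vec[OF T])
    moreover have "\<sigma> g *\<^sub>v w \<in> ?K" if "g \<in> carrier G" "w \<in> ?K" for g w
    proof -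
      have "T *\<^sub>v (\<sigma> g *\<^sub>v w) = \<rho> g *\<^sub>v (T *\<^sub>v w)"
        using that T comm[OF that(1)] rC[OF that(1)] sC[OF that(1)]
        by (metis (no_types, lifting) assoc_mult_mat_vec mem_Collect_eq)
      also have "\<dots> = 0\<^sub>v n" using that rC[OF that(1)] by auto
      finally show ?thesis using that sC[OF that(1)] by auto
    qed
    ultimately show ?thesis using irr(2) unfolding irreducible_rep_def by blast
  qed
  with zero_if False have K: "?K = {0\<^sub>v m}" by blast
  have "?I = {0\<^sub>v n} \<or> ?I = carrier_vec n"
  proof -
    have "VectorSpace.subspace class_ring ?I (module_vec TYPE(complex) n)"
      unfolding subspace_module_vec_iff
    proof (intro conjI ballI allI)
      show "?I \<subseteq> carrier_vec n" using T by auto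
      show "0\<^sub>v n \<in> ?I" using T by (intro image_eqI[of _ _ "0\<^sub>v m"]) auto
      show "v + w \<in> ?I" if "v \<in> ?I" "w \<in> ?I" for v w
        using that by (auto simp: mult_add_distrib_mat_vec[OF T, symmetric])
      show "c \<cdot>\<^sub>v v \<in> ?I" if "v \<in> ?I" for c v
        using that by (auto simp: mult_mat_vec[OF T, symmetric])
    qed
    moreover have "\<rho> g *\<^sub>v w \<in> ?I" if "g \<in> carrier G" "w \<in> ?I" for g w
    proof -
      obtain v where v: "v \<in> carrier_vec m" "w = T *\<^sub>v v" using \<open>w \<in> ?I\<close> by auto
      have "\<rho> g *\<^sub>v w = T *\<^sub>v (\<sigma> g *\<^sub>v v)"
        using that T comm[OF that(1)] rC[OF that(1)] sC[OF that(1)] v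
        by (metis (no_types, lifting) assoc_mult_mat_vec)
      thus ?thesis using v sC[OF that(1)] by auto
    qed
    ultimately show ?thesis using irr(1) unfolding irreducible_rep_def by blast
  qed
  with zero_if False have I: "?I = carrier_vec n" by blast
  \<comment> \<open>Preimages of the unit vectors, taken as columns, form a right inverse S. That S
    is also a left inverse follows from the trivial kernel of T.\<close>
  have "\<exists>s. \<forall>i<n. s i \<in> carrier_vec m \<and> T *\<^sub>v s i = unit_vec n i"
  proof -
    have "\<forall>i. \<exists>v. i < n \<longrightarrow> v \<in> carrier_vec m \<and> T *\<^sub>v v = unit_vec n i"
    proof
      fix i
      have "unit_vec n i \<in> ?I" unfolding I by simp
      thus "\<exists>v. i < n \<longrightarrow> v \<in> carrier_vec m \<and> T *\<^sub>v v = unit_vec n i" by (metis imageE)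
    qed
    thus ?thesis by metis
  qed
  then obtain s where s: "\<And>i. i < n \<Longrightarrow> s i \<in> carrier_vec m" "\<And>i. i < n \<Longrightarrow> T *\<^sub>v s i = unit_vec n i"
    by blast
  define S where "S = mat m n (\<lambda>(i, j). s j $ i)"
  have S: "S \<in> carrier_mat m n" by (simp add: S_def)
  have colS: "col S j = s j" if "j < n" for j
    using s(1)[OF that] that by (intro eq_vecI) (auto simp: S_def)
  have TS: "T * S = 1\<^sub>m n"
  proof (rule mat_col_eqI)
    fix j assume "j < dim_col (1\<^sub>m n :: complex mat)"
    thus "col (T * S) j = col (1\<^sub>m n) j" using s(2)[of j] colS[of j] by (simp add: col_mult2[OF T S])
  qed (use T S in auto)
  have "S * T = 1\<^sub>m m"
  proof (rule mat_col_eqI)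
    fix j assume "j < dim_col (1\<^sub>m m :: complex mat)"
    hence j: "j < m" by simp
    have "T *\<^sub>v (S *\<^sub>v col T j) = T *\<^sub>v unit_vec m j"
    proof -
      have "T *\<^sub>v (S *\<^sub>v col T j) = (T * S) *\<^sub>v col T j" using T S j by (simp add: assoc_mult_mat_vec[of _ n m _ n])
      also have "\<dots> = col T j" unfolding TS using T j by auto
      also have "\<dots> = T *\<^sub>v unit_vec m j" using mult_unit_vec_col[OF T j] by simp
      finally show ?thesis .
    qed
    hence "T *\<^sub>v (S *\<^sub>v col T j - unit_vec m j) = 0\<^sub>v n"
      using T S j by (simp add: mult_minus_distrib_mat_vec[OF T])
    hence "S *\<^sub>v col T j - unit_vec m j \<in> ?K" using T S j by auto
    hence "S *\<^sub>v col T j - unit_vec m j = 0\<^sub>v m" using K by blast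
    hence "S *\<^sub>v col T j = unit_vec m j"
      using T S j by (intro eq_vecI) (auto simp: vec_eq_iff)
    thus "col (S * T) j = col (1\<^sub>m m) j" using j by (simp add: col_mult2[OF S T])
  qed (use T S in auto)
  with TS S show ?thesis by blast
qed simp


lemma ex_eigenvector:
  assumes T: "T \<in> carrier_mat n n" and n: "n > 0"
  obtains c v where "v \<in> carrier_vec n" "v \<noteq> 0\<^sub>v n" "T *\<^sub>v v = (c :: complex) \<cdot>\<^sub>v v"
proof -
  have "degree (char_poly T) > 0" using degree_monic_char_poly[OF T] n by auto
  hence "\<exists>c. poly (char_poly T) c = 0"
    by (intro fundamental_theorem_of_algebra) (simp add: constant_degree)
  then obtain c where "eigenvalue T c" using eigenvalue_root_char_poly[OF T] by auto
  thus ?thesis using that T unfolding eigenvalue_def eigenvector_def by auto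
qed

text \<open>Over the complex numbers T has an eigenvalue c. Then T - c is an intertwiner that kills
  an eigenvector, so it is not invertible and must be 0.\<close>

lemma intertwiner_scalar:
  assumes irr: "irreducible_rep G n \<rho>" and T: "T \<in> carrier_mat n n"
    and comm: "\<And>g. g \<in> carrier G \<Longrightarrow> \<rho> g * T = T * \<rho> g"
  obtains c where "T = c \<cdot>\<^sub>m 1\<^sub>m n"
proof -
  have n: "n > 0" and rho: "matrix_rep G n \<rho>" using irr by (auto simp: irreducible_rep_def)
  obtain c v where v: "v \<in> carrier_vec n" "v \<noteq> 0\<^sub>v n" "T *\<^sub>v v = c \<cdot>\<^sub>v v"
    using ex_eigenvector[OF T n] by metis
  let ?T = "T - c \<cdot>\<^sub>m 1\<^sub>m n"
  have T': "?T \<in> carrier_mat n n" using T by auto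
  have "?T *\<^sub>v v = T *\<^sub>v v - c \<cdot>\<^sub>v v"
  proof -
    have "(c \<cdot>\<^sub>m 1\<^sub>m n) *\<^sub>v v = c \<cdot>\<^sub>v (1\<^sub>m n *\<^sub>v v)"
      using v(1) by (intro eq_vecI) auto
    thus ?thesis using minus_mult_distrib_mat_vec[OF T, of "c \<cdot>\<^sub>m 1\<^sub>m n" v] v(1) by simp
  qed
  hence ker: "?T *\<^sub>v v = 0\<^sub>v n" using v by auto
  have "\<rho> g * ?T = ?T * \<rho> g" if "g \<in> carrier G" for g
    using T matrix_repD(1)[OF rho that] comm[OF that]
    by (simp add: mult_minus_distrib_mat[of _ n n _ n] minus_mult_distrib_mat[of _ n n _ _ n]
        mult_smult_distrib[of _ n n _ n] mult_smult_assoc_mat[of _ n n _ n])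
  from intertwiner_zero_or_invertible[OF irr irr T' this]
  have "?T = 0\<^sub>m n n"
  proof
    assume "\<exists>S\<in>carrier_mat n n. ?T * S = 1\<^sub>m n \<and> S * ?T = 1\<^sub>m n"
    then obtain S where S: "S \<in> carrier_mat n n" "S * ?T = 1\<^sub>m n" by blast
    have "v = (S * ?T) *\<^sub>v v" using S v by simp
    also have "\<dots> = S *\<^sub>v (?T *\<^sub>v v)" using S(1) T' v by (intro assoc_mult_mat_vec) auto
    also have "\<dots> = 0\<^sub>v n" unfolding ker using S by auto
    finally show ?thesis using v by blast
  qed
  hence "T = c \<cdot>\<^sub>m 1\<^sub>m n"
    using T by (auto simp: mat_eq_iff)
  thus ?thesis by (rule that)
qed

section \<open>Orthogonality relations for irreducible characters\<close>

context group
begin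

lemma sum_left_translate:
  assumes "h \<in> carrier G"
  shows "(\<Sum>g\<in>carrier G. f (h \<otimes> g)) = (\<Sum>g\<in>carrier G. f g)"
  by (rule sum.reindex_bij_witness[of _ "\<lambda>g. inv h \<otimes> g" "\<lambda>g. h \<otimes> g"])
     (use assms in \<open>auto simp: m_assoc[symmetric]\<close>)

lemma sum_right_translate:
  assumes "h \<in> carrier G"
  shows "(\<Sum>g\<in>carrier G. f (g \<otimes> h)) = (\<Sum>g\<in>carrier G. f g)"
  by (rule sum.reindex_bij_witness[of _ "\<lambda>g. g \<otimes> inv h" "\<lambda>g. g \<otimes> h"])
     (use assms in \<open>auto simp: m_assoc\<close>)

text \<open>The sum over the group of \<open>\<rho> g * E * \<sigma> (inv g)\<close>, where E is the
  matrix unit in position (a, b). There is no division by the group order.\<close>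

definition averaged_unit ::
    "nat \<Rightarrow> nat \<Rightarrow> ('a \<Rightarrow> complex mat) \<Rightarrow> ('a \<Rightarrow> complex mat) \<Rightarrow> nat \<Rightarrow> nat \<Rightarrow> complex mat" where
  "averaged_unit n m \<rho> \<sigma> a b =
     mat n m (\<lambda>(i, j). \<Sum>g\<in>carrier G. \<rho> g $$ (i, a) * \<sigma> (inv g) $$ (b, j))"

text \<open>Left multiplication by \<open>\<rho> h\<close> replaces g by h g in the first factor;
  re-indexing the sum leaves \<open>\<sigma> h\<close> on the right.\<close>

lemma averaged_unit_intertwines:
  assumes rho: "matrix_rep G n \<rho>" and sig: "matrix_rep G m \<sigma>" and ab: "a < n" "b < m"
    and h: "h \<in> carrier G"
  shows "\<rho> h * averaged_unit n m \<rho> \<sigma> a b = averaged_unit n m \<rho> \<sigma> a b * \<sigma> h"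
proof (rule eq_matI)
  let ?T = "averaged_unit n m \<rho> \<sigma> a b"
  have T: "?T \<in> carrier_mat n m" by (simp add: averaged_unit_def)
  have rh: "\<rho> h \<in> carrier_mat n n" and sh: "\<sigma> h \<in> carrier_mat m m"
    using matrix_repD(1)[OF rho h] matrix_repD(1)[OF sig h] .
  fix i j assume "i < dim_row (?T * \<sigma> h)" "j < dim_col (?T * \<sigma> h)"
  hence ij: "i < n" "j < m" using T sh by auto
  have "(\<rho> h * ?T) $$ (i, j) = (\<Sum>k<n. \<rho> h $$ (i, k) * ?T $$ (k, j))"
    by (rule index_mult_mat_sum[OF rh T ij])
  also have "\<dots> = (\<Sum>k<n. \<Sum>g\<in>carrier G. \<rho> h $$ (i, k) * \<rho> g $$ (k, a) * \<sigma> (inv g) $$ (b, j))"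
    using ij by (intro sum.cong refl) (simp add: averaged_unit_def sum_distrib_left mult.assoc)
  also have "\<dots> = (\<Sum>g\<in>carrier G. (\<Sum>k<n. \<rho> h $$ (i, k) * \<rho> g $$ (k, a)) * \<sigma> (inv g) $$ (b, j))"
    by (subst sum.swap) (simp add: sum_distrib_right)
  also have "\<dots> = (\<Sum>g\<in>carrier G. \<rho> (h \<otimes> g) $$ (i, a) * \<sigma> (inv (h \<otimes> g) \<otimes> h) $$ (b, j))"
    using h ij ab by (intro sum.cong refl) (simp add: matrix_rep_index_mult[OF rho] inv_mult_group m_assoc)
  also have "\<dots> = (\<Sum>g\<in>carrier G. \<rho> g $$ (i, a) * \<sigma> (inv g \<otimes> h) $$ (b, j))"
    by (rule sum_left_translate[OF h])
  also have "\<dots> = (\<Sum>g\<in>carrier G. \<rho> g $$ (i, a) * (\<Sum>k<m. \<sigma> (inv g) $$ (b, k) * \<sigma> h $$ (k, j)))"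
    using h ij ab by (intro sum.cong refl) (simp add: matrix_rep_index_mult[OF sig])
  also have "\<dots> = (\<Sum>k<m. (\<Sum>g\<in>carrier G. \<rho> g $$ (i, a) * \<sigma> (inv g) $$ (b, k)) * \<sigma> h $$ (k, j))"
    unfolding sum_distrib_left sum_distrib_right by (subst sum.swap) (simp add: mult.assoc)
  also have "\<dots> = (\<Sum>k<m. ?T $$ (i, k) * \<sigma> h $$ (k, j))"
    using ij by (intro sum.cong refl) (simp add: averaged_unit_def)
  also have "\<dots> = (?T * \<sigma> h) $$ (i, j)"
    by (rule index_mult_mat_sum[OF T sh ij, symmetric])
  finally show "(\<rho> h * ?T) $$ (i, j) = (?T * \<sigma> h) $$ (i, j)" .
qed (use matrix_repD(1)[OF rho h] matrix_repD(1)[OF sig h] in \<open>auto simp: averaged_unit_def\<close>)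

text \<open>The link between characters and Schur's lemma. Pairing with the value at
  \<open>inv g\<close> instead of a complex conjugate keeps the relations algebraic;
  \<open>rep_character_inv\<close> translates them later.\<close>

lemma sum_rep_character_inv:
  assumes "n > 0" "m > 0"
  shows "(\<Sum>g\<in>carrier G. rep_character G n \<rho> g * rep_character G m \<sigma> (inv g)) =
    (\<Sum>i<n. \<Sum>j<m. averaged_unit n m \<rho> \<sigma> i j $$ (i, j))"
proof -
  have "(\<Sum>g\<in>carrier G. rep_character G n \<rho> g * rep_character G m \<sigma> (inv g)) =
     (\<Sum>g\<in>carrier G. \<Sum>i<n. \<Sum>j<m. \<rho> g $$ (i, i) * \<sigma> (inv g) $$ (j, j))"
    by (intro sum.cong refl) (simp add: rep_character_def sum_product)
  also have "\<dots> = (\<Sum>i<n. \<Sum>g\<in>carrier G. \<Sum>j<m. \<rho> g $$ (i, i) * \<sigma> (inv g) $$ (j, j))"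
    by (rule sum.swap)
  also have "\<dots> = (\<Sum>i<n. \<Sum>j<m. \<Sum>g\<in>carrier G. \<rho> g $$ (i, i) * \<sigma> (inv g) $$ (j, j))"
    by (intro sum.cong refl sum.swap)
  also have "\<dots> = (\<Sum>i<n. \<Sum>j<m. averaged_unit n m \<rho> \<sigma> i j $$ (i, j))"
    by (intro sum.cong refl) (simp add: averaged_unit_def)
  finally show ?thesis .
qed

lemma rep_character_orthogonal:
  assumes irr: "irreducible_rep G n \<rho>" "irreducible_rep G m \<sigma>"
    and neq: "rep_character G n \<rho> \<noteq> rep_character G m \<sigma>"
  shows "(\<Sum>g\<in>carrier G. rep_character G n \<rho> g * rep_character G m \<sigma> (inv g)) = 0"
proof -
  have rho: "matrix_rep G n \<rho>" and sig: "matrix_rep G m \<sigma>" and nm: "n > 0" "m > 0"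
    using irr by (auto simp: irreducible_rep_def)
  have "averaged_unit n m \<rho> \<sigma> a b = 0\<^sub>m n m" if ab: "a < n" "b < m" for a b
  proof -
    let ?T = "averaged_unit n m \<rho> \<sigma> a b"
    have T: "?T \<in> carrier_mat n m" by (simp add: averaged_unit_def)
    note I = averaged_unit_intertwines[OF rho sig ab]
    show ?thesis
    proof (rule ccontr)
      \<comment> \<open>An invertible average makes the two representations equivalent, which gives
        them equal traces and contradicts \<open>neq\<close>.\<close>
      assume "?T \<noteq> 0\<^sub>m n m"
      then obtain S where S: "S \<in> carrier_mat m n" "?T * S = 1\<^sub>m n" "S * ?T = 1\<^sub>m m"
        using intertwiner_zero_or_invertible[OF irr T I] by blast
      have "(\<Sum>i<n. \<rho> g $$ (i, i)) = (\<Sum>i<m. \<sigma> g $$ (i, i))" if g: "g \<in> carrier G" for g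
      proof -
        have rg: "\<rho> g \<in> carrier_mat n n" and sg: "\<sigma> g \<in> carrier_mat m m"
          using matrix_repD(1)[OF rho g] matrix_repD(1)[OF sig g] .
        have "\<rho> g = \<rho> g * (?T * S)" using S rg by simp
        also have "\<dots> = (\<rho> g * ?T) * S" using rg T S(1) by (simp add: assoc_mult_mat[of _ n n _ m _ n])
        also have "\<dots> = (?T * \<sigma> g) * S" using I[OF g] by simp
        also have "\<dots> = ?T * (\<sigma> g * S)" using sg T S(1) by (simp add: assoc_mult_mat[of _ n m _ m _ n])
        finally have "(\<Sum>i<n. \<rho> g $$ (i, i)) = (\<Sum>i<n. (?T * (\<sigma> g * S)) $$ (i, i))" by simp
        also have "\<dots> = (\<Sum>i<m. ((\<sigma> g * S) * ?T) $$ (i, i))"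
          using T sg S(1) by (intro sum_diag_mult_commute) auto
        also have "(\<sigma> g * S) * ?T = \<sigma> g * (S * ?T)"
          using sg T S(1) by (simp add: assoc_mult_mat[of _ m m _ n _ m])
        also have "\<dots> = \<sigma> g" unfolding S(3) using sg by simp
        finally show ?thesis .
      qed
      hence "rep_character G n \<rho> = rep_character G m \<sigma>" by (auto simp: rep_character_def)
      with neq show False by contradiction
    qed
  qed
  thus ?thesis unfolding sum_rep_character_inv[OF nm] by (intro sum.neutral ballI) auto
qed

text \<open>By Schur's lemma the average is a scalar c. Its trace n c equals, after exchanging the
  two factors, the sum over g of entry (b, a) of the identity matrix, which determines c.\<close>

lemma rep_character_norm:
  assumes irr: "irreducible_rep G n \<rho>"
  shows "(\<Sum>g\<in>carrier G. rep_character G n \<rho> g * rep_character G n \<rho> (inv g)) = of_nat (card (carrier G))"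
proof -
  have rho: "matrix_rep G n \<rho>" and n: "n > 0"
    using irr by (auto simp: irreducible_rep_def)
  have T: "averaged_unit n n \<rho> \<rho> a b $$ (a, b) = (if a = b then of_nat (card (carrier G)) / of_nat n else 0)"
    if ab: "a < n" "b < n" for a b
  proof -
    let ?T = "averaged_unit n n \<rho> \<rho> a b"
    have T: "?T \<in> carrier_mat n n" by (simp add: averaged_unit_def)
    obtain c where c: "?T = c \<cdot>\<^sub>m 1\<^sub>m n"
      using intertwiner_scalar[OF irr T averaged_unit_intertwines[OF rho rho ab]] by metis
    have "of_nat n * c = (\<Sum>i<n. ?T $$ (i, i))" unfolding c by simp
    also have "\<dots> = (\<Sum>g\<in>carrier G. \<Sum>i<n. \<rho> (inv g) $$ (b, i) * \<rho> g $$ (i, a))"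
      by (subst sum.swap) (simp add: averaged_unit_def mult.commute)
    also have "\<dots> = (\<Sum>g\<in>carrier G. \<rho> (inv g \<otimes> g) $$ (b, a))"
      using ab by (intro sum.cong refl) (rule matrix_rep_index_mult[OF rho, symmetric], auto)
    also have "\<dots> = (\<Sum>g\<in>carrier G. if a = b then 1 else 0)"
      using ab matrix_repD(2)[OF rho] by (intro sum.cong refl) auto
    finally have "of_nat n * c = (if a = b then of_nat (card (carrier G)) else 0)" by simp
    hence "c = (if a = b then of_nat (card (carrier G)) / of_nat n else 0)"
      using n by (auto simp: field_simps)
    thus ?thesis unfolding c using ab by auto
  qed
  have "(\<Sum>i<n. \<Sum>j<n. averaged_unit n n \<rho> \<rho> i j $$ (i, j)) =
      (\<Sum>i<n. \<Sum>j<n. if i = j then of_nat (card (carrier G)) / of_nat n else 0)"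
    by (intro sum.cong refl T) auto
  also have "\<dots> = of_nat (card (carrier G))" using n by (simp add: sum.delta)
  finally show ?thesis unfolding sum_rep_character_inv[OF n n] .
qed

end

lemma sum_swap3:
  "(\<Sum>i\<in>A. \<Sum>j\<in>B. \<Sum>k\<in>C. f i j k) = (\<Sum>k\<in>C. \<Sum>i\<in>A. \<Sum>j\<in>B. f i j k)"
proof -
  have "(\<Sum>i\<in>A. \<Sum>j\<in>B. \<Sum>k\<in>C. f i j k) = (\<Sum>i\<in>A. \<Sum>k\<in>C. \<Sum>j\<in>B. f i j k)"
    by (intro sum.cong refl sum.swap)
  also have "\<dots> = (\<Sum>k\<in>C. \<Sum>i\<in>A. \<Sum>j\<in>B. f i j k)" by (rule sum.swap)
  finally show ?thesis .
qed

context group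
begin

text \<open>The unitary trick without a change of basis: T is the Gram matrix of the averaged
  Hermitian form and intertwines \<open>\<rho>\<close> with \<open>\<sigma>\<close>, the conjugate
  transpose of its inverse. Since T is invertible, both have the same trace.\<close>

lemma rep_character_inv:
  assumes fin: "finite (carrier G)" and rho: "matrix_rep G n \<rho>" and g: "g \<in> carrier G"
  shows "rep_character G n \<rho> (inv g) = cnj (rep_character G n \<rho> g)"
proof -
  define T where "T = mat n n (\<lambda>(i, j). \<Sum>g\<in>carrier G. \<Sum>k<n. cnj (\<rho> g $$ (k, i)) * \<rho> g $$ (k, j))"
  define \<sigma> where "\<sigma> = (\<lambda>g. mat n n (\<lambda>(i, j). cnj (\<rho> (inv g) $$ (j, i))))"
  have T: "T \<in> carrier_mat n n" by (simp add: T_def)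
  have sC: "\<sigma> h \<in> carrier_mat n n" for h by (simp add: \<sigma>_def)
  note rC = matrix_repD(1)[OF rho]
  have comm: "\<sigma> h * T = T * \<rho> h" if h: "h \<in> carrier G" for h
  proof (rule eq_matI)
    fix i j assume "i < dim_row (T * \<rho> h)" "j < dim_col (T * \<rho> h)"
    hence ij: "i < n" "j < n" using T rC[OF h] by auto
    have "(\<sigma> h * T) $$ (i, j) = (\<Sum>k<n. \<sigma> h $$ (i, k) * T $$ (k, j))"
      by (rule index_mult_mat_sum[OF sC T ij])
    also have "\<dots> = (\<Sum>k<n. \<Sum>g\<in>carrier G. \<Sum>l<n. cnj (\<rho> g $$ (l, k) * \<rho> (inv h) $$ (k, i)) * \<rho> g $$ (l, j))"
      using ij by (intro sum.cong refl) (simp add: \<sigma>_def T_def sum_distrib_left mult_ac)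
    also have "\<dots> = (\<Sum>g\<in>carrier G. \<Sum>l<n. \<Sum>k<n. cnj (\<rho> g $$ (l, k) * \<rho> (inv h) $$ (k, i)) * \<rho> g $$ (l, j))"
      by (rule sum_swap3[symmetric])
    also have "\<dots> = (\<Sum>g\<in>carrier G. \<Sum>l<n. cnj (\<rho> (g \<otimes> inv h) $$ (l, i)) * \<rho> (g \<otimes> inv h \<otimes> h) $$ (l, j))"
      using h ij by (intro sum.cong refl)
        (simp add: matrix_rep_index_mult[OF rho, where g = "_ :: 'a" and h = "inv h"] sum_distrib_right m_assoc)
    also have "\<dots> = (\<Sum>g\<in>carrier G. \<Sum>l<n. cnj (\<rho> g $$ (l, i)) * \<rho> (g \<otimes> h) $$ (l, j))"
      using h by (intro sum_right_translate) auto
    also have "\<dots> = (\<Sum>g\<in>carrier G. \<Sum>l<n. \<Sum>k<n. cnj (\<rho> g $$ (l, i)) * \<rho> g $$ (l, k) * \<rho> h $$ (k, j))"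
      using h ij by (intro sum.cong refl) (simp add: matrix_rep_index_mult[OF rho] sum_distrib_left mult.assoc)
    also have "\<dots> = (\<Sum>k<n. \<Sum>g\<in>carrier G. \<Sum>l<n. cnj (\<rho> g $$ (l, i)) * \<rho> g $$ (l, k) * \<rho> h $$ (k, j))"
      by (rule sum_swap3)
    also have "\<dots> = (\<Sum>k<n. T $$ (i, k) * \<rho> h $$ (k, j))"
      using ij by (intro sum.cong refl) (simp add: T_def sum_distrib_right)
    also have "\<dots> = (T * \<rho> h) $$ (i, j)"
      by (rule index_mult_mat_sum[OF T rC[OF h] ij, symmetric])
    finally show "(\<sigma> h * T) $$ (i, j) = (T * \<rho> h) $$ (i, j)" .
  qed (use T sC rC[OF h] in auto)
  have "det T \<noteq> 0"
  proof
    assume "det T = 0"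
    then obtain v where v: "v \<in> carrier_vec n" "v \<noteq> 0\<^sub>v n" "T *\<^sub>v v = 0\<^sub>v n"
      using det_0_iff_vec_prod_zero_field[OF T] by auto
    \<comment> \<open>\<open>w g\<close> is \<open>\<rho> g\<close> applied to v. The averaged form
      at v is the sum of the squared norms of these vectors, and the summand at the neutral element
      is the squared norm of v.\<close>
    define w where "w = (\<lambda>g k. \<Sum>j<n. \<rho> g $$ (k, j) * v $ j)"
    have "0 = (\<Sum>i<n. cnj (v $ i) * (T *\<^sub>v v) $ i)" unfolding v by simp
    also have "\<dots> = (\<Sum>i<n. \<Sum>j<n. \<Sum>g\<in>carrier G. \<Sum>k<n.
        cnj (\<rho> g $$ (k, i) * v $ i) * (\<rho> g $$ (k, j) * v $ j))"
      using v(1) T by (intro sum.cong refl)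
        (simp add: T_def scalar_prod_def atLeast0LessThan sum_distrib_left sum_distrib_right mult_ac)
    also have "\<dots> = (\<Sum>g\<in>carrier G. \<Sum>k<n. \<Sum>i<n. \<Sum>j<n.
        cnj (\<rho> g $$ (k, i) * v $ i) * (\<rho> g $$ (k, j) * v $ j))"
      by (subst sum_swap3) (intro sum.cong refl sum_swap3)
    also have "\<dots> = (\<Sum>g\<in>carrier G. \<Sum>k<n. cnj (w g k) * w g k)"
      by (intro sum.cong refl) (simp add: w_def sum_product)
    also have "\<dots> = of_real (\<Sum>g\<in>carrier G. \<Sum>k<n. (cmod (w g k))\<^sup>2)"
      by (simp add: complex_norm_square mult.commute del: of_real_power)
    finally have "(\<Sum>g\<in>carrier G. \<Sum>k<n. (cmod (w g k))\<^sup>2) = 0" by (metis of_real_eq_0_iff)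
    hence "(\<Sum>k<n. (cmod (w \<one> k))\<^sup>2) = 0"
      using fin by (subst (asm) sum_nonneg_eq_0_iff) (auto intro!: sum_nonneg)
    hence "w \<one> k = 0" if "k < n" for k
      using that by (subst (asm) sum_nonneg_eq_0_iff) auto
    moreover have "w \<one> k = v $ k" if "k < n" for k
      using that matrix_repD(2)[OF rho] by (simp add: w_def if_distrib[of "\<lambda>x. x * _"] cong: if_cong)
    ultimately have "v = 0\<^sub>v n" using v(1) by (intro eq_vecI) auto
    with v(2) show False by contradiction
  qed
  then obtain S where S: "S \<in> carrier_mat n n" "T * S = 1\<^sub>m n" "S * T = 1\<^sub>m n"
    using det_non_zero_imp_unit[OF T, where b = "()"]
    by (auto simp: Units_def ring_mat_simps)
  have "\<sigma> g = \<sigma> g * (T * S)" using S sC[of g] by simp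
  also have "\<dots> = (\<sigma> g * T) * S" using S(1) T sC[of g] by (simp add: assoc_mult_mat[of _ n n _ n _ n])
  also have "\<dots> = (T * \<rho> g) * S" using comm[OF g] by simp
  also have "\<dots> = T * (\<rho> g * S)" using S(1) T rC[OF g] by (simp add: assoc_mult_mat[of _ n n _ n _ n])
  finally have "(\<Sum>i<n. \<sigma> g $$ (i, i)) = (\<Sum>i<n. (T * (\<rho> g * S)) $$ (i, i))" by simp
  also have "\<dots> = (\<Sum>i<n. ((\<rho> g * S) * T) $$ (i, i))"
    using S(1) T rC[OF g] by (intro sum_diag_mult_commute) auto
  also have "(\<rho> g * S) * T = \<rho> g * (S * T)"
    using S(1) T rC[OF g] by (simp add: assoc_mult_mat[of _ n n _ n _ n])
  also have "\<dots> = \<rho> g" unfolding S(3) using rC[OF g] by simp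
  finally have "(\<Sum>i<n. cnj (\<rho> (inv g) $$ (i, i))) = (\<Sum>i<n. \<rho> g $$ (i, i))" by (simp add: \<sigma>_def)
  hence "cnj (\<Sum>i<n. \<rho> (inv g) $$ (i, i)) = (\<Sum>i<n. \<rho> g $$ (i, i))" by simp
  hence "(\<Sum>i<n. \<rho> (inv g) $$ (i, i)) = cnj (\<Sum>i<n. \<rho> g $$ (i, i))" by (metis complex_cnj_cnj)
  thus ?thesis using g by (simp add: rep_character_def)
qed

lemma char_inner_Irr:
  assumes fin: "finite (carrier G)" and "\<chi> \<in> Irr G" "\<psi> \<in> Irr G"
  shows "char_inner G \<chi> \<psi> = (if \<chi> = \<psi> then 1 else 0)"
proof -
  obtain n \<rho> where n: "\<chi> = rep_character G n \<rho>" "irreducible_rep G n \<rho>"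
    using assms(2) by (auto simp: Irr_def)
  obtain m \<sigma> where m: "\<psi> = rep_character G m \<sigma>" "irreducible_rep G m \<sigma>"
    using assms(3) by (auto simp: Irr_def)
  have sig: "matrix_rep G m \<sigma>" using m by (simp add: irreducible_rep_def)
  have "(\<Sum>g\<in>carrier G. \<chi> g * cnj (\<psi> g)) = (\<Sum>g\<in>carrier G. \<chi> g * \<psi> (inv g))"
    unfolding m(1) by (intro sum.cong refl) (simp add: rep_character_inv[OF fin sig])
  also have "\<dots> = (if \<chi> = \<psi> then of_nat (card (carrier G)) else 0)"
    using rep_character_norm[OF n(2)] rep_character_orthogonal[OF n(2) m(2)]
    unfolding n(1)[symmetric] m(1)[symmetric] by auto
  finally show ?thesis using fin by (auto simp: char_inner_def card_eq_0_iff)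
qed

section \<open>Degrees, Bessel's inequality and linear characters\<close>

lemma Irr_at_one:
  assumes "\<chi> \<in> Irr G"
  obtains n :: nat where "n > 0" "\<chi> \<one> = of_nat n"
proof -
  obtain n \<rho> where n: "\<chi> = rep_character G n \<rho>" "irreducible_rep G n \<rho>"
    using assms by (auto simp: Irr_def)
  have "\<rho> \<one> = 1\<^sub>m n" "n > 0" using n(2) by (auto simp: irreducible_rep_def matrix_rep_def)
  thus ?thesis using n(1) that[of n] by (simp add: rep_character_def)
qed

text \<open>Here r is the regular character and s its projection to the span of X. With N the group
  order and D the sum of the degree squares, orthonormality turns the sum of |r - s|^2 into N (N -
  D), which is nonnegative.\<close>

lemma sum_degree_squares_le:
  assumes fin: "finite (carrier G)" and X: "finite X" "X \<subseteq> Irr G"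
  shows "(\<Sum>\<chi>\<in>X. (cmod (\<chi> \<one>))\<^sup>2) \<le> card (carrier G)"
proof -
  let ?N = "of_nat (card (carrier G)) :: complex"
  have N: "?N \<noteq> 0" using fin by (auto simp: card_eq_0_iff)
  define r where "r = (\<lambda>g. if g = \<one> then ?N else 0)"
  define s where "s = (\<lambda>g. \<Sum>\<chi>\<in>X. cnj (\<chi> \<one>) * \<chi> g)"
  define D where "D = (\<Sum>\<chi>\<in>X. (cmod (\<chi> \<one>))\<^sup>2)"
  have D: "of_real D = (\<Sum>\<chi>\<in>X. cnj (\<chi> \<one>) * \<chi> \<one>)"
    by (simp add: D_def complex_norm_square mult.commute del: of_real_power)
  have rr: "(\<Sum>g\<in>carrier G. r g * cnj (r g)) = ?N * ?N"
  proof -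
    have "r g * cnj (r g) = (if g = \<one> then ?N * ?N else 0)" for g by (simp add: r_def)
    thus ?thesis using fin by simp
  qed
  have sr: "(\<Sum>g\<in>carrier G. s g * cnj (r g)) = ?N * of_real D"
  proof -
    have "s g * cnj (r g) = (if g = \<one> then s \<one> * ?N else 0)" for g by (simp add: r_def)
    thus ?thesis using fin by (simp add: D s_def mult.commute)
  qed
  have rs: "(\<Sum>g\<in>carrier G. r g * cnj (s g)) = ?N * of_real D"
  proof -
    have "(\<Sum>g\<in>carrier G. r g * cnj (s g)) = cnj (\<Sum>g\<in>carrier G. s g * cnj (r g))"
      by (simp add: mult.commute)
    thus ?thesis unfolding sr by simp
  qed
  have ss: "(\<Sum>g\<in>carrier G. s g * cnj (s g)) = ?N * of_real D"
  proof -
    have "(\<Sum>g\<in>carrier G. s g * cnj (s g)) =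
        (\<Sum>g\<in>carrier G. \<Sum>\<chi>\<in>X. \<Sum>\<psi>\<in>X. cnj (\<chi> \<one>) * \<psi> \<one> * (\<chi> g * cnj (\<psi> g)))"
      by (simp add: s_def sum_product mult_ac)
    also have "\<dots> = (\<Sum>\<chi>\<in>X. \<Sum>\<psi>\<in>X. \<Sum>g\<in>carrier G. cnj (\<chi> \<one>) * \<psi> \<one> * (\<chi> g * cnj (\<psi> g)))"
      by (subst sum.swap) (intro sum.cong refl sum.swap)
    also have "\<dots> = (\<Sum>\<chi>\<in>X. \<Sum>\<psi>\<in>X. cnj (\<chi> \<one>) * \<psi> \<one> * (?N * char_inner G \<chi> \<psi>))"
      using N by (intro sum.cong refl) (simp add: char_inner_def sum_distrib_left[symmetric])
    also have "\<dots> = (\<Sum>\<chi>\<in>X. \<Sum>\<psi>\<in>X. if \<chi> = \<psi> then cnj (\<chi> \<one>) * \<psi> \<one> * ?N else 0)"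
      using X(2) by (intro sum.cong refl) (auto simp: char_inner_Irr[OF fin] subset_iff)
    also have "\<dots> = ?N * of_real D" using X(1) by (simp add: D sum_distrib_left sum.delta' mult_ac)
    finally show ?thesis .
  qed
  have "of_real (\<Sum>g\<in>carrier G. (cmod (r g - s g))\<^sup>2) = (\<Sum>g\<in>carrier G. (r g - s g) * cnj (r g - s g))"
    by (simp add: complex_norm_square del: of_real_power)
  also have "\<dots> = (\<Sum>g\<in>carrier G. r g * cnj (r g)) - (\<Sum>g\<in>carrier G. s g * cnj (r g))
      - (\<Sum>g\<in>carrier G. r g * cnj (s g)) + (\<Sum>g\<in>carrier G. s g * cnj (s g))"
    by (simp add: algebra_simps sum.distrib sum_subtractf)
  also have "\<dots> = of_real (real (card (carrier G)) * (real (card (carrier G)) - D))"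
    unfolding rr rs sr ss by (simp add: algebra_simps)
  finally have "real (card (carrier G)) * (real (card (carrier G)) - D) = (\<Sum>g\<in>carrier G. (cmod (r g - s g))\<^sup>2)"
    by (metis of_real_eq_iff)
  also have "\<dots> \<ge> 0" by (intro sum_nonneg) auto
  finally have "real (card (carrier G)) - D \<ge> 0"
    using fin by (auto simp: zero_le_mult_iff card_eq_0_iff)
  thus ?thesis by (simp add: D_def)
qed

text \<open>A further irreducible character would add a positive degree square and exceed the
  bound.\<close>

lemma Irr_eqI:
  assumes fin: "finite (carrier G)" and X: "finite X" "X \<subseteq> Irr G"
    and sum: "(\<Sum>\<chi>\<in>X. (cmod (\<chi> \<one>))\<^sup>2) = card (carrier G)"
  shows "Irr G = X"
proof (rule ccontr)
  assume "Irr G \<noteq> X"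
  then obtain \<psi> where psi: "\<psi> \<in> Irr G" "\<psi> \<notin> X" using X(2) by blast
  obtain n :: nat where n: "n > 0" "\<psi> \<one> = of_nat n" using Irr_at_one[OF psi(1)] .
  have "(\<Sum>\<chi>\<in>insert \<psi> X. (cmod (\<chi> \<one>))\<^sup>2) \<le> card (carrier G)"
    using X psi by (intro sum_degree_squares_le[OF fin]) auto
  hence "(cmod (\<psi> \<one>))\<^sup>2 \<le> 0" using X psi sum by simp
  thus False using n by simp
qed

text \<open>Translation by an element k with \<xi> k different from 1 multiplies the sum by \<xi> k,
  so the sum must vanish.\<close>

lemma sum_character_subgroup:
  fixes \<xi> :: "'a \<Rightarrow> complex"
  assumes H: "subgroup H G" and fin: "finite H"
    and hom: "\<And>h k. h \<in> H \<Longrightarrow> k \<in> H \<Longrightarrow> \<xi> (h \<otimes> k) = \<xi> h * \<xi> k" and one: "\<xi> \<one> = 1"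
  shows "(\<Sum>h\<in>H. \<xi> h) = (if \<forall>h\<in>H. \<xi> h = 1 then of_nat (card H) else 0)"
proof (cases "\<forall>h\<in>H. \<xi> h = 1")
  case False
  then obtain k where k: "k \<in> H" "\<xi> k \<noteq> 1" by blast
  have kG: "k \<in> carrier G" and HG: "H \<subseteq> carrier G" using H k by (auto dest: subgroup.subset)
  have "(\<Sum>h\<in>H. \<xi> h) = (\<Sum>h\<in>H. \<xi> (k \<otimes> h))"
    by (rule sum.reindex_bij_witness[of _ "\<lambda>h. k \<otimes> h" "\<lambda>h. inv k \<otimes> h"])
      (use H HG k kG in \<open>auto simp: m_assoc[symmetric] subset_iff subgroup.m_closed subgroup.m_inv_closed\<close>)
  also have "\<dots> = \<xi> k * (\<Sum>h\<in>H. \<xi> h)" using k by (simp add: hom sum_distrib_left)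
  finally have "(1 - \<xi> k) * (\<Sum>h\<in>H. \<xi> h) = 0" by (simp add: algebra_simps)
  hence "(\<Sum>h\<in>H. \<xi> h) = 0" using k by simp
  thus ?thesis using False by (metis (no_types, lifting))
qed auto

text \<open>Extensionality makes \<xi> literally the character of a one-dimensional representation,
  which is irreducible because a line has no proper nonzero subspace.\<close>

lemma linear_in_Irr:
  fixes \<xi> :: "'a \<Rightarrow> complex"
  assumes hom: "\<And>h k. h \<in> carrier G \<Longrightarrow> k \<in> carrier G \<Longrightarrow> \<xi> (h \<otimes> k) = \<xi> h * \<xi> k"
    and one: "\<xi> \<one> = 1" and ext: "\<xi> \<in> extensional (carrier G)"
  shows "\<xi> \<in> Irr G"
proof -
  define \<rho> where "\<rho> = (\<lambda>g. mat 1 1 (\<lambda>_. \<xi> g))"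
  have "matrix_rep G 1 \<rho>"
    unfolding matrix_rep_def \<rho>_def using one
    by (auto simp: hom scalar_prod_def intro!: eq_matI)
  moreover have "W = {0\<^sub>v 1} \<or> W = carrier_vec 1"
    if W: "VectorSpace.subspace class_ring W (module_vec TYPE(complex) 1)" for W
  proof (cases "W = {0\<^sub>v 1}")
    case False
    have W': "W \<subseteq> carrier_vec 1" "0\<^sub>v 1 \<in> W" "\<And>c v. v \<in> W \<Longrightarrow> c \<cdot>\<^sub>v v \<in> W"
      using W unfolding subspace_module_vec_iff by auto
    then obtain w where w: "w \<in> W" "w \<noteq> 0\<^sub>v 1" using False by blast
    have w0: "w $ 0 \<noteq> 0" using w W'(1) by (auto simp: vec_eq_iff)
    have "v \<in> W" if "v \<in> carrier_vec 1" for v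
    proof -
      have "v = (v $ 0 / w $ 0) \<cdot>\<^sub>v w" using that w W'(1) w0 by (intro eq_vecI) auto
      thus ?thesis using W'(3)[OF w(1)] by metis
    qed
    thus ?thesis using W'(1) by blast
  qed simp
  ultimately have "irreducible_rep G 1 \<rho>" unfolding irreducible_rep_def by auto
  moreover have "rep_character G 1 \<rho> = \<xi>"
    using ext by (auto simp: rep_character_def \<rho>_def extensional_def)
  ultimately show ?thesis unfolding Irr_def by blast
qed

end

section \<open>Induction of linear characters\<close>

lemma subspace_sum_closed:
  assumes W: "VectorSpace.subspace class_ring W (module_vec TYPE(complex) n)"
    and fin: "finite S" and u: "\<And>a. a \<in> S \<Longrightarrow> u a \<in> W"
  shows "vec n (\<lambda>j. \<Sum>a\<in>S. c a * u a $ j) \<in> W"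
  using fin u
proof (induction S)
  case empty
  have "vec n (\<lambda>j. \<Sum>a\<in>{}. c a * u a $ j) = 0\<^sub>v n" by (intro eq_vecI) auto
  thus ?case using W unfolding subspace_module_vec_iff by auto
next
  case (insert a S)
  have W': "W \<subseteq> carrier_vec n" using W unfolding subspace_module_vec_iff by auto
  have "vec n (\<lambda>j. \<Sum>a\<in>insert a S. c a * u a $ j) = c a \<cdot>\<^sub>v u a + vec n (\<lambda>j. \<Sum>a\<in>S. c a * u a $ j)"
  proof -
    have "u a \<in> carrier_vec n" using insert W' by auto
    thus ?thesis using insert(1,2) by (intro eq_vecI) auto
  qed
  thus ?case using insert W unfolding subspace_module_vec_iff by auto
qed

context group
begin

lemma subgroup_conj_iff:
  assumes "subgroup H G" "h \<in> H" "x \<in> carrier G"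
  shows "inv h \<otimes> x \<otimes> h \<in> H \<longleftrightarrow> x \<in> H"
proof
  assume a: "inv h \<otimes> x \<otimes> h \<in> H"
  have hG: "h \<in> carrier G" using assms by (auto dest: subgroup.mem_carrier)
  have "x = h \<otimes> (inv h \<otimes> x \<otimes> h) \<otimes> inv h"
    using hG assms(3) by (simp add: m_assoc inv_solve_right') (simp add: m_assoc[symmetric])
  also have "\<dots> \<in> H"
    by (rule subgroup.m_closed[OF assms(1) subgroup.m_closed[OF assms(1,2) a] subgroup.m_inv_closed[OF assms(1,2)]])
  finally show "x \<in> H" .
qed (use assms in \<open>auto intro: subgroup.m_closed subgroup.m_inv_closed\<close>)

text \<open>The dotted function of the classical formula for induced characters.\<close>

definition zero_ext :: "'a set \<Rightarrow> ('a \<Rightarrow> complex) \<Rightarrow> 'a \<Rightarrow> complex" where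
  "zero_ext H \<xi> x = (if x \<in> H then \<xi> x else 0)"

text \<open>Values off H are left open, so that a formula in coordinates that makes sense on the
  whole group can be used on H as it stands.\<close>

definition linear_char :: "'a set \<Rightarrow> ('a \<Rightarrow> complex) \<Rightarrow> bool" where
  "linear_char H \<xi> \<longleftrightarrow> \<xi> \<one> = 1 \<and> (\<forall>h\<in>H. \<forall>k\<in>H. \<xi> (h \<otimes> k) = \<xi> h * \<xi> k)"

lemma linear_char_inv:
  assumes "subgroup H G" "linear_char H \<xi>" "h \<in> H"
  shows "\<xi> h * \<xi> (inv h) = 1" "\<xi> (inv h) * \<xi> h = 1"
proof -
  have "inv h \<in> H" "h \<in> carrier G" using assms by (auto intro: subgroup.m_inv_closed subgroup.mem_carrier)
  thus "\<xi> h * \<xi> (inv h) = 1" using assms unfolding linear_char_def by (metis r_inv)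
  thus "\<xi> (inv h) * \<xi> h = 1" by (simp add: mult.commute)
qed

lemma linear_char_conj:
  assumes "subgroup H G" "linear_char H \<xi>" "h \<in> H" "x \<in> H"
  shows "\<xi> (inv h \<otimes> x \<otimes> h) = \<xi> x"
proof -
  have "inv h \<in> H" "inv h \<otimes> x \<in> H" using assms by (auto intro: subgroup.m_inv_closed subgroup.m_closed)
  hence "\<xi> (inv h \<otimes> x \<otimes> h) = (\<xi> (inv h) * \<xi> h) * \<xi> x"
    using assms unfolding linear_char_def by simp
  thus ?thesis using linear_char_inv[OF assms(1-3)] by simp
qed

lemma zero_ext_mult:
  assumes "subgroup H G" "linear_char H \<xi>" "h \<in> H" "x \<in> carrier G"
  shows "zero_ext H \<xi> (x \<otimes> h) = zero_ext H \<xi> x * \<xi> h"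
proof -
  have "x \<otimes> h \<in> H \<longleftrightarrow> x \<in> H"
  proof
    have hG: "h \<in> carrier G" using assms by (auto dest: subgroup.mem_carrier)
    assume "x \<otimes> h \<in> H"
    hence "x \<otimes> h \<otimes> inv h \<in> H"
      by (rule subgroup.m_closed[OF assms(1) _ subgroup.m_inv_closed[OF assms(1,3)]])
    thus "x \<in> H" using hG assms(4) by (simp add: m_assoc)
  qed (use assms in \<open>auto intro: subgroup.m_closed\<close>)
  thus ?thesis using assms by (simp add: zero_ext_def linear_char_def)
qed

lemma ind_char_eq_zero_ext:
  "g \<in> carrier G \<Longrightarrow> ind_char G H \<xi> g =
     (\<Sum>y\<in>carrier G. zero_ext H \<xi> (inv y \<otimes> g \<otimes> y)) / of_nat (card H)"
  by (simp add: ind_char_def zero_ext_def)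

definition transversal :: "'i set \<Rightarrow> ('i \<Rightarrow> 'a) \<Rightarrow> 'a set \<Rightarrow> bool" where
  "transversal I f H \<longleftrightarrow> f ` I \<subseteq> carrier G \<and> bij_betw (\<lambda>(i, h). f i \<otimes> h) (I \<times> H) (carrier G)"

text \<open>The summand is constant on each coset f i H, because conjugation by elements of H
  preserves both H and its linear character. Division by |H| leaves one term per coset.\<close>

lemma ind_char_transversal:
  assumes fin: "finite (carrier G)" and H: "subgroup H G" and xi: "linear_char H \<xi>"
    and tr: "transversal I f H" and g: "g \<in> carrier G"
  shows "ind_char G H \<xi> g = (\<Sum>i\<in>I. zero_ext H \<xi> (inv (f i) \<otimes> g \<otimes> f i))"
proof -
  have HG: "H \<subseteq> carrier G" using H by (rule subgroup.subset)
  have fI: "f i \<in> carrier G" if "i \<in> I" for i using tr that by (auto simp: transversal_def)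
  have card: "card H > 0" using fin HG H by (metis card_gt_0_iff empty_iff finite_subset subgroup.one_closed)
  have "(\<Sum>y\<in>carrier G. zero_ext H \<xi> (inv y \<otimes> g \<otimes> y)) =
      (\<Sum>(i, h)\<in>I \<times> H. zero_ext H \<xi> (inv (f i \<otimes> h) \<otimes> g \<otimes> (f i \<otimes> h)))"
    using sum.reindex_bij_betw[of "\<lambda>(i, h). f i \<otimes> h" "I \<times> H" "carrier G"
        "\<lambda>y. zero_ext H \<xi> (inv y \<otimes> g \<otimes> y)"] tr
    by (simp add: transversal_def case_prod_unfold)
  also have "\<dots> = (\<Sum>(i, h)\<in>I \<times> H. zero_ext H \<xi> (inv (f i) \<otimes> g \<otimes> f i))"
  proof (intro sum.cong refl, clarify)
    fix i h assume ih: "i \<in> I" "h \<in> H"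
    have hG: "h \<in> carrier G" using ih HG by auto
    have "inv (f i \<otimes> h) \<otimes> g \<otimes> (f i \<otimes> h) = inv h \<otimes> (inv (f i) \<otimes> g \<otimes> f i) \<otimes> h"
      using fI[OF ih(1)] hG g by (simp add: inv_mult_group m_assoc)
    thus "zero_ext H \<xi> (inv (f i \<otimes> h) \<otimes> g \<otimes> (f i \<otimes> h)) = zero_ext H \<xi> (inv (f i) \<otimes> g \<otimes> f i)"
      using subgroup_conj_iff[OF H ih(2), of "inv (f i) \<otimes> g \<otimes> f i"] linear_char_conj[OF H xi ih(2)]
        fI[OF ih(1)] g by (simp add: zero_ext_def)
  qed
  also have "\<dots> = of_nat (card H) * (\<Sum>i\<in>I. zero_ext H \<xi> (inv (f i) \<otimes> g \<otimes> f i))"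
    by (simp add: sum.cartesian_product[symmetric] sum_distrib_left)
  finally show ?thesis using card by (simp add: ind_char_eq_zero_ext[OF g])
qed

lemma transversal_mem_iff:
  assumes H: "subgroup H G" and tr: "transversal I f H" and ij: "i \<in> I" "j \<in> I"
  shows "inv (f i) \<otimes> f j \<in> H \<longleftrightarrow> i = j"
proof
  have fI: "f i \<in> carrier G" "f j \<in> carrier G" using tr ij by (auto simp: transversal_def)
  assume a: "inv (f i) \<otimes> f j \<in> H"
  have "f i \<otimes> (inv (f i) \<otimes> f j) = f j \<otimes> \<one>" using fI by (simp add: m_assoc[symmetric])
  moreover have "inj_on (\<lambda>(i, h). f i \<otimes> h) (I \<times> H)" using tr by (simp add: transversal_def bij_betw_def)
  ultimately have "(i, inv (f i) \<otimes> f j) = (j, \<one>)"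
    using ij a subgroup.one_closed[OF H]
    by (auto dest!: inj_onD[where x = "(i, inv (f i) \<otimes> f j)" and y = "(j, \<one>)"])
  thus "i = j" by simp
qed (use tr ij subgroup.one_closed[OF H] in \<open>auto simp: transversal_def\<close>)

text \<open>Matrices of the induced module in the basis indexed by the left cosets f i H.\<close>

definition induced_rep :: "nat \<Rightarrow> (nat \<Rightarrow> 'a) \<Rightarrow> 'a set \<Rightarrow> ('a \<Rightarrow> complex) \<Rightarrow> 'a \<Rightarrow> complex mat" where
  "induced_rep m f H \<xi> g = mat m m (\<lambda>(i, j). zero_ext H \<xi> (inv (f i) \<otimes> g \<otimes> f j))"

lemma matrix_rep_induced:
  assumes H: "subgroup H G" and xi: "linear_char H \<xi>" and tr: "transversal {..<m} f H"
  shows "matrix_rep G m (induced_rep m f H \<xi>)"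
  unfolding matrix_rep_def
proof (intro conjI ballI)
  have fI: "f i \<in> carrier G" if "i < m" for i using tr that by (auto simp: transversal_def)
  note mem = transversal_mem_iff[OF H tr, simplified]
  show "induced_rep m f H \<xi> \<one> = 1\<^sub>m m"
    using xi by (intro eq_matI) (auto simp: induced_rep_def zero_ext_def mem fI linear_char_def)
  fix g h assume gh: "g \<in> carrier G" "h \<in> carrier G"
  show "induced_rep m f H \<xi> (g \<otimes> h) = induced_rep m f H \<xi> g * induced_rep m f H \<xi> h"
  proof (rule eq_matI)
    fix i j assume "i < dim_row (induced_rep m f H \<xi> g * induced_rep m f H \<xi> h)"
      "j < dim_col (induced_rep m f H \<xi> g * induced_rep m f H \<xi> h)"
    hence ij: "i < m" "j < m" by (auto simp: induced_rep_def)
    \<comment> \<open>Left multiplication permutes the cosets: h f j lies in exactly one f k H, so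
      the only nonzero entry of column j is \<open>\<xi> h0\<close> in row k.\<close>
    have "h \<otimes> f j \<in> (\<lambda>(i, h). f i \<otimes> h) ` ({..<m} \<times> H)"
      using tr gh fI ij by (simp add: transversal_def bij_betw_def)
    then obtain k h0 where k: "k < m" "h0 \<in> H" "h \<otimes> f j = f k \<otimes> h0" by auto
    have h0: "h0 \<in> carrier G" using k H by (auto dest: subgroup.mem_carrier)
    have mul: "zero_ext H \<xi> (inv (f l) \<otimes> h \<otimes> f j) = (if l = k then \<xi> h0 else 0)" if l: "l < m" for l
    proof -
      have "inv (f l) \<otimes> h \<otimes> f j = inv (f l) \<otimes> f k \<otimes> h0"
        using k fI[OF l] fI[OF k(1)] fI[OF ij(2)] gh h0 by (simp add: m_assoc)
      hence "zero_ext H \<xi> (inv (f l) \<otimes> h \<otimes> f j) = zero_ext H \<xi> (inv (f l) \<otimes> f k) * \<xi> h0"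
        using zero_ext_mult[OF H xi k(2)] fI[OF l] fI[OF k(1)] by simp
      thus ?thesis using xi l k(1) fI by (auto simp: zero_ext_def mem linear_char_def)
    qed
    have "(induced_rep m f H \<xi> g * induced_rep m f H \<xi> h) $$ (i, j) =
        (\<Sum>l<m. induced_rep m f H \<xi> g $$ (i, l) * induced_rep m f H \<xi> h $$ (l, j))"
      by (rule index_mult_mat_sum[OF _ _ ij]) (auto simp: induced_rep_def)
    also have "\<dots> = (\<Sum>l<m. if l = k then zero_ext H \<xi> (inv (f i) \<otimes> g \<otimes> f l) * \<xi> h0 else 0)"
      using ij by (intro sum.cong refl) (simp add: induced_rep_def mul)
    also have "\<dots> = zero_ext H \<xi> (inv (f i) \<otimes> g \<otimes> f k \<otimes> h0)"
      using k ij fI gh by (simp add: zero_ext_mult[OF H xi k(2)])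
    also have "inv (f i) \<otimes> g \<otimes> f k \<otimes> h0 = inv (f i) \<otimes> (g \<otimes> h) \<otimes> f j"
      using k(1,3) ij fI gh h0 by (simp add: m_assoc)
    finally show "induced_rep m f H \<xi> (g \<otimes> h) $$ (i, j) =
        (induced_rep m f H \<xi> g * induced_rep m f H \<xi> h) $$ (i, j)"
      using ij by (simp add: induced_rep_def)
  qed (auto simp: induced_rep_def)
qed (auto simp: induced_rep_def)

text \<open>The normal subgroup \<open>A\<close> acts diagonally, and with pairwise distinct characters on the
  coordinate axes.  So a nonzero invariant subspace contains an axis, and hence all of them.\<close>

lemma irreducible_induced_rep:
  assumes fin: "finite (carrier G)" and H: "subgroup H G" and xi: "linear_char H \<xi>"
    and tr: "transversal {..<m} f H" and m: "m > 0"
    and A: "subgroup A G" "A \<subseteq> H" "\<And>y a. y \<in> carrier G \<Longrightarrow> a \<in> A \<Longrightarrow> inv y \<otimes> a \<otimes> y \<in> A"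
    and sep: "\<And>i j. i < m \<Longrightarrow> j < m \<Longrightarrow>
      (\<And>a. a \<in> A \<Longrightarrow> \<xi> (inv (f i) \<otimes> a \<otimes> f i) = \<xi> (inv (f j) \<otimes> a \<otimes> f j)) \<Longrightarrow> i = j"
  shows "irreducible_rep G m (induced_rep m f H \<xi>)"
  unfolding irreducible_rep_def
proof (intro conjI allI impI)
  let ?\<rho> = "induced_rep m f H \<xi>"
  show "matrix_rep G m ?\<rho>" by (rule matrix_rep_induced[OF H xi tr])
  show "m > 0" by fact
  have fI: "f i \<in> carrier G" if "i < m" for i using tr that by (auto simp: transversal_def)
  note mem = transversal_mem_iff[OF H tr, simplified]
  have AG: "A \<subseteq> carrier G" and finA: "finite A" using A(1) fin by (auto dest: subgroup.subset intro: finite_subset)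
  have cardA: "card A > 0" using finA A(1) by (metis card_gt_0_iff empty_iff subgroup.one_closed)
  \<comment> \<open>c i is the character by which A acts on axis i; \<open>sep\<close> says that
    these characters are pairwise distinct.\<close>
  define c where "c = (\<lambda>i a. \<xi> (inv (f i) \<otimes> a \<otimes> f i))"
  have c_mult: "c i (a \<otimes> b) = c i a * c i b" if "i < m" "a \<in> A" "b \<in> A" for i a b
  proof -
    have ab: "a \<in> carrier G" "b \<in> carrier G" using that AG by auto
    have "inv (f i) \<otimes> (a \<otimes> b) \<otimes> f i = (inv (f i) \<otimes> a \<otimes> f i) \<otimes> (inv (f i) \<otimes> b \<otimes> f i)"
      using fI[OF that(1)] ab by (simp add: m_assoc) (simp add: m_assoc[symmetric])
    thus ?thesis using xi A(2) A(3)[OF fI[OF that(1)]] that(2,3)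
      by (auto simp: linear_char_def c_def subset_iff)
  qed
  have c_one: "c i \<one> = 1" if "i < m" for i
    using xi fI[OF that] by (simp add: c_def linear_char_def)
  have c_inv: "c i (inv a) * c i a = 1" if "i < m" "a \<in> A" for i a
    using c_mult[OF that(1) subgroup.m_inv_closed[OF A(1) that(2)] that(2)] c_one[OF that(1)] that(2) AG
    by auto
  fix W assume "VectorSpace.subspace class_ring W (module_vec TYPE(complex) m) \<and>
    (\<forall>g\<in>carrier G. \<forall>w\<in>W. ?\<rho> g *\<^sub>v w \<in> W)"
  hence W: "VectorSpace.subspace class_ring W (module_vec TYPE(complex) m)"
    and inv: "\<And>g w. g \<in> carrier G \<Longrightarrow> w \<in> W \<Longrightarrow> ?\<rho> g *\<^sub>v w \<in> W" by auto
  have WC: "W \<subseteq> carrier_vec m" and W0: "0\<^sub>v m \<in> W" and Ws: "\<And>k v. v \<in> W \<Longrightarrow> k \<cdot>\<^sub>v v \<in> W"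
    using W unfolding subspace_module_vec_iff by auto
  show "W = {0\<^sub>v m} \<or> W = carrier_vec m"
  proof (cases "W = {0\<^sub>v m}")
    case False
    then obtain w where w: "w \<in> W" "w \<noteq> 0\<^sub>v m" using W0 by blast
    hence wC: "w \<in> carrier_vec m" using WC by blast
    then obtain i where i: "i < m" "w $ i \<noteq> 0" using w(2) by (auto simp: vec_eq_iff)
    have act: "(?\<rho> a *\<^sub>v w) $ j = c j a * w $ j" if a: "a \<in> A" and j: "j < m" for a j
    proof -
      have aG: "a \<in> carrier G" using a AG by auto
      have "zero_ext H \<xi> (inv (f j) \<otimes> a \<otimes> f k) = (if k = j then c j a else 0)" if k: "k < m" for k
      proof -
        have aH: "inv (f j) \<otimes> a \<otimes> f j \<in> H" using A(2) A(3)[OF fI[OF j] a] by blast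
        have "inv (inv (f j) \<otimes> a \<otimes> f j) \<otimes> (inv (f j) \<otimes> a \<otimes> f k) = inv (f j) \<otimes> f k"
          using fI[OF j] fI[OF k] aG by (simp add: inv_mult_group m_assoc) (simp add: m_assoc[symmetric])
        hence "inv (f j) \<otimes> a \<otimes> f k \<in> H \<Longrightarrow> j = k"
          using subgroup.m_closed[OF H subgroup.m_inv_closed[OF H aH]] mem[OF j k] by metis
        thus ?thesis using aH by (auto simp: zero_ext_def c_def)
      qed
      hence "(?\<rho> a *\<^sub>v w) $ j = (\<Sum>k<m. (if k = j then c j a else 0) * w $ k)"
        using j wC by (auto simp: induced_rep_def scalar_prod_def atLeast0LessThan intro!: sum.cong)
      thus ?thesis using j by (simp add: if_distrib[of "\<lambda>x. x * _"] sum.delta cong: if_cong)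
    qed
    \<comment> \<open>Up to the factor |A| this is the projection of w to axis i along the other
      axes, by orthogonality of the characters c.\<close>
    define v where "v = vec m (\<lambda>j. \<Sum>a\<in>A. c i (inv a) * (?\<rho> a *\<^sub>v w) $ j)"
    have v: "v \<in> W"
      unfolding v_def by (rule subspace_sum_closed[OF W finA]) (use inv w AG in auto)
    have "v $ j = (if j = i then of_nat (card A) * w $ i else 0)" if j: "j < m" for j
    proof -
      have "v $ j = (\<Sum>a\<in>A. c i (inv a) * c j a) * w $ j"
        using j by (simp add: v_def act sum_distrib_right mult.assoc)
      also have "(\<Sum>a\<in>A. c i (inv a) * c j a) = (if j = i then of_nat (card A) else 0)"
      proof -
        have "(\<Sum>a\<in>A. c i (inv a) * c j a) =
            (if \<forall>a\<in>A. c i (inv a) * c j a = 1 then of_nat (card A) else 0)"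
        proof (rule sum_character_subgroup[OF A(1) finA])
          fix a b assume ab: "a \<in> A" "b \<in> A"
          have "inv a \<in> A" "inv b \<in> A" using ab A(1) by (auto intro: subgroup.m_inv_closed)
          moreover have "inv (a \<otimes> b) = inv b \<otimes> inv a" using ab AG by (intro inv_mult_group) auto
          ultimately show "c i (inv (a \<otimes> b)) * c j (a \<otimes> b) = c i (inv a) * c j a * (c i (inv b) * c j b)"
            using ab i(1) j by (simp add: c_mult)
        qed (use c_one i(1) j in simp)
        moreover have "(\<forall>a\<in>A. c i (inv a) * c j a = 1) \<longleftrightarrow> j = i"
        proof
          assume *: "\<forall>a\<in>A. c i (inv a) * c j a = 1"
          have "c i a = c j a" if "a \<in> A" for a
          proof -
            have "c i (inv a) * c j a = c i (inv a) * c i a" using * that c_inv[OF i(1) that] by simp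
            thus ?thesis using c_inv[OF i(1) that] by (metis mult_cancel_left mult_zero_left zero_neq_one)
          qed
          thus "j = i" using sep[OF i(1) j] by (simp add: c_def)
        qed (use c_inv j in auto)
        ultimately show ?thesis by simp
      qed
      finally show ?thesis by simp
    qed
    hence "unit_vec m i = (1 / (of_nat (card A) * w $ i)) \<cdot>\<^sub>v v"
      using cardA i WC v by (intro eq_vecI) (auto simp: unit_vec_def)
    hence ei: "unit_vec m i \<in> W" using Ws[OF v] by metis
    \<comment> \<open>The element \<open>f j \<otimes> inv (f i)\<close> carries coset i to coset j,
      hence axis i to axis j.\<close>
    have ej: "unit_vec m j \<in> W" if j: "j < m" for j
    proof -
      have g: "f j \<otimes> inv (f i) \<in> carrier G" using fI i j by auto
      have "?\<rho> (f j \<otimes> inv (f i)) *\<^sub>v unit_vec m i = unit_vec m j"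
      proof (rule eq_vecI)
        fix k assume "k < dim_vec (unit_vec m j :: complex vec)"
        hence k: "k < m" by simp
        have "inv (f k) \<otimes> (f j \<otimes> inv (f i)) \<otimes> f i = inv (f k) \<otimes> f j"
          using fI[OF i(1)] fI[OF j] fI[OF k] by (simp add: m_assoc)
        hence "?\<rho> (f j \<otimes> inv (f i)) $$ (k, i) = (if k = j then 1 else 0)"
          using i(1) k j fI xi mem[OF k j] by (auto simp: induced_rep_def zero_ext_def linear_char_def)
        thus "(?\<rho> (f j \<otimes> inv (f i)) *\<^sub>v unit_vec m i) $ k = unit_vec m j $ k"
          using mult_unit_vec_col[of "?\<rho> (f j \<otimes> inv (f i))" m m i] i(1) k j
          by (auto simp: induced_rep_def unit_vec_def)
      qed (auto simp: induced_rep_def)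
      thus ?thesis using inv[OF g ei] by simp
    qed
    have "u \<in> W" if u: "u \<in> carrier_vec m" for u
    proof -
      have "u = vec m (\<lambda>k. \<Sum>j\<in>{..<m}. u $ j * unit_vec m j $ k)"
      proof (rule eq_vecI)
        fix k assume "k < dim_vec (vec m (\<lambda>k. \<Sum>j\<in>{..<m}. u $ j * unit_vec m j $ k))"
        hence k: "k < m" by simp
        have "(\<Sum>j\<in>{..<m}. u $ j * unit_vec m j $ k) = (\<Sum>j\<in>{..<m}. if j = k then u $ j else 0)"
          using k by (intro sum.cong refl) (auto simp: unit_vec_def)
        thus "u $ k = vec m (\<lambda>k. \<Sum>j\<in>{..<m}. u $ j * unit_vec m j $ k) $ k" using k by simp
      qed (use u in auto)
      also have "\<dots> \<in> W" by (rule subspace_sum_closed[OF W]) (use ej in auto)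
      finally show ?thesis .
    qed
    thus ?thesis using WC by blast
  qed simp
qed

text \<open>Transfers the criterion to an arbitrary finite index set by numbering it, and recognises
  the trace as the induced character.\<close>

lemma ind_char_in_Irr:
  assumes fin: "finite (carrier G)" and H: "subgroup H G" and xi: "linear_char H \<xi>"
    and tr: "transversal I f H" and I: "finite I"
    and A: "subgroup A G" "A \<subseteq> H" "\<And>y a. y \<in> carrier G \<Longrightarrow> a \<in> A \<Longrightarrow> inv y \<otimes> a \<otimes> y \<in> A"
    and sep: "\<And>i j. i \<in> I \<Longrightarrow> j \<in> I \<Longrightarrow>
      (\<And>a. a \<in> A \<Longrightarrow> \<xi> (inv (f i) \<otimes> a \<otimes> f i) = \<xi> (inv (f j) \<otimes> a \<otimes> f j)) \<Longrightarrow> i = j"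
  shows "ind_char G H \<xi> \<in> Irr G"
proof -
  obtain e where e: "bij_betw e {0..<card I} I" using ex_bij_betw_nat_finite[OF I] ..
  hence e': "bij_betw e {..<card I} I" by (simp add: lessThan_atLeast0)
  have "bij_betw (map_prod e id) ({..<card I} \<times> H) (I \<times> H)"
    by (intro bij_betw_map_prod e') simp
  hence "bij_betw ((\<lambda>(i, h). f i \<otimes> h) \<circ> map_prod e id) ({..<card I} \<times> H) (carrier G)"
    using tr by (intro bij_betw_trans) (auto simp: transversal_def)
  moreover have "(\<lambda>(i, h). f i \<otimes> h) \<circ> map_prod e id = (\<lambda>(i, h). (f \<circ> e) i \<otimes> h)" by auto
  moreover have "(f \<circ> e) ` {..<card I} \<subseteq> carrier G"
    using tr e' by (auto simp: transversal_def bij_betw_def)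
  ultimately have tr': "transversal {..<card I} (f \<circ> e) H" by (simp add: transversal_def)
  have "\<one> \<in> (\<lambda>(i, h). f i \<otimes> h) ` (I \<times> H)" using tr by (simp add: transversal_def bij_betw_def)
  hence "card I > 0" using I by (auto simp: card_gt_0_iff)
  hence irr: "irreducible_rep G (card I) (induced_rep (card I) (f \<circ> e) H \<xi>)"
  proof (intro irreducible_induced_rep[OF fin H xi tr' _ A])
    fix i j assume ij: "i < card I" "j < card I"
      and "\<And>a. a \<in> A \<Longrightarrow> \<xi> (inv ((f \<circ> e) i) \<otimes> a \<otimes> (f \<circ> e) i) = \<xi> (inv ((f \<circ> e) j) \<otimes> a \<otimes> (f \<circ> e) j)"
    hence "e i = e j" using e' by (intro sep) (auto simp: bij_betw_def)
    thus "i = j" using e' ij by (auto simp: bij_betw_def dest: inj_onD)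
  qed auto
  have "ind_char G H \<xi> = rep_character G (card I) (induced_rep (card I) (f \<circ> e) H \<xi>)"
  proof
    fix g
    show "ind_char G H \<xi> g = rep_character G (card I) (induced_rep (card I) (f \<circ> e) H \<xi>) g"
    proof (cases "g \<in> carrier G")
      case True
      thus ?thesis unfolding ind_char_transversal[OF fin H xi tr' True]
        by (simp add: rep_character_def induced_rep_def)
    qed (simp add: rep_character_def ind_char_def)
  qed
  thus ?thesis using irr unfolding Irr_def by blast
qed

text \<open>A part of Mackey's formula. Up to a factor, S is the pairing over H of the induced
  character with \<zeta>. It splits into one character sum for each y, over the intersection
  \<open>K y\<close> of H and y H y^-1, and each of these is 0 or the order of \<open>K y\<close>.
  For \<zeta> itself y = 1 contributes |H|, so S is nonzero; hence some y contributes for \<xi> as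
  well and carries it to \<zeta> on \<open>K y\<close>.\<close>

lemma ind_char_eqD:
  assumes fin: "finite (carrier G)" and H: "subgroup H G"
    and xi: "linear_char H \<xi>" and zeta: "linear_char H \<zeta>"
    and eq: "ind_char G H \<xi> = ind_char G H \<zeta>"
  obtains y where "y \<in> carrier G"
    "\<And>h. h \<in> H \<Longrightarrow> inv y \<otimes> h \<otimes> y \<in> H \<Longrightarrow> \<xi> (inv y \<otimes> h \<otimes> y) = \<zeta> h"
proof -
  have HG: "H \<subseteq> carrier G" using H by (rule subgroup.subset)
  have finH: "finite H" using fin HG by (rule finite_subset[rotated])
  define K where "K = (\<lambda>y. {h \<in> H. inv y \<otimes> h \<otimes> y \<in> H})"
  define S where "S = (\<lambda>\<xi>. \<Sum>h\<in>H. \<Sum>y\<in>carrier G. zero_ext H \<xi> (inv y \<otimes> h \<otimes> y) * \<zeta> (inv h))"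
  have S: "S \<xi>' = (\<Sum>y\<in>carrier G. if \<forall>h\<in>K y. \<xi>' (inv y \<otimes> h \<otimes> y) * \<zeta> (inv h) = 1 then of_nat (card (K y)) else 0)"
    if xi': "linear_char H \<xi>'" for \<xi>'
  proof -
    have "S \<xi>' = (\<Sum>y\<in>carrier G. \<Sum>h\<in>H. zero_ext H \<xi>' (inv y \<otimes> h \<otimes> y) * \<zeta> (inv h))"
      unfolding S_def by (rule sum.swap)
    also have "\<dots> = (\<Sum>y\<in>carrier G. \<Sum>h\<in>K y. \<xi>' (inv y \<otimes> h \<otimes> y) * \<zeta> (inv h))"
      using finH by (intro sum.cong refl sum.mono_neutral_cong_right) (auto simp: K_def zero_ext_def)
    also have "\<dots> = (\<Sum>y\<in>carrier G. if \<forall>h\<in>K y. \<xi>' (inv y \<otimes> h \<otimes> y) * \<zeta> (inv h) = 1 then of_nat (card (K y)) else 0)"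
    proof (intro sum.cong refl sum_character_subgroup)
      fix y assume y: "y \<in> carrier G"
      have cm: "inv y \<otimes> (h \<otimes> k) \<otimes> y = (inv y \<otimes> h \<otimes> y) \<otimes> (inv y \<otimes> k \<otimes> y)"
        if "h \<in> carrier G" "k \<in> carrier G" for h k
        using y that by (simp add: m_assoc) (simp add: m_assoc[symmetric])
      show "subgroup (K y) G"
      proof
        show "K y \<subseteq> carrier G" using HG by (auto simp: K_def)
        show "\<one> \<in> K y" using subgroup.one_closed[OF H] y by (simp add: K_def)
        show "h \<otimes> k \<in> K y" if "h \<in> K y" "k \<in> K y" for h k
          using that HG cm[of h k] subgroup.m_closed[OF H] by (auto simp: K_def subset_iff)
        show "inv h \<in> K y" if "h \<in> K y" for h
        proof -
          have h: "h \<in> H" "h \<in> carrier G" "inv y \<otimes> h \<otimes> y \<in> H" using that HG by (auto simp: K_def)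
          have "inv (inv y \<otimes> h \<otimes> y) = inv y \<otimes> inv h \<otimes> y"
            using y h(2) by (simp add: inv_mult_group m_assoc)
          thus ?thesis using h subgroup.m_inv_closed[OF H] unfolding K_def by (metis (mono_tags, lifting) mem_Collect_eq)
        qed
      qed
      show "finite (K y)" using finH by (simp add: K_def)
      show "\<xi>' (inv y \<otimes> \<one> \<otimes> y) * \<zeta> (inv \<one>) = 1" using y xi' zeta by (simp add: linear_char_def)
      fix h k assume "h \<in> K y" "k \<in> K y"
      hence hk: "h \<in> H" "k \<in> H" "h \<in> carrier G" "k \<in> carrier G"
        "inv y \<otimes> h \<otimes> y \<in> H" "inv y \<otimes> k \<otimes> y \<in> H" using HG by (auto simp: K_def)
      thus "\<xi>' (inv y \<otimes> (h \<otimes> k) \<otimes> y) * \<zeta> (inv (h \<otimes> k)) =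
          \<xi>' (inv y \<otimes> h \<otimes> y) * \<zeta> (inv h) * (\<xi>' (inv y \<otimes> k \<otimes> y) * \<zeta> (inv k))"
        using xi' zeta subgroup.m_inv_closed[OF H] unfolding cm[OF hk(3,4)]
        by (simp add: linear_char_def inv_mult_group)
    qed
    finally show ?thesis .
  qed
  have S_ind: "S \<xi>' = (\<Sum>h\<in>H. of_nat (card H) * ind_char G H \<xi>' h * \<zeta> (inv h))" for \<xi>'
  proof -
    have "card H \<noteq> 0" using finH subgroup.one_closed[OF H] by (auto simp: card_eq_0_iff)
    thus ?thesis unfolding S_def using HG
      by (intro sum.cong refl) (auto simp: ind_char_eq_zero_ext subset_iff sum_distrib_right)
  qed
  have "S \<xi> = S \<zeta>" unfolding S_ind eq ..
  moreover have "S \<zeta> \<noteq> 0"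
  proof -
    \<comment> \<open>The contributions are natural numbers, so nothing can cancel the one of y =
      1.\<close>
    define B where "B = (\<lambda>y. if \<forall>h\<in>K y. \<zeta> (inv y \<otimes> h \<otimes> y) * \<zeta> (inv h) = 1 then card (K y) else 0)"
    have SB: "S \<zeta> = of_nat (\<Sum>y\<in>carrier G. B y)"
      unfolding S[OF zeta] B_def of_nat_sum by (intro sum.cong refl) auto
    have "B \<one> = card H"
    proof -
      have "K \<one> = H" using HG by (auto simp: K_def)
      moreover have "\<forall>h\<in>H. \<zeta> (inv \<one> \<otimes> h \<otimes> \<one>) * \<zeta> (inv h) = 1"
      proof
        fix h assume h: "h \<in> H"
        hence "h \<in> carrier G" using HG by auto
        thus "\<zeta> (inv \<one> \<otimes> h \<otimes> \<one>) * \<zeta> (inv h) = 1"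
          using linear_char_inv(1)[OF H zeta h] by simp
      qed
      ultimately show ?thesis by (simp add: B_def)
    qed
    moreover have "card H > 0" using finH subgroup.one_closed[OF H] by (auto simp: card_gt_0_iff)
    moreover have "B \<one> \<le> (\<Sum>y\<in>carrier G. B y)" using fin by (intro member_le_sum) auto
    ultimately have "(\<Sum>y\<in>carrier G. B y) \<noteq> 0" by linarith
    thus ?thesis unfolding SB of_nat_eq_0_iff .
  qed
  ultimately have "S \<xi> \<noteq> 0" by simp
  then obtain y where y: "y \<in> carrier G" "\<forall>h\<in>K y. \<xi> (inv y \<otimes> h \<otimes> y) * \<zeta> (inv h) = 1"
    unfolding S[OF xi] by (rule sum.not_neutral_contains_not_neutral) (simp split: if_splits)
  have "\<xi> (inv y \<otimes> h \<otimes> y) = \<zeta> h" if "h \<in> H" "inv y \<otimes> h \<otimes> y \<in> H" for h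
  proof -
    have "\<xi> (inv y \<otimes> h \<otimes> y) * \<zeta> (inv h) = \<zeta> h * \<zeta> (inv h)"
      using y(2) that linear_char_inv[OF H zeta that(1)] by (simp add: K_def)
    moreover have "\<zeta> (inv h) \<noteq> 0" using linear_char_inv(1)[OF H zeta that(1)] by auto
    ultimately show ?thesis by simp
  qed
  with y(1) show ?thesis by (rule that)
qed

end

section \<open>Quotients, inflation and conjugacy\<close>

context group
begin

lemma coset_inv_conj:
  assumes N: "N \<lhd> G" and "y \<in> carrier G" "g \<in> carrier G"
  shows "inv\<^bsub>G Mod N\<^esub> (N #> y) \<otimes>\<^bsub>G Mod N\<^esub> (N #> g) \<otimes>\<^bsub>G Mod N\<^esub> (N #> y) = N #> (inv y \<otimes> g \<otimes> y)"
proof -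
  interpret normal N G by fact
  interpret Q: group "G Mod N" by (rule factorgroup_is_group)
  interpret h: group_hom G "G Mod N" "\<lambda>a. N #> a"
    by unfold_locales (use r_coset_hom_Mod in auto)
  show ?thesis using assms(2,3) by simp
qed

lemma coset_mult:
  assumes N: "N \<lhd> G" and "y \<in> carrier G" "g \<in> carrier G"
  shows "(N #> y) \<otimes>\<^bsub>G Mod N\<^esub> (N #> g) = N #> (y \<otimes> g)"
proof -
  interpret normal N G by fact
  show ?thesis using assms(2,3) by (simp add: rcos_sum)
qed

lemma coset_mem_bar_iff:
  assumes N: "N \<lhd> G" and H: "subgroup H G" and NH: "N \<subseteq> H" and g: "g \<in> carrier G"
  shows "N #> g \<in> bar G N H \<longleftrightarrow> g \<in> H"
proof
  have Ns: "subgroup N G" using N by (rule normal_imp_subgroup)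
  assume "N #> g \<in> bar G N H"
  then obtain h where h: "h \<in> H" "N #> g = N #> h" by (auto simp: bar_def)
  have "g \<in> N #> h" using rcos_self[OF g Ns] h(2) by simp
  then obtain n where "n \<in> N" "g = n \<otimes> h" by (auto simp: r_coset_def)
  thus "g \<in> H" using h NH by (auto intro: subgroup.m_closed[OF H])
qed (auto simp: bar_def)

lemma sum_over_cosets:
  assumes fin: "finite (carrier G)" and N: "N \<lhd> G" and H: "subgroup H G" and NH: "N \<subseteq> H"
  shows "(\<Sum>h\<in>H. F (N #> h)) = of_nat (card N) * (\<Sum>Y\<in>bar G N H. F Y :: complex)"
proof -
  have Ns: "subgroup N G" using N by (rule normal_imp_subgroup)
  have HG: "H \<subseteq> carrier G" and NG: "N \<subseteq> carrier G" using H Ns by (auto dest: subgroup.subset)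
  have finH: "finite H" using fin HG by (rule finite_subset[rotated])
  have "(\<Sum>h\<in>H. F (N #> h)) = (\<Sum>Y\<in>bar G N H. \<Sum>h\<in>{h \<in> H. N #> h = Y}. F (N #> h))"
    unfolding bar_def by (rule sum.image_gen[OF finH])
  also have "\<dots> = (\<Sum>Y\<in>bar G N H. of_nat (card N) * F Y)"
  proof (rule sum.cong[OF refl])
    fix Y assume "Y \<in> bar G N H"
    then obtain k where k: "k \<in> H" "Y = N #> k" by (auto simp: bar_def)
    have kG: "k \<in> carrier G" using k HG by auto
    have "{h \<in> H. N #> h = Y} = N #> k"
    proof (intro equalityI subsetI)
      fix h assume "h \<in> {h \<in> H. N #> h = Y}"
      thus "h \<in> N #> k" using rcos_self[of h N] Ns HG k(2) by auto
    next
      fix h assume h: "h \<in> N #> k"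
      hence "h \<in> H" using k(1) NH by (auto simp: r_coset_def intro: subgroup.m_closed[OF H])
      moreover have "N #> h = Y" using repr_independence[OF h kG Ns] k(2) by simp
      ultimately show "h \<in> {h \<in> H. N #> h = Y}" by simp
    qed
    moreover have "card (N #> k) = card N"
      using rcosetsI[OF NG kG] card_rcosets_equal[OF _ NG] by simp
    moreover have "(\<Sum>h\<in>{h \<in> H. N #> h = Y}. F (N #> h)) = (\<Sum>h\<in>{h \<in> H. N #> h = Y}. F Y)"
      by (intro sum.cong) auto
    ultimately show "(\<Sum>h\<in>{h \<in> H. N #> h = Y}. F (N #> h)) = of_nat (card N) * F Y" by simp
  qed
  finally show ?thesis by (simp add: sum_distrib_left)
qed

text \<open>Induction commutes with inflation. As N lies in H, membership of a conjugate in H can be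
  tested modulo N, and each coset is met |N| times, which cancels against the index relation between
  H and its image. It moves all computations from quotients into U.\<close>

lemma lift_ind_char:
  assumes fin: "finite (carrier G)" and N: "N \<lhd> G" and H: "subgroup H G" and NH: "N \<subseteq> H"
  shows "lift_char G N (ind_char (G Mod N) (bar G N H) \<mu>) = ind_char G H (\<lambda>h. \<mu> (N #> h))"
proof
  fix g
  have Ns: "subgroup N G" using N by (rule normal_imp_subgroup)
  have NG: "N \<subseteq> carrier G" using Ns by (auto dest: subgroup.subset)
  have Q: "carrier (G Mod N) = bar G N (carrier G)"
    by (auto simp: FactGroup_def RCOSETS_def bar_def)
  have "finite N" using fin NG by (rule finite_subset[rotated])
  hence cardN: "card N > 0" using subgroup.one_closed[OF Ns] by (auto simp: card_gt_0_iff)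
  show "lift_char G N (ind_char (G Mod N) (bar G N H) \<mu>) g = ind_char G H (\<lambda>h. \<mu> (N #> h)) g"
  proof (cases "g \<in> carrier G")
    case g: True
    define F where "F = (\<lambda>Y. if inv\<^bsub>G Mod N\<^esub> Y \<otimes>\<^bsub>G Mod N\<^esub> (N #> g) \<otimes>\<^bsub>G Mod N\<^esub> Y \<in> bar G N H
        then \<mu> (inv\<^bsub>G Mod N\<^esub> Y \<otimes>\<^bsub>G Mod N\<^esub> (N #> g) \<otimes>\<^bsub>G Mod N\<^esub> Y) else 0)"
    have "ind_char G H (\<lambda>h. \<mu> (N #> h)) g = (\<Sum>y\<in>carrier G. F (N #> y)) / of_nat (card H)"
    proof -
      have "(if inv y \<otimes> g \<otimes> y \<in> H then \<mu> (N #> (inv y \<otimes> g \<otimes> y)) else 0) = F (N #> y)"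
        if y: "y \<in> carrier G" for y
      proof -
        have "inv y \<otimes> g \<otimes> y \<in> carrier G" using y g by auto
        thus ?thesis unfolding F_def coset_inv_conj[OF N y g]
          by (simp only: coset_mem_bar_iff[OF N H NH])
      qed
      thus ?thesis using g unfolding ind_char_def by simp
    qed
    also have "\<dots> = of_nat (card N) * (\<Sum>Y\<in>carrier (G Mod N). F Y) / of_nat (card H)"
      unfolding Q using sum_over_cosets[OF fin N subgroup_self, of F] NG by simp
    also have "of_nat (card H) = (of_nat (card N) * of_nat (card (bar G N H)) :: complex)"
      using sum_over_cosets[OF fin N H NH, of "\<lambda>_. 1"] by simp
    also have "of_nat (card N) * (\<Sum>Y\<in>carrier (G Mod N). F Y) / (of_nat (card N) * of_nat (card (bar G N H)))
        = ind_char (G Mod N) (bar G N H) \<mu> (N #> g)"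
      using g cardN by (simp add: ind_char_def F_def Q) (auto simp: bar_def)
    finally show ?thesis using g by (simp add: lift_char_def)
  qed (simp add: lift_char_def ind_char_def)
qed

lemma subgroup_bar:
  assumes N: "N \<lhd> G" and H: "subgroup H G"
  shows "subgroup (bar G N H) (G Mod N)"
proof -
  interpret normal N G by fact
  interpret Q: group "G Mod N" by (rule factorgroup_is_group)
  interpret h: group_hom G "G Mod N" "\<lambda>a. N #> a"
    by unfold_locales (use r_coset_hom_Mod in auto)
  show ?thesis unfolding bar_def by (rule h.subgroup_img_is_subgroup[OF H])
qed

text \<open>Serves the claims of (B) that the functions to be induced are themselves irreducible
  characters of the barred subgroups.\<close>

lemma quotient_linear_in_Irr:
  assumes N: "N \<lhd> G" and H: "subgroup H G" and xi: "linear_char H \<xi>"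
    and mu: "\<And>h. h \<in> H \<Longrightarrow> \<mu> (N #> h) = \<xi> h" and ext: "\<mu> \<in> extensional (bar G N H)"
  shows "\<mu> \<in> Irr ((G Mod N)\<lparr>carrier := bar G N H\<rparr>)"
proof -
  interpret normal N G by fact
  have Q: "group (G Mod N)" by (rule factorgroup_is_group)
  interpret B: group "(G Mod N)\<lparr>carrier := bar G N H\<rparr>"
    by (rule subgroup.subgroup_is_group[OF subgroup_bar[OF N H] Q])
  have HG: "H \<subseteq> carrier G" using H by (rule subgroup.subset)
  show ?thesis
  proof (rule B.linear_in_Irr)
    have "N #> \<one> = N" using subset by (simp add: coset_mult_one)
    thus "\<mu> \<one>\<^bsub>(G Mod N)\<lparr>carrier := bar G N H\<rparr>\<^esub> = 1"
      using mu[OF subgroup.one_closed[OF H]] xi by (simp add: linear_char_def FactGroup_def)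
    fix X Y assume "X \<in> carrier ((G Mod N)\<lparr>carrier := bar G N H\<rparr>)" "Y \<in> carrier ((G Mod N)\<lparr>carrier := bar G N H\<rparr>)"
    then obtain h k where h: "h \<in> H" "X = N #> h" and k: "k \<in> H" "Y = N #> k" by (auto simp: bar_def)
    thus "\<mu> (X \<otimes>\<^bsub>(G Mod N)\<lparr>carrier := bar G N H\<rparr>\<^esub> Y) = \<mu> X * \<mu> Y"
      using HG subgroup.m_closed[OF H h(1) k(1)] xi coset_mult[OF N, of h k]
      by (auto simp: mu linear_char_def subset_iff)
  qed (use ext in simp)
qed

lemma carrier_Mod_bar: "carrier (G Mod N) = bar G N (carrier G)"
  by (auto simp: FactGroup_def RCOSETS_def bar_def)

lemma bar_set_mult:
  assumes N: "N \<lhd> G" and "S \<subseteq> carrier G" "T \<subseteq> carrier G"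
  shows "bar G N S <#>\<^bsub>G Mod N\<^esub> bar G N T = bar G N (S <#> T)"
proof -
  have "bar G N S <#>\<^bsub>G Mod N\<^esub> bar G N T = (\<Union>s\<in>S. \<Union>t\<in>T. {(N #> s) \<otimes>\<^bsub>G Mod N\<^esub> (N #> t)})"
    by (simp add: set_mult_def bar_def)
  also have "\<dots> = (\<Union>s\<in>S. \<Union>t\<in>T. {N #> (s \<otimes> t)})"
    using assms(2,3)
    by (intro SUP_cong refl arg_cong[where f = "\<lambda>x. {x}"] coset_mult[OF N]) auto
  also have "\<dots> = bar G N (S <#> T)"
    by (auto simp: set_mult_def bar_def)
  finally show ?thesis .
qed

lemma conj_class_sym:
  assumes "x \<in> carrier G" "y \<in> conj_class G x" shows "x \<in> conj_class G y"
proof -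
  obtain v where v: "v \<in> carrier G" "y = v \<otimes> x \<otimes> inv v" using assms(2) by (auto simp: conj_class_def)
  have "x = inv v \<otimes> y \<otimes> inv (inv v)"
    using assms(1) v by (simp add: m_assoc) (simp add: m_assoc[symmetric])
  moreover have "inv v \<in> carrier G" using v(1) by simp
  ultimately show ?thesis unfolding conj_class_def by blast
qed

lemma conj_class_trans:
  assumes "x \<in> carrier G" "y \<in> conj_class G x" "z \<in> conj_class G y" shows "z \<in> conj_class G x"
proof -
  obtain v w where v: "v \<in> carrier G" "y = v \<otimes> x \<otimes> inv v" and w: "w \<in> carrier G" "z = w \<otimes> y \<otimes> inv w"
    using assms(2,3) by (auto simp: conj_class_def)
  have "z = (w \<otimes> v) \<otimes> x \<otimes> inv (w \<otimes> v)"
    using assms(1) v w by (simp add: inv_mult_group m_assoc)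
  thus ?thesis using v w by (auto simp: conj_class_def)
qed

text \<open>In the form v x = y v no inverse occurs, so both sides can be expanded by the
  multiplication law.\<close>

lemma conj_class_iff:
  assumes "x \<in> carrier G"
  shows "y \<in> conj_class G x \<longleftrightarrow> y \<in> carrier G \<and> (\<exists>v\<in>carrier G. v \<otimes> x = y \<otimes> v)"
proof
  assume "y \<in> conj_class G x"
  then obtain v where v: "v \<in> carrier G" "y = v \<otimes> x \<otimes> inv v" by (auto simp: conj_class_def)
  hence "v \<otimes> x = y \<otimes> v" using assms by (simp add: m_assoc)
  moreover have "y \<in> carrier G" using v assms by simp
  ultimately show "y \<in> carrier G \<and> (\<exists>v\<in>carrier G. v \<otimes> x = y \<otimes> v)" using v(1) by blast
next
  assume "y \<in> carrier G \<and> (\<exists>v\<in>carrier G. v \<otimes> x = y \<otimes> v)"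
  then obtain v where v: "y \<in> carrier G" "v \<in> carrier G" "v \<otimes> x = y \<otimes> v" by blast
  hence "y = v \<otimes> x \<otimes> inv v" using assms by (simp add: m_assoc)
  thus "y \<in> conj_class G x" using v(2) unfolding conj_class_def by blast
qed

end

section \<open>Coordinates on the unipotent group\<close>

text \<open>The Frobenius map is a parameter of its own, so that the simplifier treats it as a ring homomorphism
  and not as a power.\<close>

locale triality_field =
  fixes p k q :: nat and fr :: "'a :: finite_field \<Rightarrow> 'a"
  assumes p: "prime p" "odd p" and q: "q = p ^ k" and card_UNIV: "card (UNIV :: 'a set) = q ^ 3"
    and fr_def: "fr = (\<lambda>x. x ^ q)"
begin

lemma char_eq: "CHAR('a) = p"
proof -
  have "CHAR('a) dvd (p ^ k) ^ 3"
    using of_nat_card_UNIV_eq_0[where ?'a = 'a] unfolding card_UNIV q of_nat_eq_0_iff_char_dvd .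
  moreover have "prime CHAR('a)"
    by (intro prime_CHAR_semidom finite_imp_CHAR_pos) simp
  ultimately show ?thesis using p(1) by (metis prime_dvd_power primes_dvd_imp_eq)
qed

lemma two_neq_0: "(2 :: 'a) \<noteq> 0"
proof
  assume "(2 :: 'a) = 0"
  hence "of_nat 2 = (0 :: 'a)" by simp
  hence "p dvd 2" unfolding of_nat_eq_0_iff_char_dvd char_eq .
  hence "p = 2" using p(1) by (simp add: primes_dvd_imp_eq)
  thus False using p(2) by simp
qed

lemma odd_q: "odd q" using p(2) by (simp add: q)

lemma fr_add [simp]: "fr (a + b) = fr a + fr b"
  unfolding fr_def by (rule freshmans_dream') (use char_eq p(1) q in auto)

lemma fr_minus [simp]: "fr (- a) = - fr a"
  using odd_q by (simp add: fr_def)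

lemma fr_diff [simp]: "fr (a - b) = fr a - fr b"
  using fr_add[of a "- b"] by simp

lemma fr_mult [simp]: "fr (a * b) = fr a * fr b"
  by (simp add: fr_def power_mult_distrib)

lemma fr_0 [simp]: "fr 0 = 0" and fr_1 [simp]: "fr 1 = 1"
  using odd_pos[OF odd_q] by (auto simp: fr_def)

lemma fr_divide [simp]: "fr (a / b) = fr a / fr b"
  by (simp add: fr_def power_divide)

lemma fr_eq_0_iff [simp]: "fr a = 0 \<longleftrightarrow> a = 0"
  using odd_pos[OF odd_q] by (auto simp: fr_def)

lemma fr_power [simp]: "fr (a ^ n) = fr a ^ n"
  by (simp add: fr_def power_mult[symmetric] mult.commute)

lemma fr_2 [simp]: "fr 2 = 2"
  using fr_add[of 1 1] by simp

lemma fr_fr_fr [simp]: "fr (fr (fr a)) = a"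
  using finite_field_power_card_eq_same[of a]
  by (simp add: fr_def card_UNIV power_mult[symmetric] power3_eq_cube mult.assoc)

lemma Fq_iff: "t \<in> Fq q \<longleftrightarrow> fr t = t"
  by (simp add: Fq_def fr_def)

lemma power_q:
  "t ^ q = fr t" "t ^ q\<^sup>2 = fr (fr t)" "t ^ (q + 1) = fr t * t" "t ^ (q\<^sup>2 + 1) = fr (fr t) * t"
  "t ^ (q\<^sup>2 + q) = fr (fr t) * fr t" "t ^ (q\<^sup>2 + q + 1) = fr (fr t) * fr t * t"
  by (simp_all add: fr_def power_add power2_eq_square power_mult)

definition Tr :: "'a \<Rightarrow> 'a" where "Tr t = t + fr t + fr (fr t)"
definition Nm :: "'a \<Rightarrow> 'a" where "Nm t = t * fr t * fr (fr t)"

lemma phi0_eq: "\<phi>0 q = Tr"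
  by (simp add: \<phi>0_def Tr_def power_q fun_eq_iff)

definition word6 :: "'a \<Rightarrow> 'a \<Rightarrow> 'a \<Rightarrow> 'a \<Rightarrow> 'a \<Rightarrow> 'a \<Rightarrow> (pos_root \<times> 'a) list" where
  "word6 t1 t2 t3 t4 t5 t6 =
     [(R2, t2), (R1, t1), (R3, fr t1), (R4, fr (fr t1)), (R12, t3), (R23, fr t3), (R24, fr (fr t3)),
      (R123, t4), (R234, fr t4), (R124, fr (fr t4)), (R1234, t5), (R12234, t6)]"

abbreviation U :: "('a mat \<Rightarrow> 'a mat) monoid" where "U \<equiv> triality_U q"

lemma U_mult_one: "monoid.mult U = monoid.mult (BijGroup so8)" "one U = one (BijGroup so8)"
  by (simp_all add: triality_U_def D4_mult)

lemma x_elt_word: "x_elt q t1 t2 t3 t4 t5 t6 = word_aut (word6 t1 t2 t3 t4 t5 t6)"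
  unfolding x_elt_def x_word U_mult_one word_aut_mult word_defs word6_def power_q
  by simp

text \<open>Corrections in the multiplication law. Moving x2(s2) to the left past x1(t1) changes the
  third and fourth coordinates to a and b. Moving x1(s1) past these gives the terms with s1, and
  moving x3(s3) past the resulting fourth coordinate gives the last term of
  \<open>c6\<close>.\<close>

definition c4 where "c4 t1 t3 t4 s1 s2 = (let a = t3 - s2 * t1 in t4 + s2 * t1 * fr t1 - s1 * fr a - fr s1 * a)"
definition c5 where "c5 t1 t3 t4 t5 s1 s2 = (let a = t3 - s2 * t1; b = t4 + s2 * t1 * fr t1 in
    t5 - s2 * Nm t1 + Tr (s1 * fr s1 * fr (fr a)) - Tr (s1 * fr b))"
definition c6 where "c6 t1 t3 t4 t5 t6 s1 s2 s3 = (let a = t3 - s2 * t1 in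
    t6 - s2 * t5 + 2 * s2\<^sup>2 * Nm t1 - s2 * Tr (t3 * fr t1 * fr (fr t1))
      + Tr (s1 * fr a * fr (fr a)) - Tr (s3 * fr (c4 t1 t3 t4 s1 s2)))"

text \<open>Equality of automorphisms is reduced to equal action on a general vector, where
  \<open>fr_fr_fr\<close> and the fixed parameters turn it into a polynomial identity in each
  entry.\<close>

lemma x_elt_mult:
  assumes "t2 \<in> Fq q" "t5 \<in> Fq q" "t6 \<in> Fq q" "s2 \<in> Fq q" "s5 \<in> Fq q" "s6 \<in> Fq q"
  shows "x_elt q t1 t2 t3 t4 t5 t6 \<otimes>\<^bsub>U\<^esub> x_elt q s1 s2 s3 s4 s5 s6 =
    x_elt q (t1 + s1) (t2 + s2) (t3 - s2 * t1 + s3) (c4 t1 t3 t4 s1 s2 + s4)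
      (c5 t1 t3 t4 t5 s1 s2 + s5) (c6 t1 t3 t4 t5 t6 s1 s2 s3 + s6)"
  unfolding x_elt_word U_mult_one word_aut_mult
proof (rule word_aut_eqI)
  fix a b c d e f g h
  show "word_act (word6 t1 t2 t3 t4 t5 t6 @ word6 s1 s2 s3 s4 s5 s6) (vec8 a b c d e f g h) =
    word_act (word6 (t1 + s1) (t2 + s2) (t3 - s2 * t1 + s3) (c4 t1 t3 t4 s1 s2 + s4)
      (c5 t1 t3 t4 t5 s1 s2 + s5) (c6 t1 t3 t4 t5 t6 s1 s2 s3 + s6)) (vec8 a b c d e f g h)"
    using assms unfolding Fq_iff
    apply (simp only: word6_def append.simps word_act.simps root_mat_vec8)
    apply (simp only: c4_def c5_def c6_def Let_def Tr_def Nm_def fr_add fr_diff fr_mult fr_fr_fr fr_minus fr_2 fr_power power2_eq_square)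
    apply (simp add: algebra_simps)
    done
qed

end

lemma set_mult_iff: "x \<in> A <#>\<^bsub>G\<^esub> B \<longleftrightarrow> (\<exists>a\<in>A. \<exists>b\<in>B. x = a \<otimes>\<^bsub>G\<^esub> b)"
  by (auto simp: set_mult_def)

lemma bex_set_mult: "(\<exists>x\<in>A <#>\<^bsub>G\<^esub> B. P x) \<longleftrightarrow> (\<exists>a\<in>A. \<exists>b\<in>B. P (a \<otimes>\<^bsub>G\<^esub> b))"
  by (auto simp: set_mult_def)

section \<open>The group U and the uniqueness of coordinates\<close>

context triality_field
begin

abbreviation F :: "'a set" where "F \<equiv> Fq q"
abbreviation X :: "'a \<Rightarrow> 'a \<Rightarrow> 'a \<Rightarrow> 'a \<Rightarrow> 'a \<Rightarrow> 'a \<Rightarrow> 'a mat \<Rightarrow> 'a mat" where "X \<equiv> x_elt q"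

lemma F_closed [simp, intro]:
  "0 \<in> F" "1 \<in> F" "a \<in> F \<Longrightarrow> - a \<in> F" "a \<in> F \<Longrightarrow> b \<in> F \<Longrightarrow> a + b \<in> F"
  "a \<in> F \<Longrightarrow> b \<in> F \<Longrightarrow> a - b \<in> F" "a \<in> F \<Longrightarrow> b \<in> F \<Longrightarrow> a * b \<in> F"
  "a \<in> F \<Longrightarrow> b \<in> F \<Longrightarrow> a / b \<in> F" "a \<in> F \<Longrightarrow> a ^ n \<in> F" "2 \<in> F"
  by (auto simp: Fq_iff)

lemma Tr_in_F [simp, intro]: "Tr a \<in> F" and Nm_in_F [simp, intro]: "Nm a \<in> F"
  by (auto simp: Fq_iff Tr_def Nm_def ac_simps)

lemma Tr_add [simp]: "Tr (a + b) = Tr a + Tr b" and Tr_minus [simp]: "Tr (- a) = - Tr a"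
  and Tr_diff [simp]: "Tr (a - b) = Tr a - Tr b" and Tr_0 [simp]: "Tr 0 = 0" and Tr_fr [simp]: "Tr (fr a) = Tr a"
  by (auto simp: Tr_def)

lemma Tr_scale: "s \<in> F \<Longrightarrow> Tr (s * a) = s * Tr a"
  by (auto simp: Tr_def Fq_iff algebra_simps)

lemma Nm_0 [simp]: "Nm 0 = 0" by (simp add: Nm_def)

lemma c5_in_F [simp, intro]: "t5 \<in> F \<Longrightarrow> s2 \<in> F \<Longrightarrow> c5 t1 t3 t4 t5 s1 s2 \<in> F"
  by (auto simp: c5_def Let_def intro!: F_closed)

lemma c6_in_F [simp, intro]: "t5 \<in> F \<Longrightarrow> t6 \<in> F \<Longrightarrow> s2 \<in> F \<Longrightarrow> c6 t1 t3 t4 t5 t6 s1 s2 s3 \<in> F"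
  by (auto simp: c6_def Let_def intro!: F_closed)

lemma carrier_U: "carrier U = {X t1 t2 t3 t4 t5 t6 | t1 t2 t3 t4 t5 t6. t2 \<in> F \<and> t5 \<in> F \<and> t6 \<in> F}"
proof -
  have *: "g \<in> carrier U \<longleftrightarrow> (\<exists>t2\<in>F. \<exists>t1 t3 t4. \<exists>t5\<in>F. \<exists>t6\<in>F. g = X t1 t2 t3 t4 t5 t6)" for g
    unfolding triality_U_def x_elt_def
    by (simp add: set_mult_iff bex_set_mult X1_def X2_def X3_def X4_def X5_def X6_def)
  show ?thesis
  proof (intro equalityI subsetI)
    fix g assume "g \<in> carrier U"
    thus "g \<in> {X t1 t2 t3 t4 t5 t6 | t1 t2 t3 t4 t5 t6. t2 \<in> F \<and> t5 \<in> F \<and> t6 \<in> F}"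
      unfolding * by blast
  next
    fix g assume "g \<in> {X t1 t2 t3 t4 t5 t6 | t1 t2 t3 t4 t5 t6. t2 \<in> F \<and> t5 \<in> F \<and> t6 \<in> F}"
    thus "g \<in> carrier U" unfolding * by blast
  qed
qed

text \<open>Lets U inherit its group structure directly from the group of all bijections of
  \<open>so8\<close>.\<close>

lemma U_def': "U = (BijGroup so8)\<lparr>carrier := carrier U\<rparr>"
  by (simp add: triality_U_def chevalley_D4_def)

lemma X_0: "X 0 0 0 0 0 0 = \<one>\<^bsub>U\<^esub>"
  unfolding x_elt_word U_mult_one word_aut_Nil[symmetric]
  by (rule word_aut_eqI) (simp only: word6_def append.simps word_act.simps root_mat_vec8, simp)

lemma x_elt_single:
  "x1 q t = X t 0 0 0 0 0" "x2 t = X 0 t 0 0 0 0" "x3 q t = X 0 0 t 0 0 0"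
  "x4 q t = X 0 0 0 t 0 0" "x5 t = X 0 0 0 0 t 0" "x6 t = X 0 0 0 0 0 t"
  unfolding x_elt_word x_word word_defs power_q
  by (rule word_aut_eqI, simp only: word6_def append.simps word_act.simps root_mat_vec8, simp)+

text \<open>The law is triangular, so each coordinate of the inverse is read off from the preceding
  ones.\<close>

lemma X_mult_inverse:
  assumes "t2 \<in> F" "t5 \<in> F" "t6 \<in> F"
  shows "X t1 t2 t3 t4 t5 t6 \<otimes>\<^bsub>U\<^esub> X (- t1) (- t2) (- (t3 + t2 * t1)) (- c4 t1 t3 t4 (- t1) (- t2))
     (- c5 t1 t3 t4 t5 (- t1) (- t2)) (- c6 t1 t3 t4 t5 t6 (- t1) (- t2) (- (t3 + t2 * t1))) = \<one>\<^bsub>U\<^esub>"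
  using assms by (subst x_elt_mult) (auto simp: X_0)

lemma group_U: "group U"
proof -
  interpret B: group "BijGroup (so8 :: 'a mat set)" by (rule group_BijGroup)
  have sub: "carrier U \<subseteq> carrier (BijGroup so8)"
    by (auto simp: carrier_U x_elt_word BijGroup_def word_aut_Bij)
  have "subgroup (carrier U) (BijGroup so8)"
  proof (rule B.subgroupI[OF sub])
    show "carrier U \<noteq> {}" by (auto simp: carrier_U intro!: exI[of _ 0])
    fix a b assume a: "a \<in> carrier U" and b: "b \<in> carrier U"
    then obtain t1 t2 t3 t4 t5 t6 s1 s2 s3 s4 s5 s6 where
      t: "a = X t1 t2 t3 t4 t5 t6" "t2 \<in> F" "t5 \<in> F" "t6 \<in> F" and
      s: "b = X s1 s2 s3 s4 s5 s6" "s2 \<in> F" "s5 \<in> F" "s6 \<in> F"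
      unfolding carrier_U by blast
    have "a \<otimes>\<^bsub>U\<^esub> b \<in> carrier U"
      unfolding t(1) s(1) x_elt_mult[OF t(2-4) s(2-4)] using t s unfolding carrier_U by blast
    thus "a \<otimes>\<^bsub>BijGroup so8\<^esub> b \<in> carrier U" by (simp only: U_mult_one)
  next
    fix a assume a: "a \<in> carrier U"
    then obtain t1 t2 t3 t4 t5 t6 where
      t: "a = X t1 t2 t3 t4 t5 t6" "t2 \<in> F" "t5 \<in> F" "t6 \<in> F"
      unfolding carrier_U by blast
    define b where "b = X (- t1) (- t2) (- (t3 + t2 * t1)) (- c4 t1 t3 t4 (- t1) (- t2))
     (- c5 t1 t3 t4 t5 (- t1) (- t2)) (- c6 t1 t3 t4 t5 t6 (- t1) (- t2) (- (t3 + t2 * t1)))"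
    have b: "b \<in> carrier U" unfolding b_def carrier_U using t by blast
    have "a \<otimes>\<^bsub>BijGroup so8\<^esub> b = \<one>\<^bsub>BijGroup so8\<^esub>"
      using X_mult_inverse[OF t(2-4)] unfolding t(1) b_def U_mult_one .
    hence "inv\<^bsub>BijGroup so8\<^esub> a = b"
      using a b sub B.inv_unique'[of a b] by (auto simp: B.inv_comm)
    thus "inv\<^bsub>BijGroup so8\<^esub> a \<in> carrier U" using b by simp
  qed
  hence "group ((BijGroup so8)\<lparr>carrier := carrier U\<rparr>)"
    by (rule B.subgroup_imp_group)
  thus ?thesis using U_def' by metis
qed

sublocale U: group U by (rule group_U)

lemma X_in_U [simp, intro]: "t2 \<in> F \<Longrightarrow> t5 \<in> F \<Longrightarrow> t6 \<in> F \<Longrightarrow> X t1 t2 t3 t4 t5 t6 \<in> carrier U"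
  unfolding carrier_U by blast

lemma U_cases:
  assumes "g \<in> carrier U"
  obtains t1 t2 t3 t4 t5 t6 where "t2 \<in> F" "t5 \<in> F" "t6 \<in> F" "g = X t1 t2 t3 t4 t5 t6"
  using assms unfolding carrier_U by blast

text \<open>Commuting with these diagonal elements of the Lie algebra forces a unitriangular matrix
  to be the identity.\<close>

definition diag8 :: "'a \<Rightarrow> 'a \<Rightarrow> 'a \<Rightarrow> 'a mat" where
  "diag8 a b c = mat 8 8 (\<lambda>(i, j). if i = j then [a, b, c, 0, 0, -c, -b, -a] ! i else 0)"

lemma diag8_carrier: "diag8 a b c \<in> carrier_mat 8 8" by (simp add: diag8_def)

lemma diag8_vec8:
  "diag8 a b c *\<^sub>v vec8 x y z u v w r s = vec8 (a * x) (b * y) (c * z) 0 0 (- c * w) (- b * r) (- a * s)"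
  by (rule eq_vecI) (auto simp: diag8_def vec8_def scalar_prod_def less_Suc_eq numeral_eq_Suc)

lemma gram8_vec8: "gram8 *\<^sub>v vec8 x y z u v w r s = vec8 s r w v u z y (x :: 'a)"
  by (rule eq_vecI) (auto simp: gram8_def vec8_def scalar_prod_def less_Suc_eq numeral_eq_Suc)

lemma diag8_so8: "diag8 a b c \<in> so8"
proof -
  let ?D = "diag8 a b c"
  note D = diag8_carrier[of a b c]
  have T: "?D\<^sup>T = ?D" by (rule eq_matI) (auto simp: diag8_def)
  have "?D\<^sup>T * gram8 + gram8 * ?D = 0\<^sub>m 8 8"
  proof (rule mat_eq_vec8)
    fix x y z u v w r s
    have "(?D * gram8 + gram8 * ?D) *\<^sub>v vec8 x y z u v w r s =
        ?D *\<^sub>v (gram8 *\<^sub>v vec8 x y z u v w r s) + gram8 *\<^sub>v (?D *\<^sub>v vec8 x y z u v w r s)"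
    proof -
      have "(?D * gram8 + gram8 * ?D) *\<^sub>v vec8 x y z u v w r s =
          (?D * gram8) *\<^sub>v vec8 x y z u v w r s + (gram8 * ?D) *\<^sub>v vec8 x y z u v w r s"
        by (rule add_mult_distrib_mat_vec[of _ 8 8]) (use D in auto)
      moreover have "(?D * gram8) *\<^sub>v vec8 x y z u v w r s = ?D *\<^sub>v (gram8 *\<^sub>v vec8 x y z u v w r s)"
        by (rule assoc_mult_mat_vec[of _ 8 8 _ 8]) (use D in auto)
      moreover have "(gram8 * ?D) *\<^sub>v vec8 x y z u v w r s = gram8 *\<^sub>v (?D *\<^sub>v vec8 x y z u v w r s)"
        by (rule assoc_mult_mat_vec[of _ 8 8 _ 8]) (use D in auto)
      ultimately show ?thesis by simp
    qed
    also have "\<dots> = 0\<^sub>v 8"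
      unfolding gram8_vec8 diag8_vec8
      by (rule eq_vecI) (auto simp: vec8_def less_Suc_eq numeral_eq_Suc)
    finally show "(?D\<^sup>T * gram8 + gram8 * ?D) *\<^sub>v vec8 x y z u v w r s = 0\<^sub>m 8 8 *\<^sub>v vec8 x y z u v w r s"
      unfolding T by (auto intro!: eq_vecI)
  qed (use D in auto)
  thus ?thesis using D by (simp add: so8_def)
qed

lemma vec8_eq_iff:
  "vec8 a b c d e f g h = vec8 a' b' c' d' e' f' g' h' \<longleftrightarrow>
    a = a' \<and> b = b' \<and> c = c' \<and> d = d' \<and> e = e' \<and> f = f' \<and> g = g' \<and> h = (h' :: 'a)"
  by (auto simp: vec8_def vec_eq_iff less_Suc_eq numeral_eq_Suc all_conj_distrib)

lemma X_eq_one: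
  assumes "X t1 t2 t3 t4 t5 t6 = \<one>\<^bsub>U\<^esub>"
  shows "t1 = 0 \<and> t2 = 0 \<and> t3 = 0 \<and> t4 = 0 \<and> t5 = 0 \<and> t6 = 0"
proof -
  define w where "w = word6 t1 t2 t3 t4 t5 t6"
  have "conj_map (word_mat w) (word_inv w) = word_aut []"
    using assms unfolding x_elt_word w_def U_mult_one word_aut_Nil by (simp add: word_aut_def)
  hence fix_diag: "word_mat w * diag8 a b c * word_inv w = diag8 a b c" for a b c
    using diag8_so8[of a b c] by (simp add: word_aut_def conj_map_def fun_eq_iff diag8_carrier)
      (metis diag8_carrier left_mult_one_mat right_mult_one_mat)
  have iso: "word_inv w * word_mat w = 1\<^sub>m 8" using iso_pair_w[of w] by (simp add: iso_pair_def)
  \<comment> \<open>Since conjugation by the word fixes each diagonal element D, the matrix of the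
    word commutes with D; this can be tested on vectors and no longer mentions the inverse
    word.\<close>
  have comm: "word_act w (diag8 a b c *\<^sub>v v) = diag8 a b c *\<^sub>v word_act w v" if v: "v \<in> carrier_vec 8" for a b c v
  proof -
    let ?D = "diag8 a b c" and ?g = "word_mat w" and ?h = "word_inv w"
    have D: "?D \<in> carrier_mat 8 8" by (rule diag8_carrier)
    have "?g * ?D = ?g * ?D * (?h * ?g)" unfolding iso using D by simp
    also have "\<dots> = (?g * ?D * ?h) * ?g"
      by (rule assoc_mult_mat[symmetric, of _ 8 8 _ 8 _ 8]) (auto intro!: mult_carrier_mat[OF _ D])
    also have "\<dots> = ?D * ?g" unfolding fix_diag ..
    finally have "(?g * ?D) *\<^sub>v v = (?D * ?g) *\<^sub>v v" by simp
    hence "?g *\<^sub>v (?D *\<^sub>v v) = ?D *\<^sub>v (?g *\<^sub>v v)"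
      using D v by (simp add: assoc_mult_mat_vec[of _ 8 8 _ 8])
    thus ?thesis using D v by (simp add: word_act)
  qed
  note simps = w_def word6_def word_act.simps root_mat_vec8 diag8_vec8
  \<comment> \<open>Each choice pairs a basis vector with a D that has different eigenvalues on this
    vector and on the basis vector whose entry carries the next parameter. Commutation then forces
    that entry, hence the parameter, to be 0; zeros found earlier clear the other terms.\<close>
  have "word_act w (diag8 1 0 0 *\<^sub>v vec8 0 1 0 0 0 0 0 0) = diag8 1 0 0 *\<^sub>v word_act w (vec8 0 1 0 0 0 0 0 0)"
    by (rule comm) simp
  hence t1: "t1 = 0" by (simp only: simps vec8_eq_iff) simp
  have "word_act w (diag8 0 0 1 *\<^sub>v vec8 0 0 1 0 0 0 0 0) = diag8 0 0 1 *\<^sub>v word_act w (vec8 0 0 1 0 0 0 0 0)"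
    by (rule comm) simp
  hence t23: "t2 = 0" "t3 = 0" by (simp_all only: simps vec8_eq_iff t1) simp_all
  have "word_act w (diag8 1 0 0 *\<^sub>v vec8 0 0 0 1 0 0 0 0) = diag8 1 0 0 *\<^sub>v word_act w (vec8 0 0 0 1 0 0 0 0)"
    by (rule comm) simp
  hence t4: "t4 = 0" by (simp only: simps vec8_eq_iff t1 t23) simp
  have "word_act w (diag8 0 0 1 *\<^sub>v vec8 0 0 0 0 0 1 0 0) = diag8 0 0 1 *\<^sub>v word_act w (vec8 0 0 0 0 0 1 0 0)"
    by (rule comm) simp
  hence t5: "t5 = 0" by (simp only: simps vec8_eq_iff t1 t23 t4) simp
  have "word_act w (diag8 0 1 0 *\<^sub>v vec8 0 0 0 0 0 0 1 0) = diag8 0 1 0 *\<^sub>v word_act w (vec8 0 0 0 0 0 0 1 0)"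
    by (rule comm) simp
  hence "t6 = 0" by (simp only: simps vec8_eq_iff t1 t23 t4 t5) simp
  with t1 t23 t4 t5 show ?thesis by simp
qed

text \<open>Injectivity from the trivial kernel: u is solved coordinate by coordinate so that X t
  times X u is X s, and equality of the two elements forces u to vanish.\<close>

lemma X_eq_iff [simp]:
  assumes t: "t2 \<in> F" "t5 \<in> F" "t6 \<in> F" and s: "s2 \<in> F" "s5 \<in> F" "s6 \<in> F"
  shows "X t1 t2 t3 t4 t5 t6 = X s1 s2 s3 s4 s5 s6 \<longleftrightarrow>
    t1 = s1 \<and> t2 = s2 \<and> t3 = s3 \<and> t4 = s4 \<and> t5 = s5 \<and> t6 = s6"
proof
  assume eq: "X t1 t2 t3 t4 t5 t6 = X s1 s2 s3 s4 s5 s6"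
  define u1 u2 u3 where "u1 = s1 - t1" and "u2 = s2 - t2" and "u3 = s3 - (t3 - u2 * t1)"
  define u4 u5 u6 where "u4 = s4 - c4 t1 t3 t4 u1 u2" and "u5 = s5 - c5 t1 t3 t4 t5 u1 u2"
    and "u6 = s6 - c6 t1 t3 t4 t5 t6 u1 u2 u3"
  have u: "u2 \<in> F" "u5 \<in> F" "u6 \<in> F" using t s unfolding u2_def u5_def u6_def by auto
  have "X t1 t2 t3 t4 t5 t6 \<otimes>\<^bsub>U\<^esub> X u1 u2 u3 u4 u5 u6 = X s1 s2 s3 s4 s5 s6"
    unfolding x_elt_mult[OF t u] by (simp add: u1_def u2_def u3_def u4_def u5_def u6_def)
  also have "\<dots> = X t1 t2 t3 t4 t5 t6 \<otimes>\<^bsub>U\<^esub> \<one>\<^bsub>U\<^esub>" using t by (simp only: eq[symmetric] U.r_one X_in_U)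
  finally have "X u1 u2 u3 u4 u5 u6 = \<one>\<^bsub>U\<^esub>" using t u by simp
  hence z: "u1 = 0" "u2 = 0" "u3 = 0" "u4 = 0" "u5 = 0" "u6 = 0" using X_eq_one by blast+
  have "X t1 t2 t3 t4 t5 t6 = X t1 t2 t3 t4 t5 t6 \<otimes>\<^bsub>U\<^esub> X 0 0 0 0 0 0" using t by (simp add: X_0)
  thus "t1 = s1 \<and> t2 = s2 \<and> t3 = s3 \<and> t4 = s4 \<and> t5 = s5 \<and> t6 = s6"
    using z by (simp add: u1_def u2_def u3_def u4_def u5_def u6_def c4_def c5_def c6_def)
qed simp

end

section \<open>Conjugacy classes\<close>

locale triality = triality_field p k q fr for p k q :: nat and fr :: "'a :: finite_field \<Rightarrow> 'a" +
  fixes \<eta> :: 'a and \<theta> :: "'a \<Rightarrow> complex" and T :: "'a \<Rightarrow> 'a set"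
  assumes eta: "\<eta> \<notin> F" "Tr \<eta> = 1"
    and theta: "nontrivial_additive_char q \<theta>"
    and transv: "\<And>a. a \<noteq> 0 \<Longrightarrow> line_transversal q a (T a)"
begin

section \<open>The trace form and the Frobenius map\<close>

lemma q_gt_1: "q > 1"
proof -
  have "card {0, 1 :: 'a} \<le> card (UNIV :: 'a set)" by (intro card_mono) auto
  hence "2 \<le> q ^ 3" using card_UNIV by simp
  thus ?thesis by (cases "q = 0 \<or> q = 1") auto
qed

text \<open>The elements of F are roots of t^q - t, and those of trace 0 are roots of a polynomial
  of degree q^2, so there are at most q and at most q^2 of them. As \<eta> has trace 1, every t is
  \<eta> Tr t plus an element of trace 0. So q^3 is at most |F| q^2, which leaves only |F| =
  q.\<close>

lemma card_F: "card F = q"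
proof -
  let ?P = "monom 1 q - monom 1 1 :: 'a poly"
  let ?Q = "monom 1 (q ^ 2) + (monom 1 q + monom 1 1) :: 'a poly"
  let ?K = "{t :: 'a. Tr t = 0}"
  have q2: "q < q ^ 2" using q_gt_1 by (simp add: power2_eq_square)
  have P0: "?P \<noteq> 0" and Q0: "?Q \<noteq> 0"
  proof -
    have "coeff ?P q = 1" "coeff ?Q (q ^ 2) = 1" using q_gt_1 q2 by auto
    thus "?P \<noteq> 0" "?Q \<noteq> 0" by (metis coeff_0 zero_neq_one)+
  qed
  have "degree ?P \<le> q" using q_gt_1 by (intro degree_diff_le) (auto simp: degree_monom_eq)
  moreover have "F = {t. poly ?P t = 0}" by (auto simp: Fq_def poly_monom)
  ultimately have F_le: "card F \<le> q" using poly_roots_degree[OF P0] by simp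
  have "degree ?Q \<le> q ^ 2" using q_gt_1 q2
    by (intro degree_add_le) (auto simp: degree_monom_eq)
  moreover have "?K = {t. poly ?Q t = 0}"
    by (auto simp: Tr_def poly_monom power_q ac_simps)
  ultimately have K_le: "card ?K \<le> q ^ 2" using poly_roots_degree[OF Q0] by simp
  have "UNIV \<subseteq> (\<lambda>(s, t). \<eta> * s + t) ` (F \<times> ?K)"
  proof
    fix t :: 'a
    have "Tr (\<eta> * Tr t) = Tr t" using Tr_scale[of "Tr t" \<eta>] eta by (simp add: mult.commute)
    hence "(Tr t, t - \<eta> * Tr t) \<in> F \<times> ?K" by simp
    thus "t \<in> (\<lambda>(s, t). \<eta> * s + t) ` (F \<times> ?K)" by (rule rev_image_eqI) simp
  qed
  hence "card (UNIV :: 'a set) \<le> card ((\<lambda>(s, t). \<eta> * s + t) ` (F \<times> ?K))" by (intro card_mono) auto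
  also have "\<dots> \<le> card (F \<times> ?K)" by (rule card_image_le) simp
  also have "\<dots> = card F * card ?K" by (rule card_cartesian_product)
  also have "\<dots> \<le> card F * q ^ 2" using K_le by simp
  finally have "q * q ^ 2 \<le> card F * q ^ 2" unfolding card_UNIV by (simp add: power3_eq_cube power2_eq_square)
  hence "q \<le> card F" using q_gt_1 by simp
  with F_le show ?thesis by simp
qed

lemma ex_Tr:
  assumes "a \<noteq> 0" "s \<in> F" shows "\<exists>r. Tr (a * r) = s"
proof
  show "Tr (a * (s * \<eta> / a)) = s" using assms Tr_scale[of s \<eta>] eta by simp
qed

lemma ex_Tr_fr:
  assumes "a \<noteq> 0" "s \<in> F" shows "\<exists>r. Tr (a * fr r) = s"
proof -
  obtain r where "Tr (a * r) = s" using ex_Tr[OF assms] ..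
  thus ?thesis by (intro exI[of _ "fr (fr r)"]) simp
qed

lemma Tr_nondegenerate:
  assumes "\<And>r. Tr (a * r) = 0" shows "a = 0"
proof (rule ccontr)
  assume "a \<noteq> 0"
  then obtain r where "Tr (a * r) = 1" using ex_Tr[of a 1] by auto
  thus False using assms by simp
qed

text \<open>For b outside the line a F the functionals Tr (a r) and Tr (b r) are independent over F.
  If the second vanished on the kernel of the first, it would be the multiple of the first by c = Tr
  (b r0), and nondegeneracy would give b = a c.\<close>

lemma ex_Tr_pair:
  assumes a: "a \<noteq> 0" and b: "\<And>c. c \<in> F \<Longrightarrow> b \<noteq> a * c" and s: "s \<in> F" "s' \<in> F"
  shows "\<exists>r. Tr (a * r) = s \<and> Tr (b * r) = s'"
proof -
  obtain r0 where r0: "Tr (a * r0) = 1" using ex_Tr[OF a, of 1] by auto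
  define c where "c = Tr (b * r0)"
  have c: "c \<in> F" by (simp add: c_def)
  have "\<exists>z. Tr (a * z) = 0 \<and> Tr (b * z) \<noteq> 0"
  proof (rule ccontr)
    assume "\<not> ?thesis"
    hence *: "Tr (b * z) = 0" if "Tr (a * z) = 0" for z using that by blast
    have "Tr ((b - a * c) * r) = 0" for r
    proof -
      define m where "m = Tr (a * r)"
      have m: "m \<in> F" by (simp add: m_def)
      have "Tr (a * (r - m * r0)) = m - Tr (m * (a * r0))" by (simp add: m_def algebra_simps)
      also have "\<dots> = 0" unfolding Tr_scale[OF m] r0 by simp
      finally have "Tr (b * (r - m * r0)) = 0" by (rule *)
      hence "Tr (b * r) = Tr (m * (b * r0))" by (simp add: algebra_simps)
      also have "\<dots> = m * c" unfolding Tr_scale[OF m] c_def ..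
      also have "\<dots> = Tr (c * (a * r))" unfolding Tr_scale[OF c] m_def by simp
      finally show ?thesis by (simp add: algebra_simps)
    qed
    hence "b - a * c = 0" by (rule Tr_nondegenerate)
    thus False using b[OF c] by simp
  qed
  then obtain z where z: "Tr (a * z) = 0" "Tr (b * z) \<noteq> 0" by blast
  \<comment> \<open>The summand \<open>s * r0\<close> settles the first equation; z lies in the
    kernel of the first functional and is scaled to correct the second.\<close>
  define l where "l = (s' - s * c) / Tr (b * z)"
  have l: "l \<in> F" using s c by (auto simp: l_def)
  have "Tr (a * (s * r0 + l * z)) = Tr (s * (a * r0)) + Tr (l * (a * z))" by (simp add: algebra_simps)
  also have "\<dots> = s" using s l z r0 by (simp add: Tr_scale)
  finally have 1: "Tr (a * (s * r0 + l * z)) = s" .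
  have "Tr (b * (s * r0 + l * z)) = Tr (s * (b * r0)) + Tr (l * (b * z))" by (simp add: algebra_simps)
  also have "\<dots> = s'" using s l z by (simp add: Tr_scale c_def[symmetric]) (simp add: l_def)
  finally show ?thesis using 1 by blast
qed

text \<open>Three applications of Frobenius give w = - w, and 2 is invertible.\<close>

lemma fr_eq_minus: "fr w = - w \<Longrightarrow> w = 0"
proof -
  assume "fr w = - w"
  hence "w = - w" using fr_fr_fr[of w] by simp
  hence "2 * w = 0" by (metis add.right_inverse mult_2)
  thus "w = 0" using two_neq_0 by simp
qed

text \<open>With u = r / t the map becomes t t^q (u^q + u), so \<open>fr_eq_minus\<close> makes its
  kernel trivial. An injective additive map of a finite field is bijective.\<close>

lemma ex_unique_commutator:
  assumes "t \<noteq> 0" shows "\<exists>!r. t * fr r + fr t * r = b"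
proof -
  let ?f = "\<lambda>r. t * fr r + fr t * r"
  have inj: "inj ?f"
  proof (rule injI)
    fix x y assume "?f x = ?f y"
    hence *: "?f (x - y) = 0" by (simp add: algebra_simps)
    have "fr ((x - y) / t) = - ((x - y) / t)"
      using assms * by (simp add: field_simps add_eq_0_iff)
    hence "(x - y) / t = 0" by (rule fr_eq_minus)
    thus "x = y" using assms by simp
  qed
  hence "surj ?f" by (simp add: finite_UNIV_inj_surj)
  with inj have "bij ?f" by (simp add: bij_def)
  thus ?thesis unfolding bij_iff by blast
qed

text \<open>The r for which the commutator of x1(t) and x3(r) has fourth coordinate b.\<close>

definition half_comm :: "'a \<Rightarrow> 'a \<Rightarrow> 'a" where
  "half_comm t b = (THE r. t * fr r + fr t * r = b)"

lemma half_comm_iff: "t \<noteq> 0 \<Longrightarrow> t * fr r + fr t * r = b \<longleftrightarrow> r = half_comm t b"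
  using theI'[OF ex_unique_commutator[of t b]] ex_unique_commutator[of t b]
  unfolding half_comm_def by blast

section \<open>Conjugacy equations in coordinates\<close>

lemma c4_0 [simp]: "c4 t1 t3 t4 0 0 = t4" "c4 0 0 t4 s1 s2 = t4"
  and c5_0 [simp]: "c5 t1 t3 t4 t5 0 0 = t5" "c5 0 0 t4 t5 s1 s2 = t5 - Tr (s1 * fr t4)"
  and c6_0 [simp]: "c6 t1 t3 t4 t5 t6 0 0 s3 = t6 - Tr (s3 * fr t4)"
    "c6 0 0 t4 t5 t6 s1 s2 s3 = t6 - s2 * t5 - Tr (s3 * fr t4)"
  by (simp_all add: c4_def c5_def c6_def)

text \<open>The equation v x = y v, read in each coordinate, with r1, ..., r6 the coordinates of v.
  The first two coordinates are class invariants, and r6 cancels because X6 is central.\<close>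

lemma conj_X_iff:
  assumes t: "t2 \<in> F" "t5 \<in> F" "t6 \<in> F" and s: "s2 \<in> F" "s5 \<in> F" "s6 \<in> F"
  shows "X s1 s2 s3 s4 s5 s6 \<in> conj_class U (X t1 t2 t3 t4 t5 t6) \<longleftrightarrow>
    s1 = t1 \<and> s2 = t2 \<and> (\<exists>r1 r2 r3 r4 r5. r2 \<in> F \<and> r5 \<in> F \<and> s3 = t3 - t2 * r1 + r2 * t1 \<and>
      s4 + (c4 t1 s3 0 r1 r2 + r4) = c4 r1 r3 r4 t1 t2 + t4 \<and>
      s5 + (c5 t1 s3 s4 0 r1 r2 + r5) = c5 r1 r3 r4 r5 t1 t2 + t5 \<and>
      s6 + c6 t1 s3 s4 s5 0 r1 r2 r3 = c6 r1 r3 r4 r5 0 t1 t2 t3 + t6)"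
    (is "?L \<longleftrightarrow> s1 = t1 \<and> s2 = t2 \<and> ?R")
proof -
  have c4': "c4 t1 s3 s4 r1 r2 = s4 + c4 t1 s3 0 r1 r2" for r1 r2 by (simp add: c4_def Let_def)
  have c5': "c5 t1 s3 s4 s5 r1 r2 = s5 + c5 t1 s3 s4 0 r1 r2" for r1 r2 by (simp add: c5_def Let_def)
  have c6': "c6 a b c d e f g h = e + c6 a b c d 0 f g h" for a b c d e f g h by (simp add: c6_def Let_def)
  have eqs: "X r1 r2 r3 r4 r5 r6 \<otimes>\<^bsub>U\<^esub> X t1 t2 t3 t4 t5 t6 = X s1 s2 s3 s4 s5 s6 \<otimes>\<^bsub>U\<^esub> X r1 r2 r3 r4 r5 r6 \<longleftrightarrow>
      s1 = t1 \<and> s2 = t2 \<and> s3 = t3 - t2 * r1 + r2 * t1 \<and>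
      s4 + (c4 t1 s3 0 r1 r2 + r4) = c4 r1 r3 r4 t1 t2 + t4 \<and>
      s5 + (c5 t1 s3 s4 0 r1 r2 + r5) = c5 r1 r3 r4 r5 t1 t2 + t5 \<and>
      s6 + c6 t1 s3 s4 s5 0 r1 r2 r3 = c6 r1 r3 r4 r5 0 t1 t2 t3 + t6"
    if r: "r2 \<in> F" "r5 \<in> F" "r6 \<in> F" for r1 r2 r3 r4 r5 r6
  proof (cases "s1 = t1 \<and> s2 = t2")
    case True
    have "X r1 r2 r3 r4 r5 r6 \<otimes>\<^bsub>U\<^esub> X t1 t2 t3 t4 t5 t6 = X s1 s2 s3 s4 s5 s6 \<otimes>\<^bsub>U\<^esub> X r1 r2 r3 r4 r5 r6 \<longleftrightarrow>
      r3 - t2 * r1 + t3 = s3 - r2 * t1 + r3 \<and> c4 r1 r3 r4 t1 t2 + t4 = c4 t1 s3 s4 r1 r2 + r4 \<and>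
      c5 r1 r3 r4 r5 t1 t2 + t5 = c5 t1 s3 s4 s5 r1 r2 + r5 \<and>
      c6 r1 r3 r4 r5 r6 t1 t2 t3 + t6 = c6 t1 s3 s4 s5 s6 r1 r2 r3 + r6"
      using r t s True by (simp add: x_elt_mult add.commute)
    moreover have "r3 - t2 * r1 + t3 = s3 - r2 * t1 + r3 \<longleftrightarrow> s3 = t3 - t2 * r1 + r2 * t1"
      by (auto simp: algebra_simps)
    moreover have "c4 r1 r3 r4 t1 t2 + t4 = c4 t1 s3 s4 r1 r2 + r4 \<longleftrightarrow>
        s4 + (c4 t1 s3 0 r1 r2 + r4) = c4 r1 r3 r4 t1 t2 + t4"
      unfolding c4' by (auto simp: algebra_simps)
    moreover have "c5 r1 r3 r4 r5 t1 t2 + t5 = c5 t1 s3 s4 s5 r1 r2 + r5 \<longleftrightarrow>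
        s5 + (c5 t1 s3 s4 0 r1 r2 + r5) = c5 r1 r3 r4 r5 t1 t2 + t5"
      unfolding c5' by (auto simp: algebra_simps)
    moreover have "c6 r1 r3 r4 r5 r6 t1 t2 t3 + t6 = c6 t1 s3 s4 s5 s6 r1 r2 r3 + r6 \<longleftrightarrow>
        s6 + c6 t1 s3 s4 s5 0 r1 r2 r3 = c6 r1 r3 r4 r5 0 t1 t2 t3 + t6"
      unfolding c6'[of r1 r3 r4 r5 r6] c6'[of t1 s3 s4 s5 s6] by (auto simp: algebra_simps)
    ultimately show ?thesis using True by simp
  next
    case False
    thus ?thesis using r t s by (auto simp: x_elt_mult add.commute)
  qed
  show ?thesis
  proof
    assume ?L
    then obtain v where v: "v \<in> carrier U" "v \<otimes>\<^bsub>U\<^esub> X t1 t2 t3 t4 t5 t6 = X s1 s2 s3 s4 s5 s6 \<otimes>\<^bsub>U\<^esub> v"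
      using t by (auto simp: U.conj_class_iff)
    obtain r1 r2 r3 r4 r5 r6 where r: "r2 \<in> F" "r5 \<in> F" "r6 \<in> F" "v = X r1 r2 r3 r4 r5 r6"
      using U_cases[OF v(1)] by metis
    show "s1 = t1 \<and> s2 = t2 \<and> ?R" using v(2) r(1,2) unfolding r(4) eqs[OF r(1-3)] by blast
  next
    assume *: "s1 = t1 \<and> s2 = t2 \<and> ?R"
    then obtain r1 r2 r3 r4 r5 where r: "r2 \<in> F" "r5 \<in> F" and e: "s3 = t3 - t2 * r1 + r2 * t1"
      "s4 + (c4 t1 s3 0 r1 r2 + r4) = c4 r1 r3 r4 t1 t2 + t4"
      "s5 + (c5 t1 s3 s4 0 r1 r2 + r5) = c5 r1 r3 r4 r5 t1 t2 + t5"
      "s6 + c6 t1 s3 s4 s5 0 r1 r2 r3 = c6 r1 r3 r4 r5 0 t1 t2 t3 + t6"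
      by (elim conjE exE)
    have "X r1 r2 r3 r4 r5 0 \<otimes>\<^bsub>U\<^esub> X t1 t2 t3 t4 t5 t6 = X s1 s2 s3 s4 s5 s6 \<otimes>\<^bsub>U\<^esub> X r1 r2 r3 r4 r5 0"
      unfolding eqs[OF r F_closed(1)] using * by (intro conjI e) simp_all
    moreover have "X r1 r2 r3 r4 r5 0 \<in> carrier U" "X s1 s2 s3 s4 s5 s6 \<in> carrier U" using r s by auto
    ultimately show ?L using t by (auto simp: U.conj_class_iff)
  qed
qed

text \<open>Special cases of the corrections with one of t1, s1, s2 equal to 0; they cover most
  sides of the conjugacy equations.\<close>

lemma c_t1_0: "c4 0 t3 t4 s1 s2 = t4 - s1 * fr t3 - fr s1 * t3"
  "c5 0 t3 t4 t5 s1 s2 = t5 + Tr (s1 * fr s1 * fr (fr t3)) - Tr (s1 * fr t4)"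
  "c6 0 t3 t4 t5 t6 s1 s2 s3 =
     t6 - s2 * t5 + Tr (s1 * fr t3 * fr (fr t3)) - Tr (s3 * fr (t4 - s1 * fr t3 - fr s1 * t3))"
  by (simp_all add: c4_def c5_def c6_def)

lemma c_s1_0: "c4 t1 t3 t4 0 s2 = t4 + s2 * t1 * fr t1"
  "c5 t1 t3 t4 t5 0 s2 = t5 - s2 * Nm t1"
  "c6 t1 t3 t4 t5 t6 0 s2 s3 = t6 - s2 * t5 + 2 * s2\<^sup>2 * Nm t1
     - s2 * Tr (t3 * fr t1 * fr (fr t1)) - Tr (s3 * fr (t4 + s2 * t1 * fr t1))"
  by (simp_all add: c4_def c5_def c6_def)

lemma c_s2_0: "c4 t1 t3 t4 s1 0 = t4 - s1 * fr t3 - fr s1 * t3"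
  "c5 t1 t3 t4 t5 s1 0 = t5 + Tr (s1 * fr s1 * fr (fr t3)) - Tr (s1 * fr t4)"
  "c6 t1 t3 t4 t5 t6 s1 0 s3 =
     t6 + Tr (s1 * fr t3 * fr (fr t3)) - Tr (s3 * fr (t4 - s1 * fr t3 - fr s1 * t3))"
  by (simp_all add: c4_def c5_def c6_def)

text \<open>For t3 = s2 t1 the intermediate value a of the multiplication law is 0, so s1 drops
  out.\<close>

lemma c_line: "c4 t1 (s2 * t1) t4 s1 s2 = c4 t1 0 t4 0 s2"
  "c6 t1 (s2 * t1) t4 t5 t6 s1 s2 s3 = c6 t1 (s2 * t1) t4 t5 t6 0 s2 s3"
  by (simp_all add: c4_def c6_def)

lemma half_comm_0 [simp]: "t \<noteq> 0 \<Longrightarrow> half_comm t 0 = 0"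
  using half_comm_iff[of t 0 0] by simp

lemma half_comm_eq: "t \<noteq> 0 \<Longrightarrow> t * fr (half_comm t b) + fr t * half_comm t b = b"
  using half_comm_iff by blast

lemma conj_X_I:
  assumes "t2 \<in> F" "t5 \<in> F" "t6 \<in> F" "s2 \<in> F" "s5 \<in> F" "s6 \<in> F" "b \<in> F" "e \<in> F"
    "s1 = t1" "s2 = t2" "s3 = t3 - t2 * a + b * t1"
    "s4 + (c4 t1 s3 0 a b + d) = c4 a c d t1 t2 + t4"
    "s5 + (c5 t1 s3 s4 0 a b + e) = c5 a c d e t1 t2 + t5"
    "s6 + c6 t1 s3 s4 s5 0 a b c = c6 a c d e 0 t1 t2 t3 + t6"
  shows "X s1 s2 s3 s4 s5 s6 \<in> conj_class U (X t1 t2 t3 t4 t5 t6)"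
  using assms unfolding conj_X_iff[OF assms(1-6)] by blast

lemma class_X6:
  assumes "t6 \<in> F" "s2 \<in> F" "s5 \<in> F" "s6 \<in> F"
  shows "X s1 s2 s3 s4 s5 s6 \<in> conj_class U (X 0 0 0 0 0 t6) \<longleftrightarrow>
    s1 = 0 \<and> s2 = 0 \<and> s3 = 0 \<and> s4 = 0 \<and> s5 = 0 \<and> s6 = t6" (is "?L \<longleftrightarrow> ?R")
proof
  assume ?L
  thus ?R using assms by (auto simp: conj_X_iff)
next
  assume ?R
  thus ?L using assms
    by (intro conj_X_I[where a = 0 and b = 0 and c = 0 and d = 0 and e = 0]) simp_all
qed

lemma class_X5:
  assumes "t5 \<in> F" "t5 \<noteq> 0" "s2 \<in> F" "s5 \<in> F" "s6 \<in> F"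
  shows "X s1 s2 s3 s4 s5 s6 \<in> conj_class U (X 0 0 0 0 t5 0) \<longleftrightarrow>
    s1 = 0 \<and> s2 = 0 \<and> s3 = 0 \<and> s4 = 0 \<and> s5 = t5" (is "?L \<longleftrightarrow> ?R")
proof
  assume ?L
  thus ?R using assms by (auto simp: conj_X_iff)
next
  assume ?R
  \<comment> \<open>A factor x2(b) changes the sixth coordinate by b t5, whence the witness s6 /
    t5.\<close>
  thus ?L using assms
    by (intro conj_X_I[where a = 0 and b = "s6 / t5" and c = 0 and d = 0 and e = 0])
      (simp_all add: c_s1_0)
qed

lemma class_X4:
  assumes "t4 \<noteq> 0" "s2 \<in> F" "s5 \<in> F" "s6 \<in> F"
  shows "X s1 s2 s3 s4 s5 s6 \<in> conj_class U (X 0 0 0 t4 0 0) \<longleftrightarrow>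
    s1 = 0 \<and> s2 = 0 \<and> s3 = 0 \<and> s4 = t4" (is "?L \<longleftrightarrow> ?R")
proof
  assume ?L
  thus ?R using assms by (auto simp: conj_X_iff)
next
  assume R: ?R
  \<comment> \<open>r1 reaches the fifth coordinate and r3 the sixth, each through a trace form that
    takes every value in F.\<close>
  have "fr t4 \<noteq> 0" using assms by simp
  then obtain r1 r3 where "Tr (fr t4 * r1) = s5" "Tr (fr t4 * r3) = s6" using ex_Tr assms by meson
  hence "Tr (r1 * fr t4) = s5" "Tr (r3 * fr t4) = s6" by (simp_all add: mult.commute)
  thus ?L using assms R
    by (intro conj_X_I[where a = r1 and b = 0 and c = r3 and d = 0 and e = 0]) simp_all
qed

text \<open>The functions \<open>hat5\<close>, \<open>hat4'\<close>, \<open>hat5'\<close>, \<open>hat6\<close> give the dependent parameters of the classes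
  5, 6 and 7 of (A), relative to those of the representative.\<close>

definition hat5 :: "'a \<Rightarrow> 'a \<Rightarrow> 'a" where
  "hat5 t3 s4 = (let r = half_comm t3 s4 in Tr (r * fr s4) - Tr (r * fr r * fr (fr t3)))"

lemma hat5_in_F [simp, intro]: "hat5 t3 s4 \<in> F" by (simp add: hat5_def Let_def)

text \<open>The fourth coordinate determines r1 through \<open>half_comm\<close>, and this forces
  the fifth. The parameter r4 is still free and reaches every sixth coordinate through Tr (t3
  r4^q).\<close>

lemma class_X3:
  assumes t: "t3 \<noteq> 0" "t5 \<in> F" and s: "s2 \<in> F" "s5 \<in> F" "s6 \<in> F"
  shows "X s1 s2 s3 s4 s5 s6 \<in> conj_class U (X 0 0 t3 0 t5 0) \<longleftrightarrow>
    s1 = 0 \<and> s2 = 0 \<and> s3 = t3 \<and> s5 = t5 + hat5 t3 s4" (is "?L \<longleftrightarrow> ?R")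
proof
  assume ?L
  then obtain r1 r2 where 1: "s1 = 0" "s2 = 0" "s3 = t3"
    and 4: "s4 + c4 0 t3 0 r1 r2 = 0" and 5: "s5 + c5 0 t3 s4 0 r1 r2 = t5"
    using t s by (auto simp: conj_X_iff)
  have "t3 * fr r1 + fr t3 * r1 = s4" using 4 by (simp add: c_t1_0 algebra_simps)
  hence "r1 = half_comm t3 s4" using half_comm_iff t(1) by simp
  hence "s5 = t5 + hat5 t3 s4" using 5 by (simp add: c_t1_0 hat5_def Let_def algebra_simps)
  with 1 show ?R by simp
next
  assume R: ?R
  define r1 where "r1 = half_comm t3 s4"
  have 4: "s4 + (c4 0 t3 0 r1 0 + r4) = r4" for r4
    using half_comm_eq[OF t(1), of s4] by (simp add: c_t1_0 r1_def algebra_simps)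
  have 5: "s5 + (c5 0 t3 s4 0 r1 0 + 0) = 0 + t5"
    using R by (simp add: c_t1_0 hat5_def Let_def r1_def)
  obtain r4 where "Tr (t3 * fr r4) = - (s6 + c6 0 t3 s4 s5 0 r1 0 0)"
    using ex_Tr_fr[OF t(1), of "- (s6 + c6 0 t3 s4 s5 0 r1 0 0)"] s by auto
  hence 6: "s6 + c6 0 t3 s4 s5 0 r1 0 0 = - Tr (t3 * fr r4)" by simp
  show ?L
    using R 4[of r4] 5 6 s t
    by (intro conj_X_I[where a = r1 and b = 0 and c = 0 and d = r4 and e = 0]) simp_all
qed

definition hat4' :: "'a \<Rightarrow> 'a \<Rightarrow> 'a" where
  "hat4' t2 s3 = (let r = - s3 / t2 in t2 * r * fr r + r * fr s3 + fr r * s3)"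
definition hat5' :: "'a \<Rightarrow> 'a \<Rightarrow> 'a \<Rightarrow> 'a" where
  "hat5' t2 s3 s4 = (let r = - s3 / t2 in Tr (r * fr s4) - Tr (r * fr r * fr (fr s3)) - t2 * Nm r)"

lemma hat5'_in_F [simp, intro]: "t2 \<in> F \<Longrightarrow> hat5' t2 s3 s4 \<in> F" by (simp add: hat5'_def Let_def)

text \<open>Here s3 determines r1 = - s3 / t2, which forces the fourth and fifth coordinates, while
  r5 reaches every sixth coordinate through t2 r5.\<close>

lemma class_X2:
  assumes t: "t2 \<in> F" "t2 \<noteq> 0" "t5 \<in> F" and s: "s2 \<in> F" "s5 \<in> F" "s6 \<in> F"
  shows "X s1 s2 s3 s4 s5 s6 \<in> conj_class U (X 0 t2 0 t4 t5 0) \<longleftrightarrow>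
    s1 = 0 \<and> s2 = t2 \<and> s4 = t4 + hat4' t2 s3 \<and> s5 = t5 + hat5' t2 s3 s4" (is "?L \<longleftrightarrow> ?R")
proof
  assume ?L
  then obtain r1 r2 r3 r4 r5 where 1: "s1 = 0" "s2 = t2" and 3: "s3 = - (t2 * r1)"
    and 4: "s4 + (c4 0 s3 0 r1 r2 + r4) = c4 r1 r3 r4 0 t2 + t4"
    and 5: "s5 + (c5 0 s3 s4 0 r1 r2 + r5) = c5 r1 r3 r4 r5 0 t2 + t5"
    using t s by (auto simp: conj_X_iff)
  have r1: "r1 = - s3 / t2" using 3 t(2) by simp
  show ?R using 1 4 5 unfolding hat4'_def hat5'_def r1[symmetric] Let_def
    by (simp add: c_t1_0 c_s1_0 algebra_simps)
next
  assume R: ?R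
  define r1 where "r1 = - s3 / t2"
  have 3: "s3 = 0 - t2 * r1 + 0 * 0" using t(2) by (simp add: r1_def)
  have 4: "s4 + (c4 0 s3 0 r1 0 + 0) = c4 r1 0 0 0 t2 + t4"
    using R by (simp add: c_t1_0 c_s1_0 hat4'_def Let_def r1_def)
  have 5: "s5 + (c5 0 s3 s4 0 r1 0 + r5) = c5 r1 0 0 r5 0 t2 + t5" for r5
    using R by (simp add: c_t1_0 c_s1_0 hat5'_def Let_def r1_def)
  define r5 where "r5 = (2 * t2\<^sup>2 * Nm r1 - s6 - c6 0 s3 s4 s5 0 r1 0 0) / t2"
  have r5: "r5 \<in> F" unfolding r5_def using t s by (intro F_closed Nm_in_F c6_in_F)
  have 6: "s6 + c6 0 s3 s4 s5 0 r1 0 0 = c6 r1 0 0 r5 0 0 t2 0 + 0"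
    using t(2) by (simp add: c_s1_0(3)[of r1]) (simp add: r5_def)
  show ?L
    using R 3 4 5[of r5] 6 r5 s t
    by (intro conj_X_I[where a = r1 and b = 0 and c = 0 and d = 0 and e = r5]) simp_all
qed

definition hat6 :: "'a \<Rightarrow> 'a \<Rightarrow> 'a \<Rightarrow> 'a \<Rightarrow> 'a" where
  "hat6 t1 s2 s4 s5 = (let r = half_comm t1 (- (s4 + s2 * t1 * fr t1)) in
     Tr (t1 * fr r * fr (fr r)) - c6 t1 (s2 * t1) s4 s5 0 0 s2 r)"

lemma hat6_in_F [simp, intro]: "s2 \<in> F \<Longrightarrow> s5 \<in> F \<Longrightarrow> hat6 t1 s2 s4 s5 \<in> F"
  by (simp add: hat6_def Let_def)

text \<open>s3 fixes r2 and s4 fixes r3, while r1 drops out by \<open>c_line\<close>. The parameter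
  r4 reaches every fifth coordinate. As the representative has third coordinate 0, r4 does not enter
  the sixth coordinate, which is therefore forced.\<close>

lemma class_X1:
  assumes t: "t1 \<noteq> 0" "t6 \<in> F" and s: "s2 \<in> F" "s5 \<in> F" "s6 \<in> F"
  shows "X s1 s2 s3 s4 s5 s6 \<in> conj_class U (X t1 0 0 0 0 t6) \<longleftrightarrow>
    s1 = t1 \<and> s2 = 0 \<and> (\<exists>r2\<in>F. s3 = t1 * r2 \<and> s6 = t6 + hat6 t1 r2 s4 s5)" (is "?L \<longleftrightarrow> ?R")
proof
  assume ?L
  then obtain r1 r2 r3 r4 r5 where 1: "s1 = t1" "s2 = 0" and r2: "r2 \<in> F" and 3: "s3 = r2 * t1"
    and 4: "s4 + (c4 t1 s3 0 r1 r2 + r4) = c4 r1 r3 r4 t1 0"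
    and 6: "s6 + c6 t1 s3 s4 s5 0 r1 r2 r3 = c6 r1 r3 r4 r5 0 t1 0 0 + t6"
    using t s by (auto simp: conj_X_iff)
  have "t1 * fr r3 + fr t1 * r3 + (s4 + r2 * t1 * fr t1) = 0"
    using 4 unfolding 3 c_line(1) by (simp add: c_s1_0 c_s2_0 algebra_simps)
  hence "t1 * fr r3 + fr t1 * r3 = - (s4 + r2 * t1 * fr t1)"
    by (simp only: eq_neg_iff_add_eq_0)
  hence r3: "r3 = half_comm t1 (- (s4 + r2 * t1 * fr t1))" using half_comm_iff t(1) by simp
  have "s6 = t6 + hat6 t1 r2 s4 s5"
    using 6 unfolding 3 c_line(2)[of t1 r2 s4 s5 0 r1] hat6_def r3[symmetric] Let_def by (simp add: c_s2_0 algebra_simps)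
  with 1 r2 3 show ?R by (auto simp: mult.commute)
next
  assume R: ?R
  then obtain r2 where r2: "r2 \<in> F" "s3 = r2 * t1" and s6: "s6 = t6 + hat6 t1 r2 s4 s5"
    by (auto simp: mult.commute)
  define r3 where "r3 = half_comm t1 (- (s4 + r2 * t1 * fr t1))"
  have 4: "s4 + (c4 t1 s3 0 0 r2 + r4) = c4 0 r3 r4 t1 0 + 0" for r4
    using half_comm_eq[OF t(1), of "- (s4 + r2 * t1 * fr t1)"]
    by (simp add: c_s1_0 c_s2_0 r3_def algebra_simps)
  obtain r4 where r4: "Tr (t1 * fr r4) = Tr (t1 * fr t1 * fr (fr r3)) - (s5 + c5 t1 s3 s4 0 0 r2)"
    using ex_Tr_fr[OF t(1), of "Tr (t1 * fr t1 * fr (fr r3)) - (s5 + c5 t1 s3 s4 0 0 r2)"] s r2 by auto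
  have 5: "s5 + (c5 t1 s3 s4 0 0 r2 + 0) = c5 0 r3 r4 0 t1 0 + 0"
    using r4 by (simp add: c_s2_0)
  have 6: "s6 + c6 t1 s3 s4 s5 0 0 r2 r3 = c6 0 r3 r4 0 0 t1 0 0 + t6"
    using s6 unfolding r2(2) hat6_def r3_def[symmetric] Let_def by (simp add: c_s2_0)
  show ?L
    using R 4[of r4] 5 6 r2 s t
    by (intro conj_X_I[where a = 0 and b = r2 and c = r3 and d = r4 and e = 0]) simp_all
qed

text \<open>In contrast to \<open>class_X1\<close>, r4 enters the fifth coordinate through Tr (t1
  r4^q) and the sixth through Tr (t3 r4^q). Off the line t1 F these functionals are independent, so
  both coordinates become free.\<close>

lemma class_X13:
  assumes t: "t1 \<noteq> 0" "\<And>c. c \<in> F \<Longrightarrow> t3 \<noteq> t1 * c" and s: "s2 \<in> F" "s5 \<in> F" "s6 \<in> F"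
  shows "X s1 s2 s3 s4 s5 s6 \<in> conj_class U (X t1 0 t3 0 0 0) \<longleftrightarrow>
    s1 = t1 \<and> s2 = 0 \<and> (\<exists>r2\<in>F. s3 = t3 + t1 * r2)" (is "?L \<longleftrightarrow> ?R")
proof
  assume ?L
  thus ?R using t s by (auto simp: conj_X_iff mult.commute)
next
  assume R: ?R
  then obtain r2 where r2: "r2 \<in> F" "s3 = t3 + r2 * t1" by (auto simp: mult.commute)
  define r3 where "r3 = half_comm t1 (- (s4 + c4 t1 s3 0 0 r2))"
  have 4: "s4 + (c4 t1 s3 0 0 r2 + r4) = c4 0 r3 r4 t1 0 + 0" for r4
    using half_comm_eq[OF t(1), of "- (s4 + c4 t1 s3 0 0 r2)"]
    by (simp add: c_s2_0 r3_def algebra_simps)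
  obtain r where r: "Tr (t1 * r) = Tr (t1 * fr t1 * fr (fr r3)) - (s5 + c5 t1 s3 s4 0 0 r2)"
    "Tr (t3 * r) = Tr (t1 * fr r3 * fr (fr r3)) + Tr (t3 * fr (t1 * fr r3 + fr t1 * r3))
      - (s6 + c6 t1 s3 s4 s5 0 0 r2 r3)"
    using ex_Tr_pair[OF t, of "Tr (t1 * fr t1 * fr (fr r3)) - (s5 + c5 t1 s3 s4 0 0 r2)"
      "Tr (t1 * fr r3 * fr (fr r3)) + Tr (t3 * fr (t1 * fr r3 + fr t1 * r3))
      - (s6 + c6 t1 s3 s4 s5 0 0 r2 r3)"] s r2 by auto
  \<comment> \<open>Chosen so that \<open>fr r4 = r\<close>.\<close>
  define r4 where "r4 = fr (fr r)"
  have 5: "s5 + (c5 t1 s3 s4 0 0 r2 + 0) = c5 0 r3 r4 0 t1 0 + 0"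
    using r(1) by (simp add: c_s2_0 r4_def)
  have 6: "s6 + c6 t1 s3 s4 s5 0 0 r2 r3 = c6 0 r3 r4 0 0 t1 0 t3 + 0"
  proof -
    have "t3 * fr (r4 - t1 * fr r3 - fr t1 * r3) = t3 * r - t3 * fr (t1 * fr r3 + fr t1 * r3)"
      by (simp add: r4_def right_diff_distrib distrib_left)
    hence "Tr (t3 * fr (r4 - t1 * fr r3 - fr t1 * r3)) = Tr (t3 * r) - Tr (t3 * fr (t1 * fr r3 + fr t1 * r3))"
      by (simp only: Tr_diff)
    hence "c6 0 r3 r4 0 0 t1 0 t3 =
        Tr (t1 * fr r3 * fr (fr r3)) - (Tr (t3 * r) - Tr (t3 * fr (t1 * fr r3 + fr t1 * r3)))"
      unfolding c_s2_0(3) by simp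
    thus ?thesis unfolding r(2) by simp
  qed
  show ?L
    using R 4[of r4] 5 6 r2 s t
    by (intro conj_X_I[where a = 0 and b = r2 and c = r3 and d = r4 and e = 0]) simp_all
qed

text \<open>Only the first two coordinates are invariants: r1, r3, r4, r5 are chosen in this order
  to reach s3, s4, s5, s6, by division by t2, by \<open>half_comm\<close>, by the trace form and
  again by division by t2.\<close>

lemma class_X12:
  assumes t: "t1 \<noteq> 0" "t2 \<noteq> 0" "t2 \<in> F" and s: "s2 \<in> F" "s5 \<in> F" "s6 \<in> F"
  shows "X s1 s2 s3 s4 s5 s6 \<in> conj_class U (X t1 t2 0 0 0 0) \<longleftrightarrow> s1 = t1 \<and> s2 = t2" (is "?L \<longleftrightarrow> ?R")
proof
  assume ?L
  thus ?R using t s by (auto simp: conj_X_iff)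
next
  assume R: ?R
  define r1 where "r1 = - s3 / t2"
  have 3: "s3 = 0 - t2 * r1 + 0 * t1" using t by (simp add: r1_def)
  \<comment> \<open>On the side v x the parameter r3 enters the fourth coordinate only through the
    difference r3 - t2 r1; a is the value required of it.\<close>
  define a where "a = half_comm t1 (t2 * r1 * fr r1 - s4 - c4 t1 s3 0 r1 0)"
  define r3 where "r3 = a + t2 * r1"
  have 4: "s4 + (c4 t1 s3 0 r1 0 + r4) = c4 r1 r3 r4 t1 t2 + 0" for r4
  proof -
    have "t1 * fr a + fr t1 * a = t2 * r1 * fr r1 - s4 - c4 t1 s3 0 r1 0"
      unfolding a_def by (rule half_comm_eq[OF t(1)])
    thus ?thesis by (simp add: c4_def[of r1] r3_def Let_def algebra_simps)
  qed
  have c5: "c5 r1 r3 r4 0 t1 t2 = c5 r1 r3 0 0 t1 t2 - Tr (t1 * fr r4)" for r4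
    by (simp add: c5_def Let_def algebra_simps)
  obtain r4 where r4: "Tr (t1 * fr r4) = c5 r1 r3 0 0 t1 t2 - (s5 + c5 t1 s3 s4 0 r1 0)"
    using ex_Tr_fr[OF t(1), of "c5 r1 r3 0 0 t1 t2 - (s5 + c5 t1 s3 s4 0 r1 0)"] s t by auto
  have c5': "c5 r1 r3 r4 r5 t1 t2 = c5 r1 r3 r4 0 t1 t2 + r5" for r5 by (simp add: c5_def Let_def)
  have 5: "s5 + (c5 t1 s3 s4 0 r1 0 + r5) = c5 r1 r3 r4 r5 t1 t2 + 0" for r5
    unfolding c5'[of r5] c5[of r4] r4 by simp
  have c6: "c6 r1 r3 r4 r5 0 t1 t2 0 = c6 r1 r3 r4 0 0 t1 t2 0 - t2 * r5" for r5
    by (simp add: c6_def Let_def)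
  define r5 where "r5 = (c6 r1 r3 r4 0 0 t1 t2 0 - s6 - c6 t1 s3 s4 s5 0 r1 0 r3) / t2"
  have r5: "r5 \<in> F" unfolding r5_def using t s by (intro F_closed c6_in_F)
  have 6: "s6 + c6 t1 s3 s4 s5 0 r1 0 r3 = c6 r1 r3 r4 r5 0 t1 t2 0 + 0"
    unfolding c6[of r5] using t by (simp add: r5_def)
  show ?L
    using R 3 4[of r4] 5[of r5] 6 r5 s t
    by (intro conj_X_I[where a = r1 and b = 0 and c = r3 and d = r4 and e = r5]) simp_all
qed

section \<open>Transversals and the list of representatives\<close>

lemma T_0: "a \<noteq> 0 \<Longrightarrow> 0 \<in> T a"
  using transv by (simp add: line_transversal_def)

lemma T_ex: "a \<noteq> 0 \<Longrightarrow> \<exists>r\<in>T a. \<exists>c\<in>F. t = r + a * c"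
proof -
  assume "a \<noteq> 0"
  then obtain r where "r \<in> T a" "t - r \<in> {a * s | s. s \<in> F}"
    using transv unfolding line_transversal_def by blast
  thus ?thesis by (auto simp: diff_eq_eq add.commute)
qed

lemma T_unique:
  assumes "a \<noteq> 0" "r \<in> T a" "r' \<in> T a" "c \<in> F" "r = r' + a * c"
  shows "r = r'"
proof -
  have "\<exists>!s. s \<in> T a \<and> r - s \<in> {a * s | s. s \<in> F}"
    using transv[OF assms(1)] unfolding line_transversal_def by blast
  moreover have "r - r \<in> {a * s | s. s \<in> F}" by (auto intro!: exI[of _ 0])
  moreover have "r - r' \<in> {a * s | s. s \<in> F}" using assms(4,5) by auto
  ultimately show ?thesis using assms(2,3) by blast
qed

lemma T_not_line: "a \<noteq> 0 \<Longrightarrow> r \<in> T a \<Longrightarrow> r \<noteq> 0 \<Longrightarrow> c \<in> F \<Longrightarrow> r \<noteq> a * c"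
  using T_unique[OF _ _ T_0, of a r c] by auto

lemma finite_UNIV_F [simp]: "finite (A :: 'a set)" by (rule finite_subset[OF subset_UNIV]) simp

lemma conj_class_eqI:
  assumes t: "t2 \<in> F" "t5 \<in> F" "t6 \<in> F"
    and S: "S \<subseteq> carrier U" "\<And>s1 s2 s3 s4 s5 s6. s2 \<in> F \<Longrightarrow> s5 \<in> F \<Longrightarrow> s6 \<in> F \<Longrightarrow>
      X s1 s2 s3 s4 s5 s6 \<in> conj_class U (X t1 t2 t3 t4 t5 t6) \<longleftrightarrow> X s1 s2 s3 s4 s5 s6 \<in> S"
  shows "conj_class U (X t1 t2 t3 t4 t5 t6) = S"
proof (intro equalityI subsetI)
  fix y assume y: "y \<in> conj_class U (X t1 t2 t3 t4 t5 t6)"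
  hence "y \<in> carrier U" using t by (auto simp: U.conj_class_iff)
  then obtain s1 s2 s3 s4 s5 s6 where "s2 \<in> F" "s5 \<in> F" "s6 \<in> F" "y = X s1 s2 s3 s4 s5 s6"
    using U_cases by metis
  thus "y \<in> S" using y S(2) by simp
next
  fix y assume y: "y \<in> S"
  hence "y \<in> carrier U" using S(1) by auto
  then obtain s1 s2 s3 s4 s5 s6 where "s2 \<in> F" "s5 \<in> F" "s6 \<in> F" "y = X s1 s2 s3 s4 s5 s6"
    using U_cases by metis
  thus "y \<in> conj_class U (X t1 t2 t3 t4 t5 t6)" using y S(2) by simp
qed

lemma conj_class_one: "conj_class U \<one>\<^bsub>U\<^esub> = {\<one>\<^bsub>U\<^esub>}"
  by (auto simp: conj_class_def intro!: exI[of _ "\<one>\<^bsub>U\<^esub>"])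

lemma conj_class_x6: "t6 \<in> F \<Longrightarrow> conj_class U (X 0 0 0 0 0 t6) = {X 0 0 0 0 0 t6}"
  by (rule conj_class_eqI) (auto simp: class_X6)

lemma conj_class_x5:
  "t5 \<in> F \<Longrightarrow> t5 \<noteq> 0 \<Longrightarrow> conj_class U (X 0 0 0 0 t5 0) = (\<lambda>s6. X 0 0 0 0 t5 s6) ` F"
  by (rule conj_class_eqI) (auto simp: class_X5 image_iff)

lemma conj_class_x4:
  "t4 \<noteq> 0 \<Longrightarrow> conj_class U (X 0 0 0 t4 0 0) = (\<lambda>(s5, s6). X 0 0 0 t4 s5 s6) ` (F \<times> F)"
  by (rule conj_class_eqI) (auto simp: class_X4 image_iff)

lemma conj_class_x3:
  "t3 \<noteq> 0 \<Longrightarrow> t5 \<in> F \<Longrightarrow> conj_class U (X 0 0 t3 0 t5 0) =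
     (\<lambda>(s4, s6). X 0 0 t3 s4 (t5 + hat5 t3 s4) s6) ` (UNIV \<times> F)"
  by (rule conj_class_eqI) (auto simp: class_X3 image_iff)

lemma conj_class_x2:
  "t2 \<in> F \<Longrightarrow> t2 \<noteq> 0 \<Longrightarrow> t5 \<in> F \<Longrightarrow> conj_class U (X 0 t2 0 t4 t5 0) =
     (\<lambda>(s3, s6). X 0 t2 s3 (t4 + hat4' t2 s3) (t5 + hat5' t2 s3 (t4 + hat4' t2 s3)) s6) ` (UNIV \<times> F)"
  by (rule conj_class_eqI) (auto simp: class_X2 image_iff)

lemma conj_class_x1:
  "t1 \<noteq> 0 \<Longrightarrow> t6 \<in> F \<Longrightarrow> conj_class U (X t1 0 0 0 0 t6) =
     (\<lambda>(s2, s4, s5). X t1 0 (t1 * s2) s4 s5 (t6 + hat6 t1 s2 s4 s5)) ` (F \<times> UNIV \<times> F)"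
  by (rule conj_class_eqI) (auto simp: class_X1 image_iff)

lemma conj_class_x13:
  "t1 \<noteq> 0 \<Longrightarrow> t3 \<in> T t1 \<Longrightarrow> t3 \<noteq> 0 \<Longrightarrow> conj_class U (X t1 0 t3 0 0 0) =
     (\<lambda>(s2, s4, s5, s6). X t1 0 (t3 + t1 * s2) s4 s5 s6) ` (F \<times> UNIV \<times> F \<times> F)"
  by (rule conj_class_eqI) (auto simp: class_X13 T_not_line image_iff)

lemma conj_class_x12:
  "t1 \<noteq> 0 \<Longrightarrow> t2 \<in> F \<Longrightarrow> t2 \<noteq> 0 \<Longrightarrow> conj_class U (X t1 t2 0 0 0 0) =
     (\<lambda>(s3, s4, s5, s6). X t1 t2 s3 s4 s5 s6) ` (UNIV \<times> UNIV \<times> F \<times> F)"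
  by (rule conj_class_eqI) (auto simp: class_X12 image_iff)

lemma card_conj_classes:
  "t5 \<in> F \<Longrightarrow> t5 \<noteq> 0 \<Longrightarrow> card (conj_class U (X 0 0 0 0 t5 0)) = q"
  "t4 \<noteq> 0 \<Longrightarrow> card (conj_class U (X 0 0 0 t4 0 0)) = q ^ 2"
  "t3 \<noteq> 0 \<Longrightarrow> t5 \<in> F \<Longrightarrow> card (conj_class U (X 0 0 t3 0 t5 0)) = q ^ 4"
  "t2 \<in> F \<Longrightarrow> t2 \<noteq> 0 \<Longrightarrow> t5 \<in> F \<Longrightarrow> card (conj_class U (X 0 t2 0 t4 t5 0)) = q ^ 4"
  "t1 \<noteq> 0 \<Longrightarrow> t6 \<in> F \<Longrightarrow> card (conj_class U (X t1 0 0 0 0 t6)) = q ^ 5"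
  "t1 \<noteq> 0 \<Longrightarrow> t3 \<in> T t1 \<Longrightarrow> t3 \<noteq> 0 \<Longrightarrow> card (conj_class U (X t1 0 t3 0 0 0)) = q ^ 6"
  "t1 \<noteq> 0 \<Longrightarrow> t2 \<in> F \<Longrightarrow> t2 \<noteq> 0 \<Longrightarrow> card (conj_class U (X t1 t2 0 0 0 0)) = q ^ 8"
  by (simp add: conj_class_x5 conj_class_x4 conj_class_x3 conj_class_x2 conj_class_x1 conj_class_x13
      conj_class_x12, subst card_image,
      force simp: inj_on_def, simp add: card_cartesian_product card_F card_UNIV eval_nat_numeral)+

text \<open>The nine families of (A) as one condition on coordinates. Families 7 and 8 share the
  branch \<open>t3 \<in> T t1\<close>, where t6 is free only for t3 = 0; the last branch comprises
  families 1, 2 and 3.\<close>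

definition canonical :: "'a \<Rightarrow> 'a \<Rightarrow> 'a \<Rightarrow> 'a \<Rightarrow> 'a \<Rightarrow> 'a \<Rightarrow> bool" where
  "canonical t1 t2 t3 t4 t5 t6 \<longleftrightarrow> t2 \<in> F \<and> t5 \<in> F \<and> t6 \<in> F \<and>
    (if t1 \<noteq> 0 then
       if t2 \<noteq> 0 then t3 = 0 \<and> t4 = 0 \<and> t5 = 0 \<and> t6 = 0
       else t3 \<in> T t1 \<and> t4 = 0 \<and> t5 = 0 \<and> (t3 \<noteq> 0 \<longrightarrow> t6 = 0)
     else if t2 \<noteq> 0 then t3 = 0 \<and> t6 = 0
     else if t3 \<noteq> 0 then t4 = 0 \<and> t6 = 0
     else if t4 \<noteq> 0 then t5 = 0 \<and> t6 = 0
     else t5 \<noteq> 0 \<longrightarrow> t6 = 0)"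

text \<open>The dependent parameters are measured from the representative, so they vanish at the
  representative itself.\<close>

lemma hat_0: "t \<noteq> 0 \<Longrightarrow> hat5 t 0 = 0" "hat4' t 0 = 0" "hat5' t 0 s = 0" "t \<noteq> 0 \<Longrightarrow> hat6 t 0 0 0 = 0"
  by (simp_all add: hat5_def hat4'_def hat5'_def hat6_def Let_def)

lemma canonical_unique:
  assumes t: "canonical t1 t2 t3 t4 t5 t6" and s: "canonical s1 s2 s3 s4 s5 s6"
    and conj: "X s1 s2 s3 s4 s5 s6 \<in> conj_class U (X t1 t2 t3 t4 t5 t6)"
  shows "X s1 s2 s3 s4 s5 s6 = X t1 t2 t3 t4 t5 t6"
proof -
  have F: "t2 \<in> F" "t5 \<in> F" "t6 \<in> F" "s2 \<in> F" "s5 \<in> F" "s6 \<in> F" using s t by (auto simp: canonical_def)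
  have 12: "s1 = t1" "s2 = t2" using conj unfolding conj_X_iff[OF F] by auto
  consider "t1 \<noteq> 0" "t2 \<noteq> 0" | "t1 \<noteq> 0" "t2 = 0" "t3 \<noteq> 0" | "t1 \<noteq> 0" "t2 = 0" "t3 = 0" | "t1 = 0" "t2 \<noteq> 0"
    | "t1 = 0" "t2 = 0" "t3 \<noteq> 0" | "t1 = 0" "t2 = 0" "t3 = 0" "t4 \<noteq> 0"
    | "t1 = 0" "t2 = 0" "t3 = 0" "t4 = 0" "t5 \<noteq> 0" | "t1 = 0" "t2 = 0" "t3 = 0" "t4 = 0" "t5 = 0"
    by blast
  thus ?thesis
  proof cases
    case 1 thus ?thesis using s t 12 by (simp add: canonical_def)
  next
    case 2
    hence t': "t3 \<in> T t1" "t4 = 0" "t5 = 0" "t6 = 0" using t by (auto simp: canonical_def)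
    have "\<exists>r2\<in>F. s3 = t3 + t1 * r2"
      using conj 2 F unfolding t' \<open>t2 = 0\<close> by (simp add: class_X13 T_not_line t')
    moreover have s': "s3 \<in> T t1" "s4 = 0" "s5 = 0" "s3 \<noteq> 0 \<longrightarrow> s6 = 0"
      using s 2 12 by (auto simp: canonical_def)
    ultimately have "s3 = t3" using T_unique[OF 2(1) s'(1) t'(1)] by blast
    thus ?thesis using 2 s' t' 12 by simp
  next
    case 3
    hence t': "t4 = 0" "t5 = 0" using t by (auto simp: canonical_def)
    obtain r2 where r2: "r2 \<in> F" "s3 = t1 * r2" "s6 = t6 + hat6 t1 r2 s4 s5"
      using conj 3 F unfolding t' \<open>t2 = 0\<close> \<open>t3 = 0\<close> by (auto simp: class_X1)
    have s': "s3 \<in> T t1" "s4 = 0" "s5 = 0" using s 3 12 by (auto simp: canonical_def)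
    have "s3 = 0" using T_not_line[OF 3(1) s'(1) _ r2(1)] r2(2) by blast
    hence "r2 = 0" using r2(2) 3(1) by simp
    thus ?thesis using r2 s' t' 12 3 by (simp add: hat_0)
  next
    case 4
    hence t': "t3 = 0" "t6 = 0" and s': "s3 = 0" "s6 = 0" using s t 12 by (auto simp: canonical_def)
    have "s4 = t4 + hat4' t2 s3" "s5 = t5 + hat5' t2 s3 s4"
      using conj 4 F unfolding t' \<open>t1 = 0\<close> by (auto simp: class_X2)
    thus ?thesis using s' t' 12 4 by (simp add: hat_0)
  next
    case 5
    hence t': "t4 = 0" "t6 = 0" using t by (auto simp: canonical_def)
    have "s3 = t3" "s5 = t5 + hat5 t3 s4"
      using conj 5 F unfolding t' \<open>t1 = 0\<close> \<open>t2 = 0\<close> by (auto simp: class_X3)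
    thus ?thesis using s 5 12 t' by (simp add: canonical_def hat_0)
  next
    case 6
    hence t': "t5 = 0" "t6 = 0" using t by (auto simp: canonical_def)
    have "s3 = 0" "s4 = t4"
      using conj 6 F unfolding t' \<open>t1 = 0\<close> \<open>t2 = 0\<close> \<open>t3 = 0\<close> by (auto simp: class_X4)
    thus ?thesis using s 6 12 t' by (simp add: canonical_def)
  next
    case 7
    hence t': "t6 = 0" using t by (auto simp: canonical_def)
    have "s3 = 0" "s4 = 0" "s5 = t5"
      using conj 7 F unfolding t' \<open>t1 = 0\<close> \<open>t2 = 0\<close> \<open>t3 = 0\<close> \<open>t4 = 0\<close> by (auto simp: class_X5)
    thus ?thesis using s 7 12 t' by (simp add: canonical_def)
  next
    case 8
    have "s3 = 0" "s4 = 0" "s5 = 0" "s6 = t6"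
      using conj 8 F unfolding \<open>t1 = 0\<close> \<open>t2 = 0\<close> \<open>t3 = 0\<close> \<open>t4 = 0\<close> \<open>t5 = 0\<close> by (auto simp: class_X6)
    thus ?thesis using 8 12 by simp
  qed
qed

text \<open>The free coordinates of the representative are obtained by subtracting the dependent
  parameters from the given coordinates; on the branch with T they come from the decomposition of s3
  along the line s1 F.\<close>

lemma canonical_ex:
  assumes s: "s2 \<in> F" "s5 \<in> F" "s6 \<in> F"
  shows "\<exists>t1 t2 t3 t4 t5 t6. canonical t1 t2 t3 t4 t5 t6 \<and>
    X s1 s2 s3 s4 s5 s6 \<in> conj_class U (X t1 t2 t3 t4 t5 t6)"
proof -
  note classes = class_X12 class_X13 class_X1 class_X2 class_X3 class_X4 class_X5 class_X6
  consider "s1 \<noteq> 0" "s2 \<noteq> 0" | "s1 \<noteq> 0" "s2 = 0" | "s1 = 0" "s2 \<noteq> 0"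
    | "s1 = 0" "s2 = 0" "s3 \<noteq> 0" | "s1 = 0" "s2 = 0" "s3 = 0" "s4 \<noteq> 0"
    | "s1 = 0" "s2 = 0" "s3 = 0" "s4 = 0" "s5 \<noteq> 0" | "s1 = 0" "s2 = 0" "s3 = 0" "s4 = 0" "s5 = 0"
    by blast
  thus ?thesis
  proof cases
    case 1
    hence "canonical s1 s2 0 0 0 0" "X s1 s2 s3 s4 s5 s6 \<in> conj_class U (X s1 s2 0 0 0 0)"
      using s by (auto simp: canonical_def classes)
    thus ?thesis by blast
  next
    case 2
    obtain r c where r: "r \<in> T s1" "c \<in> F" "s3 = r + s1 * c" using T_ex[OF 2(1)] by blast
    show ?thesis
    proof (cases "r = 0")
      case False
      hence "canonical s1 s2 r 0 0 0" "X s1 s2 s3 s4 s5 s6 \<in> conj_class U (X s1 s2 r 0 0 0)"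
        using s r 2 by (auto simp: canonical_def classes T_not_line)
      thus ?thesis by blast
    next
      case True
      have "canonical s1 s2 0 0 0 (s6 - hat6 s1 c s4 s5)"
        using s r 2 T_0 by (simp add: canonical_def)
      moreover have "X s1 s2 s3 s4 s5 s6 \<in> conj_class U (X s1 s2 0 0 0 (s6 - hat6 s1 c s4 s5))"
        using s r 2 True by (auto simp: classes)
      ultimately show ?thesis by blast
    qed
  next
    case 3
    hence "canonical 0 s2 0 (s4 - hat4' s2 s3) (s5 - hat5' s2 s3 s4) 0"
      "X s1 s2 s3 s4 s5 s6 \<in> conj_class U (X 0 s2 0 (s4 - hat4' s2 s3) (s5 - hat5' s2 s3 s4) 0)"
      using s by (auto simp: canonical_def classes)
    thus ?thesis by blast
  next
    case 4
    hence "canonical 0 0 s3 0 (s5 - hat5 s3 s4) 0"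
      "X s1 s2 s3 s4 s5 s6 \<in> conj_class U (X 0 0 s3 0 (s5 - hat5 s3 s4) 0)"
      using s by (auto simp: canonical_def classes)
    thus ?thesis by blast
  next
    case 5
    hence "canonical 0 0 0 s4 0 0" "X s1 s2 s3 s4 s5 s6 \<in> conj_class U (X 0 0 0 s4 0 0)"
      using s by (auto simp: canonical_def classes)
    thus ?thesis by blast
  next
    case 6
    hence "canonical 0 0 0 0 s5 0" "X s1 s2 s3 s4 s5 s6 \<in> conj_class U (X 0 0 0 0 s5 0)"
      using s by (auto simp: canonical_def classes)
    thus ?thesis by blast
  next
    case 7
    hence "canonical 0 0 0 0 0 s6" "X s1 s2 s3 s4 s5 s6 \<in> conj_class U (X 0 0 0 0 0 s6)"
      using s by (auto simp: canonical_def classes)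
    thus ?thesis by blast
  qed
qed

definition reps :: "('a mat \<Rightarrow> 'a mat) set" where
  "reps = {X t1 t2 t3 t4 t5 t6 | t1 t2 t3 t4 t5 t6. canonical t1 t2 t3 t4 t5 t6}"

lemma repsI: "canonical t1 t2 t3 t4 t5 t6 \<Longrightarrow> X t1 t2 t3 t4 t5 t6 \<in> reps"
  unfolding reps_def by blast

lemma reps_unique:
  assumes "g \<in> carrier U" shows "\<exists>!r. r \<in> reps \<and> g \<in> conj_class U r"
proof -
  obtain s1 s2 s3 s4 s5 s6 where s: "s2 \<in> F" "s5 \<in> F" "s6 \<in> F" "g = X s1 s2 s3 s4 s5 s6"
    using U_cases[OF assms] by metis
  obtain r where r: "r \<in> reps" "g \<in> conj_class U r"
    using canonical_ex[OF s(1-3), of s1 s3 s4] unfolding s(4) reps_def by blast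
  have "r' = r" if r': "r' \<in> reps" "g \<in> conj_class U r'" for r'
  proof -
    have c: "r \<in> carrier U" "r' \<in> carrier U" using r(1) r'(1) by (auto simp: reps_def canonical_def)
    have "r' \<in> conj_class U r"
      using U.conj_class_trans[OF c(1) r(2) U.conj_class_sym[OF c(2) r'(2)]] .
    thus ?thesis using r(1) r'(1) canonical_unique unfolding reps_def by blast
  qed
  with r show ?thesis by blast
qed

lemma reps_eq: "reps =
      {\<one>\<^bsub>U\<^esub>}
      \<union> {x6 t6 | t6. t6 \<in> F - {0}}
      \<union> {x5 t5 | t5. t5 \<in> F - {0}}
      \<union> {x4 q t4 | t4. t4 \<in> UNIV - {0}}
      \<union> {X 0 0 t3 0 t5 0 | t3 t5. t3 \<in> UNIV - {0} \<and> t5 \<in> F}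
      \<union> {X 0 t2 0 t4 t5 0 | t2 t4 t5. t2 \<in> F - {0} \<and> t5 \<in> F}
      \<union> {X t1 0 0 0 0 t6 | t1 t6. t1 \<in> UNIV - {0} \<and> t6 \<in> F}
      \<union> {X t1 0 t3 0 0 0 | t1 t3. t1 \<in> UNIV - {0} \<and> t3 \<in> T t1 \<and> t3 \<noteq> 0}
      \<union> {X t1 t2 0 0 0 0 | t1 t2. t1 \<in> UNIV - {0} \<and> t2 \<in> F - {0}}" (is "_ = ?R")
proof (intro equalityI subsetI)
  fix g assume "g \<in> reps"
  then obtain t1 t2 t3 t4 t5 t6 where g: "g = X t1 t2 t3 t4 t5 t6" and t: "canonical t1 t2 t3 t4 t5 t6"
    unfolding reps_def by blast
  consider "t1 \<noteq> 0" "t2 \<noteq> 0" | "t1 \<noteq> 0" "t2 = 0" "t3 \<noteq> 0" | "t1 \<noteq> 0" "t2 = 0" "t3 = 0" | "t1 = 0" "t2 \<noteq> 0"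
    | "t1 = 0" "t2 = 0" "t3 \<noteq> 0" | "t1 = 0" "t2 = 0" "t3 = 0" "t4 \<noteq> 0"
    | "t1 = 0" "t2 = 0" "t3 = 0" "t4 = 0" "t5 \<noteq> 0"
    | "t1 = 0" "t2 = 0" "t3 = 0" "t4 = 0" "t5 = 0" "t6 \<noteq> 0"
    | "t1 = 0" "t2 = 0" "t3 = 0" "t4 = 0" "t5 = 0" "t6 = 0"
    by blast
  thus "g \<in> ?R" unfolding X_0[symmetric] x_elt_single g using t unfolding canonical_def
    by cases (simp only: if_True if_False not_False_eq_True simp_thms Un_iff mem_Collect_eq, blast)+
next
  fix g assume "g \<in> ?R"
  thus "g \<in> reps" unfolding X_0[symmetric] x_elt_single Un_iff
    by (elim disjE CollectE exE singletonE conjE) (auto intro!: repsI simp: canonical_def T_0)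
qed

end

section \<open>Irreducible characters\<close>

text \<open>Normality turns the left factor from N into a right factor. On the right, elements whose
  first two coordinates are 0 are where the multiplication law is simplest.\<close>

lemma (in group) coset_eq_iff:
  assumes N: "N \<lhd> G" and a: "a \<in> carrier G" and b: "b \<in> carrier G"
  shows "N #> a = N #> b \<longleftrightarrow> (\<exists>n\<in>N. b = a \<otimes> n)"
proof -
  have Ns: "subgroup N G" using N by (rule normal_imp_subgroup)
  have 1: "N #> a = N #> b \<longleftrightarrow> b \<in> N #> a"
    using repr_independence[OF _ a Ns, of b] rcos_self[OF b Ns] by auto
  have 2: "N #> a = a <# N" using normal.coset_eq[OF N] a by simp
  show ?thesis unfolding 1 unfolding 2 l_coset_def by auto
qed

lemma sum_character_additive:
  fixes f :: "'b :: ab_group_add \<Rightarrow> complex"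
  assumes "\<And>a b. a \<in> A \<Longrightarrow> b \<in> A \<Longrightarrow> a + b \<in> A" "\<And>a. a \<in> A \<Longrightarrow> - a \<in> A"
    and "\<And>a b. a \<in> A \<Longrightarrow> b \<in> A \<Longrightarrow> f (a + b) = f a * f b" and "c \<in> A" "f c \<noteq> 1"
  shows "(\<Sum>a\<in>A. f a) = 0"
proof -
  have "(\<Sum>a\<in>A. f a) = (\<Sum>a\<in>A. f (c + a))"
  proof (rule sum.reindex_bij_witness[of _ "\<lambda>a. c + a" "\<lambda>a. - c + a"])
    fix a assume "a \<in> A"
    thus "- c + a \<in> A" "c + a \<in> A" using assms(1,2,4) by blast+
  qed auto
  also have "\<dots> = f c * (\<Sum>a\<in>A. f a)" using assms(3,4) by (simp add: sum_distrib_left)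
  finally have "(1 - f c) * (\<Sum>a\<in>A. f a) = 0" by (simp add: algebra_simps)
  thus ?thesis using assms(5) by simp
qed

section \<open>The additive character and the trace form\<close>

context triality
begin

lemma theta_add: "a \<in> F \<Longrightarrow> b \<in> F \<Longrightarrow> \<theta> (a + b) = \<theta> a * \<theta> b"
  and theta_neq_0: "a \<in> F \<Longrightarrow> \<theta> a \<noteq> 0"
  using theta by (auto simp: nontrivial_additive_char_def)

lemma theta_0 [simp]: "\<theta> 0 = 1"
  using theta_add[of 0 0] theta_neq_0[of 0] by simp

lemma theta_diff: "a \<in> F \<Longrightarrow> b \<in> F \<Longrightarrow> \<theta> (a - b) = \<theta> a / \<theta> b"
  using theta_add[of "a - b" b] theta_neq_0[of b] by (simp add: field_simps)

lemma theta_minus: "a \<in> F \<Longrightarrow> \<theta> (- a) = inverse (\<theta> a)"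
  using theta_diff[of 0 a] by (simp add: divide_inverse)

lemma theta_eq_iff: "a \<in> F \<Longrightarrow> b \<in> F \<Longrightarrow> \<theta> a = \<theta> b \<longleftrightarrow> \<theta> (a - b) = 1"
  using theta_neq_0[of b] by (simp add: theta_diff field_simps)

lemma ex_theta: obtains c where "c \<in> F" "\<theta> c \<noteq> 1"
  using theta by (auto simp: nontrivial_additive_char_def)

lemma theta_F_nondegenerate:
  assumes "a \<in> F" "b \<in> F" "\<And>r. r \<in> F \<Longrightarrow> \<theta> (a * r) = \<theta> (b * r)" shows "a = b"
proof (rule ccontr)
  assume "a \<noteq> b"
  obtain c where c: "c \<in> F" "\<theta> c \<noteq> 1" by (rule ex_theta)
  \<comment> \<open>With this m the difference a m - b m equals c, where \<theta> is not 1.\<close>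
  define m where "m = c / (a - b)"
  have m: "m \<in> F" "a * m \<in> F" "b * m \<in> F" using assms c by (auto simp: m_def)
  have "a * m - b * m = c"
    using \<open>a \<noteq> b\<close> unfolding left_diff_distrib[symmetric] m_def by simp
  moreover have "\<theta> (a * m - b * m) = 1"
    using assms(3)[OF m(1)] theta_eq_iff[OF m(2,3)] by simp
  ultimately show False using c by simp
qed

lemma theta_Tr_nondegenerate:
  assumes "\<And>r. \<theta> (Tr (a * r)) = \<theta> (Tr (b * r))" shows "a = b"
proof (rule ccontr)
  assume "a \<noteq> b"
  obtain c where c: "c \<in> F" "\<theta> c \<noteq> 1" by (rule ex_theta)
  obtain r where "Tr ((a - b) * r) = c" using ex_Tr[of "a - b" c] \<open>a \<noteq> b\<close> c by auto
  hence "Tr (a * r) - Tr (b * r) = c" by (simp add: left_diff_distrib)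
  moreover have "\<theta> (Tr (a * r) - Tr (b * r)) = 1"
    using assms[of r] theta_eq_iff[of "Tr (a * r)" "Tr (b * r)"] by auto
  ultimately show False using c by simp
qed

lemma sum_theta_F:
  assumes "a \<in> F" shows "(\<Sum>r\<in>F. \<theta> (a * r)) = (if a = 0 then of_nat q else 0)"
proof (cases "a = 0")
  case False
  then obtain c where c: "c \<in> F" "\<theta> (a * c) \<noteq> 1"
    using theta_F_nondegenerate[OF assms F_closed(1)] by force
  have "(\<Sum>r\<in>F. \<theta> (a * r)) = 0"
    by (rule sum_character_additive[where c = c]) (use assms c in \<open>auto simp: distrib_left theta_add\<close>)
  thus ?thesis using False by simp
qed (simp add: card_F)

lemma sum_theta_Tr: "(\<Sum>r\<in>UNIV. \<theta> (Tr (a * r))) = (if a = 0 then of_nat (q ^ 3) else 0)"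
proof (cases "a = 0")
  case False
  then obtain c where c: "\<theta> (Tr (a * c)) \<noteq> 1"
    using theta_Tr_nondegenerate[of a 0] by force
  have "(\<Sum>r\<in>UNIV. \<theta> (Tr (a * r))) = 0"
    by (rule sum_character_additive[where c = c]) (use c in \<open>auto simp: distrib_left theta_add\<close>)
  thus ?thesis using False by simp
qed (simp add: card_UNIV)

lemma pi_eq: "\<pi>q q \<eta> t = Tr (\<eta> * t)"
  by (simp add: \<pi>q_def phi0_eq)

lemma pi_F: "t \<in> F \<Longrightarrow> Tr (\<eta> * t) = t"
  using Tr_scale[of t \<eta>] eta by (simp add: mult.commute)

lemma eta_neq_0: "\<eta> \<noteq> 0" using eta by auto

section \<open>Subgroups cut out by coordinates\<close>

definition SX :: "('a \<Rightarrow> 'a \<Rightarrow> 'a \<Rightarrow> 'a \<Rightarrow> 'a \<Rightarrow> 'a \<Rightarrow> bool) \<Rightarrow> ('a mat \<Rightarrow> 'a mat) set" where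
  "SX P = {X t1 t2 t3 t4 t5 t6 | t1 t2 t3 t4 t5 t6. t2 \<in> F \<and> t5 \<in> F \<and> t6 \<in> F \<and> P t1 t2 t3 t4 t5 t6}"

lemma X_in_SX [simp]:
  "t2 \<in> F \<Longrightarrow> t5 \<in> F \<Longrightarrow> t6 \<in> F \<Longrightarrow> X t1 t2 t3 t4 t5 t6 \<in> SX P \<longleftrightarrow> P t1 t2 t3 t4 t5 t6"
  unfolding SX_def by (auto intro!: exI)

lemma SX_cases:
  assumes "g \<in> SX P"
  obtains t1 t2 t3 t4 t5 t6 where "t2 \<in> F" "t5 \<in> F" "t6 \<in> F" "P t1 t2 t3 t4 t5 t6" "g = X t1 t2 t3 t4 t5 t6"
  using assms unfolding SX_def by blast

lemma SX_subset: "SX P \<subseteq> carrier U"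
  by (auto elim!: SX_cases)

lemma carrier_SX: "carrier U = SX (\<lambda>t1 t2 t3 t4 t5 t6. True)"
  unfolding carrier_U SX_def by simp

lemma inv_X:
  assumes "t2 \<in> F" "t5 \<in> F" "t6 \<in> F"
  shows "inv\<^bsub>U\<^esub> X t1 t2 t3 t4 t5 t6 = X (- t1) (- t2) (- (t3 + t2 * t1)) (- c4 t1 t3 t4 (- t1) (- t2))
     (- c5 t1 t3 t4 t5 (- t1) (- t2)) (- c6 t1 t3 t4 t5 t6 (- t1) (- t2) (- (t3 + t2 * t1)))"
  using X_mult_inverse[OF assms] assms
  by (intro U.inv_unique'[symmetric]) (auto simp: U.inv_comm)

lemma subgroup_SX:
  assumes "P 0 0 0 0 0 0"
    and "\<And>t1 t2 t3 t4 t5 t6 s1 s2 s3 s4 s5 s6. P t1 t2 t3 t4 t5 t6 \<Longrightarrow> P s1 s2 s3 s4 s5 s6 \<Longrightarrow>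
      P (t1 + s1) (t2 + s2) (t3 - s2 * t1 + s3) (c4 t1 t3 t4 s1 s2 + s4)
      (c5 t1 t3 t4 t5 s1 s2 + s5) (c6 t1 t3 t4 t5 t6 s1 s2 s3 + s6)"
    and "\<And>t1 t2 t3 t4 t5 t6. P t1 t2 t3 t4 t5 t6 \<Longrightarrow> P (- t1) (- t2) (- (t3 + t2 * t1))
      (- c4 t1 t3 t4 (- t1) (- t2)) (- c5 t1 t3 t4 t5 (- t1) (- t2))
      (- c6 t1 t3 t4 t5 t6 (- t1) (- t2) (- (t3 + t2 * t1)))"
  shows "subgroup (SX P) U"
proof (rule U.subgroupI[OF SX_subset])
  have "X 0 0 0 0 0 0 \<in> SX P" using assms(1) by simp
  thus "SX P \<noteq> {}" by blast
  fix a assume a: "a \<in> SX P"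
  then obtain t1 t2 t3 t4 t5 t6 where t: "t2 \<in> F" "t5 \<in> F" "t6 \<in> F" "P t1 t2 t3 t4 t5 t6"
    "a = X t1 t2 t3 t4 t5 t6" by (rule SX_cases)
  show "inv\<^bsub>U\<^esub> a \<in> SX P"
    unfolding t(5) inv_X[OF t(1-3)] using assms(3)[OF t(4)] t by (subst X_in_SX) auto
  fix b assume "b \<in> SX P"
  with a show "a \<otimes>\<^bsub>U\<^esub> b \<in> SX P"
    by (elim SX_cases) (simp add: x_elt_mult assms(2))
qed

text \<open>The conjugacy criterion replaces explicit conjugation: the equations of
  \<open>conj_X_iff\<close> show that the coordinates required to vanish stay 0.\<close>

lemma normal_SX:
  assumes "subgroup (SX P) U"
    and "\<And>t1 t2 t3 t4 t5 t6 s1 s2 s3 s4 s5 s6. t2 \<in> F \<Longrightarrow> t5 \<in> F \<Longrightarrow> t6 \<in> F \<Longrightarrow> s2 \<in> F \<Longrightarrow> s5 \<in> F \<Longrightarrow> s6 \<in> F \<Longrightarrow>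
      P t1 t2 t3 t4 t5 t6 \<Longrightarrow> X s1 s2 s3 s4 s5 s6 \<in> conj_class U (X t1 t2 t3 t4 t5 t6) \<Longrightarrow> P s1 s2 s3 s4 s5 s6"
  shows "SX P \<lhd> U"
  unfolding U.normal_inv_iff
proof (intro conjI ballI assms(1))
  fix x h assume x: "x \<in> carrier U" and h: "h \<in> SX P"
  obtain t1 t2 t3 t4 t5 t6 where t: "t2 \<in> F" "t5 \<in> F" "t6 \<in> F" "P t1 t2 t3 t4 t5 t6" "h = X t1 t2 t3 t4 t5 t6"
    using h by (rule SX_cases)
  have "x \<otimes>\<^bsub>U\<^esub> h \<otimes>\<^bsub>U\<^esub> inv\<^bsub>U\<^esub> x \<in> carrier U" using x t by simp
  then obtain s1 s2 s3 s4 s5 s6 where s: "s2 \<in> F" "s5 \<in> F" "s6 \<in> F"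
    "x \<otimes>\<^bsub>U\<^esub> h \<otimes>\<^bsub>U\<^esub> inv\<^bsub>U\<^esub> x = X s1 s2 s3 s4 s5 s6" using U_cases by metis
  have "X s1 s2 s3 s4 s5 s6 \<in> conj_class U (X t1 t2 t3 t4 t5 t6)"
    unfolding s(4)[symmetric] t(5)[symmetric] conj_class_def using x by blast
  thus "x \<otimes>\<^bsub>U\<^esub> h \<otimes>\<^bsub>U\<^esub> inv\<^bsub>U\<^esub> x \<in> SX P"
    unfolding s(4) using assms(2)[OF t(1-3) s(1-3) t(4)] s(1-3) by simp
qed

text \<open>The digits name the coordinates that stay free; the others are 0.\<close>

abbreviation "P3456 \<equiv> (\<lambda>t1 t2 t3 t4 t5 t6. t1 = (0 :: 'a) \<and> t2 = (0 :: 'a))"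
abbreviation "P456 \<equiv> (\<lambda>t1 t2 t3 t4 t5 t6. t1 = (0 :: 'a) \<and> t2 = (0 :: 'a) \<and> t3 = (0 :: 'a))"
abbreviation "P56 \<equiv> (\<lambda>t1 t2 t3 t4 t5 t6. t1 = (0 :: 'a) \<and> t2 = (0 :: 'a) \<and> t3 = (0 :: 'a) \<and> t4 = (0 :: 'a))"
abbreviation "P6 \<equiv> (\<lambda>t1 t2 t3 t4 t5 t6. t1 = (0 :: 'a) \<and> t2 = (0 :: 'a) \<and> t3 = (0 :: 'a) \<and> t4 = (0 :: 'a) \<and> t5 = (0 :: 'a))"
abbreviation "P13456 \<equiv> (\<lambda>t1 t2 t3 t4 t5 t6. t2 = (0 :: 'a))"
abbreviation "P23456 \<equiv> (\<lambda>t1 t2 t3 t4 t5 t6. t1 = (0 :: 'a))"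
abbreviation "P1456 \<equiv> (\<lambda>t1 t2 t3 t4 t5 t6. t2 = (0 :: 'a) \<and> t3 = (0 :: 'a))"
abbreviation "P45 \<equiv> (\<lambda>t1 t2 t3 t4 t5 t6. t1 = (0 :: 'a) \<and> t2 = (0 :: 'a) \<and> t3 = (0 :: 'a) \<and> t6 = (0 :: 'a))"

lemma subgroups:
  "subgroup (SX P3456) U" "subgroup (SX P456) U" "subgroup (SX P56) U" "subgroup (SX P6) U"
  "subgroup (SX P13456) U" "subgroup (SX P23456) U" "subgroup (SX P1456) U" "subgroup (SX P45) U"
  by (rule subgroup_SX; simp)+

lemma normals:
  "SX P3456 \<lhd> U" "SX P456 \<lhd> U" "SX P56 \<lhd> U" "SX P6 \<lhd> U" "SX P13456 \<lhd> U" "SX P23456 \<lhd> U"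
  by (rule normal_SX, rule subgroups, auto simp: conj_X_iff)+

text \<open>The root subgroups are multiplied in the order of the coordinates, so no correction
  arises and the product sets are coordinate sets.\<close>

lemma X_products:
  "X2 q <#>\<^bsub>U\<^esub> X1 q = SX (\<lambda>t1 t2 t3 t4 t5 t6. t3 = 0 \<and> t4 = 0 \<and> t5 = 0 \<and> t6 = 0)"
  "X2 q <#>\<^bsub>U\<^esub> X1 q <#>\<^bsub>U\<^esub> X3 q = SX (\<lambda>t1 t2 t3 t4 t5 t6. t4 = 0 \<and> t5 = 0 \<and> t6 = 0)"
  "X2 q <#>\<^bsub>U\<^esub> X1 q <#>\<^bsub>U\<^esub> X3 q <#>\<^bsub>U\<^esub> X4 q = SX (\<lambda>t1 t2 t3 t4 t5 t6. t5 = 0 \<and> t6 = 0)"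
  "X2 q <#>\<^bsub>U\<^esub> X1 q <#>\<^bsub>U\<^esub> X3 q <#>\<^bsub>U\<^esub> X4 q <#>\<^bsub>U\<^esub> X5 q = SX (\<lambda>t1 t2 t3 t4 t5 t6. t6 = 0)"
  "X1 q <#>\<^bsub>U\<^esub> X3 q = SX (\<lambda>t1 t2 t3 t4 t5 t6. t2 = 0 \<and> t4 = 0 \<and> t5 = 0 \<and> t6 = 0)"
  "X2 q <#>\<^bsub>U\<^esub> X3 q <#>\<^bsub>U\<^esub> X4 q = SX (\<lambda>t1 t2 t3 t4 t5 t6. t1 = 0 \<and> t5 = 0 \<and> t6 = 0)"
  "X2 q <#>\<^bsub>U\<^esub> X3 q <#>\<^bsub>U\<^esub> X4 q <#>\<^bsub>U\<^esub> X5 q = SX (\<lambda>t1 t2 t3 t4 t5 t6. t1 = 0 \<and> t6 = 0)"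
  "X1 q <#>\<^bsub>U\<^esub> X6 q = SX (\<lambda>t1 t2 t3 t4 t5 t6. t2 = 0 \<and> t3 = 0 \<and> t4 = 0 \<and> t5 = 0)"
  "X3456 q = SX P3456" "X456 q = SX P456" "X56 q = SX P56" "X6 q = SX P6" "X45 q = SX P45" "X1456 q = SX P1456"
  unfolding X3456_def X456_def X56_def X45_def X1456_def
  by (rule Set.set_eqI, simp add: set_mult_iff bex_set_mult X1_def X2_def X3_def X4_def X5_def X6_def
      x_elt_single x_elt_mult SX_def image_iff cong: bex_cong conj_cong; blast)+

lemma X_sets:
  "X1 q = SX (\<lambda>t1 t2 t3 t4 t5 t6. t2 = 0 \<and> t3 = 0 \<and> t4 = 0 \<and> t5 = 0 \<and> t6 = 0)"
  "X2 q = SX (\<lambda>t1 t2 t3 t4 t5 t6. t1 = 0 \<and> t3 = 0 \<and> t4 = 0 \<and> t5 = 0 \<and> t6 = 0)"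
  "X3 q = SX (\<lambda>t1 t2 t3 t4 t5 t6. t1 = 0 \<and> t2 = 0 \<and> t4 = 0 \<and> t5 = 0 \<and> t6 = 0)"
  "X4 q = SX (\<lambda>t1 t2 t3 t4 t5 t6. t1 = 0 \<and> t2 = 0 \<and> t3 = 0 \<and> t5 = 0 \<and> t6 = 0)"
  "X5 q = SX (\<lambda>t1 t2 t3 t4 t5 t6. t1 = 0 \<and> t2 = 0 \<and> t3 = 0 \<and> t4 = 0 \<and> t6 = 0)"
  by (rule Set.set_eqI, simp add: X1_def X2_def X3_def X4_def X5_def x_elt_single SX_def image_iff; blast)+

lemma card_U: "card (carrier U) = q ^ 12"
proof -
  have "carrier U = (\<lambda>(t1, t2, t3, t4, t5, t6). X t1 t2 t3 t4 t5 t6) ` (UNIV \<times> F \<times> UNIV \<times> UNIV \<times> F \<times> F)"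
  proof (intro equalityI subsetI)
    fix g assume "g \<in> carrier U"
    then obtain t1 t2 t3 t4 t5 t6 where "t2 \<in> F" "t5 \<in> F" "t6 \<in> F" "g = X t1 t2 t3 t4 t5 t6"
      using U_cases by metis
    thus "g \<in> (\<lambda>(t1, t2, t3, t4, t5, t6). X t1 t2 t3 t4 t5 t6) ` (UNIV \<times> F \<times> UNIV \<times> UNIV \<times> F \<times> F)"
      by (intro rev_image_eqI[of "(t1, t2, t3, t4, t5, t6)"]) auto
  qed auto
  also have "card \<dots> = card ((UNIV :: 'a set) \<times> F \<times> (UNIV :: 'a set) \<times> (UNIV :: 'a set) \<times> F \<times> F)"
    by (rule card_image) (auto simp: inj_on_def)
  also have "\<dots> = q ^ 12" by (simp add: card_cartesian_product card_F card_UNIV eval_nat_numeral)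
  finally show ?thesis .
qed

lemma finite_U: "finite (carrier U)"
proof -
  have "card (carrier U) \<noteq> 0" using card_U q_gt_1 by simp
  thus ?thesis by (rule card_ge_0_finite[OF neq0_conv[THEN iffD1]])
qed

definition co :: "('a mat \<Rightarrow> 'a mat) \<Rightarrow> 'a \<times> 'a \<times> 'a \<times> 'a \<times> 'a \<times> 'a" where
  "co = the_inv_into (UNIV \<times> F \<times> UNIV \<times> UNIV \<times> F \<times> F) (\<lambda>(t1, t2, t3, t4, t5, t6). X t1 t2 t3 t4 t5 t6)"

lemma co_X [simp]:
  assumes "t2 \<in> F" "t5 \<in> F" "t6 \<in> F" shows "co (X t1 t2 t3 t4 t5 t6) = (t1, t2, t3, t4, t5, t6)"
proof -
  have "inj_on (\<lambda>(t1, t2, t3, t4, t5, t6). X t1 t2 t3 t4 t5 t6) (UNIV \<times> F \<times> UNIV \<times> UNIV \<times> F \<times> F)"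
    by (auto simp: inj_on_def)
  from the_inv_into_f_f[OF this, of "(t1, t2, t3, t4, t5, t6)"] show ?thesis
    using assms by (simp add: co_def)
qed

text \<open>The induction formula asks for y^-1 g y. It is described by y s = g y, which avoids
  inverting y.\<close>

lemma conj_X_obtain:
  assumes t: "t2 \<in> F" "t5 \<in> F" "t6 \<in> F" and r: "r2 \<in> F" "r5 \<in> F" "r6 \<in> F"
  obtains s3 s4 s5 s6 where "s5 \<in> F" "s6 \<in> F"
    "inv\<^bsub>U\<^esub> X r1 r2 r3 r4 r5 r6 \<otimes>\<^bsub>U\<^esub> X t1 t2 t3 t4 t5 t6 \<otimes>\<^bsub>U\<^esub> X r1 r2 r3 r4 r5 r6 = X t1 t2 s3 s4 s5 s6"
    "s3 = t3 - r2 * t1 + t2 * r1" "c4 r1 r3 r4 t1 t2 + s4 = c4 t1 t3 t4 r1 r2 + r4"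
    "c5 r1 r3 r4 r5 t1 t2 + s5 = c5 t1 t3 t4 t5 r1 r2 + r5"
    "c6 r1 r3 r4 r5 r6 t1 t2 s3 + s6 = c6 t1 t3 t4 t5 t6 r1 r2 r3 + r6"
proof -
  let ?y = "X r1 r2 r3 r4 r5 r6" and ?g = "X t1 t2 t3 t4 t5 t6"
  have c: "?y \<in> carrier U" "?g \<in> carrier U" using t r by auto
  hence "inv\<^bsub>U\<^esub> ?y \<otimes>\<^bsub>U\<^esub> ?g \<otimes>\<^bsub>U\<^esub> ?y \<in> carrier U" by simp
  then obtain s1 s2 s3 s4 s5 s6 where s: "s2 \<in> F" "s5 \<in> F" "s6 \<in> F"
    "inv\<^bsub>U\<^esub> ?y \<otimes>\<^bsub>U\<^esub> ?g \<otimes>\<^bsub>U\<^esub> ?y = X s1 s2 s3 s4 s5 s6" using U_cases by metis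
  have "?y \<otimes>\<^bsub>U\<^esub> X s1 s2 s3 s4 s5 s6 = ?g \<otimes>\<^bsub>U\<^esub> ?y"
    unfolding s(4)[symmetric] using c by (simp add: U.m_assoc) (simp add: U.m_assoc[symmetric])
  hence *: "X r1 r2 r3 r4 r5 r6 \<otimes>\<^bsub>U\<^esub> X s1 s2 s3 s4 s5 s6 = ?g \<otimes>\<^bsub>U\<^esub> ?y" .
  hence 12: "s1 = t1" "s2 = t2"
    unfolding x_elt_mult[OF r s(1-3)] x_elt_mult[OF t r] using t r s(1-3) by auto
  have e: "r3 - t2 * r1 + s3 = t3 - r2 * t1 + r3" "c4 r1 r3 r4 t1 t2 + s4 = c4 t1 t3 t4 r1 r2 + r4"
    "c5 r1 r3 r4 r5 t1 t2 + s5 = c5 t1 t3 t4 t5 r1 r2 + r5"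
    "c6 r1 r3 r4 r5 r6 t1 t2 s3 + s6 = c6 t1 t3 t4 t5 t6 r1 r2 r3 + r6"
    using * unfolding x_elt_mult[OF r s(1-3)] x_elt_mult[OF t r] using t r s(1-3) 12 by auto
  have "s3 = t3 - r2 * t1 + t2 * r1" using e(1) by (simp add: algebra_simps)
  thus ?thesis using that[OF s(2,3)] s(4) e(2-4) unfolding 12 by blast
qed

end

lemma on_coords_apply: "inj_on P A \<Longrightarrow> t \<in> A \<Longrightarrow> on_coords A P f (P t) = f t"
  by (simp add: on_coords_def the_inv_into_f_f)

lemma on_coords_extensional: "on_coords A P f \<in> extensional (P ` A)"
  by (simp add: on_coords_def)

lemma ind_char_cong: "(\<And>h. h \<in> H \<Longrightarrow> \<mu> h = \<nu> h) \<Longrightarrow> ind_char G H \<mu> = ind_char G H \<nu>"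
  unfolding ind_char_def by (intro restrict_ext arg_cong2[where f = "(/)"] sum.cong refl) auto

lemma (in group) lift_ind_char_eq:
  assumes fin: "finite (carrier G)" and N: "N \<lhd> G" and H: "subgroup H G" and NH: "N \<subseteq> H"
    and "\<And>h. h \<in> H \<Longrightarrow> \<mu> (N #> h) = \<xi> h"
  shows "lift_char G N (ind_char (G Mod N) (bar G N H) \<mu>) = ind_char G H \<xi>"
  unfolding lift_ind_char[OF assms(1-4)] by (rule ind_char_cong) (rule assms(5))

section \<open>Quotients of U and the linear characters to be induced\<close>

context triality
begin

lemma coset_X_iff:
  assumes N: "SX P \<lhd> U" and t: "t2 \<in> F" "t5 \<in> F" "t6 \<in> F" and s: "s2 \<in> F" "s5 \<in> F" "s6 \<in> F"
    and P: "\<And>t1 t2 t3 t4 t5 t6. P t1 t2 t3 t4 t5 t6 \<Longrightarrow> t1 = 0 \<and> t2 = 0"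
  shows "SX P #>\<^bsub>U\<^esub> X t1 t2 t3 t4 t5 t6 = SX P #>\<^bsub>U\<^esub> X s1 s2 s3 s4 s5 s6 \<longleftrightarrow>
    t1 = s1 \<and> t2 = s2 \<and> P 0 0 (s3 - t3) (s4 - t4) (s5 - t5) (s6 - t6 + Tr ((s3 - t3) * fr t4))" (is "?L \<longleftrightarrow> ?R")
proof -
  \<comment> \<open>The right factor that takes the first element to the second; the trace
    compensates for moving its third coordinate past t4.\<close>
  let ?n = "X 0 0 (s3 - t3) (s4 - t4) (s5 - t5) (s6 - t6 + Tr ((s3 - t3) * fr t4))"
  have mult: "X t1 t2 t3 t4 t5 t6 \<otimes>\<^bsub>U\<^esub> ?n = X t1 t2 s3 s4 s5 s6" using s t by (simp add: x_elt_mult)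
  have "?L \<longleftrightarrow> (\<exists>n\<in>SX P. X s1 s2 s3 s4 s5 s6 = X t1 t2 t3 t4 t5 t6 \<otimes>\<^bsub>U\<^esub> n)"
    using t s by (intro U.coset_eq_iff[OF N]) auto
  also have "\<dots> \<longleftrightarrow> ?R"
  proof
    assume "\<exists>n\<in>SX P. X s1 s2 s3 s4 s5 s6 = X t1 t2 t3 t4 t5 t6 \<otimes>\<^bsub>U\<^esub> n"
    then obtain n1 n2 n3 n4 n5 n6 where n: "n2 \<in> F" "n5 \<in> F" "n6 \<in> F" "P n1 n2 n3 n4 n5 n6"
      "X s1 s2 s3 s4 s5 s6 = X t1 t2 t3 t4 t5 t6 \<otimes>\<^bsub>U\<^esub> X n1 n2 n3 n4 n5 n6"
      by (auto elim!: SX_cases)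
    have n0: "n1 = 0" "n2 = 0" using P[OF n(4)] by auto
    have "s1 = t1" "s2 = t2" "s3 = t3 + n3" "s4 = t4 + n4" "s5 = t5 + n5" "s6 = t6 - Tr (n3 * fr t4) + n6"
      using n(5) t s n(2,3) by (simp_all add: x_elt_mult n0)
    thus ?R using n(4) n0 by simp
  next
    assume R: ?R
    hence "?n \<in> SX P" using s t by simp
    thus "\<exists>n\<in>SX P. X s1 s2 s3 s4 s5 s6 = X t1 t2 t3 t4 t5 t6 \<otimes>\<^bsub>U\<^esub> n"
      using mult R by metis
  qed
  finally show ?thesis .
qed

lemma cosets:
  assumes "t2 \<in> F" "t5 \<in> F" "t6 \<in> F" "s2 \<in> F" "s5 \<in> F" "s6 \<in> F"
  shows
   "SX P3456 #>\<^bsub>U\<^esub> X t1 t2 t3 t4 t5 t6 = SX P3456 #>\<^bsub>U\<^esub> X s1 s2 s3 s4 s5 s6 \<longleftrightarrow> t1 = s1 \<and> t2 = s2"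
   "SX P456 #>\<^bsub>U\<^esub> X t1 t2 t3 t4 t5 t6 = SX P456 #>\<^bsub>U\<^esub> X s1 s2 s3 s4 s5 s6 \<longleftrightarrow> t1 = s1 \<and> t2 = s2 \<and> t3 = s3"
   "SX P56 #>\<^bsub>U\<^esub> X t1 t2 t3 t4 t5 t6 = SX P56 #>\<^bsub>U\<^esub> X s1 s2 s3 s4 s5 s6 \<longleftrightarrow>
      t1 = s1 \<and> t2 = s2 \<and> t3 = s3 \<and> t4 = s4"
   "SX P6 #>\<^bsub>U\<^esub> X t1 t2 t3 t4 t5 t6 = SX P6 #>\<^bsub>U\<^esub> X s1 s2 s3 s4 s5 s6 \<longleftrightarrow>
      t1 = s1 \<and> t2 = s2 \<and> t3 = s3 \<and> t4 = s4 \<and> t5 = s5"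
  by ((subst coset_X_iff[OF normals(1) assms], blast, auto)[1],
      (subst coset_X_iff[OF normals(2) assms], blast, auto)[1],
      (subst coset_X_iff[OF normals(3) assms], blast, auto)[1],
      (subst coset_X_iff[OF normals(4) assms], blast, auto)[1])

lemma bar_SX:
  assumes 1: "\<And>t1 t2 t3 t4 t5 t6. t2 \<in> F \<Longrightarrow> t5 \<in> F \<Longrightarrow> t6 \<in> F \<Longrightarrow> P t1 t2 t3 t4 t5 t6 \<Longrightarrow>
      \<exists>a\<in>A. N #>\<^bsub>U\<^esub> X t1 t2 t3 t4 t5 t6 = f a"
    and 2: "\<And>a. a \<in> A \<Longrightarrow> \<exists>g\<in>SX P. f a = N #>\<^bsub>U\<^esub> g"
  shows "bar U N (SX P) = f ` A"
proof (intro equalityI subsetI)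
  fix Y assume "Y \<in> bar U N (SX P)"
  then obtain g where g: "g \<in> SX P" "Y = N #>\<^bsub>U\<^esub> g" by (auto simp: bar_def)
  obtain t1 t2 t3 t4 t5 t6 where t: "t2 \<in> F" "t5 \<in> F" "t6 \<in> F" "P t1 t2 t3 t4 t5 t6" "g = X t1 t2 t3 t4 t5 t6"
    using g(1) by (rule SX_cases)
  show "Y \<in> f ` A" using 1[OF t(1-4)] unfolding g(2) t(5) by blast
next
  fix Y assume "Y \<in> f ` A"
  thus "Y \<in> bar U N (SX P)" using 2 by (fastforce simp: bar_def)
qed

lemma Ubar_carrier:
  "carrier (Ubar_lin q) = bar U (X3456 q) (X2 q) <#>\<^bsub>Ubar_lin q\<^esub> bar U (X3456 q) (X1 q)"
  "carrier (Ubar3 q) = bar U (X456 q) (X2 q) <#>\<^bsub>Ubar3 q\<^esub> bar U (X456 q) (X1 q) <#>\<^bsub>Ubar3 q\<^esub> bar U (X456 q) (X3 q)"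
  "carrier (Ubar4 q) = bar U (X56 q) (X2 q) <#>\<^bsub>Ubar4 q\<^esub> bar U (X56 q) (X1 q)
     <#>\<^bsub>Ubar4 q\<^esub> bar U (X56 q) (X3 q) <#>\<^bsub>Ubar4 q\<^esub> bar U (X56 q) (X4 q)"
  "carrier (Ubar5 q) = bar U (X6 q) (X2 q) <#>\<^bsub>Ubar5 q\<^esub> bar U (X6 q) (X1 q)
     <#>\<^bsub>Ubar5 q\<^esub> bar U (X6 q) (X3 q) <#>\<^bsub>Ubar5 q\<^esub> bar U (X6 q) (X4 q) <#>\<^bsub>Ubar5 q\<^esub> bar U (X6 q) (X5 q)"
proof -
  have sub: "X1 q \<subseteq> carrier U" "X2 q \<subseteq> carrier U" "X3 q \<subseteq> carrier U" "X4 q \<subseteq> carrier U" "X5 q \<subseteq> carrier U"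
    unfolding X_sets by (rule SX_subset)+
  have sub': "X2 q <#>\<^bsub>U\<^esub> X1 q \<subseteq> carrier U" "X2 q <#>\<^bsub>U\<^esub> X1 q <#>\<^bsub>U\<^esub> X3 q \<subseteq> carrier U"
    "X2 q <#>\<^bsub>U\<^esub> X1 q <#>\<^bsub>U\<^esub> X3 q <#>\<^bsub>U\<^esub> X4 q \<subseteq> carrier U"
    by (simp only: X_products(1) SX_subset, simp only: X_products(2) SX_subset, simp only: X_products(3) SX_subset)
  note mult = U.bar_set_mult[OF normals(1)] U.bar_set_mult[OF normals(2)] U.bar_set_mult[OF normals(3)]
    U.bar_set_mult[OF normals(4)]
  \<comment> \<open>Inside a coset of N the coordinates belonging to N may be set to 0, so every
    coset meets the product of the remaining root subgroups.\<close>
  have B: "bar U (SX P) (carrier U) = bar U (SX P) (SX Q)"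
    if "\<And>t1 t2 t3 t4 t5 t6. t2 \<in> F \<Longrightarrow> t5 \<in> F \<Longrightarrow> t6 \<in> F \<Longrightarrow>
      \<exists>g\<in>SX Q. SX P #>\<^bsub>U\<^esub> X t1 t2 t3 t4 t5 t6 = SX P #>\<^bsub>U\<^esub> g" for P Q
    unfolding carrier_SX using that SX_subset[of Q] carrier_SX
    by (subst bar_SX[where A = "SX Q" and f = "\<lambda>g. SX P #>\<^bsub>U\<^esub> g"]) (auto simp: bar_def)
  show "carrier (Ubar_lin q) = bar U (X3456 q) (X2 q) <#>\<^bsub>Ubar_lin q\<^esub> bar U (X3456 q) (X1 q)"
    unfolding Ubar_lin_def X_products(9) by (simp only: mult sub sub' U.carrier_Mod_bar, simp only: X_products(1))
      (rule B, rule_tac x = "X t1 t2 0 0 0 0" in bexI, auto simp: cosets)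
  show "carrier (Ubar3 q) = bar U (X456 q) (X2 q) <#>\<^bsub>Ubar3 q\<^esub> bar U (X456 q) (X1 q)
      <#>\<^bsub>Ubar3 q\<^esub> bar U (X456 q) (X3 q)"
    unfolding Ubar3_def X_products(10) by (simp only: mult sub sub' U.carrier_Mod_bar, simp only: X_products(2))
      (rule B, rule_tac x = "X t1 t2 t3 0 0 0" in bexI, auto simp: cosets)
  show "carrier (Ubar4 q) = bar U (X56 q) (X2 q) <#>\<^bsub>Ubar4 q\<^esub> bar U (X56 q) (X1 q)
     <#>\<^bsub>Ubar4 q\<^esub> bar U (X56 q) (X3 q) <#>\<^bsub>Ubar4 q\<^esub> bar U (X56 q) (X4 q)"
    unfolding Ubar4_def X_products(11) by (simp only: mult sub sub' U.carrier_Mod_bar, simp only: X_products(3))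
      (rule B, rule_tac x = "X t1 t2 t3 t4 0 0" in bexI, auto simp: cosets)
  show "carrier (Ubar5 q) = bar U (X6 q) (X2 q) <#>\<^bsub>Ubar5 q\<^esub> bar U (X6 q) (X1 q)
     <#>\<^bsub>Ubar5 q\<^esub> bar U (X6 q) (X3 q) <#>\<^bsub>Ubar5 q\<^esub> bar U (X6 q) (X4 q) <#>\<^bsub>Ubar5 q\<^esub> bar U (X6 q) (X5 q)"
    unfolding Ubar5_def X_products(12) by (simp only: mult sub sub' U.carrier_Mod_bar, simp only: X_products(4))
      (rule B, rule_tac x = "X t1 t2 t3 t4 t5 0" in bexI, auto simp: cosets)
qed

text \<open>Each \<open>\<xi>\<close> is the inflation of the corresponding \<open>\<mu>\<close> to the preimage in \<open>U\<close> of its domain.\<close>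

definition \<xi>_lin :: "'a \<Rightarrow> 'a \<Rightarrow> ('a mat \<Rightarrow> 'a mat) \<Rightarrow> complex" where
  "\<xi>_lin A12 A23 g = (case co g of (t1, t2, t3, t4, t5, t6) \<Rightarrow> \<theta> (Tr (\<eta> * (A12 * t1))) * \<theta> (A23 * t2))"

definition \<xi>3 :: "'a \<Rightarrow> 'a \<Rightarrow> ('a mat \<Rightarrow> 'a mat) \<Rightarrow> complex" where
  "\<xi>3 A13 A12 g = (case co g of (t1, t2, t3, t4, t5, t6) \<Rightarrow> \<theta> (Tr (\<eta> * (A12 * t1 - A13 * t3))))"

definition \<xi>4 :: "'a \<Rightarrow> 'a \<Rightarrow> 'a \<Rightarrow> ('a mat \<Rightarrow> 'a mat) \<Rightarrow> complex" where
  "\<xi>4 A15 A23 A13 g = (case co g of (t1, t2, t3, t4, t5, t6) \<Rightarrow>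
     \<theta> (A23 * t2) * \<theta> (Tr (\<eta> * (- A13 * t3))) * \<theta> (Tr (\<eta> * (fr A15 * t4 + A15 * fr (fr t4)))))"

definition \<xi>5 :: "'a \<Rightarrow> 'a \<Rightarrow> 'a \<Rightarrow> 'a \<Rightarrow> ('a mat \<Rightarrow> 'a mat) \<Rightarrow> complex" where
  "\<xi>5 A16 A23 A13 A15 g = (case co g of (t1, t2, t3, t4, t5, t6) \<Rightarrow>
     \<theta> (A23 * t2) * \<theta> (Tr (\<eta> * (- A13 * t3))) * \<theta> (Tr (\<eta> * (fr A15 * t4 + A15 * fr (fr t4)))) * \<theta> (A16 * t5))"

definition \<xi>6 :: "'a \<Rightarrow> 'a \<Rightarrow> ('a mat \<Rightarrow> 'a mat) \<Rightarrow> complex" where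
  "\<xi>6 A17 A12 g = (case co g of (t1, t2, t3, t4, t5, t6) \<Rightarrow> \<theta> (Tr (\<eta> * (A12 * t1))) * \<theta> (A17 * t6))"

lemma linear_char_SX:
  assumes "\<And>t1 t2 t3 t4 t5 t6 s1 s2 s3 s4 s5 s6. t2 \<in> F \<Longrightarrow> t5 \<in> F \<Longrightarrow> t6 \<in> F \<Longrightarrow> s2 \<in> F \<Longrightarrow> s5 \<in> F \<Longrightarrow> s6 \<in> F \<Longrightarrow>
      P t1 t2 t3 t4 t5 t6 \<Longrightarrow> P s1 s2 s3 s4 s5 s6 \<Longrightarrow>
      f (t1 + s1) (t2 + s2) (t3 - s2 * t1 + s3) (c4 t1 t3 t4 s1 s2 + s4)
      (c5 t1 t3 t4 t5 s1 s2 + s5) (c6 t1 t3 t4 t5 t6 s1 s2 s3 + s6) = f t1 t2 t3 t4 t5 t6 * f s1 s2 s3 s4 s5 s6"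
    and "f 0 0 0 0 0 0 = 1"
  shows "U.linear_char (SX P) (\<lambda>g. case co g of (t1, t2, t3, t4, t5, t6) \<Rightarrow> f t1 t2 t3 t4 t5 t6)"
  unfolding U.linear_char_def
proof (intro conjI ballI)
  show "(case co \<one>\<^bsub>U\<^esub> of (t1, t2, t3, t4, t5, t6) \<Rightarrow> f t1 t2 t3 t4 t5 t6) = 1"
    using assms(2) by (simp add: X_0[symmetric])
  fix g h assume "g \<in> SX P" "h \<in> SX P"
  thus "(case co (g \<otimes>\<^bsub>U\<^esub> h) of (t1, t2, t3, t4, t5, t6) \<Rightarrow> f t1 t2 t3 t4 t5 t6) =
      (case co g of (t1, t2, t3, t4, t5, t6) \<Rightarrow> f t1 t2 t3 t4 t5 t6) *
      (case co h of (t1, t2, t3, t4, t5, t6) \<Rightarrow> f t1 t2 t3 t4 t5 t6)"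
    by (elim SX_cases) (simp add: x_elt_mult assms(1))
qed

text \<open>Each exponent uses only coordinates in which the multiplication law, restricted to the
  subgroup, is additive.\<close>

lemma linear_chars:
  "A23 \<in> F \<Longrightarrow> U.linear_char (SX (\<lambda>t1 t2 t3 t4 t5 t6. True)) (\<xi>_lin A12 A23)"
  "U.linear_char (SX P13456) (\<xi>3 A13 A12)"
  "A23 \<in> F \<Longrightarrow> U.linear_char (SX P23456) (\<xi>4 A15 A23 A13)"
  "A16 \<in> F \<Longrightarrow> A23 \<in> F \<Longrightarrow> U.linear_char (SX P23456) (\<xi>5 A16 A23 A13 A15)"
  "A17 \<in> F \<Longrightarrow> U.linear_char (SX P1456) (\<xi>6 A17 A12)"
  unfolding \<xi>_lin_def[abs_def] \<xi>3_def[abs_def] \<xi>4_def[abs_def] \<xi>5_def[abs_def] \<xi>6_def[abs_def]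
  by (rule linear_char_SX, simp_all add: theta_add theta_diff theta_neq_0 distrib_left
      right_diff_distrib c_s2_0 c_s1_0 theta_minus divide_inverse mult_ac)+

abbreviation "K_lin \<equiv> (\<lambda>(t2, t1). SX P3456 #>\<^bsub>U\<^esub> X t1 t2 0 0 0 0)"
abbreviation "K3 \<equiv> (\<lambda>(t1, t3). SX P456 #>\<^bsub>U\<^esub> X t1 0 t3 0 0 0)"
abbreviation "K4 \<equiv> (\<lambda>(t2, t3, t4). SX P56 #>\<^bsub>U\<^esub> X 0 t2 t3 t4 0 0)"
abbreviation "K5 \<equiv> (\<lambda>(t2, t3, t4, t5). SX P6 #>\<^bsub>U\<^esub> X 0 t2 t3 t4 t5 0)"

lemma on_coords_cong:
  assumes "\<And>t. t \<in> A \<Longrightarrow> P t = Q t" shows "on_coords A P f = on_coords A Q f"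
proof -
  have "P ` A = Q ` A" using assms by (intro image_cong) auto
  moreover have "the_inv_into A P g = the_inv_into A Q g" for g
    unfolding the_inv_into_def using assms by (intro arg_cong[where f = The] ext) auto
  ultimately show ?thesis by (simp add: on_coords_def)
qed

text \<open>The parametrisations by products of cosets are replaced by cosets of single elements in
  normal form.\<close>

lemma \<mu>_coords:
  "\<mu>_lin q \<eta> \<theta> A12 A23 = on_coords (F \<times> UNIV) K_lin (\<lambda>(t2, t1). \<theta> (Tr (\<eta> * (A12 * t1))) * \<theta> (A23 * t2))"
  "\<mu>3 q \<eta> \<theta> A13 A12 = on_coords UNIV K3 (\<lambda>(t1, t3). \<theta> (Tr (\<eta> * (A12 * t1 - A13 * t3))))"
  "\<mu>4 q \<eta> \<theta> A15 A23 A13 = on_coords (F \<times> UNIV \<times> UNIV) K4 (\<lambda>(t2, t3, t4). \<theta> (A23 * t2)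
     * \<theta> (Tr (\<eta> * (- A13 * t3))) * \<theta> (Tr (\<eta> * (fr A15 * t4 + A15 * fr (fr t4)))))"
  "\<mu>5 q \<eta> \<theta> A16 A23 A13 A15 = on_coords (F \<times> UNIV \<times> UNIV \<times> F) K5 (\<lambda>(t2, t3, t4, t5). \<theta> (A23 * t2)
     * \<theta> (Tr (\<eta> * (- A13 * t3))) * \<theta> (Tr (\<eta> * (fr A15 * t4 + A15 * fr (fr t4)))) * \<theta> (A16 * t5))"
  unfolding \<mu>_lin_def \<mu>3_def \<mu>4_def \<mu>5_def Ubar_lin_def Ubar3_def Ubar4_def Ubar5_def pi_eq power_q X_products
  by (rule on_coords_cong; force simp: x_elt_single U.coset_mult normals x_elt_mult simp del: mult_FactGroup)+

lemma inj_K: "inj_on K_lin (F \<times> UNIV)" "inj K3" "inj_on K4 (F \<times> UNIV \<times> UNIV)" "inj_on K5 (F \<times> UNIV \<times> UNIV \<times> F)"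
  by (auto simp: inj_on_def cosets)

lemma bar_K:
  "bar U (SX P3456) (carrier U) = K_lin ` (F \<times> UNIV)"
  "bar U (SX P456) (SX P13456) = range K3"
  "bar U (SX P56) (SX P23456) = K4 ` (F \<times> UNIV \<times> UNIV)"
  "bar U (SX P6) (SX P23456) = K5 ` (F \<times> UNIV \<times> UNIV \<times> F)"
proof -
  show "bar U (SX P3456) (carrier U) = K_lin ` (F \<times> UNIV)"
    unfolding carrier_SX
  proof (rule bar_SX)
    fix t1 t2 t3 t4 t5 t6 :: 'a assume "t2 \<in> F" "t5 \<in> F" "t6 \<in> F"
    thus "\<exists>a\<in>F \<times> UNIV. SX P3456 #>\<^bsub>U\<^esub> X t1 t2 t3 t4 t5 t6 = K_lin a"
      by (intro bexI[of _ "(t2, t1)"]) (auto simp: cosets)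
  qed (force intro: X_in_SX[THEN iffD2])
  show "bar U (SX P456) (SX P13456) = range K3"
  proof (rule bar_SX)
    fix t1 t2 t3 t4 t5 t6 :: 'a assume "t2 \<in> F" "t5 \<in> F" "t6 \<in> F" "t2 = 0"
    thus "\<exists>a\<in>UNIV. SX P456 #>\<^bsub>U\<^esub> X t1 t2 t3 t4 t5 t6 = K3 a"
      by (intro bexI[of _ "(t1, t3)"]) (auto simp: cosets)
  qed (force intro: X_in_SX[THEN iffD2])
  show "bar U (SX P56) (SX P23456) = K4 ` (F \<times> UNIV \<times> UNIV)"
  proof (rule bar_SX)
    fix t1 t2 t3 t4 t5 t6 :: 'a assume "t2 \<in> F" "t5 \<in> F" "t6 \<in> F" "t1 = 0"
    thus "\<exists>a\<in>F \<times> UNIV \<times> UNIV. SX P56 #>\<^bsub>U\<^esub> X t1 t2 t3 t4 t5 t6 = K4 a"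
      by (intro bexI[of _ "(t2, t3, t4)"]) (auto simp: cosets)
  qed (force intro: X_in_SX[THEN iffD2])
  show "bar U (SX P6) (SX P23456) = K5 ` (F \<times> UNIV \<times> UNIV \<times> F)"
  proof (rule bar_SX)
    fix t1 t2 t3 t4 t5 t6 :: 'a assume "t2 \<in> F" "t5 \<in> F" "t6 \<in> F" "t1 = 0"
    thus "\<exists>a\<in>F \<times> UNIV \<times> UNIV \<times> F. SX P6 #>\<^bsub>U\<^esub> X t1 t2 t3 t4 t5 t6 = K5 a"
      by (intro bexI[of _ "(t2, t3, t4, t5)"]) (auto simp: cosets)
  qed (force intro: X_in_SX[THEN iffD2])
qed

text \<open>The root subgroups missing from the product lie in N, so the product has the same image
  as the full coordinate subgroup. In this form \<open>lift_ind_char\<close> applies.\<close>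

lemma Hbar_eq:
  "Hbar3 q = bar U (SX P456) (SX P13456)"
  "Hbar4 q = bar U (SX P56) (SX P23456)"
  "Hbar5 q = bar U (SX P6) (SX P23456)"
proof -
  have sub: "X1 q \<subseteq> carrier U" "X2 q \<subseteq> carrier U" "X3 q \<subseteq> carrier U" "X4 q \<subseteq> carrier U" "X5 q \<subseteq> carrier U"
    unfolding X_sets by (rule SX_subset)+
  have "X2 q <#>\<^bsub>U\<^esub> X3 q = SX (\<lambda>t1 t2 t3 t4 t5 t6. t1 = 0 \<and> t4 = 0 \<and> t5 = 0 \<and> t6 = 0)"
    by (rule Set.set_eqI, simp add: set_mult_iff bex_set_mult X2_def X3_def
      x_elt_single x_elt_mult SX_def image_iff cong: bex_cong conj_cong; blast)
  hence sub': "X2 q <#>\<^bsub>U\<^esub> X3 q \<subseteq> carrier U" using SX_subset by simp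
  have sub'': "X2 q <#>\<^bsub>U\<^esub> X3 q <#>\<^bsub>U\<^esub> X4 q \<subseteq> carrier U" by (simp only: X_products(6) SX_subset)
  note mult = U.bar_set_mult[OF normals(1)] U.bar_set_mult[OF normals(2)] U.bar_set_mult[OF normals(3)]
    U.bar_set_mult[OF normals(4)]
  have "Hbar3 q = bar U (SX P456) (X1 q <#>\<^bsub>U\<^esub> X3 q)"
    unfolding Hbar3_def Ubar3_def X_products(10) by (simp only: mult sub)
  also have "\<dots> = range K3" unfolding X_products(5)
  proof (rule bar_SX)
    fix t1 t2 t3 t4 t5 t6 :: 'a assume "t2 = 0 \<and> t4 = 0 \<and> t5 = 0 \<and> t6 = 0"
    thus "\<exists>a\<in>UNIV. SX P456 #>\<^bsub>U\<^esub> X t1 t2 t3 t4 t5 t6 = K3 a"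
      by (intro bexI[of _ "(t1, t3)"]) auto
  qed (force intro: X_in_SX[THEN iffD2])
  finally show "Hbar3 q = bar U (SX P456) (SX P13456)" unfolding bar_K .
  have "Hbar4 q = bar U (SX P56) (X2 q <#>\<^bsub>U\<^esub> X3 q <#>\<^bsub>U\<^esub> X4 q)"
    unfolding Hbar4_def Ubar4_def X_products(11) by (simp only: mult sub sub')
  also have "\<dots> = K4 ` (F \<times> UNIV \<times> UNIV)" unfolding X_products(6)
  proof (rule bar_SX)
    fix t1 t2 t3 t4 t5 t6 :: 'a assume "t1 = 0 \<and> t5 = 0 \<and> t6 = 0" "t2 \<in> F"
    thus "\<exists>a\<in>F \<times> UNIV \<times> UNIV. SX P56 #>\<^bsub>U\<^esub> X t1 t2 t3 t4 t5 t6 = K4 a"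
      by (intro bexI[of _ "(t2, t3, t4)"]) auto
  qed (force intro: X_in_SX[THEN iffD2])
  finally show "Hbar4 q = bar U (SX P56) (SX P23456)" unfolding bar_K .
  have "Hbar5 q = bar U (SX P6) (X2 q <#>\<^bsub>U\<^esub> X3 q <#>\<^bsub>U\<^esub> X4 q <#>\<^bsub>U\<^esub> X5 q)"
    unfolding Hbar5_def Ubar5_def X_products(12) by (simp only: mult sub sub' sub'')
  also have "\<dots> = K5 ` (F \<times> UNIV \<times> UNIV \<times> F)" unfolding X_products(7)
  proof (rule bar_SX)
    fix t1 t2 t3 t4 t5 t6 :: 'a assume "t1 = 0 \<and> t6 = 0" "t2 \<in> F" "t5 \<in> F"
    thus "\<exists>a\<in>F \<times> UNIV \<times> UNIV \<times> F. SX P6 #>\<^bsub>U\<^esub> X t1 t2 t3 t4 t5 t6 = K5 a"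
      by (intro bexI[of _ "(t2, t3, t4, t5)"]) auto
  qed (force intro: X_in_SX[THEN iffD2])
  finally show "Hbar5 q = bar U (SX P6) (SX P23456)" unfolding bar_K .
qed

lemma \<mu>_coset:
  "h \<in> carrier U \<Longrightarrow> \<mu>_lin q \<eta> \<theta> A12 A23 (SX P3456 #>\<^bsub>U\<^esub> h) = \<xi>_lin A12 A23 h"
  "h \<in> SX P13456 \<Longrightarrow> \<mu>3 q \<eta> \<theta> A13 A12 (SX P456 #>\<^bsub>U\<^esub> h) = \<xi>3 A13 A12 h"
  "h \<in> SX P23456 \<Longrightarrow> \<mu>4 q \<eta> \<theta> A15 A23 A13 (SX P56 #>\<^bsub>U\<^esub> h) = \<xi>4 A15 A23 A13 h"
  "h \<in> SX P23456 \<Longrightarrow> \<mu>5 q \<eta> \<theta> A16 A23 A13 A15 (SX P6 #>\<^bsub>U\<^esub> h) = \<xi>5 A16 A23 A13 A15 h"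
proof -
  assume "h \<in> carrier U"
  then obtain t1 t2 t3 t4 t5 t6 where t: "t2 \<in> F" "t5 \<in> F" "t6 \<in> F" "h = X t1 t2 t3 t4 t5 t6"
    using U_cases by metis
  hence "SX P3456 #>\<^bsub>U\<^esub> h = K_lin (t2, t1)" by (simp add: cosets)
  thus "\<mu>_lin q \<eta> \<theta> A12 A23 (SX P3456 #>\<^bsub>U\<^esub> h) = \<xi>_lin A12 A23 h"
    unfolding \<mu>_coords using on_coords_apply[OF inj_K(1), of "(t2, t1)"] t by (simp add: \<xi>_lin_def)
next
  assume "h \<in> SX P13456"
  then obtain t1 t2 t3 t4 t5 t6 where t: "t2 \<in> F" "t5 \<in> F" "t6 \<in> F" "t2 = 0" "h = X t1 t2 t3 t4 t5 t6"
    by (rule SX_cases)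
  hence "SX P456 #>\<^bsub>U\<^esub> h = K3 (t1, t3)" by (simp add: cosets)
  thus "\<mu>3 q \<eta> \<theta> A13 A12 (SX P456 #>\<^bsub>U\<^esub> h) = \<xi>3 A13 A12 h"
    unfolding \<mu>_coords using on_coords_apply[OF inj_K(2), of "(t1, t3)"] t by (simp add: \<xi>3_def)
next
  assume "h \<in> SX P23456"
  then obtain t1 t2 t3 t4 t5 t6 where t: "t2 \<in> F" "t5 \<in> F" "t6 \<in> F" "t1 = 0" "h = X t1 t2 t3 t4 t5 t6"
    by (rule SX_cases)
  hence "SX P56 #>\<^bsub>U\<^esub> h = K4 (t2, t3, t4)" by (simp add: cosets)
  thus "\<mu>4 q \<eta> \<theta> A15 A23 A13 (SX P56 #>\<^bsub>U\<^esub> h) = \<xi>4 A15 A23 A13 h"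
    unfolding \<mu>_coords using on_coords_apply[OF inj_K(3), of "(t2, t3, t4)"] t by (simp add: \<xi>4_def)
  have "SX P6 #>\<^bsub>U\<^esub> h = K5 (t2, t3, t4, t5)" using t by (simp add: cosets)
  thus "\<mu>5 q \<eta> \<theta> A16 A23 A13 A15 (SX P6 #>\<^bsub>U\<^esub> h) = \<xi>5 A16 A23 A13 A15 h"
    unfolding \<mu>_coords using on_coords_apply[OF inj_K(4), of "(t2, t3, t4, t5)"] t by (simp add: \<xi>5_def)
qed

lemma \<mu>_Irr:
  "A23 \<in> F \<Longrightarrow> \<mu>_lin q \<eta> \<theta> A12 A23 \<in> Irr (Ubar_lin q)"
  "\<mu>3 q \<eta> \<theta> A13 A12 \<in> Irr ((Ubar3 q)\<lparr>carrier := Hbar3 q\<rparr>)"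
  "A23 \<in> F \<Longrightarrow> \<mu>4 q \<eta> \<theta> A15 A23 A13 \<in> Irr ((Ubar4 q)\<lparr>carrier := Hbar4 q\<rparr>)"
  "A16 \<in> F \<Longrightarrow> A23 \<in> F \<Longrightarrow> \<mu>5 q \<eta> \<theta> A16 A23 A13 A15 \<in> Irr ((Ubar5 q)\<lparr>carrier := Hbar5 q\<rparr>)"
proof -
  have "Ubar_lin q = (U Mod SX P3456)\<lparr>carrier := bar U (SX P3456) (carrier U)\<rparr>"
    unfolding Ubar_lin_def X_products U.carrier_Mod_bar[symmetric] by simp
  moreover assume "A23 \<in> F"
  ultimately show "\<mu>_lin q \<eta> \<theta> A12 A23 \<in> Irr (Ubar_lin q)"
    using U.quotient_linear_in_Irr[OF normals(1) U.subgroup_self linear_chars(1)[of A23 A12, folded carrier_SX]]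
      \<mu>_coset(1) on_coords_extensional[of "F \<times> UNIV" K_lin] unfolding bar_K \<mu>_coords by simp
next
  show "\<mu>3 q \<eta> \<theta> A13 A12 \<in> Irr ((Ubar3 q)\<lparr>carrier := Hbar3 q\<rparr>)"
    unfolding Ubar3_def Hbar_eq X_products
    by (rule U.quotient_linear_in_Irr[OF normals(2) subgroups(5) linear_chars(2) \<mu>_coset(2)])
      (simp_all only: bar_K \<mu>_coords on_coords_extensional)
next
  assume "A23 \<in> F"
  thus "\<mu>4 q \<eta> \<theta> A15 A23 A13 \<in> Irr ((Ubar4 q)\<lparr>carrier := Hbar4 q\<rparr>)"
    unfolding Ubar4_def Hbar_eq X_products
    by (intro U.quotient_linear_in_Irr[OF normals(3) subgroups(6) linear_chars(3) \<mu>_coset(3)])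
      (simp_all only: bar_K \<mu>_coords on_coords_extensional)
next
  assume "A16 \<in> F" "A23 \<in> F"
  thus "\<mu>5 q \<eta> \<theta> A16 A23 A13 A15 \<in> Irr ((Ubar5 q)\<lparr>carrier := Hbar5 q\<rparr>)"
    unfolding Ubar5_def Hbar_eq X_products
    by (intro U.quotient_linear_in_Irr[OF normals(4) subgroups(6) linear_chars(4) \<mu>_coset(4)])
      (simp_all only: bar_K \<mu>_coords on_coords_extensional)
qed

lemma SX_mono: "(\<And>t1 t2 t3 t4 t5 t6. P t1 t2 t3 t4 t5 t6 \<Longrightarrow> Q t1 t2 t3 t4 t5 t6) \<Longrightarrow> SX P \<subseteq> SX Q"
  by (auto elim!: SX_cases)

lemma \<chi>_lin_eq: "\<chi>_lin q \<eta> \<theta> A12 A23 = (\<lambda>g\<in>carrier U. \<xi>_lin A12 A23 g)"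
  unfolding \<chi>_lin_def lift_char_def X_products by (rule restrict_ext) (rule \<mu>_coset(1))

lemma \<chi>3_eq: "\<chi>3 q \<eta> \<theta> A13 A12 = ind_char U (SX P13456) (\<xi>3 A13 A12)"
  unfolding \<chi>3_def Hbar_eq Ubar3_def X_products
  by (rule U.lift_ind_char_eq[OF finite_U normals(2) subgroups(5)], rule SX_mono, simp, rule \<mu>_coset(2))

lemma \<chi>4_eq: "\<chi>4 q \<eta> \<theta> A15 A23 = ind_char U (SX P23456) (\<xi>4 A15 A23 0)"
  unfolding \<chi>4_def Hbar_eq Ubar4_def X_products
  by (rule U.lift_ind_char_eq[OF finite_U normals(3) subgroups(6)], rule SX_mono, simp, rule \<mu>_coset(3))

lemma \<chi>5_eq: "\<chi>5 q \<eta> \<theta> A16 A23 A13 = ind_char U (SX P23456) (\<xi>5 A16 A23 A13 0)"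
  unfolding \<chi>5_def Hbar_eq Ubar5_def X_products
  by (rule U.lift_ind_char_eq[OF finite_U normals(4) subgroups(6)], rule SX_mono, simp, rule \<mu>_coset(4))

end

section \<open>Transversals and explicit conjugates\<close>

lemma (in group) transversalI:
  assumes H: "subgroup H G" and f: "\<And>i. i \<in> I \<Longrightarrow> f i \<in> carrier G"
    and inj: "\<And>i j. i \<in> I \<Longrightarrow> j \<in> I \<Longrightarrow> inv (f i) \<otimes> f j \<in> H \<Longrightarrow> i = j"
    and surj: "\<And>g. g \<in> carrier G \<Longrightarrow> \<exists>i\<in>I. inv (f i) \<otimes> g \<in> H"
  shows "transversal I f H"
  unfolding transversal_def
proof
  have HG: "H \<subseteq> carrier G" using H by (rule subgroup.subset)
  show "f ` I \<subseteq> carrier G" using f by auto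
  show "bij_betw (\<lambda>(i, h). f i \<otimes> h) (I \<times> H) (carrier G)"
    unfolding bij_betw_def
  proof
    show "inj_on (\<lambda>(i, h). f i \<otimes> h) (I \<times> H)"
    proof (rule inj_onI, clarify)
      fix i h j k assume ij: "i \<in> I" "j \<in> I" and hk: "h \<in> H" "k \<in> H" and eq: "f i \<otimes> h = f j \<otimes> k"
      have G: "f i \<in> carrier G" "f j \<in> carrier G" "h \<in> carrier G" "k \<in> carrier G" using f ij hk HG by auto
      have "f i \<otimes> (h \<otimes> inv k) = f j" using eq G by (simp add: m_assoc[symmetric]) (simp add: m_assoc)
      hence "inv (f i) \<otimes> f j = inv (f i) \<otimes> (f i \<otimes> (h \<otimes> inv k))" by simp
      also have "\<dots> = h \<otimes> inv k" using G by (simp add: m_assoc[symmetric])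
      also have "\<dots> \<in> H" using hk H by (intro subgroup.m_closed subgroup.m_inv_closed)
      finally have "i = j" by (rule inj[OF ij])
      thus "i = j \<and> h = k" using eq G by simp
    qed
    show "(\<lambda>(i, h). f i \<otimes> h) ` (I \<times> H) = carrier G"
    proof (intro equalityI subsetI)
      fix g assume g: "g \<in> carrier G"
      then obtain i where i: "i \<in> I" "inv (f i) \<otimes> g \<in> H" using surj by blast
      have "g = f i \<otimes> (inv (f i) \<otimes> g)" using f[OF i(1)] g by (simp add: m_assoc[symmetric])
      with i show "g \<in> (\<lambda>(i, h). f i \<otimes> h) ` (I \<times> H)" by (intro rev_image_eqI[of "(i, inv (f i) \<otimes> g)"]) auto
    qed (use f HG in auto)
  qed
qed

context triality
begin

lemma transversals:
  "U.transversal F (\<lambda>r. X 0 r 0 0 0 0) (SX P13456)"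
  "U.transversal UNIV (\<lambda>r. X r 0 0 0 0 0) (SX P23456)"
  "U.transversal (F \<times> UNIV) (\<lambda>(r2, r3). X 0 r2 r3 0 0 0) (SX P1456)"
proof -
  show "U.transversal F (\<lambda>r. X 0 r 0 0 0 0) (SX P13456)"
  proof (rule U.transversalI[OF subgroups(5)])
    fix g assume "g \<in> carrier U"
    thus "\<exists>i\<in>F. inv\<^bsub>U\<^esub> X 0 i 0 0 0 0 \<otimes>\<^bsub>U\<^esub> g \<in> SX P13456"
    proof (elim U_cases)
      fix t1 t2 t3 t4 t5 t6 assume "t2 \<in> F" "t5 \<in> F" "t6 \<in> F" "g = X t1 t2 t3 t4 t5 t6"
      thus ?thesis by (intro bexI[of _ t2]) (simp_all add: inv_X x_elt_mult)
    qed
  qed (auto simp: inv_X x_elt_mult)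
  show "U.transversal UNIV (\<lambda>r. X r 0 0 0 0 0) (SX P23456)"
  proof (rule U.transversalI[OF subgroups(6)])
    fix g assume "g \<in> carrier U"
    thus "\<exists>i\<in>UNIV. inv\<^bsub>U\<^esub> X i 0 0 0 0 0 \<otimes>\<^bsub>U\<^esub> g \<in> SX P23456"
    proof (elim U_cases)
      fix t1 t2 t3 t4 t5 t6 assume "t2 \<in> F" "t5 \<in> F" "t6 \<in> F" "g = X t1 t2 t3 t4 t5 t6"
      thus ?thesis by (intro bexI[of _ t1]) (simp_all add: inv_X x_elt_mult)
    qed
  qed (auto simp: inv_X x_elt_mult)
  show "U.transversal (F \<times> UNIV) (\<lambda>(r2, r3). X 0 r2 r3 0 0 0) (SX P1456)"
  proof (rule U.transversalI[OF subgroups(7)])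
    fix g assume "g \<in> carrier U"
    thus "\<exists>i\<in>F \<times> UNIV. inv\<^bsub>U\<^esub> (case i of (r2, r3) \<Rightarrow> X 0 r2 r3 0 0 0) \<otimes>\<^bsub>U\<^esub> g \<in> SX P1456"
    proof (elim U_cases)
      fix t1 t2 t3 t4 t5 t6 assume "t2 \<in> F" "t5 \<in> F" "t6 \<in> F" "g = X t1 t2 t3 t4 t5 t6"
      thus ?thesis by (intro bexI[of _ "(t2, t3)"]) (simp_all add: inv_X x_elt_mult)
    qed
  qed (auto simp: inv_X x_elt_mult)
qed

text \<open>Each of the four conjugation lemmas leaves open the coordinates that the linear
  characters evaluated with it ignore.\<close>

lemma conj_13456:
  assumes t: "t5 \<in> F" "t6 \<in> F" and r: "r2 \<in> F" "r5 \<in> F" "r6 \<in> F"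
  obtains s4 s5 s6 where "s5 \<in> F" "s6 \<in> F"
    "inv\<^bsub>U\<^esub> X r1 r2 r3 r4 r5 r6 \<otimes>\<^bsub>U\<^esub> X t1 0 t3 t4 t5 t6 \<otimes>\<^bsub>U\<^esub> X r1 r2 r3 r4 r5 r6 = X t1 0 (t3 - r2 * t1) s4 s5 s6"
  by (rule conj_X_obtain[OF F_closed(1) t r, of r1 r3 r4 t1 t3 t4]) (simp add: that)

lemma conj_23456:
  assumes t: "t2 \<in> F" "t5 \<in> F" "t6 \<in> F" and r: "r2 \<in> F" "r5 \<in> F" "r6 \<in> F"
  obtains s6 where "s6 \<in> F"
    "inv\<^bsub>U\<^esub> X r1 r2 r3 r4 r5 r6 \<otimes>\<^bsub>U\<^esub> X 0 t2 t3 t4 t5 t6 \<otimes>\<^bsub>U\<^esub> X r1 r2 r3 r4 r5 r6 =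
      X 0 t2 (t3 + t2 * r1) (t4 - r1 * fr t3 - fr r1 * t3 - t2 * r1 * fr r1)
        (t5 + Tr (r1 * fr r1 * fr (fr t3)) - Tr (r1 * fr t4) + t2 * Nm r1) s6"
proof -
  obtain s3 s4 s5 s6 where s: "s5 \<in> F" "s6 \<in> F"
    "inv\<^bsub>U\<^esub> X r1 r2 r3 r4 r5 r6 \<otimes>\<^bsub>U\<^esub> X 0 t2 t3 t4 t5 t6 \<otimes>\<^bsub>U\<^esub> X r1 r2 r3 r4 r5 r6 = X 0 t2 s3 s4 s5 s6"
    "s3 = t3 - r2 * 0 + t2 * r1" "c4 r1 r3 r4 0 t2 + s4 = c4 0 t3 t4 r1 r2 + r4"
    "c5 r1 r3 r4 r5 0 t2 + s5 = c5 0 t3 t4 t5 r1 r2 + r5"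
    by (rule conj_X_obtain[OF t r, of r1 r3 r4 0 t3 t4])
  have "s4 = t4 - r1 * fr t3 - fr r1 * t3 - t2 * r1 * fr r1"
    using s(5) by (simp add: c_s1_0 c_t1_0 algebra_simps)
  moreover have "s5 = t5 + Tr (r1 * fr r1 * fr (fr t3)) - Tr (r1 * fr t4) + t2 * Nm r1"
    using s(6) by (simp add: c_s1_0 c_t1_0 algebra_simps)
  ultimately show ?thesis using that[OF s(2)] s(3,4) by simp
qed

lemma conj_456:
  assumes t: "t5 \<in> F" "t6 \<in> F" and r: "r2 \<in> F" "r5 \<in> F" "r6 \<in> F"
  obtains s4 s5 where "s5 \<in> F"
    "inv\<^bsub>U\<^esub> X r1 r2 r3 r4 r5 r6 \<otimes>\<^bsub>U\<^esub> X 0 0 0 t4 t5 t6 \<otimes>\<^bsub>U\<^esub> X r1 r2 r3 r4 r5 r6 =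
      X 0 0 0 s4 s5 (t6 - r2 * t5 - Tr (r3 * fr t4))"
proof -
  obtain s3 s4 s5 s6 where s: "s5 \<in> F" "s6 \<in> F"
    "inv\<^bsub>U\<^esub> X r1 r2 r3 r4 r5 r6 \<otimes>\<^bsub>U\<^esub> X 0 0 0 t4 t5 t6 \<otimes>\<^bsub>U\<^esub> X r1 r2 r3 r4 r5 r6 = X 0 0 s3 s4 s5 s6"
    "s3 = 0 - r2 * 0 + 0 * r1" "c6 r1 r3 r4 r5 r6 0 0 s3 + s6 = c6 0 0 t4 t5 t6 r1 r2 r3 + r6"
    by (rule conj_X_obtain[OF F_closed(1) t r, of r1 r3 r4 0 0 t4])
  have "s6 = t6 - r2 * t5 - Tr (r3 * fr t4)" using s(4,5) by (simp add: algebra_simps)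
  thus ?thesis using that[OF s(1)] s(3,4) by simp
qed

lemma conj_1456:
  assumes t: "t2 \<in> F" "t5 \<in> F" "t6 \<in> F" and r: "r2 \<in> F"
  obtains s4 s5 s6 where "s5 \<in> F" "s6 \<in> F"
    "inv\<^bsub>U\<^esub> X 0 r2 r3 0 0 0 \<otimes>\<^bsub>U\<^esub> X t1 t2 t3 t4 t5 t6 \<otimes>\<^bsub>U\<^esub> X 0 r2 r3 0 0 0 = X t1 t2 (t3 - r2 * t1) s4 s5 s6"
    "t2 = 0 \<Longrightarrow> t3 = r2 * t1 \<Longrightarrow> s6 = c6 t1 t3 t4 t5 t6 0 r2 r3 - Tr (t1 * fr r3 * fr (fr r3))"
proof -
  obtain s3 s4 s5 s6 where s: "s5 \<in> F" "s6 \<in> F"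
    "inv\<^bsub>U\<^esub> X 0 r2 r3 0 0 0 \<otimes>\<^bsub>U\<^esub> X t1 t2 t3 t4 t5 t6 \<otimes>\<^bsub>U\<^esub> X 0 r2 r3 0 0 0 = X t1 t2 s3 s4 s5 s6"
    "s3 = t3 - r2 * t1 + t2 * 0" "c6 0 r3 0 0 0 t1 t2 s3 + s6 = c6 t1 t3 t4 t5 t6 0 r2 r3 + 0"
    by (rule conj_X_obtain[OF t r F_closed(1,1), of 0 r3 0 t1 t3 t4])
  have "s6 = c6 t1 t3 t4 t5 t6 0 r2 r3 - Tr (t1 * fr r3 * fr (fr r3))" if "t2 = 0" "t3 = r2 * t1"
    using s(5) that unfolding s(4) by (simp add: c_s2_0(3)[of 0] algebra_simps)
  thus ?thesis using that[OF s(1,2)] s(3,4) by simp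
qed

lemma Tr_mult_fr: "Tr (a * fr b) = Tr (fr (fr a) * b)" "Tr (a * fr (fr b)) = Tr (fr a * b)"
  by (simp_all add: Tr_def algebra_simps)

text \<open>The coefficient B for which the exponent Tr (\<eta> (A^q s + A s^(q^2))) becomes Tr (B
  s): invariance of the trace under Frobenius moves all powers from s to the coefficient.\<close>

definition coeff4 :: "'a \<Rightarrow> 'a" where "coeff4 A = fr A * (\<eta> + fr \<eta>)"

lemma Tr_coeff4: "Tr (\<eta> * (fr A * s + A * fr (fr s))) = Tr (coeff4 A * s)"
proof -
  have "Tr (\<eta> * (fr A * s + A * fr (fr s))) = Tr (\<eta> * fr A * s) + Tr ((\<eta> * A) * fr (fr s))"
    by (simp add: distrib_left mult.assoc)
  also have "\<dots> = Tr (\<eta> * fr A * s + fr (\<eta> * A) * s)" by (simp add: Tr_mult_fr)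
  also have "\<eta> * fr A * s + fr (\<eta> * A) * s = coeff4 A * s" by (simp add: coeff4_def algebra_simps)
  finally show ?thesis .
qed

text \<open>Otherwise Tr \<eta> = 1 would read \<eta>^(q^2) = 1, so \<eta> = 1 would lie in
  F.\<close>

lemma eta_fr_eta_neq_0: "\<eta> + fr \<eta> \<noteq> 0"
proof
  assume "\<eta> + fr \<eta> = 0"
  hence "fr (fr \<eta>) = 1" using eta(2) by (simp add: Tr_def)
  hence "\<eta> = 1" using fr_fr_fr[of \<eta>] by simp
  thus False using eta(1) by simp
qed

lemma coeff4_eq_iff: "coeff4 A = coeff4 B \<longleftrightarrow> A = B"
proof
  assume "coeff4 A = coeff4 B"
  hence "fr A = fr B" using eta_fr_eta_neq_0 by (simp add: coeff4_def)
  hence "fr (fr (fr A)) = fr (fr (fr B))" by (simp only:)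
  thus "A = B" by simp
qed simp

lemma coeff4_0 [simp]: "coeff4 0 = 0" by (simp add: coeff4_def)

lemma coeff4_eq_0 [simp]: "coeff4 A = 0 \<longleftrightarrow> A = 0"
  using coeff4_eq_iff[of A 0] by simp

text \<open>If the sum vanishes, then \<open>w = fr B * fr d * B\<close> satisfies \<open>fr w = - w\<close>.\<close>

lemma twisted_sum_eq_0:
  assumes "B \<noteq> 0" "fr (fr (B * d)) + B * fr d = 0" shows "d = 0"
proof -
  have "fr (fr B) * fr (fr d) = - (B * fr d)" using assms(2) by (simp add: add_eq_0_iff2)
  hence "fr (fr B * fr d * B) = - (fr B * fr d * B)" by (simp add: mult_ac)
  hence "fr B * fr d * B = 0" by (rule fr_eq_minus)
  thus ?thesis using assms(1) by simp
qed

lemma Tr_twisted: "Tr (B * (r * fr t + fr r * t)) = Tr ((fr (fr (B * r)) + B * fr r) * t)"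
proof -
  have "Tr (B * (r * fr t + fr r * t)) = Tr ((B * r) * fr t) + Tr (B * fr r * t)"
    by (simp add: distrib_left mult.assoc)
  also have "\<dots> = Tr (fr (fr (B * r)) * t + B * fr r * t)" by (simp add: Tr_mult_fr)
  finally show ?thesis by (simp add: distrib_right)
qed

text \<open>Conjugating x3(t) by x1(r) shifts the fourth coordinate by r t^q + r^q t up to sign.
  Once Frobenius is moved off t, the coefficient of t is additive in r with trivial kernel by
  \<open>twisted_sum_eq_0\<close>, so different r give different characters of X3.\<close>

lemma twisted_char_nondegenerate:
  assumes "B \<noteq> 0" "\<And>t. \<theta> (Tr (B * (r * fr t + fr r * t))) = \<theta> (Tr (B * (s * fr t + fr s * t)))"
  shows "r = s"
proof -
  have "fr (fr (B * r)) + B * fr r = fr (fr (B * s)) + B * fr s"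
    by (rule theta_Tr_nondegenerate) (use assms(2) in \<open>simp only: Tr_twisted\<close>)
  hence "fr (fr (B * (r - s))) + B * fr (r - s) = 0" by (simp add: algebra_simps)
  hence "r - s = 0" by (rule twisted_sum_eq_0[OF assms(1)])
  thus ?thesis by simp
qed

section \<open>Irreducibility and distinctness of the families\<close>

lemma \<xi>3_X: "t2 \<in> F \<Longrightarrow> t5 \<in> F \<Longrightarrow> t6 \<in> F \<Longrightarrow>
    \<xi>3 A13 A12 (X t1 t2 t3 t4 t5 t6) = \<theta> (Tr (\<eta> * (A12 * t1 - A13 * t3)))"
  and \<xi>4_X: "t2 \<in> F \<Longrightarrow> t5 \<in> F \<Longrightarrow> t6 \<in> F \<Longrightarrow>
    \<xi>4 A15 A23 0 (X t1 t2 t3 t4 t5 t6) = \<theta> (A23 * t2) * \<theta> (Tr (coeff4 A15 * t4))"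
  and \<xi>5_X: "t2 \<in> F \<Longrightarrow> t5 \<in> F \<Longrightarrow> t6 \<in> F \<Longrightarrow>
    \<xi>5 A16 A23 A13 0 (X t1 t2 t3 t4 t5 t6) = \<theta> (A23 * t2) * \<theta> (Tr (\<eta> * (- A13 * t3))) * \<theta> (A16 * t5)"
  and \<xi>6_X: "t2 \<in> F \<Longrightarrow> t5 \<in> F \<Longrightarrow> t6 \<in> F \<Longrightarrow>
    \<xi>6 A17 A12 (X t1 t2 t3 t4 t5 t6) = \<theta> (Tr (\<eta> * (A12 * t1))) * \<theta> (A17 * t6)"
  by (simp_all only: \<xi>3_def \<xi>4_def \<xi>5_def \<xi>6_def co_X prod.case Tr_coeff4) simp_all

text \<open>H itself is normal here. Conjugation by x2(r) replaces A12 by A12 + A13 r, which the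
  values on X1 detect.\<close>

lemma \<chi>3_Irr:
  assumes "A13 \<noteq> 0" shows "ind_char U (SX P13456) (\<xi>3 A13 A12) \<in> Irr U"
proof (rule U.ind_char_in_Irr[OF finite_U subgroups(5) linear_chars(2) transversals(1) finite_UNIV_F
      subgroups(5) subset_refl normal.inv_op_closed1[OF normals(5)]])
  fix r s assume r: "r \<in> F" "s \<in> F"
    and eq: "\<And>a. a \<in> SX P13456 \<Longrightarrow> \<xi>3 A13 A12 (inv\<^bsub>U\<^esub> X 0 r 0 0 0 0 \<otimes>\<^bsub>U\<^esub> a \<otimes>\<^bsub>U\<^esub> X 0 r 0 0 0 0)
      = \<xi>3 A13 A12 (inv\<^bsub>U\<^esub> X 0 s 0 0 0 0 \<otimes>\<^bsub>U\<^esub> a \<otimes>\<^bsub>U\<^esub> X 0 s 0 0 0 0)"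
  have val: "\<xi>3 A13 A12 (inv\<^bsub>U\<^esub> X 0 r 0 0 0 0 \<otimes>\<^bsub>U\<^esub> X t 0 0 0 0 0 \<otimes>\<^bsub>U\<^esub> X 0 r 0 0 0 0) =
      \<theta> (Tr (\<eta> * (A12 + A13 * r) * t))" if r: "r \<in> F" for t r
    by (rule conj_13456[OF F_closed(1,1) r F_closed(1,1), of 0 0 0 t 0 0])
      (simp add: \<xi>3_X algebra_simps)
  have "\<eta> * (A12 + A13 * r) = \<eta> * (A12 + A13 * s)"
    by (rule theta_Tr_nondegenerate) (use eq[of "X _ 0 0 0 0 0"] r in \<open>simp add: val\<close>)
  thus "r = s" using eta_neq_0 assms by simp
qed auto

text \<open>The normal subgroup is X3 X4 X5 X6. The conjugates by x1(r) are told apart on X3, where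
  A15 enters through the twisted form.\<close>

lemma \<chi>4_Irr:
  assumes "A15 \<noteq> 0" "A23 \<in> F" shows "ind_char U (SX P23456) (\<xi>4 A15 A23 0) \<in> Irr U"
proof (rule U.ind_char_in_Irr[OF finite_U subgroups(6) linear_chars(3)[OF assms(2)] transversals(2) finite_UNIV_F
      subgroups(1) _ normal.inv_op_closed1[OF normals(1)]])
  show "SX P3456 \<subseteq> SX P23456" by (rule SX_mono) simp
  fix r s assume eq: "\<And>a. a \<in> SX P3456 \<Longrightarrow> \<xi>4 A15 A23 0 (inv\<^bsub>U\<^esub> X r 0 0 0 0 0 \<otimes>\<^bsub>U\<^esub> a \<otimes>\<^bsub>U\<^esub> X r 0 0 0 0 0)
      = \<xi>4 A15 A23 0 (inv\<^bsub>U\<^esub> X s 0 0 0 0 0 \<otimes>\<^bsub>U\<^esub> a \<otimes>\<^bsub>U\<^esub> X s 0 0 0 0 0)"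
  have val: "\<xi>4 A15 A23 0 (inv\<^bsub>U\<^esub> X r 0 0 0 0 0 \<otimes>\<^bsub>U\<^esub> X 0 0 t 0 0 0 \<otimes>\<^bsub>U\<^esub> X r 0 0 0 0 0) =
      inverse (\<theta> (Tr (coeff4 A15 * (r * fr t + fr r * t))))" for t r
  proof (rule conj_23456[OF F_closed(1,1,1,1,1,1), of r 0 0 t 0])
    have e: "- (r * fr t) - fr r * t = - (r * fr t + fr r * t)" by simp
    thus ?thesis if "s6 \<in> F" "inv\<^bsub>U\<^esub> X r 0 0 0 0 0 \<otimes>\<^bsub>U\<^esub> X 0 0 t 0 0 0 \<otimes>\<^bsub>U\<^esub> X r 0 0 0 0 0 =
      X 0 0 (t + 0 * r) (0 - r * fr t - fr r * t - 0 * r * fr r)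
        (0 + Tr (r * fr r * fr (fr t)) - Tr (r * fr 0) + 0 * Nm r) s6" for s6
      unfolding that(2) using that(1)
      by (simp add: \<xi>4_X theta_minus e del: minus_add_distrib)
  qed
  show "r = s"
    by (rule twisted_char_nondegenerate[of "coeff4 A15"]) (use eq[of "X 0 0 _ 0 0 0"] assms(1) in \<open>simp_all add: val\<close>)
qed auto

text \<open>The subgroups are those of the preceding family, but x1(r) is now detected on X4, where
  it shifts the fifth coordinate by a trace.\<close>

lemma \<chi>5_Irr:
  assumes "A16 \<noteq> 0" "A16 \<in> F" "A23 \<in> F" shows "ind_char U (SX P23456) (\<xi>5 A16 A23 A13 0) \<in> Irr U"
proof (rule U.ind_char_in_Irr[OF finite_U subgroups(6) linear_chars(4)[OF assms(2,3)] transversals(2) finite_UNIV_F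
      subgroups(1) _ normal.inv_op_closed1[OF normals(1)]])
  show "SX P3456 \<subseteq> SX P23456" by (rule SX_mono) simp
  fix r s assume eq: "\<And>a. a \<in> SX P3456 \<Longrightarrow> \<xi>5 A16 A23 A13 0 (inv\<^bsub>U\<^esub> X r 0 0 0 0 0 \<otimes>\<^bsub>U\<^esub> a \<otimes>\<^bsub>U\<^esub> X r 0 0 0 0 0)
      = \<xi>5 A16 A23 A13 0 (inv\<^bsub>U\<^esub> X s 0 0 0 0 0 \<otimes>\<^bsub>U\<^esub> a \<otimes>\<^bsub>U\<^esub> X s 0 0 0 0 0)"
  \<comment> \<open>The argument \<open>fr (fr t)\<close> is the inverse Frobenius of t, which makes
    the exponent Tr (A16 r t).\<close>
  have val: "\<xi>5 A16 A23 A13 0 (inv\<^bsub>U\<^esub> X r 0 0 0 0 0 \<otimes>\<^bsub>U\<^esub> X 0 0 0 (fr (fr t)) 0 0 \<otimes>\<^bsub>U\<^esub> X r 0 0 0 0 0) =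
      inverse (\<theta> (Tr (A16 * r * t)))" for t r
    by (rule conj_23456[OF F_closed(1,1,1,1,1,1), of r 0 0 0 "fr (fr t)"])
      (use assms Tr_scale[of A16 "r * t"] in \<open>simp add: \<xi>5_X theta_minus mult.assoc\<close>)
  have "A16 * r = A16 * s"
    by (rule theta_Tr_nondegenerate) (use eq[of "X 0 0 0 (fr (fr _)) 0 0"] in \<open>simp add: val\<close>)
  thus "r = s" using assms(1) by simp
qed auto

text \<open>On the normal subgroup X4 X5 X6, conjugation by x2(r2) x3(r3) changes the sixth
  coordinate by - r2 t5 - Tr (r3 t4^q). Thus X5 detects r2 and X4 detects r3.\<close>

lemma \<chi>6_Irr:
  assumes "A17 \<noteq> 0" "A17 \<in> F" shows "ind_char U (SX P1456) (\<xi>6 A17 A12) \<in> Irr U"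
proof (rule U.ind_char_in_Irr[OF finite_U subgroups(7) linear_chars(5)[OF assms(2)] transversals(3) _
      subgroups(2) _ normal.inv_op_closed1[OF normals(2)]])
  show "SX P456 \<subseteq> SX P1456" by (rule SX_mono) simp
  fix r s :: "'a \<times> 'a" assume "r \<in> F \<times> UNIV" "s \<in> F \<times> UNIV"
    and eq: "\<And>a. a \<in> SX P456 \<Longrightarrow>
      \<xi>6 A17 A12 (inv\<^bsub>U\<^esub> (case r of (r2, r3) \<Rightarrow> X 0 r2 r3 0 0 0) \<otimes>\<^bsub>U\<^esub> a \<otimes>\<^bsub>U\<^esub> (case r of (r2, r3) \<Rightarrow> X 0 r2 r3 0 0 0))
      = \<xi>6 A17 A12 (inv\<^bsub>U\<^esub> (case s of (r2, r3) \<Rightarrow> X 0 r2 r3 0 0 0) \<otimes>\<^bsub>U\<^esub> a \<otimes>\<^bsub>U\<^esub> (case s of (r2, r3) \<Rightarrow> X 0 r2 r3 0 0 0))"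
  then obtain r2 r3 s2 s3 where rs: "r = (r2, r3)" "s = (s2, s3)" "r2 \<in> F" "s2 \<in> F" by auto
  have val: "\<xi>6 A17 A12 (inv\<^bsub>U\<^esub> X 0 r2 r3 0 0 0 \<otimes>\<^bsub>U\<^esub> X 0 0 0 t4 t5 0 \<otimes>\<^bsub>U\<^esub> X 0 r2 r3 0 0 0) =
      \<theta> (- (A17 * r2 * t5) - Tr (A17 * r3 * fr t4))" if "r2 \<in> F" "t5 \<in> F" for r2 r3 t4 t5
    by (rule conj_456[OF that(2) F_closed(1) that(1) F_closed(1,1), of 0 r3 0 t4])
      (use assms that Tr_scale[of A17 "r3 * fr t4"] in \<open>simp add: \<xi>6_X algebra_simps\<close>)
  have "A17 * r2 = A17 * s2"
  proof (rule theta_F_nondegenerate)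
    fix t assume t: "t \<in> F"
    show "\<theta> (A17 * r2 * t) = \<theta> (A17 * s2 * t)"
      using eq[of "X 0 0 0 0 t 0"] t rs(3,4) assms(2) unfolding rs by (simp add: val theta_minus)
  qed (use assms rs in auto)
  moreover have "A17 * r3 = A17 * s3"
  proof (rule theta_Tr_nondegenerate)
    fix t
    show "\<theta> (Tr (A17 * r3 * t)) = \<theta> (Tr (A17 * s3 * t))"
      using eq[of "X 0 0 0 (fr (fr t)) 0 0"] rs(3,4) unfolding rs by (simp add: val theta_minus)
  qed
  ultimately show "r = s" using assms(1) rs by simp
qed (auto intro: finite_cartesian_product)

lemma \<chi>_lin_Irr:
  assumes "A23 \<in> F" shows "(\<lambda>g\<in>carrier U. \<xi>_lin A12 A23 g) \<in> Irr U"
  using linear_chars(1)[OF assms, folded carrier_SX, of A12] unfolding U.linear_char_def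
  by (intro U.linear_in_Irr) auto

text \<open>Conjugation fixes A13 and moves A12 within its coset of the line A13 F; this is why A12
  ranges over a transversal.\<close>

lemma \<chi>3_inj:
  assumes A: "A13 \<noteq> 0" "A12 \<in> T A13" "B12 \<in> T B13"
    and eq: "ind_char U (SX P13456) (\<xi>3 A13 A12) = ind_char U (SX P13456) (\<xi>3 B13 B12)"
  shows "A13 = B13 \<and> A12 = B12"
proof -
  obtain y where y: "y \<in> carrier U" and eq': "\<And>h. h \<in> SX P13456 \<Longrightarrow> inv\<^bsub>U\<^esub> y \<otimes>\<^bsub>U\<^esub> h \<otimes>\<^bsub>U\<^esub> y \<in> SX P13456 \<Longrightarrow>
      \<xi>3 A13 A12 (inv\<^bsub>U\<^esub> y \<otimes>\<^bsub>U\<^esub> h \<otimes>\<^bsub>U\<^esub> y) = \<xi>3 B13 B12 h"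
    using U.ind_char_eqD[OF finite_U subgroups(5) linear_chars(2) linear_chars(2) eq] by blast
  obtain r1 r2 r3 r4 r5 r6 where r: "r2 \<in> F" "r5 \<in> F" "r6 \<in> F" "y = X r1 r2 r3 r4 r5 r6"
    using U_cases[OF y] by metis
  have *: "\<theta> (Tr (\<eta> * (A12 * t1 - A13 * (t3 - r2 * t1)))) = \<theta> (Tr (\<eta> * (B12 * t1 - B13 * t3)))" for t1 t3
    by (rule conj_13456[OF F_closed(1,1) r(1-3), of r1 r3 r4 t1 t3 0])
      (use eq'[of "X t1 0 t3 0 0 0"] in \<open>simp add: \<xi>3_X r(4)\<close>)
  have "- (\<eta> * A13) = - (\<eta> * B13)"
    by (rule theta_Tr_nondegenerate) (use *[of 0] in \<open>simp add: algebra_simps\<close>)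
  hence 13: "A13 = B13" using eta_neq_0 by simp
  have "\<eta> * (A12 + A13 * r2) = \<eta> * B12"
    by (rule theta_Tr_nondegenerate) (use *[of _ 0] in \<open>simp add: algebra_simps\<close>)
  hence "B12 = A12 + A13 * r2" using eta_neq_0 by simp
  hence "B12 = A12" using T_unique[of A13 B12 A12 r2] A 13 r(1) by simp
  with 13 show ?thesis by simp
qed

text \<open>The values on X4 give A15. Those on X3 then force r1 = 0, after which conjugation has no
  effect on X2 and A23 can be read off.\<close>

lemma \<chi>4_inj:
  assumes A: "A15 \<noteq> 0" "A23 \<in> F" "B23 \<in> F"
    and eq: "ind_char U (SX P23456) (\<xi>4 A15 A23 0) = ind_char U (SX P23456) (\<xi>4 B15 B23 0)"
  shows "A15 = B15 \<and> A23 = B23"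
proof -
  obtain y where y: "y \<in> carrier U" and eq': "\<And>h. h \<in> SX P23456 \<Longrightarrow> inv\<^bsub>U\<^esub> y \<otimes>\<^bsub>U\<^esub> h \<otimes>\<^bsub>U\<^esub> y \<in> SX P23456 \<Longrightarrow>
      \<xi>4 A15 A23 0 (inv\<^bsub>U\<^esub> y \<otimes>\<^bsub>U\<^esub> h \<otimes>\<^bsub>U\<^esub> y) = \<xi>4 B15 B23 0 h"
    using U.ind_char_eqD[OF finite_U subgroups(6) linear_chars(3)[OF A(2)] linear_chars(3)[OF A(3)] eq] by blast
  obtain r1 r2 r3 r4 r5 r6 where r: "r2 \<in> F" "r5 \<in> F" "r6 \<in> F" "y = X r1 r2 r3 r4 r5 r6"
    using U_cases[OF y] by metis
  have *: "\<theta> (A23 * t2) * \<theta> (Tr (coeff4 A15 * (t4 - r1 * fr t3 - fr r1 * t3 - t2 * r1 * fr r1))) =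
      \<theta> (B23 * t2) * \<theta> (Tr (coeff4 B15 * t4))" if t2: "t2 \<in> F" for t2 t3 t4
    by (rule conj_23456[OF t2 F_closed(1,1) r(1-3), of r1 r3 r4 t3 t4])
      (use eq'[of "X 0 t2 t3 t4 0 0"] t2 in \<open>simp add: \<xi>4_X r(4)\<close>)
  have "coeff4 A15 = coeff4 B15"
    by (rule theta_Tr_nondegenerate) (use *[of 0 _ 0] in simp)
  hence 15: "A15 = B15" by (simp add: coeff4_eq_iff)
  have "r1 = 0"
  proof (rule twisted_char_nondegenerate)
    fix t
    have "- (r1 * fr t) - fr r1 * t = - (r1 * fr t + fr r1 * t)" by simp
    hence "\<theta> (- Tr (coeff4 A15 * (r1 * fr t + fr r1 * t))) = 1"
      using *[of 0 0 t] by (simp only: Tr_minus[symmetric] mult_minus_right[symmetric] F_closed) simp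
    thus "\<theta> (Tr (coeff4 A15 * (r1 * fr t + fr r1 * t))) = \<theta> (Tr (coeff4 A15 * (0 * fr t + fr 0 * t)))"
      by (simp only: theta_minus Tr_in_F inverse_eq_1_iff) simp
  qed (use A in simp)
  hence "A23 = B23" by (intro theta_F_nondegenerate A) (use *[of _ 0 0] in simp)
  with 15 show ?thesis by simp
qed

text \<open>X5 gives A16 and X4 forces r1 = 0; then A13 and A23 are visible on X3 and X2.\<close>

lemma \<chi>5_inj:
  assumes A: "A16 \<noteq> 0" "A16 \<in> F" "A23 \<in> F" "B16 \<in> F" "B23 \<in> F"
    and eq: "ind_char U (SX P23456) (\<xi>5 A16 A23 A13 0) = ind_char U (SX P23456) (\<xi>5 B16 B23 B13 0)"
  shows "A16 = B16 \<and> A23 = B23 \<and> A13 = B13"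
proof -
  obtain y where y: "y \<in> carrier U" and eq': "\<And>h. h \<in> SX P23456 \<Longrightarrow> inv\<^bsub>U\<^esub> y \<otimes>\<^bsub>U\<^esub> h \<otimes>\<^bsub>U\<^esub> y \<in> SX P23456 \<Longrightarrow>
      \<xi>5 A16 A23 A13 0 (inv\<^bsub>U\<^esub> y \<otimes>\<^bsub>U\<^esub> h \<otimes>\<^bsub>U\<^esub> y) = \<xi>5 B16 B23 B13 0 h"
    using U.ind_char_eqD[OF finite_U subgroups(6) linear_chars(4)[OF A(2,3)] linear_chars(4)[OF A(4,5)] eq] by blast
  obtain r1 r2 r3 r4 r5 r6 where r: "r2 \<in> F" "r5 \<in> F" "r6 \<in> F" "y = X r1 r2 r3 r4 r5 r6"
    using U_cases[OF y] by metis
  have *: "\<theta> (A23 * t2) * \<theta> (Tr (\<eta> * (- A13 * (t3 + t2 * r1))))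
        * \<theta> (A16 * (t5 + Tr (r1 * fr r1 * fr (fr t3)) - Tr (r1 * fr t4) + t2 * Nm r1)) =
      \<theta> (B23 * t2) * \<theta> (Tr (\<eta> * (- B13 * t3))) * \<theta> (B16 * t5)" if t: "t2 \<in> F" "t5 \<in> F" for t2 t3 t4 t5
    by (rule conj_23456[OF t F_closed(1) r(1-3), of r1 r3 r4 t3 t4])
      (use eq'[of "X 0 t2 t3 t4 t5 0"] t in \<open>simp add: \<xi>5_X r(4)\<close>)
  have 16: "A16 = B16" by (rule theta_F_nondegenerate) (use *[of 0 _ 0 0] A in auto)
  have "- A16 * r1 = 0"
  proof (rule theta_Tr_nondegenerate)
    fix t
    have "\<theta> (A16 * - Tr (r1 * t)) = 1" using *[of 0 0 0 "fr (fr t)"] by simp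
    thus "\<theta> (Tr (- A16 * r1 * t)) = \<theta> (Tr (0 * t))"
      using Tr_scale[OF A(2), of "r1 * t"] by (simp add: mult.assoc)
  qed
  hence r1: "r1 = 0" using A by simp
  have "- (\<eta> * A13) = - (\<eta> * B13)"
    by (rule theta_Tr_nondegenerate) (use *[of 0 0 _ 0] r1 in \<open>simp add: algebra_simps\<close>)
  hence 13: "A13 = B13" using eta_neq_0 by simp
  have "A23 = B23" by (intro theta_F_nondegenerate A) (use *[of _ 0 0 0] r1 in simp)
  with 13 16 show ?thesis by simp
qed

text \<open>X6 gives A17, and X5 and X4 force r2 = r3 = 0. Conjugation by what is left keeps the
  sixth coordinate of x1(t) at 0, which exposes A12.\<close>

lemma \<chi>6_inj:
  assumes A: "A17 \<noteq> 0" "A17 \<in> F" "B17 \<in> F"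
    and eq: "ind_char U (SX P1456) (\<xi>6 A17 A12) = ind_char U (SX P1456) (\<xi>6 B17 B12)"
  shows "A17 = B17 \<and> A12 = B12"
proof -
  obtain y where y: "y \<in> carrier U" and eq': "\<And>h. h \<in> SX P1456 \<Longrightarrow> inv\<^bsub>U\<^esub> y \<otimes>\<^bsub>U\<^esub> h \<otimes>\<^bsub>U\<^esub> y \<in> SX P1456 \<Longrightarrow>
      \<xi>6 A17 A12 (inv\<^bsub>U\<^esub> y \<otimes>\<^bsub>U\<^esub> h \<otimes>\<^bsub>U\<^esub> y) = \<xi>6 B17 B12 h"
    using U.ind_char_eqD[OF finite_U subgroups(7) linear_chars(5)[OF A(2)] linear_chars(5)[OF A(3)] eq] by blast
  obtain r1 r2 r3 r4 r5 r6 where r: "r2 \<in> F" "r5 \<in> F" "r6 \<in> F" "y = X r1 r2 r3 r4 r5 r6"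
    using U_cases[OF y] by metis
  have *: "\<theta> (A17 * (t6 - r2 * t5 - Tr (r3 * fr t4))) = \<theta> (B17 * t6)" if t: "t5 \<in> F" "t6 \<in> F" for t4 t5 t6
    by (rule conj_456[OF t r(1-3), of r1 r3 r4 t4])
      (use eq'[of "X 0 0 0 t4 t5 t6"] t r(1) in \<open>simp add: \<xi>6_X r(4)\<close>)
  have 17: "A17 = B17" by (rule theta_F_nondegenerate) (use *[of 0 _ 0] A in auto)
  have "- (A17 * r2) = 0"
  proof (rule theta_F_nondegenerate)
    fix t assume "t \<in> F"
    thus "\<theta> (- (A17 * r2) * t) = \<theta> (0 * t)" using *[of t 0 0] by (simp add: mult.assoc)
  qed (use A r in auto)
  hence r2: "r2 = 0" using A by simp
  have "- A17 * r3 = 0"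
  proof (rule theta_Tr_nondegenerate)
    fix t
    have "\<theta> (A17 * - Tr (r3 * t)) = 1" using *[of 0 0 "fr (fr t)"] by simp
    thus "\<theta> (Tr (- A17 * r3 * t)) = \<theta> (Tr (0 * t))"
      using Tr_scale[OF A(2), of "r3 * t"] by (simp add: mult.assoc)
  qed
  hence r3: "r3 = 0" using A by simp
  have "\<eta> * A12 = \<eta> * B12"
  proof (rule theta_Tr_nondegenerate)
    fix t
    obtain s3 s4 s5 s6 where s: "s5 \<in> F" "s6 \<in> F"
      "inv\<^bsub>U\<^esub> X r1 0 0 r4 r5 r6 \<otimes>\<^bsub>U\<^esub> X t 0 0 0 0 0 \<otimes>\<^bsub>U\<^esub> X r1 0 0 r4 r5 r6 = X t 0 s3 s4 s5 s6"
      "s3 = 0 - 0 * t + 0 * r1" "c6 r1 0 r4 r5 r6 t 0 s3 + s6 = c6 t 0 0 0 0 r1 0 0 + r6"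
      by (rule conj_X_obtain[OF F_closed(1,1,1,1) r(2,3), of r1 0 r4 t 0 0])
    \<comment> \<open>With r2 = r3 = 0 the correction terms on both sides vanish and r6
      cancels.\<close>
    have "s6 = 0" using s(4,5) by (simp add: c_s2_0)
    thus "\<theta> (Tr (\<eta> * A12 * t)) = \<theta> (Tr (\<eta> * B12 * t))"
      using eq'[of "X t 0 0 0 0 0"] s(1-4) unfolding r(4) r2 r3 by (simp add: \<xi>6_X mult.assoc)
  qed
  with 17 show ?thesis using eta_neq_0 by simp
qed

lemma \<chi>_lin_inj:
  assumes A: "A23 \<in> F" "B23 \<in> F"
    and eq: "(\<lambda>g\<in>carrier U. \<xi>_lin A12 A23 g) = (\<lambda>g\<in>carrier U. \<xi>_lin B12 B23 g)"
  shows "A12 = B12 \<and> A23 = B23"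
proof -
  have *: "\<theta> (Tr (\<eta> * (A12 * t1))) * \<theta> (A23 * t2) = \<theta> (Tr (\<eta> * (B12 * t1))) * \<theta> (B23 * t2)"
    if "t2 \<in> F" for t1 t2
    using fun_cong[OF eq, of "X t1 t2 0 0 0 0"] that by (simp add: \<xi>_lin_def)
  have "\<eta> * A12 = \<eta> * B12"
    by (rule theta_Tr_nondegenerate) (use *[of 0] in \<open>simp add: mult.assoc\<close>)
  moreover have "A23 = B23" by (intro theta_F_nondegenerate A) (use *[of _ 0] in simp)
  ultimately show ?thesis using eta_neq_0 by simp
qed

section \<open>Values as sums over transversals\<close>

lemma \<chi>_lin_value:
  assumes "t2 \<in> F" "t5 \<in> F" "t6 \<in> F"
  shows "\<chi>_lin q \<eta> \<theta> A12 A23 (X t1 t2 t3 t4 t5 t6) = \<theta> (Tr (\<eta> * (A12 * t1))) * \<theta> (A23 * t2)"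
  unfolding \<chi>_lin_eq using assms by (simp add: \<xi>_lin_def)

text \<open>All conjugates of an element share the coordinate t2, so either every term of the sum
  survives or none does.\<close>

lemma \<chi>3_value:
  assumes t: "t2 \<in> F" "t5 \<in> F" "t6 \<in> F"
  shows "\<chi>3 q \<eta> \<theta> A13 A12 (X t1 t2 t3 t4 t5 t6) =
    (if t2 = 0 then \<Sum>r\<in>F. \<theta> (Tr (\<eta> * (A12 * t1 - A13 * (t3 - r * t1)))) else 0)"
proof -
  have "\<chi>3 q \<eta> \<theta> A13 A12 (X t1 t2 t3 t4 t5 t6) = (\<Sum>r\<in>F. U.zero_ext (SX P13456) (\<xi>3 A13 A12)
      (inv\<^bsub>U\<^esub> X 0 r 0 0 0 0 \<otimes>\<^bsub>U\<^esub> X t1 t2 t3 t4 t5 t6 \<otimes>\<^bsub>U\<^esub> X 0 r 0 0 0 0))"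
    unfolding \<chi>3_eq using t
    by (intro U.ind_char_transversal[OF finite_U subgroups(5) linear_chars(2) transversals(1)]) auto
  also have "\<dots> = (\<Sum>r\<in>F. if t2 = 0 then \<theta> (Tr (\<eta> * (A12 * t1 - A13 * (t3 - r * t1)))) else 0)"
  proof (rule sum.cong[OF refl])
    fix r assume r: "r \<in> F"
    show "U.zero_ext (SX P13456) (\<xi>3 A13 A12) (inv\<^bsub>U\<^esub> X 0 r 0 0 0 0 \<otimes>\<^bsub>U\<^esub> X t1 t2 t3 t4 t5 t6 \<otimes>\<^bsub>U\<^esub> X 0 r 0 0 0 0) =
        (if t2 = 0 then \<theta> (Tr (\<eta> * (A12 * t1 - A13 * (t3 - r * t1)))) else 0)"
      by (rule conj_X_obtain[OF t r F_closed(1,1), of 0 0 0 t1 t3 t4])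
        (use t in \<open>simp add: U.zero_ext_def \<xi>3_X\<close>)
  qed
  finally show ?thesis by simp
qed

lemma \<chi>4_value:
  assumes A: "A23 \<in> F" and t: "t2 \<in> F" "t5 \<in> F" "t6 \<in> F"
  shows "\<chi>4 q \<eta> \<theta> A15 A23 (X t1 t2 t3 t4 t5 t6) = (if t1 = 0 then \<Sum>r\<in>UNIV. \<theta> (A23 * t2) *
      \<theta> (Tr (coeff4 A15 * (t4 - r * fr t3 - fr r * t3 - t2 * r * fr r))) else 0)"
proof -
  have "\<chi>4 q \<eta> \<theta> A15 A23 (X t1 t2 t3 t4 t5 t6) = (\<Sum>r\<in>UNIV. U.zero_ext (SX P23456) (\<xi>4 A15 A23 0)
      (inv\<^bsub>U\<^esub> X r 0 0 0 0 0 \<otimes>\<^bsub>U\<^esub> X t1 t2 t3 t4 t5 t6 \<otimes>\<^bsub>U\<^esub> X r 0 0 0 0 0))"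
    unfolding \<chi>4_eq using t
    by (intro U.ind_char_transversal[OF finite_U subgroups(6) linear_chars(3)[OF A] transversals(2)]) auto
  also have "\<dots> = (\<Sum>r\<in>UNIV. if t1 = 0 then \<theta> (A23 * t2) *
      \<theta> (Tr (coeff4 A15 * (t4 - r * fr t3 - fr r * t3 - t2 * r * fr r))) else 0)"
  proof (rule sum.cong[OF refl], cases "t1 = 0")
    case True
    fix r
    show "U.zero_ext (SX P23456) (\<xi>4 A15 A23 0) (inv\<^bsub>U\<^esub> X r 0 0 0 0 0 \<otimes>\<^bsub>U\<^esub> X t1 t2 t3 t4 t5 t6 \<otimes>\<^bsub>U\<^esub> X r 0 0 0 0 0) =
        (if t1 = 0 then \<theta> (A23 * t2) * \<theta> (Tr (coeff4 A15 * (t4 - r * fr t3 - fr r * t3 - t2 * r * fr r))) else 0)"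
      unfolding True by (rule conj_23456[OF t F_closed(1,1,1), of r 0 0 t3 t4])
        (use t in \<open>simp add: U.zero_ext_def \<xi>4_X\<close>)
  next
    case False
    fix r
    show "U.zero_ext (SX P23456) (\<xi>4 A15 A23 0) (inv\<^bsub>U\<^esub> X r 0 0 0 0 0 \<otimes>\<^bsub>U\<^esub> X t1 t2 t3 t4 t5 t6 \<otimes>\<^bsub>U\<^esub> X r 0 0 0 0 0) =
        (if t1 = 0 then \<theta> (A23 * t2) * \<theta> (Tr (coeff4 A15 * (t4 - r * fr t3 - fr r * t3 - t2 * r * fr r))) else 0)"
      by (rule conj_X_obtain[OF t F_closed(1,1,1), of r 0 0 t1 t3 t4])
        (use t False in \<open>simp add: U.zero_ext_def\<close>)
  qed
  finally show ?thesis by simp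
qed

lemma \<chi>5_value:
  assumes A: "A16 \<in> F" "A23 \<in> F" and t: "t2 \<in> F" "t5 \<in> F" "t6 \<in> F"
  shows "\<chi>5 q \<eta> \<theta> A16 A23 A13 (X t1 t2 t3 t4 t5 t6) = (if t1 = 0 then \<Sum>r\<in>UNIV. \<theta> (A23 * t2) *
      \<theta> (Tr (\<eta> * (- A13 * (t3 + t2 * r)))) *
      \<theta> (A16 * (t5 + Tr (r * fr r * fr (fr t3)) - Tr (r * fr t4) + t2 * Nm r)) else 0)"
proof -
  have "\<chi>5 q \<eta> \<theta> A16 A23 A13 (X t1 t2 t3 t4 t5 t6) = (\<Sum>r\<in>UNIV. U.zero_ext (SX P23456) (\<xi>5 A16 A23 A13 0)
      (inv\<^bsub>U\<^esub> X r 0 0 0 0 0 \<otimes>\<^bsub>U\<^esub> X t1 t2 t3 t4 t5 t6 \<otimes>\<^bsub>U\<^esub> X r 0 0 0 0 0))"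
    unfolding \<chi>5_eq using t
    by (intro U.ind_char_transversal[OF finite_U subgroups(6) linear_chars(4)[OF A] transversals(2)]) auto
  also have "\<dots> = (\<Sum>r\<in>UNIV. if t1 = 0 then \<theta> (A23 * t2) * \<theta> (Tr (\<eta> * (- A13 * (t3 + t2 * r)))) *
      \<theta> (A16 * (t5 + Tr (r * fr r * fr (fr t3)) - Tr (r * fr t4) + t2 * Nm r)) else 0)"
  proof (rule sum.cong[OF refl], cases "t1 = 0")
    case True
    fix r
    show "U.zero_ext (SX P23456) (\<xi>5 A16 A23 A13 0) (inv\<^bsub>U\<^esub> X r 0 0 0 0 0 \<otimes>\<^bsub>U\<^esub> X t1 t2 t3 t4 t5 t6 \<otimes>\<^bsub>U\<^esub> X r 0 0 0 0 0) =
        (if t1 = 0 then \<theta> (A23 * t2) * \<theta> (Tr (\<eta> * (- A13 * (t3 + t2 * r)))) *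
        \<theta> (A16 * (t5 + Tr (r * fr r * fr (fr t3)) - Tr (r * fr t4) + t2 * Nm r)) else 0)"
      unfolding True by (rule conj_23456[OF t F_closed(1,1,1), of r 0 0 t3 t4])
        (use t in \<open>simp add: U.zero_ext_def \<xi>5_X\<close>)
  next
    case False
    fix r
    show "U.zero_ext (SX P23456) (\<xi>5 A16 A23 A13 0) (inv\<^bsub>U\<^esub> X r 0 0 0 0 0 \<otimes>\<^bsub>U\<^esub> X t1 t2 t3 t4 t5 t6 \<otimes>\<^bsub>U\<^esub> X r 0 0 0 0 0) =
        (if t1 = 0 then \<theta> (A23 * t2) * \<theta> (Tr (\<eta> * (- A13 * (t3 + t2 * r)))) *
        \<theta> (A16 * (t5 + Tr (r * fr r * fr (fr t3)) - Tr (r * fr t4) + t2 * Nm r)) else 0)"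
      by (rule conj_X_obtain[OF t F_closed(1,1,1), of r 0 0 t1 t3 t4])
        (use t False in \<open>simp add: U.zero_ext_def\<close>)
  qed
  finally show ?thesis by simp
qed

section \<open>The subgroup H and the family nontrivial on X6\<close>

abbreviation HU :: "('a mat \<Rightarrow> 'a mat) monoid" where "HU \<equiv> H6 q"

lemma H6_eq: "HU = U\<lparr>carrier := SX P1456\<rparr>"
  by (simp add: H6_def X_products)

lemma H6_simps: "carrier HU = SX P1456" "monoid.mult HU = monoid.mult U" "one HU = one U"
  by (simp_all add: H6_eq)

sublocale H6: group HU
  unfolding H6_eq by (rule U.subgroup_imp_group[OF subgroups(7)])

text \<open>For conjugating elements of H the coordinates r2 and r3 vanish, which is what keeps the
  sixth coordinate at 0 in \<open>conj_456\<close>.\<close>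

lemma normal_X45: "SX P45 \<lhd> HU"
  unfolding H6.normal_inv_iff
proof (intro conjI ballI)
  show "subgroup (SX P45) HU"
    unfolding H6_eq by (rule U.subgroup_incl[OF subgroups(8,7) SX_mono]) simp
  fix x h assume x: "x \<in> carrier HU" and h: "h \<in> SX P45"
  have x': "x \<in> SX P1456" "x \<in> carrier U" using x SX_subset by (auto simp: H6_simps)
  have inv: "inv\<^bsub>HU\<^esub> x = inv\<^bsub>U\<^esub> x"
    unfolding H6_eq by (rule U.m_inv_consistent[OF subgroups(7) x'(1)])
  have "inv\<^bsub>U\<^esub> x \<in> SX P1456" by (rule subgroup.m_inv_closed[OF subgroups(7) x'(1)])
  then obtain r1 r2 r3 r4 r5 r6 where r: "r2 \<in> F" "r5 \<in> F" "r6 \<in> F" "r2 = 0 \<and> r3 = 0"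
    "inv\<^bsub>U\<^esub> x = X r1 r2 r3 r4 r5 r6" by (rule SX_cases)
  obtain t1 t2 t3 t4 t5 t6 where t: "t2 \<in> F" "t5 \<in> F" "t6 \<in> F" "t1 = 0 \<and> t2 = 0 \<and> t3 = 0 \<and> t6 = 0"
    "h = X t1 t2 t3 t4 t5 t6" using h by (rule SX_cases)
  have "x \<otimes>\<^bsub>U\<^esub> h \<otimes>\<^bsub>U\<^esub> inv\<^bsub>U\<^esub> x = inv\<^bsub>U\<^esub> X r1 r2 r3 r4 r5 r6 \<otimes>\<^bsub>U\<^esub> X t1 t2 t3 t4 t5 t6 \<otimes>\<^bsub>U\<^esub> X r1 r2 r3 r4 r5 r6"
    unfolding r(5)[symmetric] t(5) using x' by simp
  also have "\<dots> \<in> SX P45"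
  proof -
    have z: "t1 = 0" "t2 = 0" "t3 = 0" "t6 = 0" "r2 = 0" "r3 = 0" using r(4) t(4) by auto
    show ?thesis unfolding z
      by (rule conj_456[OF t(2) F_closed(1,1) r(2,3), of r1 0 r4 t4]) simp
  qed
  finally show "x \<otimes>\<^bsub>HU\<^esub> h \<otimes>\<^bsub>HU\<^esub> inv\<^bsub>HU\<^esub> x \<in> SX P45" unfolding inv H6_simps .
qed

lemma coset_X45:
  assumes "t5 \<in> F" "t6 \<in> F" "s5 \<in> F" "s6 \<in> F"
  shows "SX P45 #>\<^bsub>HU\<^esub> X t1 0 0 t4 t5 t6 = SX P45 #>\<^bsub>HU\<^esub> X s1 0 0 s4 s5 s6 \<longleftrightarrow> t1 = s1 \<and> t6 = s6"
proof -
  have "SX P45 #>\<^bsub>HU\<^esub> X t1 0 0 t4 t5 t6 = SX P45 #>\<^bsub>HU\<^esub> X s1 0 0 s4 s5 s6 \<longleftrightarrow>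
      (\<exists>n\<in>SX P45. X s1 0 0 s4 s5 s6 = X t1 0 0 t4 t5 t6 \<otimes>\<^bsub>HU\<^esub> n)"
    using assms by (intro H6.coset_eq_iff[OF normal_X45]) (auto simp: H6_simps)
  also have "\<dots> \<longleftrightarrow> t1 = s1 \<and> t6 = s6"
  proof
    assume "\<exists>n\<in>SX P45. X s1 0 0 s4 s5 s6 = X t1 0 0 t4 t5 t6 \<otimes>\<^bsub>HU\<^esub> n"
    thus "t1 = s1 \<and> t6 = s6" using assms by (auto simp: H6_simps x_elt_mult elim!: SX_cases)
  next
    assume "t1 = s1 \<and> t6 = s6"
    thus "\<exists>n\<in>SX P45. X s1 0 0 s4 s5 s6 = X t1 0 0 t4 t5 t6 \<otimes>\<^bsub>HU\<^esub> n"
      using assms by (intro bexI[of _ "X 0 0 0 (s4 - t4) (s5 - t5) 0"]) (simp_all add: H6_simps x_elt_mult)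
  qed
  finally show ?thesis .
qed

abbreviation "K6 \<equiv> (\<lambda>(t1, t6). SX P45 #>\<^bsub>HU\<^esub> X t1 0 0 0 0 t6)"

lemma \<mu>6_coords:
  "\<mu>6 q \<eta> \<theta> A17 A12 = on_coords (UNIV \<times> F) K6 (\<lambda>(t1, t6). \<theta> (Tr (\<eta> * (A12 * t1))) * \<theta> (A17 * t6))"
proof -
  have "(SX P45 #>\<^bsub>HU\<^esub> x1 q t1) \<otimes>\<^bsub>HU Mod SX P45\<^esub> (SX P45 #>\<^bsub>HU\<^esub> x6 t6) =
      SX P45 #>\<^bsub>HU\<^esub> X t1 0 0 0 0 t6" if "t6 \<in> F" for t1 t6
  proof -
    have "x1 q t1 \<in> carrier HU" "x6 t6 \<in> carrier HU" "x1 q t1 \<otimes>\<^bsub>HU\<^esub> x6 t6 = X t1 0 0 0 0 t6"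
      using that by (auto simp: H6_simps x_elt_single x_elt_mult)
    thus ?thesis using H6.coset_mult[OF normal_X45, of "x1 q t1" "x6 t6"] by simp
  qed
  thus ?thesis unfolding \<mu>6_def Hbar6_def pi_eq X_products by (intro on_coords_cong) auto
qed

lemma inj_K6: "inj_on K6 (UNIV \<times> F)"
  by (auto simp: inj_on_def coset_X45)

lemma bar_K6: "bar HU (SX P45) (SX P1456) = K6 ` (UNIV \<times> F)"
proof (intro equalityI subsetI)
  fix Y assume "Y \<in> bar HU (SX P45) (SX P1456)"
  then obtain g where g: "g \<in> SX P1456" "Y = SX P45 #>\<^bsub>HU\<^esub> g" by (auto simp: bar_def)
  from g(1) obtain t1 t2 t3 t4 t5 t6 where t: "t2 \<in> F" "t5 \<in> F" "t6 \<in> F" "t2 = 0 \<and> t3 = 0" "g = X t1 t2 t3 t4 t5 t6"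
    by (rule SX_cases)
  have "Y = K6 (t1, t6)" unfolding g(2) t(5) using t by (simp add: coset_X45)
  thus "Y \<in> K6 ` (UNIV \<times> F)" using t(3) by blast
next
  fix Y assume "Y \<in> K6 ` (UNIV \<times> F)"
  then obtain t1 t6 where "t6 \<in> F" "Y = SX P45 #>\<^bsub>HU\<^esub> X t1 0 0 0 0 t6" by auto
  thus "Y \<in> bar HU (SX P45) (SX P1456)" unfolding bar_def by (intro image_eqI[of _ _ "X t1 0 0 0 0 t6"]) auto
qed

lemma Hbar6_carrier:
  "carrier (Hbar6 q) = bar HU (X45 q) (X1 q) <#>\<^bsub>Hbar6 q\<^esub> bar HU (X45 q) (X6 q)"
proof -
  have sub: "X1 q \<subseteq> carrier HU" "X6 q \<subseteq> carrier HU"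
    unfolding X_sets X_products H6_simps by (rule SX_mono; simp)+
  have "X1 q <#>\<^bsub>HU\<^esub> X6 q = X1 q <#>\<^bsub>U\<^esub> X6 q" by (simp add: set_mult_def H6_simps)
  hence "bar HU (X45 q) (X1 q) <#>\<^bsub>Hbar6 q\<^esub> bar HU (X45 q) (X6 q) =
      bar HU (SX P45) (SX (\<lambda>t1 t2 t3 t4 t5 t6. t2 = 0 \<and> t3 = 0 \<and> t4 = 0 \<and> t5 = 0))"
    unfolding Hbar6_def X_products(13) H6.bar_set_mult[OF normal_X45 sub] by (simp only: X_products(8))
  also have "\<dots> = K6 ` (UNIV \<times> F)"
  proof (intro equalityI subsetI)
    fix Y assume "Y \<in> bar HU (SX P45) (SX (\<lambda>t1 t2 t3 t4 t5 t6. t2 = 0 \<and> t3 = 0 \<and> t4 = 0 \<and> t5 = 0))"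
    thus "Y \<in> K6 ` (UNIV \<times> F)" by (force simp: bar_def elim!: SX_cases)
  next
    fix Y assume "Y \<in> K6 ` (UNIV \<times> F)"
    then obtain t1 t6 where "t6 \<in> F" "Y = SX P45 #>\<^bsub>HU\<^esub> X t1 0 0 0 0 t6" by auto
    thus "Y \<in> bar HU (SX P45) (SX (\<lambda>t1 t2 t3 t4 t5 t6. t2 = 0 \<and> t3 = 0 \<and> t4 = 0 \<and> t5 = 0))"
      unfolding bar_def by (intro image_eqI[of _ _ "X t1 0 0 0 0 t6"]) auto
  qed
  also have "\<dots> = carrier (Hbar6 q)"
    unfolding bar_K6[symmetric] Hbar6_def X_products(13) H6.carrier_Mod_bar H6_simps ..
  finally show ?thesis ..
qed

lemma \<mu>6_coset: "h \<in> SX P1456 \<Longrightarrow> \<mu>6 q \<eta> \<theta> A17 A12 (SX P45 #>\<^bsub>HU\<^esub> h) = \<xi>6 A17 A12 h"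
proof -
  assume "h \<in> SX P1456"
  then obtain t1 t2 t3 t4 t5 t6 where t: "t2 \<in> F" "t5 \<in> F" "t6 \<in> F" "t2 = 0 \<and> t3 = 0" "h = X t1 t2 t3 t4 t5 t6"
    by (rule SX_cases)
  hence "SX P45 #>\<^bsub>HU\<^esub> h = K6 (t1, t6)" by (simp add: coset_X45)
  thus "\<mu>6 q \<eta> \<theta> A17 A12 (SX P45 #>\<^bsub>HU\<^esub> h) = \<xi>6 A17 A12 h"
    unfolding \<mu>6_coords using on_coords_apply[OF inj_K6, of "(t1, t6)"] t by (simp add: \<xi>6_def)
qed

lemma \<mu>6_Irr:
  assumes "A17 \<in> F" shows "\<mu>6 q \<eta> \<theta> A17 A12 \<in> Irr (Hbar6 q)"
proof -
  have "\<mu>6 q \<eta> \<theta> A17 A12 \<in> Irr ((HU Mod SX P45)\<lparr>carrier := bar HU (SX P45) (SX P1456)\<rparr>)"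
  proof (rule H6.quotient_linear_in_Irr[OF normal_X45])
    show "subgroup (SX P1456) HU" using H6.subgroup_self by (simp add: H6_simps)
    show "H6.linear_char (SX P1456) (\<xi>6 A17 A12)"
      using linear_chars(5)[OF assms, of A12] by (simp add: H6.linear_char_def U.linear_char_def H6_simps)
    show "\<mu>6 q \<eta> \<theta> A17 A12 \<in> extensional (bar HU (SX P45) (SX P1456))"
      by (simp only: bar_K6 \<mu>6_coords on_coords_extensional)
  qed (rule \<mu>6_coset)
  moreover have "(HU Mod SX P45)\<lparr>carrier := bar HU (SX P45) (SX P1456)\<rparr> = Hbar6 q"
    unfolding Hbar6_def X_products(13) H6_simps(1)[symmetric] H6.carrier_Mod_bar[symmetric] by simp
  ultimately show ?thesis by simp
qed

text \<open>Here inflation takes place inside H and precedes induction, so only the values of the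
  inflated character on H have to agree.\<close>

lemma \<chi>6_eq: "\<chi>6 q \<eta> \<theta> A17 A12 = ind_char U (SX P1456) (\<xi>6 A17 A12)"
  unfolding \<chi>6_def X_products
  by (rule ind_char_cong) (simp add: lift_char_def H6_simps \<mu>6_coset)

text \<open>H is not normal in U: for t2 = 0 the conjugate by x2(r2) x3(r3) lies in H exactly when
  t3 = r2 t1, so single terms can drop out of the sum.\<close>

lemma \<chi>6_value:
  assumes A: "A17 \<in> F" and t: "t2 \<in> F" "t5 \<in> F" "t6 \<in> F"
  shows "\<chi>6 q \<eta> \<theta> A17 A12 (X t1 t2 t3 t4 t5 t6) = (\<Sum>r2\<in>F. \<Sum>r3\<in>UNIV. if t2 = 0 \<and> t3 = r2 * t1 then
      \<theta> (Tr (\<eta> * (A12 * t1))) * \<theta> (A17 * (c6 t1 t3 t4 t5 t6 0 r2 r3 - Tr (t1 * fr r3 * fr (fr r3)))) else 0)"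
proof -
  have "\<chi>6 q \<eta> \<theta> A17 A12 (X t1 t2 t3 t4 t5 t6) = (\<Sum>r\<in>F \<times> UNIV. U.zero_ext (SX P1456) (\<xi>6 A17 A12)
      (inv\<^bsub>U\<^esub> (case r of (r2, r3) \<Rightarrow> X 0 r2 r3 0 0 0) \<otimes>\<^bsub>U\<^esub> X t1 t2 t3 t4 t5 t6
        \<otimes>\<^bsub>U\<^esub> (case r of (r2, r3) \<Rightarrow> X 0 r2 r3 0 0 0)))"
    unfolding \<chi>6_eq using t
    by (intro U.ind_char_transversal[OF finite_U subgroups(7) linear_chars(5)[OF A] transversals(3)]) auto
  also have "\<dots> = (\<Sum>r\<in>F \<times> UNIV. case r of (r2, r3) \<Rightarrow> if t2 = 0 \<and> t3 = r2 * t1 then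
      \<theta> (Tr (\<eta> * (A12 * t1))) * \<theta> (A17 * (c6 t1 t3 t4 t5 t6 0 r2 r3 - Tr (t1 * fr r3 * fr (fr r3)))) else 0)"
  proof (rule sum.cong[OF refl], clarify)
    fix r2 r3 assume r: "r2 \<in> F"
    have eq: "t3 - r2 * t1 = 0 \<longleftrightarrow> t3 = r2 * t1" by simp
    show "U.zero_ext (SX P1456) (\<xi>6 A17 A12) (inv\<^bsub>U\<^esub> X 0 r2 r3 0 0 0 \<otimes>\<^bsub>U\<^esub> X t1 t2 t3 t4 t5 t6 \<otimes>\<^bsub>U\<^esub> X 0 r2 r3 0 0 0) =
      (if t2 = 0 \<and> t3 = r2 * t1 then
      \<theta> (Tr (\<eta> * (A12 * t1))) * \<theta> (A17 * (c6 t1 t3 t4 t5 t6 0 r2 r3 - Tr (t1 * fr r3 * fr (fr r3)))) else 0)"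
      by (rule conj_1456[OF t r, of r3 t1 t3 t4])
        (use t in \<open>auto simp: U.zero_ext_def \<xi>6_X eq\<close>)
  qed
  finally show ?thesis by (simp add: sum.cartesian_product)
qed

section \<open>The character table\<close>

lemma x_products:
  "t6 \<in> F \<Longrightarrow> x1 q t1 \<otimes>\<^bsub>U\<^esub> x6 t6 = X t1 0 0 0 0 t6"
  "x1 q t1 \<otimes>\<^bsub>U\<^esub> x3 q t3 = X t1 0 t3 0 0 0"
  "t2 \<in> F \<Longrightarrow> t5 \<in> F \<Longrightarrow> x2 t2 \<otimes>\<^bsub>U\<^esub> x4 q t4 \<otimes>\<^bsub>U\<^esub> x5 t5 = X 0 t2 0 t4 t5 0"
  "t2 \<in> F \<Longrightarrow> x2 t2 \<otimes>\<^bsub>U\<^esub> x1 q t1 = X t1 t2 0 0 0 0"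
  "t5 \<in> F \<Longrightarrow> x3 q t3 \<otimes>\<^bsub>U\<^esub> x5 t5 = X 0 0 t3 0 t5 0"
  by (simp_all add: x_elt_single x_elt_mult)

text \<open>Adjusts the sign of the summation variable, which in the table is opposite to that of
  the transversal element.\<close>

lemma sum_F_minus: "(\<Sum>r\<in>F. f (- r)) = (\<Sum>r\<in>F. f r)"
  by (rule sum.reindex_bij_witness[of _ uminus uminus]) auto

lemma sum_UNIV_minus: "(\<Sum>r\<in>UNIV. f (- r :: 'a)) = (\<Sum>r\<in>UNIV. f r)"
  by (rule sum.reindex_bij_witness[of _ uminus uminus]) auto

lemma \<chi>3_at_X1:
  "\<chi>3 q \<eta> \<theta> A13 A12 (X t1 0 t3 0 0 t6) = (\<Sum>r2\<in>F. \<theta> (Tr (\<eta> * ((A12 - A13 * r2) * t1 - t3 * A13))))"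
  if "t6 \<in> F"
  by (subst sum_F_minus[symmetric]) (use that in \<open>simp add: \<chi>3_value algebra_simps\<close>)

lemma \<chi>3_at_X3456:
  assumes "t5 \<in> F" "t6 \<in> F"
  shows "\<chi>3 q \<eta> \<theta> A13 A12 (X 0 0 t3 t4 t5 t6) = of_nat q * \<theta> (Tr (\<eta> * (- A13 * t3)))"
  using assms by (simp add: \<chi>3_value card_F)

lemma \<chi>4_at_X456:
  assumes "A23 \<in> F" "t5 \<in> F" "t6 \<in> F"
  shows "\<chi>4 q \<eta> \<theta> A15 A23 (X 0 0 0 t4 t5 t6) = of_nat (q ^ 3) * \<theta> (Tr (coeff4 A15 * t4))"
  using assms by (simp add: \<chi>4_value card_UNIV)

text \<open>As a function of r the exponent is Tr (- D r), and D is nonzero by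
  \<open>twisted_sum_eq_0\<close>, so the sum of a nontrivial character vanishes.\<close>

lemma \<chi>4_at_X3:
  assumes "A15 \<noteq> 0" "A23 \<in> F" "t3 \<noteq> 0" "t5 \<in> F" "t6 \<in> F"
  shows "\<chi>4 q \<eta> \<theta> A15 A23 (X 0 0 t3 0 t5 t6) = 0"
proof -
  define D where "D = fr (fr (coeff4 A15 * t3)) + coeff4 A15 * fr t3"
  have D: "D \<noteq> 0" using twisted_sum_eq_0[of "coeff4 A15" t3] assms(1,3) by (auto simp: D_def)
  have "Tr (coeff4 A15 * (0 - r * fr t3 - fr r * t3 - 0 * r * fr r)) = Tr (- D * r)" for r
  proof -
    have "coeff4 A15 * (0 - r * fr t3 - fr r * t3 - 0 * r * fr r) = - (coeff4 A15 * (t3 * fr r + fr t3 * r))"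
      by (simp add: algebra_simps)
    thus ?thesis using Tr_twisted[of "coeff4 A15" t3 r] unfolding D_def
      by (simp only: Tr_minus mult_minus_left)
  qed
  thus ?thesis using assms D sum_theta_Tr[of "- D"] by (simp add: \<chi>4_value)
qed

lemma \<chi>5_at_X456:
  assumes "A16 \<in> F" "A23 \<in> F" "t5 \<in> F" "t6 \<in> F"
  shows "\<chi>5 q \<eta> \<theta> A16 A23 A13 (X 0 0 0 t4 t5 t6) =
    (if A16 * t4 = 0 then of_nat (q ^ 3) * \<theta> (A16 * t5) else 0)"
proof -
  have "\<theta> (A16 * (t5 - Tr (r * fr t4))) = \<theta> (A16 * t5) * \<theta> (Tr (- (A16 * fr t4) * r))" for r
  proof -
    have "A16 * (t5 - Tr (r * fr t4)) = A16 * t5 + Tr (- (A16 * fr t4) * r)"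
      using Tr_scale[OF assms(1), of "r * fr t4"] by (simp add: algebra_simps)
    thus ?thesis using assms by (simp only: theta_add F_closed Tr_in_F)
  qed
  hence "\<chi>5 q \<eta> \<theta> A16 A23 A13 (X 0 0 0 t4 t5 t6) =
      \<theta> (A16 * t5) * (\<Sum>r\<in>UNIV. \<theta> (Tr (- (A16 * fr t4) * r)))"
    using assms by (simp add: \<chi>5_value sum_distrib_left)
  thus ?thesis unfolding sum_theta_Tr by simp
qed

text \<open>The double sum factors into a character sum over F, which detects t5 = 0, and one over
  the large field, which detects t4 = 0. Their nonzero values q and q^3 make up the degree.\<close>

lemma \<chi>6_at_X456:
  assumes A: "A17 \<noteq> 0" "A17 \<in> F" and t: "t5 \<in> F" "t6 \<in> F"
  shows "\<chi>6 q \<eta> \<theta> A17 A12 (X 0 0 0 t4 t5 t6) = (if t4 = 0 \<and> t5 = 0 then of_nat (q ^ 4) * \<theta> (A17 * t6) else 0)"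
proof -
  have "\<theta> (A17 * (t6 - r2 * t5 - Tr (r3 * fr t4))) =
      \<theta> (A17 * t6) * (\<theta> (- (A17 * t5) * r2) * \<theta> (Tr (- (A17 * fr t4) * r3)))" if "r2 \<in> F" for r2 r3
  proof -
    have "A17 * (t6 - r2 * t5 - Tr (r3 * fr t4)) = A17 * t6 + (- (A17 * t5) * r2 + Tr (- (A17 * fr t4) * r3))"
      using Tr_scale[OF A(2), of "r3 * fr t4"] by (simp add: algebra_simps)
    moreover have "- (A17 * t5) * r2 \<in> F" using A t that by (intro F_closed)
    ultimately show ?thesis using A t by (simp only: theta_add F_closed Tr_in_F)
  qed
  hence "\<chi>6 q \<eta> \<theta> A17 A12 (X 0 0 0 t4 t5 t6) = (\<Sum>r2\<in>F. \<Sum>r3\<in>UNIV.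
      \<theta> (A17 * t6) * (\<theta> (- (A17 * t5) * r2) * \<theta> (Tr (- (A17 * fr t4) * r3))))"
    using A t by (simp add: \<chi>6_value cong: sum.cong)
  also have "\<dots> = \<theta> (A17 * t6) * ((\<Sum>r2\<in>F. \<theta> (- (A17 * t5) * r2)) * (\<Sum>r3\<in>UNIV. \<theta> (Tr (- (A17 * fr t4) * r3))))"
    by (subst sum_product) (simp only: sum_distrib_left)
  also have "(\<Sum>r2\<in>F. \<theta> (- (A17 * t5) * r2)) = (if t5 = 0 then of_nat q else 0)"
    using A t by (subst sum_theta_F) auto
  also have "(\<Sum>r3\<in>UNIV. \<theta> (Tr (- (A17 * fr t4) * r3))) = (if t4 = 0 then of_nat (q ^ 3) else 0)"
    using A by (subst sum_theta_Tr) auto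
  finally show ?thesis by (simp add: eval_nat_numeral)
qed

lemma table_lin:
  assumes "A23 \<in> F"
  shows "let \<chi> = \<chi>_lin q \<eta> \<theta> A12 A23 in
       (\<forall>t1\<in>UNIV - {0}. \<forall>t6\<in>F. \<chi> (x1 q t1 \<otimes>\<^bsub>U\<^esub> x6 t6) = \<theta> (\<pi>q q \<eta> (A12 * t1))) \<and>
       (\<forall>t1\<in>UNIV - {0}. \<forall>t3\<in>T t1 - {0}. \<chi> (x1 q t1 \<otimes>\<^bsub>U\<^esub> x3 q t3) = \<theta> (\<pi>q q \<eta> (A12 * t1))) \<and>
       (\<forall>t2\<in>F - {0}. \<forall>t4. \<forall>t5\<in>F. \<chi> (x2 t2 \<otimes>\<^bsub>U\<^esub> x4 q t4 \<otimes>\<^bsub>U\<^esub> x5 t5) = \<theta> (A23 * t2)) \<and>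
       (\<forall>t1\<in>UNIV - {0}. \<forall>t2\<in>F - {0}. \<chi> (x2 t2 \<otimes>\<^bsub>U\<^esub> x1 q t1) = \<theta> (\<pi>q q \<eta> (A12 * t1)) * \<theta> (A23 * t2)) \<and>
       \<chi> \<one>\<^bsub>U\<^esub> = 1 \<and>
       (\<forall>t3\<in>UNIV - {0}. \<forall>t5\<in>F. \<chi> (x3 q t3 \<otimes>\<^bsub>U\<^esub> x5 t5) = 1) \<and>
       (\<forall>t4\<in>UNIV - {0}. \<chi> (x4 q t4) = 1) \<and>
       (\<forall>t5\<in>F - {0}. \<chi> (x5 t5) = 1) \<and>
       (\<forall>t6\<in>F - {0}. \<chi> (x6 t6) = 1)"
  unfolding Let_def
  by (intro conjI ballI allI) (simp_all add: x_products X_0[symmetric] pi_eq, simp_all add: x_elt_single \<chi>_lin_value)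

lemma table3:
  assumes "A13 \<in> UNIV - {0}" "A12 \<in> T A13"
  shows "let \<chi> = \<chi>3 q \<eta> \<theta> A13 A12 in
       \<chi> \<one>\<^bsub>U\<^esub> = of_nat q \<and>
       (\<forall>t4\<in>UNIV - {0}. \<chi> (x4 q t4) = of_nat q) \<and>
       (\<forall>t5\<in>F - {0}. \<chi> (x5 t5) = of_nat q) \<and>
       (\<forall>t6\<in>F - {0}. \<chi> (x6 t6) = of_nat q) \<and>
       (\<forall>t2\<in>F - {0}. \<forall>t4. \<forall>t5\<in>F. \<chi> (x2 t2 \<otimes>\<^bsub>U\<^esub> x4 q t4 \<otimes>\<^bsub>U\<^esub> x5 t5) = 0) \<and>
       (\<forall>t1\<in>UNIV - {0}. \<forall>t2\<in>F - {0}. \<chi> (x2 t2 \<otimes>\<^bsub>U\<^esub> x1 q t1) = 0) \<and>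
       (\<forall>t3\<in>UNIV - {0}. \<forall>t5\<in>F. \<chi> (x3 q t3 \<otimes>\<^bsub>U\<^esub> x5 t5) = of_nat q * \<theta> (\<pi>q q \<eta> (- A13 * t3))) \<and>
       (\<forall>t1\<in>UNIV - {0}. \<forall>t6\<in>F. \<chi> (x1 q t1 \<otimes>\<^bsub>U\<^esub> x6 t6) =
          (\<Sum>r2\<in>F. \<theta> (\<pi>q q \<eta> ((A12 - A13 * r2) * t1)))) \<and>
       (\<forall>t1\<in>UNIV - {0}. \<forall>t3\<in>T t1 - {0}. \<chi> (x1 q t1 \<otimes>\<^bsub>U\<^esub> x3 q t3) =
          (\<Sum>r2\<in>F. \<theta> (\<pi>q q \<eta> ((A12 - A13 * r2) * t1 - t3 * A13))))"
  unfolding Let_def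
proof (intro conjI ballI allI)
  show "\<chi>3 q \<eta> \<theta> A13 A12 (x1 q t1 \<otimes>\<^bsub>U\<^esub> x6 t6) = (\<Sum>r2\<in>F. \<theta> (\<pi>q q \<eta> ((A12 - A13 * r2) * t1)))"
    if "t6 \<in> F" for t1 t6
    using that \<chi>3_at_X1[OF that, of A13 A12 t1 0] by (simp add: x_products pi_eq)
  show "\<chi>3 q \<eta> \<theta> A13 A12 (x1 q t1 \<otimes>\<^bsub>U\<^esub> x3 q t3) = (\<Sum>r2\<in>F. \<theta> (\<pi>q q \<eta> ((A12 - A13 * r2) * t1 - t3 * A13)))" for t1 t3
    unfolding x_products pi_eq by (rule \<chi>3_at_X1) simp
qed (simp_all add: x_products X_0[symmetric] pi_eq, simp_all add: x_elt_single \<chi>3_value card_F)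

lemma table4:
  assumes "A15 \<in> UNIV - {0}" "A23 \<in> F"
  shows "let \<chi> = \<chi>4 q \<eta> \<theta> A15 A23 in
       \<chi> \<one>\<^bsub>U\<^esub> = of_nat (q ^ 3) \<and>
       (\<forall>t5\<in>F - {0}. \<chi> (x5 t5) = of_nat (q ^ 3)) \<and>
       (\<forall>t6\<in>F - {0}. \<chi> (x6 t6) = of_nat (q ^ 3)) \<and>
       (\<forall>t1\<in>UNIV - {0}. \<forall>t6\<in>F. \<chi> (x1 q t1 \<otimes>\<^bsub>U\<^esub> x6 t6) = 0) \<and>
       (\<forall>t1\<in>UNIV - {0}. \<forall>t3\<in>T t1 - {0}. \<chi> (x1 q t1 \<otimes>\<^bsub>U\<^esub> x3 q t3) = 0) \<and>
       (\<forall>t1\<in>UNIV - {0}. \<forall>t2\<in>F - {0}. \<chi> (x2 t2 \<otimes>\<^bsub>U\<^esub> x1 q t1) = 0) \<and>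
       (\<forall>t3\<in>UNIV - {0}. \<forall>t5\<in>F. \<chi> (x3 q t3 \<otimes>\<^bsub>U\<^esub> x5 t5) = 0) \<and>
       (\<forall>t4\<in>UNIV - {0}. \<chi> (x4 q t4) =
          of_nat (q ^ 3) * \<theta> (\<pi>q q \<eta> (A15 ^ q * t4)) * \<theta> (\<pi>q q \<eta> (A15 * t4 ^ q\<^sup>2))) \<and>
       (\<forall>t2\<in>F - {0}. \<forall>t4. \<forall>t5\<in>F. \<chi> (x2 t2 \<otimes>\<^bsub>U\<^esub> x4 q t4 \<otimes>\<^bsub>U\<^esub> x5 t5) =
          \<theta> (A23 * t2) *
          (\<Sum>r1\<in>UNIV. \<theta> (\<pi>q q \<eta> (A15 ^ q * (t4 - t2 * r1 ^ (q + 1))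
             + A15 * (t4 ^ q\<^sup>2 - t2 * r1 ^ (q\<^sup>2 + 1))))))"
  unfolding Let_def
proof (intro conjI ballI allI)
  show "\<chi>4 q \<eta> \<theta> A15 A23 (x4 q t4) =
      of_nat (q ^ 3) * \<theta> (\<pi>q q \<eta> (A15 ^ q * t4)) * \<theta> (\<pi>q q \<eta> (A15 * t4 ^ q\<^sup>2))" for t4
    using assms Tr_coeff4[of A15 t4]
    by (simp add: x_elt_single \<chi>4_at_X456 pi_eq power_q theta_add[symmetric] distrib_left mult.assoc)
  show "\<chi>4 q \<eta> \<theta> A15 A23 (x3 q t3 \<otimes>\<^bsub>U\<^esub> x5 t5) = 0" if "t3 \<in> UNIV - {0}" "t5 \<in> F" for t3 t5
    using assms that by (simp add: x_products \<chi>4_at_X3)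
  fix t2 t4 t5 assume t: "t2 \<in> F - {0}" "t5 \<in> F"
  have v: "\<chi>4 q \<eta> \<theta> A15 A23 (x2 t2 \<otimes>\<^bsub>U\<^esub> x4 q t4 \<otimes>\<^bsub>U\<^esub> x5 t5) = (\<Sum>r\<in>UNIV. \<theta> (A23 * t2) *
      \<theta> (Tr (coeff4 A15 * (t4 - r * fr 0 - fr r * 0 - t2 * r * fr r))))"
    using assms t by (simp add: x_products \<chi>4_value)
  have e: "coeff4 A15 * (t4 - r * fr 0 - fr r * 0 - t2 * r * fr r) = coeff4 A15 * (t4 - t2 * (fr r * r))" for r
    by (simp add: algebra_simps)
  \<comment> \<open>Returns from \<open>coeff4\<close> to the two summands displayed in the table;
    t2 is fixed by Frobenius.\<close>
  have e': "Tr (coeff4 A15 * (t4 - t2 * (fr r * r))) =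
      Tr (\<eta> * (fr A15 * (t4 - t2 * (fr r * r)) + A15 * (fr (fr t4) - t2 * (fr (fr r) * r))))" for r
    unfolding Tr_coeff4[symmetric] using t by (simp add: Fq_iff mult.commute[of r])
  show "\<chi>4 q \<eta> \<theta> A15 A23 (x2 t2 \<otimes>\<^bsub>U\<^esub> x4 q t4 \<otimes>\<^bsub>U\<^esub> x5 t5) = \<theta> (A23 * t2) *
      (\<Sum>r1\<in>UNIV. \<theta> (\<pi>q q \<eta> (A15 ^ q * (t4 - t2 * r1 ^ (q + 1)) + A15 * (t4 ^ q\<^sup>2 - t2 * r1 ^ (q\<^sup>2 + 1)))))"
    unfolding v e e' power_q pi_eq sum_distrib_left ..
qed (use assms in \<open>simp_all add: x_products X_0[symmetric] pi_eq\<close>,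
     use assms in \<open>simp_all add: x_elt_single \<chi>4_value card_UNIV\<close>)

lemma table5:
  assumes "A16 \<in> F - {0}" "A23 \<in> F"
  shows "let \<chi> = \<chi>5 q \<eta> \<theta> A16 A23 A13 in
       \<chi> \<one>\<^bsub>U\<^esub> = of_nat (q ^ 3) \<and>
       (\<forall>t6\<in>F - {0}. \<chi> (x6 t6) = of_nat (q ^ 3)) \<and>
       (\<forall>t1\<in>UNIV - {0}. \<forall>t6\<in>F. \<chi> (x1 q t1 \<otimes>\<^bsub>U\<^esub> x6 t6) = 0) \<and>
       (\<forall>t1\<in>UNIV - {0}. \<forall>t3\<in>T t1 - {0}. \<chi> (x1 q t1 \<otimes>\<^bsub>U\<^esub> x3 q t3) = 0) \<and>
       (\<forall>t1\<in>UNIV - {0}. \<forall>t2\<in>F - {0}. \<chi> (x2 t2 \<otimes>\<^bsub>U\<^esub> x1 q t1) = 0) \<and>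
       (\<forall>t4\<in>UNIV - {0}. \<chi> (x4 q t4) = 0) \<and>
       (\<forall>t5\<in>F - {0}. \<chi> (x5 t5) = of_nat (q ^ 3) * \<theta> (A16 * t5)) \<and>
       (\<forall>t3\<in>UNIV - {0}. \<forall>t5\<in>F. \<chi> (x3 q t3 \<otimes>\<^bsub>U\<^esub> x5 t5) =
          \<theta> (\<pi>q q \<eta> (- A13 * t3 + A16 * t5)) *
          (\<Sum>r1\<in>UNIV. \<theta> (A16 * \<phi>0 q (t3 * r1 ^ (q\<^sup>2 + q))))) \<and>
       (\<forall>t2\<in>F - {0}. \<forall>t4. \<forall>t5\<in>F. \<chi> (x2 t2 \<otimes>\<^bsub>U\<^esub> x4 q t4 \<otimes>\<^bsub>U\<^esub> x5 t5) =
          \<theta> (A23 * t2 + A16 * t5) *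
          (\<Sum>r1\<in>UNIV. \<theta> (\<pi>q q \<eta> (A13 * r1 * t2
             + A16 * (\<phi>0 q (r1 * t4 ^ q) - t2 * r1 ^ (q\<^sup>2 + q + 1))))))"
  unfolding Let_def
proof (intro conjI ballI allI)
  have A: "A16 \<in> F" "A16 \<noteq> 0" using assms by auto
  show "\<chi>5 q \<eta> \<theta> A16 A23 A13 (x3 q t3 \<otimes>\<^bsub>U\<^esub> x5 t5) = \<theta> (\<pi>q q \<eta> (- A13 * t3 + A16 * t5)) *
      (\<Sum>r1\<in>UNIV. \<theta> (A16 * \<phi>0 q (t3 * r1 ^ (q\<^sup>2 + q))))" if t: "t5 \<in> F" for t3 t5
  proof -
    have 1: "\<chi>5 q \<eta> \<theta> A16 A23 A13 (x3 q t3 \<otimes>\<^bsub>U\<^esub> x5 t5) =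
        (\<Sum>r\<in>UNIV. \<theta> (Tr (\<eta> * (- A13 * t3))) * \<theta> (A16 * (t5 + Tr (r * fr r * fr (fr t3)))))"
      using A assms t by (simp add: x_products \<chi>5_value)
    have 2: "\<theta> (Tr (\<eta> * (- A13 * t3))) * \<theta> (A16 * (t5 + Tr (r * fr r * fr (fr t3)))) =
        \<theta> (Tr (\<eta> * (- A13 * t3 + A16 * t5))) * \<theta> (A16 * Tr (t3 * (fr (fr r) * fr r)))" for r
    proof -
      \<comment> \<open>One application of Frobenius under the trace frees t3 of its power and
        yields the product displayed in the table.\<close>
      have "Tr (r * fr r * fr (fr t3)) = Tr (t3 * (fr (fr r) * fr r))"
        using Tr_fr[of "r * fr r * fr (fr t3)"] by (simp add: mult_ac)
      moreover have "Tr (\<eta> * (- A13 * t3 + A16 * t5)) = Tr (\<eta> * (- A13 * t3)) + A16 * t5"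
        using pi_F[of "A16 * t5"] A t by (simp add: right_diff_distrib)
      moreover have "A16 * (t5 + Tr (t3 * (fr (fr r) * fr r))) = A16 * t5 + A16 * Tr (t3 * (fr (fr r) * fr r))"
        by (rule distrib_left)
      ultimately show ?thesis using A t by (simp only: theta_add F_closed Tr_in_F mult.assoc)
    qed
    show ?thesis unfolding 1 2 pi_eq power_q phi0_eq sum_distrib_left ..
  qed
  fix t2 t4 t5 assume t: "t2 \<in> F - {0}" "t5 \<in> F"
  \<comment> \<open>The sum is rewritten with - r in place of r to match the signs of the
    table.\<close>
  have 1: "\<chi>5 q \<eta> \<theta> A16 A23 A13 (x2 t2 \<otimes>\<^bsub>U\<^esub> x4 q t4 \<otimes>\<^bsub>U\<^esub> x5 t5) = (\<Sum>r\<in>UNIV. \<theta> (A23 * t2) *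
      \<theta> (Tr (\<eta> * (- A13 * (t2 * - r)))) * \<theta> (A16 * (t5 - Tr (- r * fr t4) + t2 * Nm (- r))))"
    using A assms t sum_UNIV_minus[of "\<lambda>r. \<theta> (A23 * t2) *
      \<theta> (Tr (\<eta> * (- A13 * (t2 * r)))) * \<theta> (A16 * (t5 - Tr (r * fr t4) + t2 * Nm r))"]
    by (simp add: x_products \<chi>5_value)
  have 2: "\<theta> (A23 * t2) * \<theta> (Tr (\<eta> * (- A13 * (t2 * - r)))) * \<theta> (A16 * (t5 - Tr (- r * fr t4) + t2 * Nm (- r))) =
      \<theta> (A23 * t2 + A16 * t5) * \<theta> (Tr (\<eta> * (A13 * r * t2 + A16 * (Tr (r * fr t4) - t2 * (fr (fr r) * fr r * r)))))" for r
  proof -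
    \<comment> \<open>z lies in F, where \<open>\<pi>q\<close> is the identity; this is how it moves
      into the argument of \<open>\<pi>q\<close>.\<close>
    define z where "z = A16 * (Tr (r * fr t4) - t2 * Nm r)"
    have z: "z \<in> F" "A23 * t2 \<in> F" "A16 * t5 \<in> F" using A assms t by (auto simp: z_def)
    have "A16 * (t5 - Tr (- r * fr t4) + t2 * Nm (- r)) = A16 * t5 + z"
      by (simp add: z_def Nm_def algebra_simps)
    moreover have "A16 * (Tr (r * fr t4) - t2 * (fr (fr r) * fr r * r)) = z"
      by (simp add: z_def Nm_def mult_ac)
    moreover have "Tr (\<eta> * (A13 * r * t2 + z)) = Tr (\<eta> * (- A13 * (t2 * - r))) + z"
      using pi_F[OF z(1)] by (simp add: distrib_left mult_ac)
    ultimately show ?thesis by (simp only: theta_add z Tr_in_F) (simp only: mult_ac)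
  qed
  show "\<chi>5 q \<eta> \<theta> A16 A23 A13 (x2 t2 \<otimes>\<^bsub>U\<^esub> x4 q t4 \<otimes>\<^bsub>U\<^esub> x5 t5) = \<theta> (A23 * t2 + A16 * t5) *
      (\<Sum>r1\<in>UNIV. \<theta> (\<pi>q q \<eta> (A13 * r1 * t2 + A16 * (\<phi>0 q (r1 * t4 ^ q) - t2 * r1 ^ (q\<^sup>2 + q + 1)))))"
    unfolding 1 2 pi_eq power_q phi0_eq sum_distrib_left ..
qed (use assms in \<open>simp_all add: x_products X_0[symmetric] pi_eq\<close>,
     use assms in \<open>simp_all add: x_elt_single \<chi>5_value card_UNIV\<close>,
     use assms \<chi>5_at_X456[of A16 A23 0 0] in \<open>simp_all add: \<chi>5_value\<close>)

lemma table6: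
  assumes "A17 \<in> F - {0}"
  shows "let \<chi> = \<chi>6 q \<eta> \<theta> A17 A12 in
       \<chi> \<one>\<^bsub>U\<^esub> = of_nat (q ^ 4) \<and>
       (\<forall>t1\<in>UNIV - {0}. \<forall>t3\<in>T t1 - {0}. \<chi> (x1 q t1 \<otimes>\<^bsub>U\<^esub> x3 q t3) = 0) \<and>
       (\<forall>t2\<in>F - {0}. \<forall>t4. \<forall>t5\<in>F. \<chi> (x2 t2 \<otimes>\<^bsub>U\<^esub> x4 q t4 \<otimes>\<^bsub>U\<^esub> x5 t5) = 0) \<and>
       (\<forall>t1\<in>UNIV - {0}. \<forall>t2\<in>F - {0}. \<chi> (x2 t2 \<otimes>\<^bsub>U\<^esub> x1 q t1) = 0) \<and>
       (\<forall>t3\<in>UNIV - {0}. \<forall>t5\<in>F. \<chi> (x3 q t3 \<otimes>\<^bsub>U\<^esub> x5 t5) = 0) \<and>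
       (\<forall>t4\<in>UNIV - {0}. \<chi> (x4 q t4) = 0) \<and>
       (\<forall>t5\<in>F - {0}. \<chi> (x5 t5) = 0) \<and>
       (\<forall>t6\<in>F - {0}. \<chi> (x6 t6) = of_nat (q ^ 4) * \<theta> (A17 * t6)) \<and>
       (\<forall>t1\<in>UNIV - {0}. \<forall>t6\<in>F. \<chi> (x1 q t1 \<otimes>\<^bsub>U\<^esub> x6 t6) =
          \<theta> (\<pi>q q \<eta> (A12 * t1 + A17 * t6)) *
          (\<Sum>r3\<in>UNIV. \<theta> (A17 * \<phi>0 q (- t1 * r3 ^ (q\<^sup>2 + q)))))"
  unfolding Let_def
proof (intro conjI ballI allI)
  have A: "A17 \<in> F" "A17 \<noteq> 0" using assms by auto
  show "\<chi>6 q \<eta> \<theta> A17 A12 (x1 q t1 \<otimes>\<^bsub>U\<^esub> x3 q t3) = 0" if "t1 \<in> UNIV - {0}" "t3 \<in> T t1 - {0}" for t1 t3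
  proof -
    \<comment> \<open>A nonzero element of T t1 lies off the line t1 F, so no conjugate falls into
      H.\<close>
    have "t3 \<noteq> r * t1" if "r \<in> F" for r
      using T_not_line[of t1 t3 r] that \<open>t1 \<in> _\<close> \<open>t3 \<in> _\<close> by (auto simp: mult.commute)
    thus ?thesis using A by (simp add: x_products \<chi>6_value)
  qed
  show "\<chi>6 q \<eta> \<theta> A17 A12 (x1 q t1 \<otimes>\<^bsub>U\<^esub> x6 t6) = \<theta> (\<pi>q q \<eta> (A12 * t1 + A17 * t6)) *
      (\<Sum>r3\<in>UNIV. \<theta> (A17 * \<phi>0 q (- t1 * r3 ^ (q\<^sup>2 + q))))" if t: "t1 \<in> UNIV - {0}" "t6 \<in> F" for t1 t6
  proof -
    \<comment> \<open>For third coordinate 0 and t1 nonzero, only r2 = 0 contributes.\<close>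
    have "\<chi>6 q \<eta> \<theta> A17 A12 (x1 q t1 \<otimes>\<^bsub>U\<^esub> x6 t6) = (\<Sum>r2\<in>F. if r2 = 0 then \<Sum>r3\<in>UNIV.
        \<theta> (Tr (\<eta> * (A12 * t1))) * \<theta> (A17 * (t6 - Tr (t1 * fr r3 * fr (fr r3)))) else 0)"
      using A t by (simp only: x_products \<chi>6_value F_closed) (rule sum.cong[OF refl], auto)
    also have "\<dots> = (\<Sum>r3\<in>UNIV. \<theta> (Tr (\<eta> * (A12 * t1))) * \<theta> (A17 * (t6 - Tr (t1 * fr r3 * fr (fr r3)))))"
      by (simp add: sum.delta)
    also have "\<dots> = (\<Sum>r3\<in>UNIV. \<theta> (Tr (\<eta> * (A12 * t1 + A17 * t6))) * \<theta> (A17 * Tr (- t1 * (fr (fr r3) * fr r3))))"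
    proof (rule sum.cong[OF refl])
      fix r
      have "A17 * (t6 - Tr (t1 * fr r * fr (fr r))) = A17 * t6 + A17 * Tr (- t1 * (fr (fr r) * fr r))"
        by (simp add: algebra_simps)
      moreover have "Tr (\<eta> * (A12 * t1 + A17 * t6)) = Tr (\<eta> * (A12 * t1)) + A17 * t6"
        using pi_F[of "A17 * t6"] A t by (simp add: distrib_left)
      ultimately show "\<theta> (Tr (\<eta> * (A12 * t1))) * \<theta> (A17 * (t6 - Tr (t1 * fr r * fr (fr r)))) =
          \<theta> (Tr (\<eta> * (A12 * t1 + A17 * t6))) * \<theta> (A17 * Tr (- t1 * (fr (fr r) * fr r)))"
        using A t by (simp only: theta_add F_closed Tr_in_F mult.assoc)
    qed
    finally show ?thesis unfolding pi_eq power_q phi0_eq sum_distrib_left .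
  qed
qed (use assms in \<open>simp_all add: x_products X_0[symmetric] pi_eq\<close>,
     use assms in \<open>simp_all add: x_elt_single \<chi>6_at_X456\<close>, use assms in \<open>simp_all add: \<chi>6_value\<close>)

end

text \<open>The families are told apart by how much of the filtration X6, X56, X456, X3456 their
  kernels contain. The sets N6, N5, N4, N3 stand for these terms, and M5, M4, M3 for the root
  subgroups X5, X4, X3 inside them.\<close>

lemma filtration_disjoint:
  fixes k :: "'x \<Rightarrow> 'y set"
  assumes "\<And>x. x \<in> A \<Longrightarrow> N3 \<subseteq> k x" "\<And>x. x \<in> B \<Longrightarrow> N4 \<subseteq> k x \<and> \<not> M3 \<subseteq> k x"
    "\<And>x. x \<in> C \<Longrightarrow> N5 \<subseteq> k x \<and> \<not> M4 \<subseteq> k x" "\<And>x. x \<in> D \<Longrightarrow> N6 \<subseteq> k x \<and> \<not> M5 \<subseteq> k x"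
    "\<And>x. x \<in> E \<Longrightarrow> \<not> N6 \<subseteq> k x"
    and "N6 \<subseteq> N5" "N5 \<subseteq> N4" "N4 \<subseteq> N3" "M5 \<subseteq> N5" "M4 \<subseteq> N4" "M3 \<subseteq> N3"
  shows "A \<inter> B = {}" "A \<inter> C = {}" "A \<inter> D = {}" "A \<inter> E = {}" "B \<inter> C = {}" "B \<inter> D = {}" "B \<inter> E = {}"
    "C \<inter> D = {}" "C \<inter> E = {}" "D \<inter> E = {}"
  using assms by (meson disjoint_iff subset_trans)+

text \<open>Once the five families exhaust I, each kernel condition selects exactly one of them,
  since it holds on that family and fails on the other four.\<close>

lemma filtration_partition:
  fixes k :: "'x \<Rightarrow> 'y set"
  assumes "\<And>x. x \<in> A \<Longrightarrow> N3 \<subseteq> k x" "\<And>x. x \<in> B \<Longrightarrow> N4 \<subseteq> k x \<and> \<not> M3 \<subseteq> k x"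
    "\<And>x. x \<in> C \<Longrightarrow> N5 \<subseteq> k x \<and> \<not> M4 \<subseteq> k x" "\<And>x. x \<in> D \<Longrightarrow> N6 \<subseteq> k x \<and> \<not> M5 \<subseteq> k x"
    "\<And>x. x \<in> E \<Longrightarrow> \<not> N6 \<subseteq> k x"
    and "N6 \<subseteq> N5" "N5 \<subseteq> N4" "N4 \<subseteq> N3" "M5 \<subseteq> N5" "M4 \<subseteq> N4" "M3 \<subseteq> N3"
    and I: "I = A \<union> B \<union> C \<union> D \<union> E"
  shows "{x \<in> I. N3 \<subseteq> k x} = A" "{x \<in> I. N4 \<subseteq> k x \<and> \<not> M3 \<subseteq> k x} = B"
    "{x \<in> I. N5 \<subseteq> k x \<and> \<not> M4 \<subseteq> k x} = C" "{x \<in> I. N6 \<subseteq> k x \<and> \<not> M5 \<subseteq> k x} = D" "{x \<in> I. \<not> N6 \<subseteq> k x} = E"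
proof -
  have I': "x \<in> I \<longleftrightarrow> x \<in> A \<or> x \<in> B \<or> x \<in> C \<or> x \<in> D \<or> x \<in> E" for x unfolding I by blast
  show "{x \<in> I. N3 \<subseteq> k x} = A" "{x \<in> I. N4 \<subseteq> k x \<and> \<not> M3 \<subseteq> k x} = B"
    "{x \<in> I. N5 \<subseteq> k x \<and> \<not> M4 \<subseteq> k x} = C" "{x \<in> I. N6 \<subseteq> k x \<and> \<not> M5 \<subseteq> k x} = D" "{x \<in> I. \<not> N6 \<subseteq> k x} = E"
    by (rule Set.set_eqI, unfold mem_Collect_eq I', meson assms(1-11) subset_trans)+
qed

section \<open>Counting and completeness\<close>

context triality
begin

abbreviation Phi_lin where "Phi_lin \<equiv> {\<chi>_lin q \<eta> \<theta> A12 A23 | A12 A23. A23 \<in> F}"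
abbreviation Phi3 where "Phi3 \<equiv> {\<chi>3 q \<eta> \<theta> A13 A12 | A13 A12. A13 \<in> UNIV - {0} \<and> A12 \<in> T A13}"
abbreviation Phi4 where "Phi4 \<equiv> {\<chi>4 q \<eta> \<theta> A15 A23 | A15 A23. A15 \<in> UNIV - {0} \<and> A23 \<in> F}"
abbreviation Phi5 where "Phi5 \<equiv> {\<chi>5 q \<eta> \<theta> A16 A23 A13 | A16 A23 A13. A16 \<in> F - {0} \<and> A23 \<in> F}"
abbreviation Phi6 where "Phi6 \<equiv> {\<chi>6 q \<eta> \<theta> A17 A12 | A17 A12. A17 \<in> F - {0}}"

lemma inj_families:
  "inj_on (\<lambda>(A12, A23). \<chi>_lin q \<eta> \<theta> A12 A23) (UNIV \<times> F)"
  "inj_on (\<lambda>(A13, A12). \<chi>3 q \<eta> \<theta> A13 A12) (SIGMA A13:UNIV - {0}. T A13)"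
  "inj_on (\<lambda>(A15, A23). \<chi>4 q \<eta> \<theta> A15 A23) ((UNIV - {0}) \<times> F)"
  "inj_on (\<lambda>(A16, A23, A13). \<chi>5 q \<eta> \<theta> A16 A23 A13) ((F - {0}) \<times> F \<times> UNIV)"
  "inj_on (\<lambda>(A17, A12). \<chi>6 q \<eta> \<theta> A17 A12) ((F - {0}) \<times> UNIV)"
  unfolding \<chi>_lin_eq \<chi>3_eq \<chi>4_eq \<chi>5_eq \<chi>6_eq
  by (rule inj_onI; clarify; drule \<chi>_lin_inj[rotated 2] \<chi>3_inj[rotated 3] \<chi>4_inj[rotated 3]
      \<chi>5_inj[rotated 5] \<chi>6_inj[rotated 3]; simp)+

lemma family_eq_image:
  "Phi_lin = (\<lambda>(A12, A23). \<chi>_lin q \<eta> \<theta> A12 A23) ` (UNIV \<times> F)"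
  "Phi3 = (\<lambda>(A13, A12). \<chi>3 q \<eta> \<theta> A13 A12) ` (SIGMA A13:UNIV - {0}. T A13)"
  "Phi4 = (\<lambda>(A15, A23). \<chi>4 q \<eta> \<theta> A15 A23) ` ((UNIV - {0}) \<times> F)"
  "Phi5 = (\<lambda>(A16, A23, A13). \<chi>5 q \<eta> \<theta> A16 A23 A13) ` ((F - {0}) \<times> F \<times> UNIV)"
  "Phi6 = (\<lambda>(A17, A12). \<chi>6 q \<eta> \<theta> A17 A12) ` ((F - {0}) \<times> UNIV)"
  by (auto simp: image_iff Sigma_def) blast+

text \<open>The field is the disjoint union of the translates r + a F with r in T a, and F has q
  elements.\<close>

lemma card_T: "a \<noteq> 0 \<Longrightarrow> card (T a) = q ^ 2"
proof -
  assume a: "a \<noteq> 0"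
  have "bij_betw (\<lambda>(r, c). r + a * c) (T a \<times> F) UNIV"
    unfolding bij_betw_def
  proof
    show "inj_on (\<lambda>(r, c). r + a * c) (T a \<times> F)"
    proof (rule inj_onI, clarify)
      fix r c s d assume rs: "r \<in> T a" "s \<in> T a" "c \<in> F" "d \<in> F" "r + a * c = s + a * d"
      hence "r = s + a * (d - c)" by (simp add: algebra_simps)
      hence "r = s" using T_unique[OF a rs(1,2), of "d - c"] rs by simp
      thus "r = s \<and> c = d" using rs(5) a by simp
    qed
    show "(\<lambda>(r, c). r + a * c) ` (T a \<times> F) = UNIV" using T_ex[OF a] by (fastforce simp: image_iff)
  qed
  hence "card (T a \<times> F) = card (UNIV :: 'a set)" by (rule bij_betw_same_card)
  hence "card (T a) * q = q ^ 2 * q"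
    by (simp add: card_cartesian_product card_F card_UNIV power3_eq_cube power2_eq_square)
  thus ?thesis using q_gt_1 by simp
qed

text \<open>Real numbers keep q - 1 and q^3 - 1 free of truncated subtraction.\<close>

lemma card_families:
  "card Phi_lin = q ^ 4" "real (card Phi3) = (real q ^ 3 - 1) * real q ^ 2"
  "real (card Phi4) = (real q ^ 3 - 1) * real q" "real (card Phi5) = (real q - 1) * real q ^ 4"
  "real (card Phi6) = (real q - 1) * real q ^ 3"
proof -
  have K: "real (card (UNIV - {0 :: 'a})) = real q ^ 3 - 1"
    using q_gt_1 by (simp add: card_UNIV of_nat_diff)
  have F: "real (card (F - {0})) = real q - 1"
    using q_gt_1 by (simp add: card_F of_nat_diff)
  show "card Phi_lin = q ^ 4"
    unfolding family_eq_image card_image[OF inj_families(1)]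
    by (simp add: card_cartesian_product card_F card_UNIV eval_nat_numeral)
  show "real (card Phi3) = (real q ^ 3 - 1) * real q ^ 2"
  proof -
    have "card (SIGMA A13:UNIV - {0}. T A13) = (\<Sum>a\<in>UNIV - {0}. card (T a))" by (rule card_SigmaI) auto
    also have "\<dots> = card (UNIV - {0 :: 'a}) * q ^ 2" by (simp add: card_T)
    finally show ?thesis unfolding family_eq_image card_image[OF inj_families(2)] K[symmetric] by simp
  qed
  show "real (card Phi4) = (real q ^ 3 - 1) * real q"
    unfolding family_eq_image card_image[OF inj_families(3)] K[symmetric] card_cartesian_product card_F by simp
  show "real (card Phi5) = (real q - 1) * real q ^ 4"
    unfolding family_eq_image card_image[OF inj_families(4)] F[symmetric] card_cartesian_product card_F card_UNIV
    by (simp add: eval_nat_numeral)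
  show "real (card Phi6) = (real q - 1) * real q ^ 3"
    unfolding family_eq_image card_image[OF inj_families(5)] F[symmetric] card_cartesian_product card_UNIV
    by simp
qed

lemma finite_families: "finite Phi_lin" "finite Phi3" "finite Phi4" "finite Phi5" "finite Phi6"
  unfolding family_eq_image by (intro finite_imageI finite_cartesian_product finite_SigmaI finite_UNIV_F)+

lemma families_Irr: "Phi_lin \<subseteq> Irr U" "Phi3 \<subseteq> Irr U" "Phi4 \<subseteq> Irr U" "Phi5 \<subseteq> Irr U" "Phi6 \<subseteq> Irr U"
  unfolding \<chi>_lin_eq \<chi>3_eq \<chi>4_eq \<chi>5_eq \<chi>6_eq
  subgoal by (rule subsetI, elim CollectE exE conjE, hypsubst, rule \<chi>_lin_Irr)
  subgoal by (rule subsetI, elim CollectE exE conjE, hypsubst, rule \<chi>3_Irr, simp)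
  subgoal by (rule subsetI, elim CollectE exE conjE, hypsubst, rule \<chi>4_Irr, simp_all)
  subgoal by (rule subsetI, elim CollectE exE conjE, hypsubst, rule \<chi>5_Irr, simp_all)
  subgoal by (rule subsetI, elim CollectE exE conjE, hypsubst, rule \<chi>6_Irr, simp_all)
  done

lemma degrees:
  "\<chi> \<in> Phi_lin \<Longrightarrow> \<chi> \<one>\<^bsub>U\<^esub> = 1" "\<chi> \<in> Phi3 \<Longrightarrow> \<chi> \<one>\<^bsub>U\<^esub> = of_nat q"
  "\<chi> \<in> Phi4 \<Longrightarrow> \<chi> \<one>\<^bsub>U\<^esub> = of_nat (q ^ 3)" "\<chi> \<in> Phi5 \<Longrightarrow> \<chi> \<one>\<^bsub>U\<^esub> = of_nat (q ^ 3)"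
  "\<chi> \<in> Phi6 \<Longrightarrow> \<chi> \<one>\<^bsub>U\<^esub> = of_nat (q ^ 4)"
  subgoal by (elim CollectE exE conjE, hypsubst, rule table_lin[unfolded Let_def, THEN conjunct2, THEN conjunct2, THEN conjunct2,
        THEN conjunct2, THEN conjunct1])
  subgoal by (elim CollectE exE conjE, hypsubst, rule table3[unfolded Let_def, THEN conjunct1])
  subgoal by (elim CollectE exE conjE, hypsubst, rule table4[unfolded Let_def, THEN conjunct1])
  subgoal by (elim CollectE exE conjE, hypsubst, rule table5[unfolded Let_def, THEN conjunct1])
  subgoal by (elim CollectE exE conjE, hypsubst, rule table6[unfolded Let_def, THEN conjunct1])
  done

lemma ker_iff:
  "SX P \<subseteq> char_kernel U \<chi> \<longleftrightarrow> (\<forall>t1 t2 t3 t4 t5 t6. t2 \<in> F \<longrightarrow> t5 \<in> F \<longrightarrow> t6 \<in> F \<longrightarrow> P t1 t2 t3 t4 t5 t6 \<longrightarrow>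
     \<chi> (X t1 t2 t3 t4 t5 t6) = \<chi> \<one>\<^bsub>U\<^esub>)" (is "?L \<longleftrightarrow> ?R")
proof
  assume ?L
  thus ?R by (auto simp: char_kernel_def subset_iff)
next
  assume R: ?R
  show ?L
  proof
    fix g assume "g \<in> SX P"
    thus "g \<in> char_kernel U \<chi>" using R by (elim SX_cases) (auto simp: char_kernel_def)
  qed
qed

text \<open>On the root subgroup that must escape the kernel, the character is its degree times a
  nontrivial additive character, by nondegeneracy of the pairings with \<theta>.\<close>

lemma kernels:
  "\<chi> \<in> Phi_lin \<Longrightarrow> X3456 q \<subseteq> char_kernel U \<chi>"
  "\<chi> \<in> Phi3 \<Longrightarrow> X456 q \<subseteq> char_kernel U \<chi> \<and> \<not> X3 q \<subseteq> char_kernel U \<chi>"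
  "\<chi> \<in> Phi4 \<Longrightarrow> X56 q \<subseteq> char_kernel U \<chi> \<and> \<not> X4 q \<subseteq> char_kernel U \<chi>"
  "\<chi> \<in> Phi5 \<Longrightarrow> X6 q \<subseteq> char_kernel U \<chi> \<and> \<not> X5 q \<subseteq> char_kernel U \<chi>"
  "\<chi> \<in> Phi6 \<Longrightarrow> \<not> X6 q \<subseteq> char_kernel U \<chi>"
proof -
  note one = degrees
  have q: "of_nat q \<noteq> (0 :: complex)" "of_nat (q ^ n) \<noteq> (0 :: complex)" for n using q_gt_1 by auto
  show "X3456 q \<subseteq> char_kernel U \<chi>" if \<chi>: "\<chi> \<in> Phi_lin"
    using \<chi> one(1)[OF \<chi>] unfolding X_products ker_iff by (auto simp: \<chi>_lin_value)
  show "X456 q \<subseteq> char_kernel U \<chi> \<and> \<not> X3 q \<subseteq> char_kernel U \<chi>" if \<chi>: "\<chi> \<in> Phi3"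
  proof -
    obtain A13 A12 where A: "A13 \<noteq> 0" "\<chi> = \<chi>3 q \<eta> \<theta> A13 A12" using \<chi> by auto
    have "\<exists>t. \<theta> (Tr (- (\<eta> * A13) * t)) \<noteq> \<theta> (Tr (0 * t))"
      using theta_Tr_nondegenerate[of "- (\<eta> * A13)" 0] A(1) eta_neq_0 by auto
    then obtain t where "\<theta> (Tr (- (\<eta> * A13) * t)) \<noteq> 1" by auto
    hence "\<chi> (X 0 0 t 0 0 0) \<noteq> of_nat q" using q by (simp add: A(2) \<chi>3_at_X3456 mult.assoc)
    moreover have "\<chi> (X 0 0 0 t4 t5 t6) = of_nat q" if "t5 \<in> F" "t6 \<in> F" for t4 t5 t6
      using that by (simp add: A(2) \<chi>3_at_X3456)
    ultimately show ?thesis unfolding X_products X_sets ker_iff one(2)[OF \<chi>] by auto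
  qed
  show "X56 q \<subseteq> char_kernel U \<chi> \<and> \<not> X4 q \<subseteq> char_kernel U \<chi>" if \<chi>: "\<chi> \<in> Phi4"
  proof -
    obtain A15 A23 where A: "A15 \<noteq> 0" "A23 \<in> F" "\<chi> = \<chi>4 q \<eta> \<theta> A15 A23" using \<chi> by auto
    have "\<exists>t. \<theta> (Tr (coeff4 A15 * t)) \<noteq> \<theta> (Tr (0 * t))"
      using theta_Tr_nondegenerate[of "coeff4 A15" 0] A(1) by auto
    then obtain t where "\<theta> (Tr (coeff4 A15 * t)) \<noteq> 1" by auto
    hence "\<chi> (X 0 0 0 t 0 0) \<noteq> of_nat (q ^ 3)" using q by (simp add: A(2,3) \<chi>4_at_X456)
    moreover have "\<chi> (X 0 0 0 0 t5 t6) = of_nat (q ^ 3)" if "t5 \<in> F" "t6 \<in> F" for t5 t6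
      using that by (simp add: A(2,3) \<chi>4_at_X456)
    ultimately show ?thesis unfolding X_products X_sets ker_iff one(3)[OF \<chi>] by auto
  qed
  show "X6 q \<subseteq> char_kernel U \<chi> \<and> \<not> X5 q \<subseteq> char_kernel U \<chi>" if \<chi>: "\<chi> \<in> Phi5"
  proof -
    obtain A16 A23 A13 where A: "A16 \<noteq> 0" "A16 \<in> F" "A23 \<in> F" "\<chi> = \<chi>5 q \<eta> \<theta> A16 A23 A13" using \<chi> by auto
    have "\<exists>t\<in>F. \<theta> (A16 * t) \<noteq> \<theta> (0 * t)"
      using theta_F_nondegenerate[of A16 0] A(1,2) by auto
    then obtain t where "t \<in> F" "\<theta> (A16 * t) \<noteq> 1" by auto
    hence "t \<in> F" "\<chi> (X 0 0 0 0 t 0) \<noteq> of_nat (q ^ 3)" using q by (simp_all add: A(2-4) \<chi>5_at_X456)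
    moreover have "\<chi> (X 0 0 0 0 0 t6) = of_nat (q ^ 3)" if "t6 \<in> F" for t6
      using that by (simp add: A(2-4) \<chi>5_at_X456)
    ultimately show ?thesis unfolding X_products X_sets ker_iff one(4)[OF \<chi>] by auto
  qed
  show "\<not> X6 q \<subseteq> char_kernel U \<chi>" if \<chi>: "\<chi> \<in> Phi6"
  proof -
    obtain A17 A12 where A: "A17 \<noteq> 0" "A17 \<in> F" "\<chi> = \<chi>6 q \<eta> \<theta> A17 A12" using \<chi> by auto
    have "\<exists>t\<in>F. \<theta> (A17 * t) \<noteq> \<theta> (0 * t)"
      using theta_F_nondegenerate[of A17 0] A(1,2) by auto
    then obtain t where "t \<in> F" "\<theta> (A17 * t) \<noteq> 1" by auto
    hence "t \<in> F" "\<chi> (X 0 0 0 0 0 t) \<noteq> of_nat (q ^ 4)" using q by (simp_all add: A \<chi>6_at_X456)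
    thus ?thesis unfolding X_products ker_iff one(5)[OF \<chi>] by blast
  qed
qed

lemma root_subgroup_inclusions:
  "X6 q \<subseteq> (X56 q :: ('a mat \<Rightarrow> 'a mat) set)" "X56 q \<subseteq> (X456 q :: ('a mat \<Rightarrow> 'a mat) set)" "X456 q \<subseteq> (X3456 q :: ('a mat \<Rightarrow> 'a mat) set)"
  "X5 q \<subseteq> (X56 q :: ('a mat \<Rightarrow> 'a mat) set)" "X4 q \<subseteq> (X456 q :: ('a mat \<Rightarrow> 'a mat) set)" "X3 q \<subseteq> (X3456 q :: ('a mat \<Rightarrow> 'a mat) set)"
  subgoal unfolding X_products by (rule SX_mono) simp
  subgoal unfolding X_products by (rule SX_mono) simp
  subgoal unfolding X_products by (rule SX_mono) simp
  subgoal unfolding X_products X_sets by (rule SX_mono) simp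
  subgoal unfolding X_products X_sets by (rule SX_mono) simp
  subgoal unfolding X_products X_sets by (rule SX_mono) simp
  done

lemma families_disjoint:
  "Phi_lin \<inter> Phi3 = {}" "Phi_lin \<inter> Phi4 = {}" "Phi_lin \<inter> Phi5 = {}" "Phi_lin \<inter> Phi6 = {}"
  "Phi3 \<inter> Phi4 = {}" "Phi3 \<inter> Phi5 = {}" "Phi3 \<inter> Phi6 = {}"
  "Phi4 \<inter> Phi5 = {}" "Phi4 \<inter> Phi6 = {}" "Phi5 \<inter> Phi6 = {}"
  by (rule filtration_disjoint[where k = "char_kernel U" and A = Phi_lin and B = Phi3 and C = Phi4 and D = Phi5
      and E = Phi6, OF _ _ _ _ _ root_subgroup_inclusions]; erule kernels)+

text \<open>The degree squares telescope: q^4 + (q^7 - q^4) + (q^10 - q^7) + (q^11 - q^10) + (q^12 -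
  q^11) = q^12.\<close>

lemma Irr_U: "Irr U = Phi_lin \<union> Phi3 \<union> Phi4 \<union> Phi5 \<union> Phi6"
proof (rule U.Irr_eqI[OF finite_U])
  have deg: "(\<Sum>\<chi>\<in>S. (cmod (\<chi> \<one>\<^bsub>U\<^esub>))\<^sup>2) = real (card S) * real d ^ 2"
    if "\<And>\<chi>. \<chi> \<in> S \<Longrightarrow> \<chi> \<one>\<^bsub>U\<^esub> = of_nat d" for S d
  proof -
    have "(\<Sum>\<chi>\<in>S. (cmod (\<chi> \<one>\<^bsub>U\<^esub>))\<^sup>2) = (\<Sum>\<chi>\<in>S. real d ^ 2)"
      using that by (intro sum.cong[OF refl]) (metis norm_of_nat)
    thus ?thesis by simp
  qed
  have union: "sum f (A \<union> B \<union> C \<union> D \<union> E) = sum f A + sum f B + sum f C + sum f D + sum f E"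
    if "A \<inter> B = {}" "A \<inter> C = {}" "A \<inter> D = {}" "A \<inter> E = {}" "B \<inter> C = {}" "B \<inter> D = {}" "B \<inter> E = {}"
      "C \<inter> D = {}" "C \<inter> E = {}" "D \<inter> E = {}" "finite A" "finite B" "finite C" "finite D" "finite E"
    for A B C D E :: "(('a mat \<Rightarrow> 'a mat) \<Rightarrow> complex) set" and f :: "_ \<Rightarrow> real"
    using that by (simp add: sum.union_disjoint Int_Un_distrib2)
  have "(\<Sum>\<chi>\<in>Phi_lin \<union> Phi3 \<union> Phi4 \<union> Phi5 \<union> Phi6. (cmod (\<chi> \<one>\<^bsub>U\<^esub>))\<^sup>2) =
      (\<Sum>\<chi>\<in>Phi_lin. (cmod (\<chi> \<one>\<^bsub>U\<^esub>))\<^sup>2) + (\<Sum>\<chi>\<in>Phi3. (cmod (\<chi> \<one>\<^bsub>U\<^esub>))\<^sup>2) + (\<Sum>\<chi>\<in>Phi4. (cmod (\<chi> \<one>\<^bsub>U\<^esub>))\<^sup>2)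
      + (\<Sum>\<chi>\<in>Phi5. (cmod (\<chi> \<one>\<^bsub>U\<^esub>))\<^sup>2) + (\<Sum>\<chi>\<in>Phi6. (cmod (\<chi> \<one>\<^bsub>U\<^esub>))\<^sup>2)"
    by (rule union[OF families_disjoint finite_families])
  also have "\<dots> = real (card Phi_lin) * real 1 ^ 2 + real (card Phi3) * real q ^ 2 + real (card Phi4) * real (q ^ 3) ^ 2
      + real (card Phi5) * real (q ^ 3) ^ 2 + real (card Phi6) * real (q ^ 4) ^ 2"
    by (intro arg_cong2[where f = "(+)"] deg) (simp_all only: degrees of_nat_1)
  also have "\<dots> = real q ^ 12"
    unfolding card_families of_nat_power by (simp add: algebra_simps flip: power_add power_Suc)
  finally show "(\<Sum>\<chi>\<in>Phi_lin \<union> Phi3 \<union> Phi4 \<union> Phi5 \<union> Phi6. (cmod (\<chi> \<one>\<^bsub>U\<^esub>))\<^sup>2) = real (card (carrier U))"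
    unfolding card_U by simp
  show "finite (Phi_lin \<union> Phi3 \<union> Phi4 \<union> Phi5 \<union> Phi6)" by (intro finite_UnI finite_families)
  show "Phi_lin \<union> Phi3 \<union> Phi4 \<union> Phi5 \<union> Phi6 \<subseteq> Irr U" by (intro Un_least families_Irr)
qed

lemma kernel_families:
  "{\<chi> \<in> Irr U. X3456 q \<subseteq> char_kernel U \<chi>} = Phi_lin"
  "{\<chi> \<in> Irr U. X456 q \<subseteq> char_kernel U \<chi> \<and> \<not> X3 q \<subseteq> char_kernel U \<chi>} = Phi3"
  "{\<chi> \<in> Irr U. X56 q \<subseteq> char_kernel U \<chi> \<and> \<not> X4 q \<subseteq> char_kernel U \<chi>} = Phi4"
  "{\<chi> \<in> Irr U. X6 q \<subseteq> char_kernel U \<chi> \<and> \<not> X5 q \<subseteq> char_kernel U \<chi>} = Phi5"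
  "{\<chi> \<in> Irr U. \<not> X6 q \<subseteq> char_kernel U \<chi>} = Phi6"
  by (rule filtration_partition[where k = "char_kernel U", OF _ _ _ _ _ root_subgroup_inclusions Irr_U]; erule kernels)+

section \<open>The class list in the form of the statement\<close>

lemma class_one: "conj_class U \<one>\<^bsub>U\<^esub> = {\<one>\<^bsub>U\<^esub>}" "card (conj_class U \<one>\<^bsub>U\<^esub>) = 1"
  unfolding conj_class_one by simp_all

lemma class_x6: "\<forall>t6\<in>F - {0}. conj_class U (x6 t6) = {x6 t6} \<and> card (conj_class U (x6 t6)) = 1"
  by (simp add: x_elt_single conj_class_x6)

lemma class_x5: "\<forall>t5\<in>F - {0}. conj_class U (x5 t5) = {x_elt q 0 0 0 0 t5 s6 | s6. s6 \<in> F} \<and>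
    card (conj_class U (x5 t5)) = q"
proof (intro ballI conjI)
  fix t5 assume t: "t5 \<in> F - {0}"
  show "conj_class U (x5 t5) = {x_elt q 0 0 0 0 t5 s6 | s6. s6 \<in> F}"
    unfolding x_elt_single using t by (subst conj_class_x5) auto
  show "card (conj_class U (x5 t5)) = q" using t by (simp add: x_elt_single card_conj_classes)
qed

lemma class_x4: "\<forall>t4\<in>UNIV - {0}. conj_class U (x4 q t4) = {x_elt q 0 0 0 t4 s5 s6 | s5 s6. s5 \<in> F \<and> s6 \<in> F} \<and>
    card (conj_class U (x4 q t4)) = q ^ 2"
proof (intro ballI conjI)
  fix t4 :: 'a assume t: "t4 \<in> UNIV - {0}"
  show "conj_class U (x4 q t4) = {x_elt q 0 0 0 t4 s5 s6 | s5 s6. s5 \<in> F \<and> s6 \<in> F}"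
    unfolding x_elt_single using t by (subst conj_class_x4) auto
  show "card (conj_class U (x4 q t4)) = q ^ 2" using t by (simp add: x_elt_single card_conj_classes)
qed

text \<open>The dependent parameter may vary with all displayed parameters; the witness varies only
  with s4.\<close>

lemma class_x3: "\<forall>t3\<in>UNIV - {0}. \<forall>t5\<in>F.
    (\<exists>f5. (\<forall>s4. \<forall>s6\<in>F. f5 s4 s6 \<in> F) \<and>
       conj_class U (x_elt q 0 0 t3 0 t5 0) = {x_elt q 0 0 t3 s4 (f5 s4 s6) s6 | s4 s6. s6 \<in> F}) \<and>
    card (conj_class U (x_elt q 0 0 t3 0 t5 0)) = q ^ 4"
proof (intro ballI conjI)
  fix t3 t5 :: 'a assume t: "t3 \<in> UNIV - {0}" "t5 \<in> F"
  show "\<exists>f5. (\<forall>s4. \<forall>s6\<in>F. f5 s4 s6 \<in> F) \<and>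
       conj_class U (x_elt q 0 0 t3 0 t5 0) = {x_elt q 0 0 t3 s4 (f5 s4 s6) s6 | s4 s6. s6 \<in> F}"
    by (rule exI[of _ "\<lambda>s4 s6. t5 + hat5 t3 s4"]) (use t in \<open>subst conj_class_x3; auto\<close>)
  show "card (conj_class U (x_elt q 0 0 t3 0 t5 0)) = q ^ 4" using t by (simp add: card_conj_classes)
qed

lemma class_x2: "\<forall>t2\<in>F - {0}. \<forall>t4. \<forall>t5\<in>F.
    (\<exists>f4 f5. (\<forall>s3. \<forall>s6\<in>F. f5 s3 s6 \<in> F) \<and>
       conj_class U (x_elt q 0 t2 0 t4 t5 0) =
         {x_elt q 0 t2 s3 (f4 s3 s6) (f5 s3 s6) s6 | s3 s6. s6 \<in> F}) \<and>
    card (conj_class U (x_elt q 0 t2 0 t4 t5 0)) = q ^ 4"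
proof (intro ballI allI conjI)
  fix t2 t4 t5 :: 'a assume t: "t2 \<in> F - {0}" "t5 \<in> F"
  show "\<exists>f4 f5. (\<forall>s3. \<forall>s6\<in>F. f5 s3 s6 \<in> F) \<and>
       conj_class U (x_elt q 0 t2 0 t4 t5 0) =
         {x_elt q 0 t2 s3 (f4 s3 s6) (f5 s3 s6) s6 | s3 s6. s6 \<in> F}"
    by (rule exI[of _ "\<lambda>s3 s6. t4 + hat4' t2 s3"], rule exI[of _ "\<lambda>s3 s6. t5 + hat5' t2 s3 (t4 + hat4' t2 s3)"])
       (use t in \<open>subst conj_class_x2; auto\<close>)
  show "card (conj_class U (x_elt q 0 t2 0 t4 t5 0)) = q ^ 4" using t by (simp add: card_conj_classes)
qed

lemma class_x1: "\<forall>t1\<in>UNIV - {0}. \<forall>t6\<in>F.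
    (\<exists>f6. (\<forall>s2\<in>F. \<forall>s4. \<forall>s5\<in>F. f6 s2 s4 s5 \<in> F) \<and>
       conj_class U (x_elt q t1 0 0 0 0 t6) =
         {x_elt q t1 0 (t1 * s2) s4 s5 (f6 s2 s4 s5) | s2 s4 s5. s2 \<in> F \<and> s5 \<in> F}) \<and>
    card (conj_class U (x_elt q t1 0 0 0 0 t6)) = q ^ 5"
proof (intro ballI conjI)
  fix t1 t6 :: 'a assume t: "t1 \<in> UNIV - {0}" "t6 \<in> F"
  show "\<exists>f6. (\<forall>s2\<in>F. \<forall>s4. \<forall>s5\<in>F. f6 s2 s4 s5 \<in> F) \<and>
       conj_class U (x_elt q t1 0 0 0 0 t6) =
         {x_elt q t1 0 (t1 * s2) s4 s5 (f6 s2 s4 s5) | s2 s4 s5. s2 \<in> F \<and> s5 \<in> F}"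
    by (rule exI[of _ "\<lambda>s2 s4 s5. t6 + hat6 t1 s2 s4 s5"]) (use t in \<open>subst conj_class_x1; force simp: image_iff\<close>)
  show "card (conj_class U (x_elt q t1 0 0 0 0 t6)) = q ^ 5" using t by (simp add: card_conj_classes)
qed

lemma class_x13: "\<forall>t1\<in>UNIV - {0}. \<forall>t3\<in>T t1 - {0}.
    conj_class U (x_elt q t1 0 t3 0 0 0) =
      {x_elt q t1 0 (t3 + t1 * s2) s4 s5 s6 | s2 s4 s5 s6. s2 \<in> F \<and> s5 \<in> F \<and> s6 \<in> F} \<and>
    card (conj_class U (x_elt q t1 0 t3 0 0 0)) = q ^ 6"
proof (intro ballI conjI)
  fix t1 t3 :: 'a assume t: "t1 \<in> UNIV - {0}" "t3 \<in> T t1 - {0}"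
  show "conj_class U (x_elt q t1 0 t3 0 0 0) =
      {x_elt q t1 0 (t3 + t1 * s2) s4 s5 s6 | s2 s4 s5 s6. s2 \<in> F \<and> s5 \<in> F \<and> s6 \<in> F}"
    using t by (subst conj_class_x13) (auto simp: image_iff)
  show "card (conj_class U (x_elt q t1 0 t3 0 0 0)) = q ^ 6" using t by (simp add: card_conj_classes)
qed

lemma class_x12: "\<forall>t1\<in>UNIV - {0}. \<forall>t2\<in>F - {0}.
    conj_class U (x_elt q t1 t2 0 0 0 0) = {x_elt q t1 t2 s3 s4 s5 s6 | s3 s4 s5 s6. s5 \<in> F \<and> s6 \<in> F} \<and>
    card (conj_class U (x_elt q t1 t2 0 0 0 0)) = q ^ 8"
proof (intro ballI conjI)
  fix t1 t2 :: 'a assume t: "t1 \<in> UNIV - {0}" "t2 \<in> F - {0}"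
  show "conj_class U (x_elt q t1 t2 0 0 0 0) = {x_elt q t1 t2 s3 s4 s5 s6 | s3 s4 s5 s6. s5 \<in> F \<and> s6 \<in> F}"
    using t by (subst conj_class_x12) (auto simp: image_iff)
  show "card (conj_class U (x_elt q t1 t2 0 0 0 0)) = q ^ 8" using t by (simp add: card_conj_classes)
qed

lemma reps_carrier: "reps \<subseteq> carrier U"
  unfolding reps_def by (auto simp: canonical_def)

lemma orthogonal: "\<forall>\<chi>\<in>Irr U. \<forall>\<psi>\<in>Irr U. \<chi> \<noteq> \<psi> \<longrightarrow> char_inner U \<chi> \<psi> = 0"
  by (simp add: U.char_inner_Irr[OF finite_U])

lemma normal_products: "X3456 q \<lhd> U" "X456 q \<lhd> U" "X56 q \<lhd> U" "X6 q \<lhd> U" "X45 q \<lhd> HU" "subgroup (X1456 q) U"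
  unfolding X_products by (rule normals normal_X45 subgroups)+

lemma subgroup_Hbar: "subgroup (Hbar3 q) (Ubar3 q :: ('a mat \<Rightarrow> 'a mat) set monoid)"
  "subgroup (Hbar4 q) (Ubar4 q :: ('a mat \<Rightarrow> 'a mat) set monoid)"
  "subgroup (Hbar5 q) (Ubar5 q :: ('a mat \<Rightarrow> 'a mat) set monoid)"
  unfolding Ubar3_def Ubar4_def Ubar5_def
  by (simp_all only: Hbar_eq X_products U.subgroup_bar normals subgroups)

end

theorem theorem1p1:
  fixes p k q :: nat
    and \<eta> :: "'a::finite_field"
    and \<theta> :: "'a \<Rightarrow> complex"
    and T :: "'a \<Rightarrow> 'a set"
    and U :: "('a mat \<Rightarrow> 'a mat) monoid"
    and F Fs Ks :: "'a set"
    and \<pi> :: "'a \<Rightarrow> 'a"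
    and reps :: "('a mat \<Rightarrow> 'a mat) set"
    and Ubl Ub3 Ub4 Ub5 Hb6 :: "('a mat \<Rightarrow> 'a mat) set monoid"
    and Hb3 Hb4 Hb5 :: "('a mat \<Rightarrow> 'a mat) set set"
    and H :: "('a mat \<Rightarrow> 'a mat) monoid"
    and F_lin F3 F4 F5 F6 :: "(('a mat \<Rightarrow> 'a mat) \<Rightarrow> complex) set"
  assumes "prime p" and "odd p" and "k \<ge> 1" and "q = p ^ k"
    and "card (UNIV :: 'a set) = q ^ 3"
    and "\<eta> \<notin> Fq q" and "\<eta> ^ q\<^sup>2 + \<eta> ^ q + \<eta> = 1"
    and "nontrivial_additive_char q \<theta>"
    and "\<And>a. a \<noteq> 0 \<Longrightarrow> line_transversal q a (T a)"
  defines "U \<equiv> triality_U q"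
    and "F \<equiv> Fq q"
    and "Fs \<equiv> Fq q - {0}"
    and "Ks \<equiv> UNIV - {0}"
    and "\<pi> \<equiv> \<pi>q q \<eta>"
    and "reps \<equiv>
      {\<one>\<^bsub>U\<^esub>}
      \<union> {x6 t6 | t6. t6 \<in> Fs}
      \<union> {x5 t5 | t5. t5 \<in> Fs}
      \<union> {x4 q t4 | t4. t4 \<in> Ks}
      \<union> {x_elt q 0 0 t3 0 t5 0 | t3 t5. t3 \<in> Ks \<and> t5 \<in> F}
      \<union> {x_elt q 0 t2 0 t4 t5 0 | t2 t4 t5. t2 \<in> Fs \<and> t5 \<in> F}
      \<union> {x_elt q t1 0 0 0 0 t6 | t1 t6. t1 \<in> Ks \<and> t6 \<in> F}
      \<union> {x_elt q t1 0 t3 0 0 0 | t1 t3. t1 \<in> Ks \<and> t3 \<in> T t1 \<and> t3 \<noteq> 0}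
      \<union> {x_elt q t1 t2 0 0 0 0 | t1 t2. t1 \<in> Ks \<and> t2 \<in> Fs}"
    and "Ubl \<equiv> Ubar_lin q" and "Ub3 \<equiv> Ubar3 q" and "Ub4 \<equiv> Ubar4 q" and "Ub5 \<equiv> Ubar5 q"
    and "Hb3 \<equiv> Hbar3 q" and "Hb4 \<equiv> Hbar4 q" and "Hb5 \<equiv> Hbar5 q"
    and "H \<equiv> H6 q" and "Hb6 \<equiv> Hbar6 q"
    and "F_lin \<equiv> {\<chi> \<in> Irr U. X3456 q \<subseteq> char_kernel U \<chi>}"
    and "F3 \<equiv> {\<chi> \<in> Irr U. X456 q \<subseteq> char_kernel U \<chi> \<and> \<not> X3 q \<subseteq> char_kernel U \<chi>}"
    and "F4 \<equiv> {\<chi> \<in> Irr U. X56 q \<subseteq> char_kernel U \<chi> \<and> \<not> X4 q \<subseteq> char_kernel U \<chi>}"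
    and "F5 \<equiv> {\<chi> \<in> Irr U. X6 q \<subseteq> char_kernel U \<chi> \<and> \<not> X5 q \<subseteq> char_kernel U \<chi>}"
    and "F6 \<equiv> {\<chi> \<in> Irr U. \<not> X6 q \<subseteq> char_kernel U \<chi>}"
  shows
   "\<comment> \<open>(A) conjugacy classes\<close>
    (reps \<subseteq> carrier U \<and> (\<forall>g\<in>carrier U. \<exists>!r. r \<in> reps \<and> g \<in> conj_class U r)) \<and>
    (conj_class U \<one>\<^bsub>U\<^esub> = {\<one>\<^bsub>U\<^esub>} \<and> card (conj_class U \<one>\<^bsub>U\<^esub>) = 1) \<and>
    (\<forall>t6\<in>Fs. conj_class U (x6 t6) = {x6 t6} \<and> card (conj_class U (x6 t6)) = 1) \<and>
    (\<forall>t5\<in>Fs. conj_class U (x5 t5) = {x_elt q 0 0 0 0 t5 s6 | s6. s6 \<in> F} \<and>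
       card (conj_class U (x5 t5)) = q) \<and>
    (\<forall>t4\<in>Ks. conj_class U (x4 q t4) = {x_elt q 0 0 0 t4 s5 s6 | s5 s6. s5 \<in> F \<and> s6 \<in> F} \<and>
       card (conj_class U (x4 q t4)) = q ^ 2) \<and>
    (\<forall>t3\<in>Ks. \<forall>t5\<in>F.
       (\<exists>f5. (\<forall>s4. \<forall>s6\<in>F. f5 s4 s6 \<in> F) \<and>
          conj_class U (x_elt q 0 0 t3 0 t5 0) =
            {x_elt q 0 0 t3 s4 (f5 s4 s6) s6 | s4 s6. s6 \<in> F}) \<and>
       card (conj_class U (x_elt q 0 0 t3 0 t5 0)) = q ^ 4) \<and>
    (\<forall>t2\<in>Fs. \<forall>t4. \<forall>t5\<in>F.
       (\<exists>f4 f5. (\<forall>s3. \<forall>s6\<in>F. f5 s3 s6 \<in> F) \<and>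
          conj_class U (x_elt q 0 t2 0 t4 t5 0) =
            {x_elt q 0 t2 s3 (f4 s3 s6) (f5 s3 s6) s6 | s3 s6. s6 \<in> F}) \<and>
       card (conj_class U (x_elt q 0 t2 0 t4 t5 0)) = q ^ 4) \<and>
    (\<forall>t1\<in>Ks. \<forall>t6\<in>F.
       (\<exists>f6. (\<forall>s2\<in>F. \<forall>s4. \<forall>s5\<in>F. f6 s2 s4 s5 \<in> F) \<and>
          conj_class U (x_elt q t1 0 0 0 0 t6) =
            {x_elt q t1 0 (t1 * s2) s4 s5 (f6 s2 s4 s5) | s2 s4 s5. s2 \<in> F \<and> s5 \<in> F}) \<and>
       card (conj_class U (x_elt q t1 0 0 0 0 t6)) = q ^ 5) \<and>
    (\<forall>t1\<in>Ks. \<forall>t3\<in>T t1 - {0}.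
       conj_class U (x_elt q t1 0 t3 0 0 0) =
         {x_elt q t1 0 (t3 + t1 * s2) s4 s5 s6 | s2 s4 s5 s6. s2 \<in> F \<and> s5 \<in> F \<and> s6 \<in> F} \<and>
       card (conj_class U (x_elt q t1 0 t3 0 0 0)) = q ^ 6) \<and>
    (\<forall>t1\<in>Ks. \<forall>t2\<in>Fs.
       conj_class U (x_elt q t1 t2 0 0 0 0) =
         {x_elt q t1 t2 s3 s4 s5 s6 | s3 s4 s5 s6. s5 \<in> F \<and> s6 \<in> F} \<and>
       card (conj_class U (x_elt q t1 t2 0 0 0 0)) = q ^ 8) \<and>

    \<comment> \<open>(B) irreducible characters\<close>
    (\<forall>\<chi>\<in>Irr U. \<forall>\<psi>\<in>Irr U. \<chi> \<noteq> \<psi> \<longrightarrow> char_inner U \<chi> \<psi> = 0) \<and>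

    (X3456 q \<lhd> U \<and>
     carrier Ubl = bar U (X3456 q) (X2 q) <#>\<^bsub>Ubl\<^esub> bar U (X3456 q) (X1 q) \<and>
     (\<forall>A12. \<forall>A23\<in>F. \<mu>_lin q \<eta> \<theta> A12 A23 \<in> Irr Ubl) \<and>
     F_lin = {\<chi>_lin q \<eta> \<theta> A12 A23 | A12 A23. A23 \<in> F} \<and>
     inj_on (\<lambda>(A12, A23). \<chi>_lin q \<eta> \<theta> A12 A23) (UNIV \<times> F)) \<and>

    (X456 q \<lhd> U \<and>
     carrier Ub3 = bar U (X456 q) (X2 q) <#>\<^bsub>Ub3\<^esub> bar U (X456 q) (X1 q)
       <#>\<^bsub>Ub3\<^esub> bar U (X456 q) (X3 q) \<and>
     subgroup Hb3 Ub3 \<and>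
     (\<forall>A12 A13. \<mu>3 q \<eta> \<theta> A13 A12 \<in> Irr (Ub3\<lparr>carrier := Hb3\<rparr>)) \<and>
     F3 = {\<chi>3 q \<eta> \<theta> A13 A12 | A13 A12. A13 \<in> Ks \<and> A12 \<in> T A13} \<and>
     inj_on (\<lambda>(A13, A12). \<chi>3 q \<eta> \<theta> A13 A12) (SIGMA A13:Ks. T A13)) \<and>

    (X56 q \<lhd> U \<and>
     carrier Ub4 = bar U (X56 q) (X2 q) <#>\<^bsub>Ub4\<^esub> bar U (X56 q) (X1 q)
       <#>\<^bsub>Ub4\<^esub> bar U (X56 q) (X3 q) <#>\<^bsub>Ub4\<^esub> bar U (X56 q) (X4 q) \<and>
     subgroup Hb4 Ub4 \<and>
     (\<forall>A15 A13. \<forall>A23\<in>F. \<mu>4 q \<eta> \<theta> A15 A23 A13 \<in> Irr (Ub4\<lparr>carrier := Hb4\<rparr>)) \<and>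
     F4 = {\<chi>4 q \<eta> \<theta> A15 A23 | A15 A23. A15 \<in> Ks \<and> A23 \<in> F} \<and>
     inj_on (\<lambda>(A15, A23). \<chi>4 q \<eta> \<theta> A15 A23) (Ks \<times> F)) \<and>

    (X6 q \<lhd> U \<and>
     carrier Ub5 = bar U (X6 q) (X2 q) <#>\<^bsub>Ub5\<^esub> bar U (X6 q) (X1 q)
       <#>\<^bsub>Ub5\<^esub> bar U (X6 q) (X3 q) <#>\<^bsub>Ub5\<^esub> bar U (X6 q) (X4 q)
       <#>\<^bsub>Ub5\<^esub> bar U (X6 q) (X5 q) \<and>
     subgroup Hb5 Ub5 \<and>
     (\<forall>A16\<in>F. \<forall>A23\<in>F. \<forall>A13 A15.
        \<mu>5 q \<eta> \<theta> A16 A23 A13 A15 \<in> Irr (Ub5\<lparr>carrier := Hb5\<rparr>)) \<and>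
     F5 = {\<chi>5 q \<eta> \<theta> A16 A23 A13 | A16 A23 A13. A16 \<in> Fs \<and> A23 \<in> F} \<and>
     inj_on (\<lambda>(A16, A23, A13). \<chi>5 q \<eta> \<theta> A16 A23 A13) (Fs \<times> F \<times> UNIV)) \<and>

    (subgroup (X1456 q) U \<and> X45 q \<lhd> H \<and>
     carrier Hb6 = bar H (X45 q) (X1 q) <#>\<^bsub>Hb6\<^esub> bar H (X45 q) (X6 q) \<and>
     (\<forall>A17\<in>F. \<forall>A12. \<mu>6 q \<eta> \<theta> A17 A12 \<in> Irr Hb6) \<and>
     F6 = {\<chi>6 q \<eta> \<theta> A17 A12 | A17 A12. A17 \<in> Fs} \<and>
     inj_on (\<lambda>(A17, A12). \<chi>6 q \<eta> \<theta> A17 A12) (Fs \<times> UNIV)) \<and>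

    (Irr U = F_lin \<union> F3 \<union> F4 \<union> F5 \<union> F6 \<and>
     F_lin \<inter> F3 = {} \<and> F_lin \<inter> F4 = {} \<and> F_lin \<inter> F5 = {} \<and> F_lin \<inter> F6 = {} \<and>
     F3 \<inter> F4 = {} \<and> F3 \<inter> F5 = {} \<and> F3 \<inter> F6 = {} \<and>
     F4 \<inter> F5 = {} \<and> F4 \<inter> F6 = {} \<and> F5 \<inter> F6 = {}) \<and>

    \<comment> \<open>(C) character table\<close>
    (\<forall>A12. \<forall>A23\<in>F.
       let \<chi> = \<chi>_lin q \<eta> \<theta> A12 A23 in
       (\<forall>t1\<in>Ks. \<forall>t6\<in>F. \<chi> (x1 q t1 \<otimes>\<^bsub>U\<^esub> x6 t6) = \<theta> (\<pi> (A12 * t1))) \<and>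
       (\<forall>t1\<in>Ks. \<forall>t3\<in>T t1 - {0}. \<chi> (x1 q t1 \<otimes>\<^bsub>U\<^esub> x3 q t3) = \<theta> (\<pi> (A12 * t1))) \<and>
       (\<forall>t2\<in>Fs. \<forall>t4. \<forall>t5\<in>F. \<chi> (x2 t2 \<otimes>\<^bsub>U\<^esub> x4 q t4 \<otimes>\<^bsub>U\<^esub> x5 t5) = \<theta> (A23 * t2)) \<and>
       (\<forall>t1\<in>Ks. \<forall>t2\<in>Fs. \<chi> (x2 t2 \<otimes>\<^bsub>U\<^esub> x1 q t1) = \<theta> (\<pi> (A12 * t1)) * \<theta> (A23 * t2)) \<and>
       \<chi> \<one>\<^bsub>U\<^esub> = 1 \<and>
       (\<forall>t3\<in>Ks. \<forall>t5\<in>F. \<chi> (x3 q t3 \<otimes>\<^bsub>U\<^esub> x5 t5) = 1) \<and>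
       (\<forall>t4\<in>Ks. \<chi> (x4 q t4) = 1) \<and>
       (\<forall>t5\<in>Fs. \<chi> (x5 t5) = 1) \<and>
       (\<forall>t6\<in>Fs. \<chi> (x6 t6) = 1)) \<and>

    (\<forall>A13\<in>Ks. \<forall>A12\<in>T A13.
       let \<chi> = \<chi>3 q \<eta> \<theta> A13 A12 in
       \<chi> \<one>\<^bsub>U\<^esub> = of_nat q \<and>
       (\<forall>t4\<in>Ks. \<chi> (x4 q t4) = of_nat q) \<and>
       (\<forall>t5\<in>Fs. \<chi> (x5 t5) = of_nat q) \<and>
       (\<forall>t6\<in>Fs. \<chi> (x6 t6) = of_nat q) \<and>
       (\<forall>t2\<in>Fs. \<forall>t4. \<forall>t5\<in>F. \<chi> (x2 t2 \<otimes>\<^bsub>U\<^esub> x4 q t4 \<otimes>\<^bsub>U\<^esub> x5 t5) = 0) \<and>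
       (\<forall>t1\<in>Ks. \<forall>t2\<in>Fs. \<chi> (x2 t2 \<otimes>\<^bsub>U\<^esub> x1 q t1) = 0) \<and>
       (\<forall>t3\<in>Ks. \<forall>t5\<in>F. \<chi> (x3 q t3 \<otimes>\<^bsub>U\<^esub> x5 t5) = of_nat q * \<theta> (\<pi> (- A13 * t3))) \<and>
       (\<forall>t1\<in>Ks. \<forall>t6\<in>F. \<chi> (x1 q t1 \<otimes>\<^bsub>U\<^esub> x6 t6) =
          (\<Sum>r2\<in>F. \<theta> (\<pi> ((A12 - A13 * r2) * t1)))) \<and>
       (\<forall>t1\<in>Ks. \<forall>t3\<in>T t1 - {0}. \<chi> (x1 q t1 \<otimes>\<^bsub>U\<^esub> x3 q t3) =
          (\<Sum>r2\<in>F. \<theta> (\<pi> ((A12 - A13 * r2) * t1 - t3 * A13))))) \<and>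

    (\<forall>A15\<in>Ks. \<forall>A23\<in>F.
       let \<chi> = \<chi>4 q \<eta> \<theta> A15 A23 in
       \<chi> \<one>\<^bsub>U\<^esub> = of_nat (q ^ 3) \<and>
       (\<forall>t5\<in>Fs. \<chi> (x5 t5) = of_nat (q ^ 3)) \<and>
       (\<forall>t6\<in>Fs. \<chi> (x6 t6) = of_nat (q ^ 3)) \<and>
       (\<forall>t1\<in>Ks. \<forall>t6\<in>F. \<chi> (x1 q t1 \<otimes>\<^bsub>U\<^esub> x6 t6) = 0) \<and>
       (\<forall>t1\<in>Ks. \<forall>t3\<in>T t1 - {0}. \<chi> (x1 q t1 \<otimes>\<^bsub>U\<^esub> x3 q t3) = 0) \<and>
       (\<forall>t1\<in>Ks. \<forall>t2\<in>Fs. \<chi> (x2 t2 \<otimes>\<^bsub>U\<^esub> x1 q t1) = 0) \<and>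
       (\<forall>t3\<in>Ks. \<forall>t5\<in>F. \<chi> (x3 q t3 \<otimes>\<^bsub>U\<^esub> x5 t5) = 0) \<and>
       (\<forall>t4\<in>Ks. \<chi> (x4 q t4) =
          of_nat (q ^ 3) * \<theta> (\<pi> (A15 ^ q * t4)) * \<theta> (\<pi> (A15 * t4 ^ q\<^sup>2))) \<and>
       (\<forall>t2\<in>Fs. \<forall>t4. \<forall>t5\<in>F. \<chi> (x2 t2 \<otimes>\<^bsub>U\<^esub> x4 q t4 \<otimes>\<^bsub>U\<^esub> x5 t5) =
          \<theta> (A23 * t2) *
          (\<Sum>r1\<in>UNIV. \<theta> (\<pi> (A15 ^ q * (t4 - t2 * r1 ^ (q + 1))
             + A15 * (t4 ^ q\<^sup>2 - t2 * r1 ^ (q\<^sup>2 + 1))))))) \<and>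

    (\<forall>A16\<in>Fs. \<forall>A23\<in>F. \<forall>A13.
       let \<chi> = \<chi>5 q \<eta> \<theta> A16 A23 A13 in
       \<chi> \<one>\<^bsub>U\<^esub> = of_nat (q ^ 3) \<and>
       (\<forall>t6\<in>Fs. \<chi> (x6 t6) = of_nat (q ^ 3)) \<and>
       (\<forall>t1\<in>Ks. \<forall>t6\<in>F. \<chi> (x1 q t1 \<otimes>\<^bsub>U\<^esub> x6 t6) = 0) \<and>
       (\<forall>t1\<in>Ks. \<forall>t3\<in>T t1 - {0}. \<chi> (x1 q t1 \<otimes>\<^bsub>U\<^esub> x3 q t3) = 0) \<and>
       (\<forall>t1\<in>Ks. \<forall>t2\<in>Fs. \<chi> (x2 t2 \<otimes>\<^bsub>U\<^esub> x1 q t1) = 0) \<and>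
       (\<forall>t4\<in>Ks. \<chi> (x4 q t4) = 0) \<and>
       (\<forall>t5\<in>Fs. \<chi> (x5 t5) = of_nat (q ^ 3) * \<theta> (A16 * t5)) \<and>
       (\<forall>t3\<in>Ks. \<forall>t5\<in>F. \<chi> (x3 q t3 \<otimes>\<^bsub>U\<^esub> x5 t5) =
          \<theta> (\<pi> (- A13 * t3 + A16 * t5)) *
          (\<Sum>r1\<in>UNIV. \<theta> (A16 * \<phi>0 q (t3 * r1 ^ (q\<^sup>2 + q))))) \<and>
       (\<forall>t2\<in>Fs. \<forall>t4. \<forall>t5\<in>F. \<chi> (x2 t2 \<otimes>\<^bsub>U\<^esub> x4 q t4 \<otimes>\<^bsub>U\<^esub> x5 t5) =
          \<theta> (A23 * t2 + A16 * t5) *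
          (\<Sum>r1\<in>UNIV. \<theta> (\<pi> (A13 * r1 * t2
             + A16 * (\<phi>0 q (r1 * t4 ^ q) - t2 * r1 ^ (q\<^sup>2 + q + 1))))))) \<and>

    (\<forall>A17\<in>Fs. \<forall>A12.
       let \<chi> = \<chi>6 q \<eta> \<theta> A17 A12 in
       \<chi> \<one>\<^bsub>U\<^esub> = of_nat (q ^ 4) \<and>
       (\<forall>t1\<in>Ks. \<forall>t3\<in>T t1 - {0}. \<chi> (x1 q t1 \<otimes>\<^bsub>U\<^esub> x3 q t3) = 0) \<and>
       (\<forall>t2\<in>Fs. \<forall>t4. \<forall>t5\<in>F. \<chi> (x2 t2 \<otimes>\<^bsub>U\<^esub> x4 q t4 \<otimes>\<^bsub>U\<^esub> x5 t5) = 0) \<and>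
       (\<forall>t1\<in>Ks. \<forall>t2\<in>Fs. \<chi> (x2 t2 \<otimes>\<^bsub>U\<^esub> x1 q t1) = 0) \<and>
       (\<forall>t3\<in>Ks. \<forall>t5\<in>F. \<chi> (x3 q t3 \<otimes>\<^bsub>U\<^esub> x5 t5) = 0) \<and>
       (\<forall>t4\<in>Ks. \<chi> (x4 q t4) = 0) \<and>
       (\<forall>t5\<in>Fs. \<chi> (x5 t5) = 0) \<and>
       (\<forall>t6\<in>Fs. \<chi> (x6 t6) = of_nat (q ^ 4) * \<theta> (A17 * t6)) \<and>
       (\<forall>t1\<in>Ks. \<forall>t6\<in>F. \<chi> (x1 q t1 \<otimes>\<^bsub>U\<^esub> x6 t6) =
          \<theta> (\<pi> (A12 * t1 + A17 * t6)) *
          (\<Sum>r3\<in>UNIV. \<theta> (A17 * \<phi>0 q (- t1 * r3 ^ (q\<^sup>2 + q))))))"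
proof -
  \<comment> \<open>The field locale comes first, so that its trace is available when the hypothesis
    on \<eta> is matched with trace 1.\<close>
  interpret f: triality_field p k q "\<lambda>x :: 'a. x ^ q"
    by unfold_locales (use assms in auto)
  interpret t: triality p k q "\<lambda>x :: 'a. x ^ q" \<eta> \<theta> T
  proof unfold_locales
    show "f.Tr \<eta> = 1"
      using assms(7) unfolding f.Tr_def power2_eq_square power_mult by (simp only: ac_simps)
  qed (use assms in auto)
  note defs = U_def F_def Fs_def Ks_def \<pi>_def reps_def Ubl_def Ub3_def Ub4_def Ub5_def Hb3_def Hb4_def Hb5_def
    H_def Hb6_def F_lin_def F3_def F4_def F5_def F6_def
  show ?thesis
    \<comment> \<open>Folding the representatives into \<open>t.reps\<close> and rewriting the
      kernel conditions as parametrised families leaves conjuncts that are single lemmas of the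
      locale.\<close>
    unfolding defs t.reps_eq[symmetric] t.kernel_families
    by (intro conjI)
      (rule t.reps_carrier t.class_one t.class_x6 t.class_x5 t.class_x4 t.class_x3
        t.class_x2 t.class_x1 t.class_x13 t.class_x12 t.orthogonal t.normal_products t.Ubar_carrier
        t.Hbar6_carrier t.subgroup_Hbar refl t.inj_families t.Irr_U t.families_disjoint
      | intro allI ballI, rule t.reps_unique t.\<mu>_Irr t.\<mu>6_Irr t.table_lin t.table3
        t.table4 t.table5 t.table6; assumption)+
qed

end
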